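(* Let $T>0$, $\sigma\neq 0$, and let $(k_n)_{n\ge1}$ be positive real numbers, with the convention $k_0=0$. Given $x=(x_n)_{n\ge1}\in l^2$, weak uniqueness holds for the stochastic inviscid dyadic model in the class of exponentially integrable weak solutions on $[0,T]$: if $(\Omega^{(i)},F^{(i)}_t,P^{(i)},W^{(i)},X^{(i)})$, $i=1,2$, are two exponentially integrable weak solutions on $[0,T]$ with the same initial condition $x$, then the laws of $X^{(1)}$ under $P^{(1)}$ and of $X^{(2)}$ under $P^{(2)}$ on $C([0,T];\mathbb{R})^{\mathbb{N}}$ coincide.
   Context: A filtered probability space $(\Omega,F_t,P)$ on $[0,T]$ means a probability space $(\Omega,F_T,P)$ with a right-continuous filtration $(F_t)_{t\in[0,T]}$. Given $x\in l^2$, a weak solution (in $l^2$) is a filtered probability space $(\Omega,F_t,P)$, a sequence $(W_n)_{n\ge1}$ of independent Brownian motions on it, and an $l^2$-valued process $X=(X_n)_{n\ge1}$ with continuous adapted components such that for each $n\ge1$ and $t\in[0,T]$, $$X_n(t)=x_n+\int_0^t\big(k_{n-1}X_{n-1}^2(s)-k_nX_n(s)X_{n+1}(s)\big)ds+\int_0^t\sigma k_{n-1}X_{n-1}(s)\,dW_{n-1}(s)-\int_0^t\sigma k_nX_{n+1}(s)\,dW_n(s)-\int_0^t\frac{\sigma^2}{2}(k_n^2+k_{n-1}^2)X_n(s)\,ds,$$ with $k_0=0$ and $X_0\equiv 0$ (this is the Itô form of the Stratonovich system $dX_n=(k_{n-1}X_{n-1}^2-k_nX_nX_{n+1})dt+\sigma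 k_{n-1}X_{n-1}\circ dW_{n-1}-\sigma k_nX_{n+1}\circ dW_n$). A weak solution is exponentially integrable if for every $i\in\mathbb{N}$, $$E^P\Big[e^{\frac{1}{\sigma^2}\int_0^T\sum_{n=1}^\infty X_n^2(t)\,dt}\Big(1+\int_0^TX_i^4(t)\,dt\Big)^2\Big]<\infty.$$ *)

theory Defs
  imports "HOL-Probability.Probability"
begin

definition filtered_prob_space_on :: "real \<Rightarrow> 'a measure \<Rightarrow> (real \<Rightarrow> 'a measure) \<Rightarrow> bool" where
  "filtered_prob_space_on T M F \<longleftrightarrow>
     prob_space M \<and>
     (\<forall>t\<in>{0..T}. space (F t) = space M) \<and>
     (\<forall>s t. 0 \<le> s \<longrightarrow> s \<le> t \<longrightarrow> t \<le> T \<longrightarrow> sets (F s) \<subseteq> sets (F t)) \<and>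
     sets (F T) = sets M \<and>
     (\<forall>t. 0 \<le> t \<longrightarrow> t < T \<longrightarrow> sets (F t) = (\<Inter>u\<in>{t<..T}. sets (F u)))"

definition brownian_motion_on :: "real \<Rightarrow> 'a measure \<Rightarrow> (real \<Rightarrow> 'a measure) \<Rightarrow> (real \<Rightarrow> 'a \<Rightarrow> real) \<Rightarrow> bool" where
  "brownian_motion_on T M F W \<longleftrightarrow>
     (\<forall>\<omega>\<in>space M. W 0 \<omega> = 0) \<and>
     (\<forall>\<omega>\<in>space M. continuous_on {0..T} (\<lambda>t. W t \<omega>)) \<and>
     (\<forall>t\<in>{0..T}. W t \<in> borel_measurable (F t)) \<and>
     (\<forall>s t. 0 \<le> s \<longrightarrow> s < t \<longrightarrow> t \<le> T \<longrightarrow>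
        distributed M lborel (\<lambda>\<omega>. W t \<omega> - W s \<omega>) (normal_density 0 (sqrt (t - s))) \<and>
        (\<forall>A\<in>sets (F s). \<forall>B\<in>sets borel.
           measure M (A \<inter> {\<omega>\<in>space M. W t \<omega> - W s \<omega> \<in> B}) =
           measure M A * measure M {\<omega>\<in>space M. W t \<omega> - W s \<omega> \<in> B}))"

text \<open>Path space C([0,T];R) carrying the cylinder sigma-algebra (paths restricted to [0,T]).\<close>
definition path_space :: "real \<Rightarrow> (real \<Rightarrow> real) measure" where
  "path_space T = PiM {0..T} (\<lambda>_. borel)"

definition path_of :: "real \<Rightarrow> (real \<Rightarrow> 'a \<Rightarrow> real) \<Rightarrow> 'a \<Rightarrow> (real \<Rightarrow> real)" where
  "path_of T Y \<omega> = (\<lambda>t\<in>{0..T}. Y t \<omega>)"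

text \<open>Ito integral of a continuous adapted integrand H against a Brownian motion W over [0,t],
  characterised as the limit in probability of left-point Riemann sums along dyadic partitions
  (for continuous adapted integrands this coincides with the Ito integral).\<close>
definition has_ito_integral ::
  "'a measure \<Rightarrow> (real \<Rightarrow> 'a \<Rightarrow> real) \<Rightarrow> (real \<Rightarrow> 'a \<Rightarrow> real) \<Rightarrow> real \<Rightarrow> ('a \<Rightarrow> real) \<Rightarrow> bool" where
  "has_ito_integral M H W t I \<longleftrightarrow>
     I \<in> borel_measurable M \<and>
     (\<forall>e>0. (\<lambda>m::nat. measure M {\<omega>\<in>space M.
        \<bar>(\<Sum>j<2^m. H (t * real j / 2^m) \<omega> *
              (W (t * real (Suc j) / 2^m) \<omega> - W (t * real j / 2^m) \<omega>)) - I \<omega>\<bar> > e})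
      \<longlonglongrightarrow> 0)"

text \<open>Weak solution of the stochastic inviscid dyadic model. Components are indexed by n \<ge> 1,
  X 0 is identically 0, k 0 = 0 is imposed in the theorem.\<close>
definition weak_solution ::
  "real \<Rightarrow> real \<Rightarrow> (nat \<Rightarrow> real) \<Rightarrow> (nat \<Rightarrow> real) \<Rightarrow> 'a measure \<Rightarrow> (real \<Rightarrow> 'a measure)
   \<Rightarrow> (nat \<Rightarrow> real \<Rightarrow> 'a \<Rightarrow> real) \<Rightarrow> (nat \<Rightarrow> real \<Rightarrow> 'a \<Rightarrow> real) \<Rightarrow> bool" where
  "weak_solution T \<sigma> k x M F W X \<longleftrightarrow>
     filtered_prob_space_on T M F \<and>
     (\<forall>n\<ge>1. brownian_motion_on T M F (W n)) \<and>
     prob_space.indep_vars M (\<lambda>_. path_space T) (\<lambda>n. path_of T (W n)) {1..} \<and>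
     (\<forall>t \<omega>. X 0 t \<omega> = 0) \<and>
     (\<forall>n\<ge>1. \<forall>\<omega>\<in>space M. continuous_on {0..T} (\<lambda>t. X n t \<omega>)) \<and>
     (\<forall>n\<ge>1. \<forall>t\<in>{0..T}. X n t \<in> borel_measurable (F t)) \<and>
     (\<forall>t\<in>{0..T}. \<forall>\<omega>\<in>space M. summable (\<lambda>n. (X n t \<omega>)\<^sup>2)) \<and>
     (\<forall>n\<ge>1. \<forall>t\<in>{0..T}. \<exists>I1 I2.
        has_ito_integral M (\<lambda>s \<omega>. \<sigma> * k (n - 1) * X (n - 1) s \<omega>) (W (n - 1)) t I1 \<and>
        has_ito_integral M (\<lambda>s \<omega>. \<sigma> * k n * X (Suc n) s \<omega>) (W n) t I2 \<and>
        (AE \<omega> in M. X n t \<omega> =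
            x n
          + integral {0..t} (\<lambda>s. k (n - 1) * (X (n - 1) s \<omega>)\<^sup>2 - k n * X n s \<omega> * X (Suc n) s \<omega>)
          + I1 \<omega> - I2 \<omega>
          - integral {0..t} (\<lambda>s. \<sigma>\<^sup>2 / 2 * ((k n)\<^sup>2 + (k (n - 1))\<^sup>2) * X n s \<omega>)))"

text \<open>Exponential integrability: for every i \<ge> 1,
  E[ exp(1/\<sigma>^2 \<integral>_0^T \<Sum>_n X_n(t)^2 dt) (1 + \<integral>_0^T X_i(t)^4 dt)^2 ] < \<infinity>.
  The inner time integral (a priori in [0,\<infinity>]) is taken as a nonnegative Lebesgue integral;
  finiteness of the expectation is expressed by a.s. finiteness of it plus finiteness of the
  nonnegative expectation.\<close>
definition energy_integral :: "real \<Rightarrow> (nat \<Rightarrow> real \<Rightarrow> 'a \<Rightarrow> real) \<Rightarrow> 'a \<Rightarrow> ennreal" where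
  "energy_integral T X \<omega> = (\<integral>\<^sup>+ t \<in> {0..T}. ennreal (\<Sum>n. (X n t \<omega>)\<^sup>2) \<partial>lborel)"

definition exp_integrable ::
  "real \<Rightarrow> real \<Rightarrow> 'a measure \<Rightarrow> (nat \<Rightarrow> real \<Rightarrow> 'a \<Rightarrow> real) \<Rightarrow> bool" where
  "exp_integrable T \<sigma> M X \<longleftrightarrow>
     (AE \<omega> in M. energy_integral T X \<omega> < \<infinity>) \<and>
     (\<forall>i\<ge>1. (\<integral>\<^sup>+ \<omega>. ennreal (exp (enn2real (energy_integral T X \<omega>) / \<sigma>\<^sup>2) *
                    (1 + integral {0..T} (\<lambda>t. (X i t \<omega>) ^ 4))\<^sup>2) \<partial>M) < \<infinity>)"

definition law :: "real \<Rightarrow> 'a measure \<Rightarrow> (nat \<Rightarrow> real \<Rightarrow> 'a \<Rightarrow> real) \<Rightarrow> (nat \<Rightarrow> real \<Rightarrow> real) measure" where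
  "law T M X = distr M (PiM {1..} (\<lambda>_. path_space T)) (\<lambda>\<omega>. \<lambda>n\<in>{1..}. path_of T (X n) \<omega>)"

end

theory Submission imports Defs
begin

text \<open>
With \<open>\<theta>\<^sub>n = X\<^sub>n / \<sigma>\<close>, exponential integrability makes the stochastic exponential of
\<open>-\<Sum>\<^sub>n \<integral>\<theta>\<^sub>n dW\<^sub>n\<close> the density of a probability measure \<open>Q\<close> under which
\<open>B\<^sub>n = W\<^sub>n + \<integral>\<theta>\<^sub>n dt\<close> are independent Brownian motions. The shift cancels the nonlinear drift,
so that \<open>X\<close> solves a linear system driven by \<open>B\<close>. That system has at most one solution with
\<open>E\<^sup>Q \<integral>X\<^sub>n\<^sup>2 \<rightarrow> 0\<close>: the mean square distances \<open>u\<^sub>n\<close> between \<open>X\<close> and its Picard iterates satisfy, in the limit,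
\<open>(k\<^sub>n\<^sup>2 + k\<^sub>n\<^sub>-\<^sub>1\<^sup>2) u\<^sub>n \<le> k\<^sub>n\<^sub>-\<^sub>1\<^sup>2 u\<^sub>n\<^sub>-\<^sub>1 + k\<^sub>n\<^sup>2 u\<^sub>n\<^sub>+\<^sub>1\<close>; as \<open>k\<^sub>0 = 0\<close>, \<open>u\<close> is then nondecreasing in \<open>n\<close>, and it
tends to \<open>0\<close>. Hence \<open>X\<close>, and with it the density, is the same measurable functional of the increments of
\<open>B\<close> for both solutions. Everything is done on dyadic grids: stochastic integrals are limits in
probability of left-point sums, and Brownian motions enter only through their dyadic increments.
\<close>

text \<open>The two solutions live on different spaces, with filtrations that may be larger than
  what the noise generates, so they can only be compared through one explicit functional of the
  noise. Picard iterates on a grid supply it, being built from finitely many increments. Constants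
  decide the argument: 2 \<open>c n\<close> equals \<sigma>^2 (k_n^2 + k_{n-1}^2), so damping and
  noise input balance exactly, and a factor lost in the isometry would destroy the inequality for u.
  Hence the iterates are compared by exact discrete recursions, while cruder bounds with a factor 2
  serve only for regularity. Those come from exponential supermartingale bounds, which need no
  integrability of the integrand: at the outset only time integrals of \<open>X\<close> have second
  moments, not \<open>X\<close> at fixed times. The other obstacle is the passage to fine grids and
  infinitely many components in the density. There the integrands are replaced by averages over the
  preceding cell, whose discrete energy never exceeds the true one, so that exp A dominates at every
  stage.\<close>

abbreviation cr :: "real \<Rightarrow> complex" where "cr \<equiv> complex_of_real"

lemmas L1_bound = Bochner_Integration.integrable_bound and L1_add = Bochner_Integration.integrable_add
  and L1_sum = Bochner_Integration.integrable_sum and L1_diff = Bochner_Integration.integrable_diff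

section \<open>Convergence in probability\<close>

text \<open>The mean of min(1, |f - g|) metrizes convergence in probability. A single numerical
  sequence is easier to add, to restrict to subsequences and to transport to another measure than a
  family of tail probabilities. Measurability is included so that limits always carry it
  along.\<close>

definition conv_prob :: "'a measure \<Rightarrow> (nat \<Rightarrow> 'a \<Rightarrow> real) \<Rightarrow> ('a \<Rightarrow> real) \<Rightarrow> bool" where
  "conv_prob M f g \<longleftrightarrow> (\<forall>m. f m \<in> borel_measurable M) \<and> g \<in> borel_measurable M \<and>
     (\<lambda>m. \<integral>z. min 1 \<bar>f m z - g z\<bar> \<partial>M) \<longlonglongrightarrow> 0"

text \<open>Stands in for Cauchy-Schwarz: with e of the order of the root mean square of x, a second
  moment bound becomes a first moment bound of the same order.\<close>

lemma abs_le_young: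
  fixes x e :: real
  assumes "e > 0"
  shows "\<bar>x\<bar> \<le> e + x\<^sup>2 / e"
proof -
  have "0 \<le> (\<bar>x\<bar> - e)\<^sup>2 / e + \<bar>x\<bar>" using assms by simp
  also have "\<dots> = e + x\<^sup>2 / e - \<bar>x\<bar>" using assms by (simp add: power2_eq_square field_simps)
  finally show ?thesis by simp
qed

lemma conv_prob_measurable:
  assumes "conv_prob M f g"
  shows "f m \<in> borel_measurable M" "g \<in> borel_measurable M"
  using assms by (auto simp: conv_prob_def)

lemma (in prob_space) integrable_min1:
  assumes [measurable]: "h \<in> borel_measurable M"
  shows "integrable M (\<lambda>z. min 1 \<bar>h z\<bar> :: real)"
  by (rule integrable_const_bound[where B=1]) auto

text \<open>Fatou with upper bounds that may vary along the sequence. Integrability of the limit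
  comes out instead of being assumed, which is how moment bounds of grid sums pass to stochastic
  integrals known only as limits in probability.\<close>

lemma integral_Fatou_le:
  fixes f :: "nat \<Rightarrow> 'a \<Rightarrow> real"
  assumes int: "\<And>k. integrable M (f k)" and nn: "\<And>k. AE z in M. 0 \<le> f k z"
    and le: "\<And>k. (\<integral>z. f k z \<partial>M) \<le> c k" and c: "c \<longlonglongrightarrow> C"
    and lim: "AE z in M. (\<lambda>k. f k z) \<longlonglongrightarrow> g z" and g[measurable]: "g \<in> borel_measurable M"
  shows "integrable M g" "(\<integral>z. g z \<partial>M) \<le> C"
proof -
  have [measurable]: "f k \<in> borel_measurable M" for k using int by auto
  have nn': "AE z in M. \<forall>k. 0 \<le> f k z" using nn by (simp add: AE_all_countable)
  have gnn: "AE z in M. 0 \<le> g z" using lim nn' by eventually_elim (rule LIMSEQ_le_const, auto)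
  have c0: "0 \<le> c k" for k using le[of k] integral_nonneg_AE[OF nn, of k] by linarith
  have C0: "0 \<le> C" using c c0 by (auto intro: LIMSEQ_le_const)
  have "(\<integral>\<^sup>+z. ennreal (g z) \<partial>M) = (\<integral>\<^sup>+z. liminf (\<lambda>k. ennreal (f k z)) \<partial>M)"
    using lim by (intro nn_integral_cong_AE) (auto intro!: lim_imp_Liminf[symmetric] tendsto_ennrealI elim!: eventually_mono)
  also have "\<dots> \<le> liminf (\<lambda>k. \<integral>\<^sup>+z. ennreal (f k z) \<partial>M)"
    by (rule nn_integral_liminf) auto
  also have "\<dots> \<le> liminf (\<lambda>k. ennreal (c k))"
    by (intro Liminf_mono always_eventually allI)
       (use le nn int in \<open>simp add: nn_integral_eq_integral ennreal_leI\<close>)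
  also have "\<dots> = ennreal C" using c by (auto intro!: lim_imp_Liminf tendsto_ennrealI)
  finally have le': "(\<integral>\<^sup>+z. ennreal (g z) \<partial>M) \<le> ennreal C" .
  show int: "integrable M g"
    by (rule integrableI_nonneg) (use gnn le' in \<open>auto simp: top_unique less_top intro: le_less_trans\<close>)
  show "(\<integral>z. g z \<partial>M) \<le> C"
    using le' C0 by (simp add: nn_integral_eq_integral[OF int gnn])
qed

context prob_space
begin

text \<open>Off the event where the distance exceeds r/2 the truncated distance is at most r/2, and
  on it at most 1. This is the entrance from \<open>has_ito_integral\<close>, which speaks of tail
  probabilities.\<close>

lemma conv_probI_measure:
  assumes [measurable]: "\<And>m. f m \<in> borel_measurable M" "g \<in> borel_measurable M"
    and lim: "\<And>e. e > 0 \<Longrightarrow> (\<lambda>m. measure M {z\<in>space M. \<bar>f m z - g z\<bar> > e}) \<longlonglongrightarrow> 0"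
  shows "conv_prob M f g"
  unfolding conv_prob_def
proof (intro conjI allI assms LIMSEQ_I)
  fix r :: real assume r: "r > 0"
  obtain n0 where n0: "\<And>m. m \<ge> n0 \<Longrightarrow> measure M {z\<in>space M. \<bar>f m z - g z\<bar> > r/2} < r/2"
    using LIMSEQ_D[OF lim[of "r/2"], of "r/2"] r by auto
  have "(\<integral>z. min 1 \<bar>f m z - g z\<bar> \<partial>M) < r" if "m \<ge> n0" for m
  proof -
    have "(\<integral>z. min 1 \<bar>f m z - g z\<bar> \<partial>M) \<le>
        (\<integral>z. r/2 + indicator {z\<in>space M. \<bar>f m z - g z\<bar> > r/2} z \<partial>M)"
      using r by (intro integral_mono integrable_min1 L1_add
          integrable_const integrable_real_indicator) (auto split: split_indicator simp: min_def emeasure_eq_measure)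
    also have "\<dots> = r/2 + measure M {z\<in>space M. \<bar>f m z - g z\<bar> > r/2}"
      by (subst Bochner_Integration.integral_add)
         (auto intro!: integrable_real_indicator simp: prob_space emeasure_eq_measure)
    finally show ?thesis using n0[OF that] by linarith
  qed
  moreover have "0 \<le> (\<integral>z. min 1 \<bar>f m z - g z\<bar> \<partial>M)" for m by simp
  ultimately show "\<exists>no. \<forall>m\<ge>no. norm ((\<integral>z. min 1 \<bar>f m z - g z\<bar> \<partial>M) - 0) < r"
    by (metis abs_of_nonneg diff_zero real_norm_def)
qed

text \<open>The L1 subsequence theorem is applied to the sum of all truncated distances, so one
  subsequence serves the whole finite family. A truncated distance tending to 0 is eventually below
  1 and then equals the distance itself.\<close>

lemma conv_prob_AE_subseq:
  assumes I: "finite I" and conv: "\<And>i. i \<in> I \<Longrightarrow> conv_prob M (f i) (g i)"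
  obtains r :: "nat \<Rightarrow> nat" where "strict_mono r" "AE z in M. \<forall>i\<in>I. (\<lambda>k. f i (r k) z) \<longlonglongrightarrow> g i z"
proof -
  note [measurable] = conv_prob_measurable[OF conv]
  let ?u = "\<lambda>m z. \<Sum>i\<in>I. min 1 \<bar>f i m z - g i z\<bar>"
  have int: "integrable M (?u m)" for m
    by (intro L1_sum integrable_min1) measurable
  have "(\<lambda>m. \<integral>z. norm (?u m z) \<partial>M) = (\<lambda>m. \<Sum>i\<in>I. \<integral>z. min 1 \<bar>f i m z - g i z\<bar> \<partial>M)"
    by (intro ext, subst Bochner_Integration.integral_sum[symmetric])
       (auto intro!: integrable_min1 Bochner_Integration.integral_cong abs_of_nonneg sum_nonneg)
  also have "\<dots> \<longlonglongrightarrow> (\<Sum>i\<in>I. 0)"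
    by (intro tendsto_sum) (use conv in \<open>auto simp: conv_prob_def\<close>)
  finally have "(\<lambda>m. \<integral>z. norm (?u m z) \<partial>M) \<longlonglongrightarrow> 0" by simp
  from tendsto_L1_AE_subseq[OF int this] obtain r :: "nat \<Rightarrow> nat"
    where r: "strict_mono r" "AE z in M. (\<lambda>k. ?u (r k) z) \<longlonglongrightarrow> 0" by blast
  have "AE z in M. \<forall>i\<in>I. (\<lambda>k. f i (r k) z) \<longlonglongrightarrow> g i z"
    using r(2)
  proof eventually_elim
    case (elim z)
    show ?case
    proof
      fix i assume i: "i \<in> I"
      have "(\<lambda>k. min 1 \<bar>f i (r k) z - g i z\<bar>) \<longlonglongrightarrow> 0"
        by (rule tendsto_sandwich[OF _ _ tendsto_const elim])
           (auto intro!: always_eventually member_le_sum[OF i] simp: I)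
      then have ev: "\<forall>\<^sub>F k in sequentially. min 1 \<bar>f i (r k) z - g i z\<bar> < 1"
        and lim: "(\<lambda>k. min 1 \<bar>f i (r k) z - g i z\<bar>) \<longlonglongrightarrow> 0"
        by (auto dest!: order_tendstoD(2)[where a=1])
      have "(\<lambda>k. \<bar>f i (r k) z - g i z\<bar>) \<longlonglongrightarrow> 0"
        by (rule Lim_transform_eventually[OF lim]) (use ev in eventually_elim, auto simp: min_def split: if_splits)
      then show "(\<lambda>k. f i (r k) z) \<longlonglongrightarrow> g i z"
        using LIM_zero_cancel tendsto_rabs_zero_iff by blast
    qed
  qed
  with r(1) show ?thesis by (rule that)
qed

lemma AE_imp_conv_prob:
  assumes [measurable]: "\<And>m. f m \<in> borel_measurable M" "g \<in> borel_measurable M"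
    and lim: "AE z in M. (\<lambda>m. f m z) \<longlonglongrightarrow> g z"
  shows "conv_prob M f g"
  unfolding conv_prob_def
proof (intro conjI allI assms)
  have "(\<lambda>m. \<integral>z. min 1 \<bar>f m z - g z\<bar> \<partial>M) \<longlonglongrightarrow> (\<integral>z. 0 \<partial>M)"
  proof (rule integral_dominated_convergence[where w="\<lambda>_. 1"])
    show "AE z in M. (\<lambda>m. min 1 \<bar>f m z - g z\<bar>) \<longlonglongrightarrow> 0"
      using lim
    proof eventually_elim
      case (elim z)
      have "(\<lambda>m. min 1 \<bar>f m z - g z\<bar>) \<longlonglongrightarrow> min 1 \<bar>g z - g z\<bar>"
        by (intro tendsto_intros elim)
      then show ?case by simp
    qed
  qed auto
  then show "(\<lambda>m. \<integral>z. min 1 \<bar>f m z - g z\<bar> \<partial>M) \<longlonglongrightarrow> 0" by simp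
qed

lemma conv_prob_leI:
  assumes [measurable]: "\<And>m. f m \<in> borel_measurable M" "g \<in> borel_measurable M"
    and lim: "(\<lambda>m. \<integral>z. h m z \<partial>M) \<longlonglongrightarrow> 0" and int: "\<And>m. integrable M (h m)"
    and le: "\<And>m z. z \<in> space M \<Longrightarrow> min 1 \<bar>f m z - g z\<bar> \<le> h m z"
  shows "conv_prob M f g"
  unfolding conv_prob_def
proof (intro conjI allI assms)
  show "(\<lambda>m. \<integral>z. min 1 \<bar>f m z - g z\<bar> \<partial>M) \<longlonglongrightarrow> 0"
  proof (rule tendsto_sandwich[OF _ _ tendsto_const lim])
    show "\<forall>\<^sub>F m in sequentially. (\<integral>z. min 1 \<bar>f m z - g z\<bar> \<partial>M) \<le> (\<integral>z. h m z \<partial>M)"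
      by (intro always_eventually allI integral_mono integrable_min1 int le) auto
  qed (auto intro!: always_eventually)
qed

lemma conv_prob_add:
  assumes "conv_prob M f g" "conv_prob M f' g'"
  shows "conv_prob M (\<lambda>m z. f m z + f' m z) (\<lambda>z. g z + g' z)"
proof -
  note [measurable] = conv_prob_measurable[OF assms(1)] conv_prob_measurable[OF assms(2)]
  have int: "integrable M (\<lambda>z. min 1 \<bar>f m z - g z\<bar>)" "integrable M (\<lambda>z. min 1 \<bar>f' m z - g' z\<bar>)" for m
    by (auto intro!: integrable_min1)
  show ?thesis
  proof (rule conv_prob_leI[where h="\<lambda>m z. min 1 \<bar>f m z - g z\<bar> + min 1 \<bar>f' m z - g' z\<bar>"])
    have "(\<lambda>m. (\<integral>z. min 1 \<bar>f m z - g z\<bar> \<partial>M) + (\<integral>z. min 1 \<bar>f' m z - g' z\<bar> \<partial>M)) \<longlonglongrightarrow> 0 + 0"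
      by (intro tendsto_add) (use assms in \<open>auto simp: conv_prob_def\<close>)
    then show "(\<lambda>m. \<integral>z. min 1 \<bar>f m z - g z\<bar> + min 1 \<bar>f' m z - g' z\<bar> \<partial>M) \<longlonglongrightarrow> 0"
      by (simp add: int)
  qed (auto simp: int)
qed

lemma conv_prob_const: "g \<in> borel_measurable M \<Longrightarrow> conv_prob M (\<lambda>_. g) g"
  by (simp add: conv_prob_def)

lemma conv_prob_cmult:
  assumes "conv_prob M f g"
  shows "conv_prob M (\<lambda>m z. c * f m z) (\<lambda>z. c * g z)"
proof -
  note [measurable] = conv_prob_measurable[OF assms]
  have int: "integrable M (\<lambda>z. min 1 \<bar>f m z - g z\<bar>)" for m
    by (auto intro!: integrable_min1)
  show ?thesis
  proof (rule conv_prob_leI[where h="\<lambda>m z. (1 + \<bar>c\<bar>) * min 1 \<bar>f m z - g z\<bar>"])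
    have "(\<lambda>m. (1 + \<bar>c\<bar>) * (\<integral>z. min 1 \<bar>f m z - g z\<bar> \<partial>M)) \<longlonglongrightarrow> (1 + \<bar>c\<bar>) * 0"
      by (intro tendsto_mult tendsto_const) (use assms in \<open>auto simp: conv_prob_def\<close>)
    then show "(\<lambda>m. \<integral>z. (1 + \<bar>c\<bar>) * min 1 \<bar>f m z - g z\<bar> \<partial>M) \<longlonglongrightarrow> 0"
      by simp
    fix m z
    show "min 1 \<bar>c * f m z - c * g z\<bar> \<le> (1 + \<bar>c\<bar>) * min 1 \<bar>f m z - g z\<bar>"
    proof (cases "\<bar>f m z - g z\<bar> \<le> 1")
      case True
      have "\<bar>c * f m z - c * g z\<bar> = \<bar>c\<bar> * \<bar>f m z - g z\<bar>"
        by (metis abs_mult right_diff_distrib)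
      then show ?thesis using True by (auto simp: min_def distrib_right)
    qed auto
  qed (auto simp: int)
qed

lemma conv_prob_diff:
  assumes "conv_prob M f g" "conv_prob M f' g'"
  shows "conv_prob M (\<lambda>m z. f m z - f' m z) (\<lambda>z. g z - g' z)"
  using conv_prob_add[OF assms(1) conv_prob_cmult[OF assms(2), of "-1"]] by simp

lemma conv_prob_sum:
  assumes "finite I" "\<And>i. i \<in> I \<Longrightarrow> conv_prob M (f i) (g i)"
  shows "conv_prob M (\<lambda>m z. \<Sum>i\<in>I. f i m z) (\<lambda>z. \<Sum>i\<in>I. g i z)"
  using assms by (induction I) (auto intro!: conv_prob_add conv_prob_const)

lemma conv_prob_subseq:
  assumes "conv_prob M f g" "strict_mono r"
  shows "conv_prob M (\<lambda>k. f (r k)) g"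
  using assms LIMSEQ_subseq_LIMSEQ[of "\<lambda>m. \<integral>z. min 1 \<bar>f m z - g z\<bar> \<partial>M" 0 r]
  by (auto simp: conv_prob_def o_def)

lemma conv_prob_cong_AE:
  assumes "conv_prob M f g" "AE z in M. g z = g' z" "g' \<in> borel_measurable M"
  shows "conv_prob M f g'"
proof -
  note [measurable] = conv_prob_measurable[OF assms(1)] assms(3)
  have "(\<integral>z. min 1 \<bar>f m z - g z\<bar> \<partial>M) = (\<integral>z. min 1 \<bar>f m z - g' z\<bar> \<partial>M)" for m
    using assms(2) by (intro integral_cong_AE) auto
  then show ?thesis using assms by (simp add: conv_prob_def)
qed

text \<open>Cutting the density at a level L leaves a tail of small mean, against which the
  truncated distance is at most 1, and a part bounded by L. Thus limits in probability found under
  the original measure remain valid under the Girsanov measure.\<close>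

lemma conv_prob_density:
  assumes conv: "conv_prob M f g" and Z: "integrable M Z" "\<And>z. 0 \<le> Z z"
  shows "conv_prob (density M (\<lambda>z. ennreal (Z z))) f g"
proof -
  note [measurable] = conv_prob_measurable[OF conv]
  have [measurable]: "Z \<in> borel_measurable M" using Z by auto
  let ?d = "\<lambda>m z. min 1 \<bar>f m z - g z\<bar>"
  have int: "integrable M (\<lambda>z. Z z * ?d m z)" for m
    by (rule L1_bound[OF Z(1)])
       (use Z in \<open>auto simp: abs_mult intro!: mult_left_le\<close>)
  have tail: "(\<lambda>L. \<integral>z. Z z - min (Z z) (real L) \<partial>M) \<longlonglongrightarrow> (\<integral>z. 0 \<partial>M)"
  proof (rule integral_dominated_convergence[where w=Z])
    show "AE z in M. (\<lambda>L. Z z - min (Z z) (real L)) \<longlonglongrightarrow> 0"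
    proof (rule AE_I2, rule tendsto_eventually)
      fix z
      obtain n :: nat where "Z z \<le> real n" using real_arch_simple by blast
      then show "\<forall>\<^sub>F L in sequentially. Z z - min (Z z) (real L) = 0"
        by (intro eventually_sequentiallyI[of n]) (auto simp: min_def)
    qed
  qed (use Z in auto)
  have "(\<lambda>m. \<integral>z. Z z * ?d m z \<partial>M) \<longlonglongrightarrow> 0"
  proof (rule LIMSEQ_I)
    fix e :: real assume e: "e > 0"
    then obtain L :: nat where L: "(\<integral>z. Z z - min (Z z) (real L) \<partial>M) < e/2"
      using order_tendstoD(2)[OF tail, of "e/2"] by (auto simp: eventually_sequentially)
    have "(\<lambda>m. real L * (\<integral>z. ?d m z \<partial>M)) \<longlonglongrightarrow> real L * 0"
      by (intro tendsto_mult tendsto_const) (use conv in \<open>auto simp: conv_prob_def\<close>)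
    then obtain n0 where n0: "\<And>m. m \<ge> n0 \<Longrightarrow> real L * (\<integral>z. ?d m z \<partial>M) < e/2"
      using order_tendstoD(2)[of _ 0 sequentially "e/2"] e by (auto simp: eventually_sequentially)
    have "(\<integral>z. Z z * ?d m z \<partial>M) < e" if "m \<ge> n0" for m
    proof -
      have "(\<integral>z. Z z * ?d m z \<partial>M) \<le> (\<integral>z. (Z z - min (Z z) (real L)) + real L * ?d m z \<partial>M)"
      proof (intro integral_mono int L1_add L1_diff Z integrable_mult_right integrable_min1)
        fix z
        have d: "0 \<le> ?d m z" "?d m z \<le> 1" by auto
        have "Z z * ?d m z = (Z z - min (Z z) (real L)) * ?d m z + min (Z z) (real L) * ?d m z"
          by (simp add: algebra_simps)
        also have "\<dots> \<le> (Z z - min (Z z) (real L)) * 1 + real L * ?d m z"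
          using d by (intro add_mono mult_left_mono mult_right_mono) auto
        finally show "Z z * ?d m z \<le> (Z z - min (Z z) (real L)) + real L * ?d m z" by simp
      next
        show "integrable M (\<lambda>z. min (Z z) (real L))"
          by (rule L1_bound[OF Z(1)]) (use Z in auto)
      qed auto
      also have "\<dots> = (\<integral>z. Z z - min (Z z) (real L) \<partial>M) + real L * (\<integral>z. ?d m z \<partial>M)"
        by (subst Bochner_Integration.integral_add)
           (auto intro!: integrable_min1 Z L1_diff L1_bound[OF Z(1), of "\<lambda>z. min (Z z) (real L)"] simp: Z)
      finally show ?thesis using L n0[OF that] by linarith
    qed
    moreover have "0 \<le> (\<integral>z. Z z * ?d m z \<partial>M)" for m
      by (intro integral_nonneg_AE AE_I2) (use Z in auto)
    ultimately show "\<exists>no. \<forall>m\<ge>no. norm ((\<integral>z. Z z * ?d m z \<partial>M) - 0) < e"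
      by (metis abs_of_nonneg diff_zero real_norm_def)
  qed
  moreover have "(\<integral>z. ?d m z \<partial>density M (\<lambda>z. ennreal (Z z))) = (\<integral>z. Z z * ?d m z \<partial>M)" for m
    by (subst integral_density) (auto simp: Z)
  ultimately show ?thesis
    by (simp add: conv_prob_def)
qed

text \<open>A form of Vitali's theorem. Uniform integrability is expressed by one integrable h over
  which no \<open>f k\<close> has mean excess above e: truncated at h the sequence converges by
  domination, and the excess of the limit is controlled by Fatou.\<close>

lemma uniformly_integrable_L1:
  fixes f :: "nat \<Rightarrow> 'a \<Rightarrow> real"
  assumes int: "\<And>k. integrable M (f k)" and nn: "\<And>k z. 0 \<le> f k z"
    and lim: "AE z in M. (\<lambda>k. f k z) \<longlonglongrightarrow> g z" and g[measurable]: "g \<in> borel_measurable M"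
    and gnn: "\<And>z. 0 \<le> g z"
    and ui: "\<And>e. e > 0 \<Longrightarrow> \<exists>h. integrable M h \<and> (\<forall>z. 0 \<le> h z) \<and> (\<forall>k. (\<integral>z. max 0 (f k z - h z) \<partial>M) \<le> e)"
  shows "integrable M g" "(\<lambda>k. \<integral>z. \<bar>f k z - g z\<bar> \<partial>M) \<longlonglongrightarrow> 0" (is ?g1)
proof -
  have [measurable]: "f k \<in> borel_measurable M" for k using int by auto
  have tail: "integrable M (\<lambda>z. max 0 (g z - h z)) \<and> (\<integral>z. max 0 (g z - h z) \<partial>M) \<le> e"
    if h: "integrable M h" "\<forall>z. 0 \<le> h z" "\<forall>k. (\<integral>z. max 0 (f k z - h z) \<partial>M) \<le> e" for h e
  proof -
    have [measurable]: "h \<in> borel_measurable M" using h by auto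
    have i: "integrable M (\<lambda>z. max 0 (f k z - h z))" for k
      by (rule L1_bound[OF int[of k]]) (use nn h in \<open>auto simp: max_def intro!: AE_I2\<close>)
    have l: "AE z in M. (\<lambda>k. max 0 (f k z - h z)) \<longlonglongrightarrow> max 0 (g z - h z)"
      using lim by eventually_elim (intro tendsto_intros)
    show ?thesis
      using integral_Fatou_le[where f="\<lambda>k z. max 0 (f k z - h z)" and c="\<lambda>_. e", OF i _ _ tendsto_const l] h
      by auto
  qed
  show gint: "integrable M g"
  proof -
    obtain h where h: "integrable M h" "\<forall>z. 0 \<le> h z" "\<forall>k. (\<integral>z. max 0 (f k z - h z) \<partial>M) \<le> 1"
      using ui[of 1] by auto
    then have "integrable M (\<lambda>z. max 0 (g z - h z) + h z)"
      using tail by (intro L1_add) auto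
    then show ?thesis
      by (rule L1_bound) (use gnn h in \<open>auto simp: max_def intro!: AE_I2\<close>)
  qed
  show ?g1
  proof (rule LIMSEQ_I)
    fix e :: real assume e: "e > 0"
    obtain h where h: "integrable M h" "\<forall>z. 0 \<le> h z" "\<forall>k. (\<integral>z. max 0 (f k z - h z) \<partial>M) \<le> e/4"
      using ui[of "e/4"] e by auto
    have [measurable]: "h \<in> borel_measurable M" using h by auto
    have i1: "integrable M (\<lambda>z. max 0 (f k z - h z))" for k
      by (rule L1_bound[OF int[of k]]) (use nn h in \<open>auto simp: max_def intro!: AE_I2\<close>)
    have i2: "integrable M (\<lambda>z. \<bar>min (f k z) (h z) - min (g z) (h z)\<bar>)" for k
    proof (rule L1_bound[OF h(1)])
      show "AE z in M. norm \<bar>min (f k z) (h z) - min (g z) (h z)\<bar> \<le> norm (h z)"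
      proof (rule AE_I2)
        fix z
        show "norm \<bar>min (f k z) (h z) - min (g z) (h z)\<bar> \<le> norm (h z)"
          using nn[of k z] gnn[of z] h(2)[rule_format, of z] by (auto simp: min_def abs_if)
      qed
    qed auto
    have "(\<lambda>k. \<integral>z. \<bar>min (f k z) (h z) - min (g z) (h z)\<bar> \<partial>M) \<longlonglongrightarrow> (\<integral>z. 0 \<partial>M)"
    proof (rule integral_dominated_convergence[where w=h])
      show "AE z in M. (\<lambda>k. \<bar>min (f k z) (h z) - min (g z) (h z)\<bar>) \<longlonglongrightarrow> 0"
        using lim
      proof eventually_elim
        case (elim z)
        have "(\<lambda>k. \<bar>min (f k z) (h z) - min (g z) (h z)\<bar>) \<longlonglongrightarrow> \<bar>min (g z) (h z) - min (g z) (h z)\<bar>"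
          by (intro tendsto_intros elim)
        then show ?case by simp
      qed
      show "AE z in M. norm \<bar>min (f k z) (h z) - min (g z) (h z)\<bar> \<le> h z" for k
      proof (rule AE_I2)
        fix z
        show "norm \<bar>min (f k z) (h z) - min (g z) (h z)\<bar> \<le> h z"
          using nn[of k z] gnn[of z] h(2)[rule_format, of z] by (auto simp: min_def abs_if)
      qed
    qed (use h in auto)
    then obtain n0 where n0: "\<And>k. k \<ge> n0 \<Longrightarrow> (\<integral>z. \<bar>min (f k z) (h z) - min (g z) (h z)\<bar> \<partial>M) < e/4"
      using order_tendstoD(2)[of _ 0 sequentially "e/4"] e by (auto simp: eventually_sequentially)
    have "(\<integral>z. \<bar>f k z - g z\<bar> \<partial>M) < e" if "k \<ge> n0" for k
    proof -
      have "(\<integral>z. \<bar>f k z - g z\<bar> \<partial>M) \<le>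
        (\<integral>z. \<bar>min (f k z) (h z) - min (g z) (h z)\<bar> + (max 0 (f k z - h z) + max 0 (g z - h z)) \<partial>M)"
        using tail[OF h] by (intro integral_mono L1_add i1 i2 integrable_abs L1_diff int gint)
          (auto simp: min_def max_def)
      also have "\<dots> \<le> e/4 + (e/4 + e/4)"
        using tail[OF h] h(3)[rule_format, of k] n0[OF that] by (simp add: i1 i2)
      finally show ?thesis using e by linarith
    qed
    then show "\<exists>no. \<forall>k\<ge>no. norm ((\<integral>z. \<bar>f k z - g z\<bar> \<partial>M) - 0) < e"
      by (intro exI[of _ n0]) (auto simp: integral_nonneg_AE)
  qed
qed

end

section \<open>Dyadic grids and Riemann sums\<close>

definition dy :: "real \<Rightarrow> nat \<Rightarrow> nat \<Rightarrow> real" where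
  "dy T m j = T * real j / 2 ^ m"

lemma dy_0 [simp]: "dy T m 0 = 0"
  by (simp add: dy_def)

lemma dy_top [simp]: "dy T m (2 ^ m) = T"
  by (simp add: dy_def)

lemma dy_Suc: "dy T m (Suc j) = dy T m j + T / 2 ^ m"
  by (simp add: dy_def field_simps)

lemma dy_refine: "dy T (b + m) (c * 2 ^ m) = dy T b c"
  by (simp add: dy_def power_add)

lemma dy_mono: "T > 0 \<Longrightarrow> i \<le> j \<Longrightarrow> dy T m i \<le> dy T m j"
  by (simp add: dy_def divide_right_mono)

lemma dy_nonneg: "T > 0 \<Longrightarrow> 0 \<le> dy T m j"
  by (simp add: dy_def)

lemma dy_le: "T > 0 \<Longrightarrow> j \<le> 2 ^ m \<Longrightarrow> dy T m j \<le> T"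
  using dy_mono[of T j "2 ^ m" m] by simp

lemma dy_mem: "T > 0 \<Longrightarrow> j \<le> 2 ^ m \<Longrightarrow> dy T m j \<in> {0..T}"
  by (simp add: dy_nonneg dy_le)

lemma dy_diff_le: "T > 0 \<Longrightarrow> i \<le> j \<Longrightarrow> real j - real i \<le> C \<Longrightarrow> \<bar>dy T m i - dy T m j\<bar> \<le> C * T / 2 ^ m"
proof -
  assume a: "T > 0" "i \<le> j" "real j - real i \<le> C"
  have "dy T m j - dy T m i = (real j - real i) * T / 2 ^ m" by (simp add: dy_def field_simps)
  also have "\<dots> \<le> C * T / 2 ^ m" using a by (intro divide_right_mono mult_right_mono) auto
  finally show ?thesis using dy_mono[OF a(1,2), of m] by simp
qed

text \<open>The factor \<open>C\<close> lets one lemma serve different gaps: a block of several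
  cells, or a cell of a grid that is finer by a fixed number of levels.\<close>

lemma eventually_small_oscillation:
  fixes f :: "real \<Rightarrow> real"
  assumes "continuous_on {0..T} f" "T > 0" "e > 0"
  shows "\<forall>\<^sub>F m in sequentially. \<forall>u\<in>{0..T}. \<forall>v\<in>{0..T}. \<bar>u - v\<bar> \<le> C * T / 2 ^ m \<longrightarrow> \<bar>f u - f v\<bar> \<le> e"
proof -
  have "uniformly_continuous_on {0..T} f"
    using assms(1) by (intro compact_uniformly_continuous) auto
  then obtain d where d: "d > 0" "\<And>u v. u \<in> {0..T} \<Longrightarrow> v \<in> {0..T} \<Longrightarrow> dist v u < d \<Longrightarrow> dist (f v) (f u) < e"
    unfolding uniformly_continuous_on_def using assms(3) by metis
  have "(\<lambda>m. C * T * (1 / 2) ^ m) \<longlonglongrightarrow> C * T * 0"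
    by (intro tendsto_intros) auto
  then have "(\<lambda>m. C * T / 2 ^ m) \<longlonglongrightarrow> 0"
    by (simp add: power_divide)
  then have "\<forall>\<^sub>F m in sequentially. C * T / 2 ^ m < d"
    using d(1) order_tendstoD(2) by blast
  then show ?thesis
    by eventually_elim (use d(2) in \<open>force simp: dist_real_def abs_minus_commute\<close>)
qed

lemma sum_integral_grid:
  fixes f :: "real \<Rightarrow> real"
  assumes "continuous_on {0..T} f" "T > 0" "a \<le> b" "b \<le> 2 ^ m"
  shows "(\<Sum>l=a..<b. integral {dy T m l..dy T m (Suc l)} f) = integral {dy T m a..dy T m b} f"
  using assms(3,4)
proof (induction b)
  case (Suc b)
  show ?case
  proof (cases "a = Suc b")
    case False
    then have ab: "a \<le> b" using Suc by simp
    have "f integrable_on {dy T m a..dy T m (Suc b)}"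
      by (intro integrable_continuous_real continuous_on_subset[OF assms(1)])
         (use Suc assms(2) dy_nonneg[of T m a] dy_le[of T "Suc b" m] in auto)
    then have "integral {dy T m a..dy T m b} f + integral {dy T m b..dy T m (Suc b)} f = integral {dy T m a..dy T m (Suc b)} f"
      using ab assms(2) by (intro Henstock_Kurzweil_Integration.integral_combine dy_mono) auto
    then show ?thesis using Suc ab by simp
  qed simp
qed simp

text \<open>Sample values need only be uniformly close to f away from l = 0; at l = 0 a bound
  suffices because a single cell has vanishing length. The exception is made for averages over the
  preceding cell, which are 0 at the origin.\<close>

lemma riemann_limit:
  fixes f :: "real \<Rightarrow> real"
  assumes f: "continuous_on {0..T} f" and T: "T > 0" and c: "c \<le> 2 ^ b"
    and g: "\<And>e. e > 0 \<Longrightarrow> \<forall>\<^sub>F m in sequentially. \<forall>l. 0 < l \<longrightarrow> l < c * 2 ^ m \<longrightarrow> \<bar>g m l - f (dy T (b + m) l)\<bar> \<le> e"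
    and g0: "\<And>m. \<bar>g m 0\<bar> \<le> K"
  shows "(\<lambda>m. \<Sum>l<c * 2 ^ m. g m l * (T / 2 ^ (b + m))) \<longlonglongrightarrow> integral {0..dy T b c} f"
proof (rule LIMSEQ_I)
  fix r :: real assume r: "r > 0"
  \<comment> \<open>Each cell contributes an error of at most 2 e times its length, hence r/2 over
    [0, T]; the first cell adds less than r/4.\<close>
  define e where "e = r / (4 * T)"
  have e: "e > 0" using r T by (simp add: e_def)
  define dt where "dt m = T / 2 ^ (b + m)" for m
  have dt: "dt m > 0" for m using T by (simp add: dt_def)
  have dtlim: "dt \<longlonglongrightarrow> 0"
  proof -
    have "(\<lambda>m. T / 2 ^ b * (1 / 2) ^ m) \<longlonglongrightarrow> T / 2 ^ b * 0" by (intro tendsto_intros) auto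
    then show ?thesis by (simp add: dt_def[abs_def] power_add power_divide field_simps)
  qed
  have "(\<lambda>m. (K + \<bar>f 0\<bar>) * dt m) \<longlonglongrightarrow> (K + \<bar>f 0\<bar>) * 0"
    by (intro tendsto_intros dtlim)
  then have ev0: "\<forall>\<^sub>F m in sequentially. (K + \<bar>f 0\<bar>) * dt m < r / 4"
    using r order_tendstoD(2)[of _ 0 sequentially "r/4"] by simp
  have "\<forall>\<^sub>F m in sequentially. norm ((\<Sum>l<c * 2 ^ m. g m l * (T / 2 ^ (b + m))) - integral {0..dy T b c} f) < r"
    using g[OF e] ev0 eventually_small_oscillation[OF f T e, of "1 / 2 ^ b"]
  proof eventually_elim
    case (elim m)
    let ?n = "c * 2 ^ m" and ?t = "dy T (b + m)"
    have n: "?n \<le> 2 ^ (b + m)" using c by (simp add: power_add)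
    have step: "\<bar>g m l * dt m - integral {?t l..?t (Suc l)} f\<bar> \<le> 2 * e * dt m + (if l = 0 then (K + \<bar>f 0\<bar>) * dt m else 0)" if l: "l < ?n" for l
    proof -
      have mem: "{?t l..?t (Suc l)} \<subseteq> {0..T}"
        using T l n dy_nonneg[OF T, of "b+m" l] dy_le[OF T, of "Suc l" "b+m"] by auto
      have fi: "f integrable_on {?t l..?t (Suc l)}"
        by (intro integrable_continuous_real continuous_on_subset[OF f mem])
      have le: "?t l \<le> ?t (Suc l)" using T by (simp add: dy_mono)
      have "integral {?t l..?t (Suc l)} f - f (?t l) * dt m = integral {?t l..?t (Suc l)} (\<lambda>u. f u - f (?t l))"
        using fi le by (subst Henstock_Kurzweil_Integration.integral_diff) (auto simp: dy_Suc dt_def)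
      also have "norm \<dots> \<le> e * (?t (Suc l) - ?t l)"
      proof (rule integral_bound)
        show "continuous_on {?t l..?t (Suc l)} (\<lambda>u. f u - f (?t l))"
          by (intro continuous_intros continuous_on_subset[OF f mem])
        fix u assume u: "u \<in> {?t l..?t (Suc l)}"
        then have "\<bar>u - ?t l\<bar> \<le> 1 / 2 ^ b * T / 2 ^ m"
          by (auto simp: dy_Suc power_add)
        then show "norm (f u - f (?t l)) \<le> e"
          using elim(3) u mem le by (metis atLeastAtMost_iff order_refl real_norm_def subsetD)
      qed (use le in simp)
      finally have 1: "\<bar>integral {?t l..?t (Suc l)} f - f (?t l) * dt m\<bar> \<le> e * dt m"
        by (simp add: dy_Suc dt_def)
      have 2: "\<bar>g m l * dt m - f (?t l) * dt m\<bar> \<le> e * dt m + (if l = 0 then (K + \<bar>f 0\<bar>) * dt m else 0)"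
      proof (cases "l = 0")
        case True
        have "\<bar>g m l * dt m - f (?t l) * dt m\<bar> = \<bar>g m 0 - f 0\<bar> * dt m"
          using True dt[of m] by (simp add: left_diff_distrib[symmetric] abs_mult)
        also have "\<dots> \<le> (K + \<bar>f 0\<bar>) * dt m"
          using g0[of m] dt[of m] by (intro mult_right_mono) auto
        also have "\<dots> \<le> e * dt m + (K + \<bar>f 0\<bar>) * dt m"
          using e dt[of m] by simp
        finally show ?thesis using True by simp
      next
        case False
        have "\<bar>g m l * dt m - f (?t l) * dt m\<bar> = \<bar>g m l - f (?t l)\<bar> * dt m"
          using dt[of m] by (simp add: left_diff_distrib[symmetric] abs_mult)
        also have "\<dots> \<le> e * dt m"
          using elim(1) False l dt[of m] by (intro mult_right_mono) auto
        finally show ?thesis using False by simp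
      qed
      show ?thesis using 1 2 by linarith
    qed
    have "integral {0..dy T b c} f = (\<Sum>l<?n. integral {?t l..?t (Suc l)} f)"
      using sum_integral_grid[OF f T, of 0 ?n "b+m"] n by (simp add: dy_refine atLeast0LessThan)
    then have "\<bar>(\<Sum>l<?n. g m l * dt m) - integral {0..dy T b c} f\<bar> = \<bar>\<Sum>l<?n. g m l * dt m - integral {?t l..?t (Suc l)} f\<bar>"
      by (simp add: sum_subtractf)
    also have "\<dots> \<le> (\<Sum>l<?n. 2 * e * dt m + (if l = 0 then (K + \<bar>f 0\<bar>) * dt m else 0))"
      by (rule order.trans[OF sum_abs sum_mono]) (use step in auto)
    also have "\<dots> \<le> real ?n * (2 * e * dt m) + \<bar>(K + \<bar>f 0\<bar>) * dt m\<bar>"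
      using mult_nonneg_nonneg[of "K + \<bar>f 0\<bar>" "dt m"] g0[of m] dt[of m] by (simp add: sum.distrib)
    also have "real ?n * (2 * e * dt m) \<le> 2 ^ (b + m) * (2 * e * dt m)"
      using n e dt[of m] by (intro mult_right_mono) (simp_all flip: of_nat_le_iff[where 'a=real])
    also have "2 ^ (b + m) * (2 * e * dt m) = r / 2" using T by (simp add: dt_def e_def)
    also have "\<bar>(K + \<bar>f 0\<bar>) * dt m\<bar> < r / 4"
      using elim(2) g0[of m] dt[of m] by (simp add: abs_mult)
    finally show ?case using r by (simp add: dt_def)
  qed
  then show "\<exists>no. \<forall>m\<ge>no. norm ((\<Sum>l<c * 2 ^ m. g m l * (T / 2 ^ (b + m))) - integral {0..dy T b c} f) < r"
    by (simp add: eventually_sequentially)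
qed

lemma riemann_limit':
  fixes f :: "real \<Rightarrow> real"
  assumes f: "continuous_on {0..T} f" and T: "T > 0" and c: "c \<le> 2 ^ b"
  shows "(\<lambda>m. \<Sum>l<c * 2 ^ m. f (dy T (b + m) l) * (T / 2 ^ (b + m))) \<longlonglongrightarrow> integral {0..dy T b c} f"
  by (rule riemann_limit[OF f T c, where K="\<bar>f 0\<bar>"]) auto

lemma riemann_limit_interval:
  fixes f :: "real \<Rightarrow> real"
  assumes f: "continuous_on {0..T} f" and T: "T > 0" and c: "c \<le> 2 ^ b" "a \<le> c"
  shows "(\<lambda>m. \<Sum>l=a * 2 ^ m..<c * 2 ^ m. f (dy T (b + m) l) * (T / 2 ^ (b + m))) \<longlonglongrightarrow> integral {dy T b a..dy T b c} f"
proof -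
  let ?g = "\<lambda>m l. f (dy T (b + m) l) * (T / 2 ^ (b + m))"
  have "f integrable_on {0..dy T b c}"
    by (intro integrable_continuous_real continuous_on_subset[OF f]) (use T c dy_le[OF T c(1)] in auto)
  then have "integral {0..dy T b a} f + integral {dy T b a..dy T b c} f = integral {0..dy T b c} f"
    using T c by (intro Henstock_Kurzweil_Integration.integral_combine) (auto simp: dy_nonneg dy_mono)
  then have i: "integral {dy T b a..dy T b c} f = integral {0..dy T b c} f - integral {0..dy T b a} f" by simp
  have "(\<Sum>l=a * 2 ^ m..<c * 2 ^ m. ?g m l) = (\<Sum>l<c * 2 ^ m. ?g m l) - (\<Sum>l<a * 2 ^ m. ?g m l)" for m
    using sum.atLeastLessThan_concat[of 0 "a * 2 ^ m" "c * 2 ^ m" "?g m"] c by (simp add: atLeast0LessThan)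
  then show ?thesis
    unfolding i using c by (simp only:) (intro tendsto_diff riemann_limit' f T, auto)
qed

text \<open>For each outcome the integral is a limit of dyadic Riemann sums, which are measurable.
  Since \<open>N\<close> is arbitrary, taking it to be a member of the filtration gives
  adaptedness.\<close>

lemma measurable_integral_continuous:
  fixes Y :: "real \<Rightarrow> 'a \<Rightarrow> real"
  assumes c: "\<And>z. z \<in> space N \<Longrightarrow> continuous_on {a..b} (\<lambda>u. Y u z)"
    and m: "\<And>u. u \<in> {a..b} \<Longrightarrow> Y u \<in> borel_measurable N"
  shows "(\<lambda>z. integral {a..b} (\<lambda>u. Y u z)) \<in> borel_measurable N"
proof (cases "a < b")
  case True
  let ?T = "b - a"
  let ?s = "\<lambda>m z. \<Sum>l<1 * 2 ^ m. Y (a + dy ?T (0 + m) l) z * (?T / 2 ^ (0 + m))"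
  show ?thesis
  proof (rule borel_measurable_LIMSEQ_metric[where f="?s"])
    fix m
    have "a + dy ?T m l \<in> {a..b}" if "l < 2 ^ m" for l
      using dy_mem[of ?T l m] True that by auto
    then show "?s m \<in> borel_measurable N"
      using m by (intro borel_measurable_sum borel_measurable_times) auto
  next
    fix z assume w: "z \<in> space N"
    have "continuous_on {0..?T} (\<lambda>u. Y (a + u) z)"
      by (rule continuous_on_compose2[OF c[OF w]]) (auto intro!: continuous_intros)
    from riemann_limit'[OF this, of 1 0] True
    have "(\<lambda>m. ?s m z) \<longlonglongrightarrow> integral {0..?T} (\<lambda>u. Y (a + u) z)" by (simp add: dy_def)
    also have "integral {0..?T} (\<lambda>u. Y (a + u) z) = integral {a..b} (\<lambda>u. Y u z)"
      using integral_shift_Icc_real[of 0 "b - a" "\<lambda>u. Y u z" a] by (simp add: o_def)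
    finally show "(\<lambda>m. ?s m z) \<longlonglongrightarrow> integral {a..b} (\<lambda>u. Y u z)" .
  qed
next
  case False
  then have "integral {a..b} (\<lambda>u. Y u z) = 0" for z
    by (cases "a = b") auto
  then show ?thesis by simp
qed

text \<open>Cauchy-Schwarz, read off from the nonnegative variance of f about its mean
  \<open>c\<close>.\<close>

lemma square_integral_le:
  fixes f :: "real \<Rightarrow> real"
  assumes f: "continuous_on {a..b} f" and ab: "a \<le> b"
  shows "(integral {a..b} f)\<^sup>2 \<le> (b - a) * integral {a..b} (\<lambda>u. (f u)\<^sup>2)"
proof (cases "a = b")
  case False
  then have d: "b - a > 0" using ab by simp
  define c where "c = integral {a..b} f / (b - a)"
  have i: "f integrable_on {a..b}" "(\<lambda>u. (f u)\<^sup>2) integrable_on {a..b}"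
    by (intro integrable_continuous_real continuous_intros f)+
  have "0 \<le> integral {a..b} (\<lambda>u. (f u - c)\<^sup>2)"
    by (intro Henstock_Kurzweil_Integration.integral_nonneg integrable_continuous_real continuous_intros f) auto
  also have "(\<lambda>u. (f u - c)\<^sup>2) = (\<lambda>u. (f u)\<^sup>2 - 2 * c * f u + c\<^sup>2)"
    by (auto simp: power2_eq_square algebra_simps)
  also have "integral {a..b} \<dots> = integral {a..b} (\<lambda>u. (f u)\<^sup>2) - 2 * c * integral {a..b} f + c\<^sup>2 * (b - a)"
  proof -
    have j: "(\<lambda>u. 2 * c * f u) integrable_on {a..b}" using integrable_on_cmult_left[OF i(1), of "2 * c"] by simp
    have k: "(\<lambda>u. (f u)\<^sup>2 - 2 * c * f u) integrable_on {a..b}" by (intro integrable_diff i j)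
    show ?thesis
      using ab by (subst Henstock_Kurzweil_Integration.integral_add[OF k])
        (auto simp: Henstock_Kurzweil_Integration.integral_diff[OF i(2) j])
  qed
  also have "\<dots> = integral {a..b} (\<lambda>u. (f u)\<^sup>2) - c * integral {a..b} f"
  proof -
    have "c * (b - a) = integral {a..b} f" using d by (simp add: c_def)
    then have "c\<^sup>2 * (b - a) = c * integral {a..b} f" by (simp add: power2_eq_square)
    then show ?thesis by simp
  qed
  finally have "0 \<le> (b - a) * (integral {a..b} (\<lambda>u. (f u)\<^sup>2) - c * integral {a..b} f)"
    using d by simp
  also have "\<dots> = (b - a) * integral {a..b} (\<lambda>u. (f u)\<^sup>2) - (integral {a..b} f)\<^sup>2"
    using d by (simp add: c_def right_diff_distrib power2_eq_square)
  finally show ?thesis by simp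
qed simp

text \<open>The average over the cell before grid point l. It depends only on the past, so it is an
  admissible integrand, and by Cauchy-Schwarz its discrete energy is at most the energy of f, path
  by path; left-end values have the first property but not the second. At l = 0 the preceding cell
  is empty and the value is 0.\<close>

definition lagavg :: "real \<Rightarrow> (real \<Rightarrow> real) \<Rightarrow> nat \<Rightarrow> nat \<Rightarrow> real" where
  "lagavg T f m l = 2 ^ m / T * integral {dy T m (l - 1)..dy T m l} f"

lemma lagavg_0 [simp]: "lagavg T f m 0 = 0"
  by (simp add: lagavg_def)

lemma eventually_lagavg:
  assumes f: "continuous_on {0..T} f" and T: "T > 0" and e: "e > 0"
  shows "\<forall>\<^sub>F m in sequentially. \<forall>l. 0 < l \<longrightarrow> l \<le> 2 ^ m \<longrightarrow> \<bar>lagavg T f m l - f (dy T m l)\<bar> \<le> e"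
  using eventually_small_oscillation[OF f T e, of 1]
proof eventually_elim
  case (elim m)
  show ?case
  proof (intro allI impI)
    fix l :: nat assume l: "0 < l" "l \<le> 2 ^ m"
    then obtain i where i: "l = Suc i" using gr0_implies_Suc by blast
    have mem: "{dy T m i..dy T m l} \<subseteq> {0..T}"
      using T l dy_nonneg[OF T, of m i] dy_le[OF T l(2)] by auto
    have fi: "f integrable_on {dy T m i..dy T m l}"
      by (intro integrable_continuous_real continuous_on_subset[OF f mem])
    have le: "dy T m i \<le> dy T m l" using T i by (simp add: dy_mono)
    have "integral {dy T m i..dy T m l} f - f (dy T m l) * (T / 2 ^ m) = integral {dy T m i..dy T m l} (\<lambda>u. f u - f (dy T m l))"
      using fi le i by (subst Henstock_Kurzweil_Integration.integral_diff) (auto simp: dy_Suc)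
    also have "norm \<dots> \<le> e * (dy T m l - dy T m i)"
    proof (rule integral_bound)
      show "continuous_on {dy T m i..dy T m l} (\<lambda>u. f u - f (dy T m l))"
        by (intro continuous_intros continuous_on_subset[OF f mem])
      fix u assume u: "u \<in> {dy T m i..dy T m l}"
      then have "\<bar>u - dy T m l\<bar> \<le> 1 * T / 2 ^ m"
        by (auto simp: i dy_Suc)
      then show "norm (f u - f (dy T m l)) \<le> e"
        using elim u mem le by (metis atLeastAtMost_iff order_refl real_norm_def subsetD)
    qed (use le in simp)
    finally have *: "\<bar>integral {dy T m i..dy T m l} f - f (dy T m l) * (T / 2 ^ m)\<bar> \<le> e * (T / 2 ^ m)"
      by (simp add: i dy_Suc)
    have "\<bar>lagavg T f m l - f (dy T m l)\<bar> = 2 ^ m / T * \<bar>integral {dy T m i..dy T m l} f - f (dy T m l) * (T / 2 ^ m)\<bar>"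
    proof -
      have "lagavg T f m l - f (dy T m l) = 2 ^ m / T * (integral {dy T m i..dy T m l} f - f (dy T m l) * (T / 2 ^ m))"
        using T by (simp add: lagavg_def i right_diff_distrib)
      then show ?thesis using T by (simp add: abs_mult)
    qed
    also have "\<dots> \<le> 2 ^ m / T * (e * (T / 2 ^ m))" using * T by (intro mult_left_mono) auto
    finally show "\<bar>lagavg T f m l - f (dy T m l)\<bar> \<le> e" using T by simp
  qed
qed

lemma lagavg_square_le:
  assumes f: "continuous_on {0..T} f" and T: "T > 0" and l: "l \<le> 2 ^ m"
  shows "(lagavg T f m l)\<^sup>2 * (T / 2 ^ m) \<le> integral {dy T m (l - 1)..dy T m l} (\<lambda>u. (f u)\<^sup>2)"
proof (cases l)
  case (Suc i)
  have mem: "{dy T m i..dy T m l} \<subseteq> {0..T}"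
    using T l dy_nonneg[OF T, of m i] dy_le[OF T l] by auto
  have "(lagavg T f m l)\<^sup>2 * (T / 2 ^ m) = 2 ^ m / T * (integral {dy T m i..dy T m l} f)\<^sup>2"
    using T by (simp add: lagavg_def Suc power2_eq_square field_simps)
  also have "\<dots> \<le> 2 ^ m / T * ((dy T m l - dy T m i) * integral {dy T m i..dy T m l} (\<lambda>u. (f u)\<^sup>2))"
    using T Suc by (intro mult_left_mono square_integral_le continuous_on_subset[OF f mem]) (auto simp: dy_mono)
  finally show ?thesis using T by (simp add: Suc dy_Suc)
qed simp

text \<open>Shifting the index by one matches each average with the cell it was taken from, and the
  term at l = 0 vanishes. The bound holds on every grid without an error term, which keeps discrete
  brackets below the total energy.\<close>

lemma sum_lagavg_square_le:
  assumes f: "continuous_on {0..T} f" and T: "T > 0"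
  shows "(\<Sum>l<2 ^ m. (lagavg T f m l)\<^sup>2 * (T / 2 ^ m)) \<le> integral {0..T} (\<lambda>u. (f u)\<^sup>2)"
proof -
  have c2: "continuous_on {0..T} (\<lambda>u. (f u)\<^sup>2)" by (intro continuous_intros f)
  have "(\<Sum>l<2 ^ m. (lagavg T f m l)\<^sup>2 * (T / 2 ^ m)) \<le> (\<Sum>l<Suc (2 ^ m). (lagavg T f m l)\<^sup>2 * (T / 2 ^ m))"
    using T by simp
  also have "\<dots> = (\<Sum>l<2 ^ m. (lagavg T f m (Suc l))\<^sup>2 * (T / 2 ^ m))"
    by (subst sum.lessThan_Suc_shift) simp
  also have "\<dots> \<le> (\<Sum>l=0..<2 ^ m. integral {dy T m l..dy T m (Suc l)} (\<lambda>u. (f u)\<^sup>2))"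
    unfolding atLeast0LessThan by (intro sum_mono order.trans[OF lagavg_square_le[OF f T]]) auto
  also have "\<dots> = integral {0..T} (\<lambda>u. (f u)\<^sup>2)"
    by (subst sum_integral_grid[OF c2 T]) auto
  finally show ?thesis .
qed

section \<open>Characteristic functions and independence\<close>

text \<open>Normalized, u is a density, and under it \<open>V\<close> has the characteristic
  function of \<gamma>, so Levy's uniqueness theorem identifies its law. If u has mean 0, both sides
  vanish.\<close>

lemma (in prob_space) char_factor_one:
  assumes u: "integrable M u" "\<And>z. 0 \<le> u z" and V[measurable]: "V \<in> borel_measurable M"
    and \<gamma>: "real_distribution \<gamma>"
    and h: "\<And>l. (\<integral>z. cr (u z) * iexp (l * V z) \<partial>M) = cr (\<integral>z. u z \<partial>M) * char \<gamma> l"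
    and C[measurable]: "C \<in> sets borel"
  shows "(\<integral>z. u z * indicator C (V z) \<partial>M) = (\<integral>z. u z \<partial>M) * measure \<gamma> C"
proof -
  have [measurable]: "u \<in> borel_measurable M" using u by auto
  define c where "c = (\<integral>z. u z \<partial>M)"
  have c0: "c \<ge> 0" using u by (simp add: c_def)
  show ?thesis
  proof (cases "c = 0")
    case True
    then have "AE z in M. u z = 0"
      using u integral_nonneg_eq_0_iff_AE[OF u(1)] by (simp add: c_def)
    then have "(\<integral>z. u z * indicator C (V z) \<partial>M) = (\<integral>z. 0 \<partial>M)"
      by (intro integral_cong_AE) auto
    then show ?thesis using True by (simp add: c_def)
  next
    case False
    then have c: "c > 0" using c0 by simp
    define D where "D = density M (\<lambda>z. ennreal (u z / c))"
    have uc: "integrable M (\<lambda>z. u z / c)" using u by simp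
    interpret D: prob_space D
    proof
      have "emeasure D (space D) = (\<integral>\<^sup>+z. ennreal (u z / c) \<partial>M)"
        by (simp add: D_def emeasure_density cong: nn_integral_cong)
      also have "\<dots> = ennreal (\<integral>z. u z / c \<partial>M)"
        using u c by (intro nn_integral_eq_integral uc) auto
      also have "(\<integral>z. u z / c \<partial>M) = 1" using c by (simp add: c_def)
      finally show "emeasure D (space D) = 1" by simp
    qed
    have VD[measurable]: "V \<in> borel_measurable D" by (simp add: D_def)
    interpret N: real_distribution "distr D borel V"
      by (rule D.real_distribution_distr) simp
    have "char (distr D borel V) = char \<gamma>"
    proof
      fix l
      have "char (distr D borel V) l = (\<integral>z. (u z / c) *\<^sub>R iexp (l * V z) \<partial>M)"
        using u c by (simp add: char_def integral_distr D_def integral_density)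
      also have "\<dots> = (\<integral>z. cr (u z) * iexp (l * V z) / c \<partial>M)"
        by (intro Bochner_Integration.integral_cong) (auto simp: scaleR_conv_of_real)
      also have "\<dots> = char \<gamma> l" using h c by (simp add: c_def[symmetric])
      finally show "char (distr D borel V) l = char \<gamma> l" .
    qed
    then have eq: "distr D borel V = \<gamma>"
      using Levy_uniqueness[OF N.real_distribution_axioms \<gamma>] by simp
    have "measure \<gamma> C = measure D (V -` C \<inter> space D)"
      unfolding eq[symmetric] by (subst measure_distr) auto
    also have "\<dots> = (\<integral>z. indicator (V -` C \<inter> space D) z \<partial>D)" by simp
    also have "\<dots> = (\<integral>z. indicator C (V z) \<partial>D)"
      by (intro Bochner_Integration.integral_cong) (auto simp: indicator_def)
    also have "\<dots> = (\<integral>z. u z / c * indicator C (V z) \<partial>M)"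
      using u c by (simp add: D_def integral_density)
    also have "\<dots> = (\<integral>z. u z * indicator C (V z) \<partial>M) / c" by simp
    finally show ?thesis using c by (simp add: c_def[symmetric])
  qed
qed

lemma (in prob_space) integrable_mult_iexp:
  assumes "integrable M (g :: 'a \<Rightarrow> complex)" and [measurable]: "Y \<in> borel_measurable M"
  shows "integrable M (\<lambda>z. g z * iexp (Y z))"
proof -
  have [measurable]: "g \<in> borel_measurable M" using assms by auto
  show ?thesis
    by (rule L1_bound[OF assms(1)]) (auto simp: norm_mult)
qed

text \<open>Coordinates are peeled off one at a time. Restricting coordinate \<open>a\<close> to
  \<open>C a\<close> changes the weight from w to \<open>w'\<close>; the point is that the
  characteristic identity for the remaining coordinates survives this change, so that the induction
  hypothesis applies to \<open>w'\<close>.\<close>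

lemma (in prob_space) char_factor_box:
  assumes "finite I" and "integrable M w" "\<And>z. 0 \<le> w z"
    and V[measurable]: "\<And>i. i \<in> I \<Longrightarrow> V i \<in> borel_measurable M"
    and \<gamma>: "\<And>i. i \<in> I \<Longrightarrow> real_distribution (\<gamma> i)"
    and "\<And>mu. (\<integral>z. cr (w z) * iexp (\<Sum>i\<in>I. mu i * V i z) \<partial>M)
          = cr (\<integral>z. w z \<partial>M) * (\<Prod>i\<in>I. char (\<gamma> i) (mu i))"
    and C: "\<And>i. i \<in> I \<Longrightarrow> C i \<in> sets borel"
  shows "(\<integral>z. w z * (\<Prod>i\<in>I. indicator (C i) (V i z)) \<partial>M) = (\<integral>z. w z \<partial>M) * (\<Prod>i\<in>I. measure (\<gamma> i) (C i))"
  using assms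
proof (induction I arbitrary: w)
  case (insert a I)
  note w = insert.prems(1,2) and h = insert.prems(5)
  have [measurable]: "w \<in> borel_measurable M" using w by auto
  have [measurable]: "V a \<in> borel_measurable M" "\<And>i. i \<in> I \<Longrightarrow> V i \<in> borel_measurable M" "C a \<in> sets borel"
    using insert.prems by auto
  interpret ga: real_distribution "\<gamma> a" using insert.prems by simp
  define c where "c = cr (\<integral>z. w z \<partial>M)"
  have wc: "integrable M (\<lambda>z. cr (w z))" using w by simp
  have hI: "(\<integral>z. cr (w z) * iexp (l * V a z + (\<Sum>i\<in>I. mu i * V i z)) \<partial>M)
      = c * (char (\<gamma> a) l * (\<Prod>i\<in>I. char (\<gamma> i) (mu i)))" for l mu
  proof -
    have "(\<Sum>i\<in>insert a I. (mu(a := l)) i * V i z) = l * V a z + (\<Sum>i\<in>I. mu i * V i z)" for z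
      using insert.hyps by (auto intro!: sum.cong)
    moreover have "(\<Prod>i\<in>insert a I. char (\<gamma> i) ((mu(a := l)) i)) = char (\<gamma> a) l * (\<Prod>i\<in>I. char (\<gamma> i) (mu i))"
      using insert.hyps by (auto intro!: prod.cong)
    ultimately show ?thesis using h[of "mu(a := l)"] by (simp only: c_def)
  qed
  have one: "(\<integral>z. w z * indicator (C a) (V a z) \<partial>M) = (\<integral>z. w z \<partial>M) * measure (\<gamma> a) (C a)"
    using hI[of _ "\<lambda>_. 0"] insert.prems
    by (intro char_factor_one w) (auto simp: c_def ga.char_zero prod.neutral real_distribution.char_zero)
  define w' where "w' z = w z * indicator (C a) (V a z)" for z
  have w'int: "integrable M w'"
    unfolding w'_def[abs_def] by (rule L1_bound[OF w(1)]) (auto simp: indicator_def)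
  have [measurable]: "w' \<in> borel_measurable M" using w'int by auto
  have cosint: "integrable M (\<lambda>z. v z * cos (Y z))" if "integrable M v" "Y \<in> borel_measurable M" for v Y :: "'a \<Rightarrow> real"
  proof -
    have [measurable]: "v \<in> borel_measurable M" "Y \<in> borel_measurable M" using that by auto
    show ?thesis
      by (rule L1_bound[OF that(1)]) (auto simp: abs_mult intro!: mult_left_le)
  qed
  have cosw: "(\<integral>z. w' z * cos ((\<Sum>i\<in>I. mu i * V i z) + th) \<partial>M) = measure (\<gamma> a) (C a) * (\<integral>z. w z * cos ((\<Sum>i\<in>I. mu i * V i z) + th) \<partial>M)" for mu th
  proof -
    define Y where "Y z = (\<Sum>i\<in>I. mu i * V i z)" for z
    have [measurable]: "Y \<in> borel_measurable M" unfolding Y_def[abs_def] by measurable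
    \<comment> \<open>\<open>char_factor_one\<close> asks for a nonnegative real weight, which a
      complex exponential is not. The weight w (1 + cos (Y + th)) is nonnegative, and the phases th
      = 0 and th = -pi/2 recover the real and imaginary parts.\<close>
    define u where "u z = w z + w z * cos (Y z + th)" for z
    have uint: "integrable M u" unfolding u_def[abs_def] using w by (intro L1_add cosint) auto
    have u0: "0 \<le> u z" for z
    proof -
      have "u z = w z * (1 + cos (Y z + th))" by (simp add: u_def distrib_left)
      also have "\<dots> \<ge> 0" using w(2)[of z] cos_ge_minus_one[of "Y z + th"] by (intro mult_nonneg_nonneg) linarith+
      finally show ?thesis .
    qed
    \<comment> \<open>The contribution of the coordinates in \<open>I\<close> to the transform of
      \<open>u\<close>. It does not depend on l, which is what separates the factor
      \<open>char (\<gamma> a) l\<close>.\<close>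
    define K where "K = 1 + (exp (\<i> * th) * (\<Prod>i\<in>I. char (\<gamma> i) (mu i)) + exp (- (\<i> * th)) * (\<Prod>i\<in>I. char (\<gamma> i) (- mu i))) / 2"
    have uK: "(\<integral>z. cr (u z) * iexp (l * V a z) \<partial>M) = c * char (\<gamma> a) l * K" for l
    proof -
      let ?E = "\<lambda>\<nu> z. cr (w z) * iexp (l * V a z + (\<Sum>i\<in>I. \<nu> i * V i z))"
      have lin: "(\<integral>z. f0 z + (x * f1 z + y * f2 z) \<partial>M) = (\<integral>z. f0 z \<partial>M) + (x * (\<integral>z. f1 z \<partial>M) + y * (\<integral>z. f2 z \<partial>M))"
        if "integrable M f0" "integrable M f1" "integrable M f2" for f0 f1 f2 :: "'a \<Rightarrow> complex" and x y
        using that by simp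
      have Eint: "integrable M (?E \<nu>)" for \<nu> by (intro integrable_mult_iexp wc) measurable
      have "cr (u z) * iexp (l * V a z) = ?E (\<lambda>_. 0) z + (exp (\<i> * th) / 2 * ?E mu z + exp (- (\<i> * th)) / 2 * ?E (\<lambda>i. - mu i) z)" for z
      proof -
        have "cr (cos (Y z + th)) = (exp (\<i> * th) * iexp (Y z) + exp (- (\<i> * th)) * iexp (- Y z)) / 2"
          by (simp add: cos_of_real[symmetric] cos_exp_eq exp_add[symmetric] algebra_simps)
        moreover have "iexp (l * V a z + Y z) = iexp (l * V a z) * iexp (Y z)"
          "iexp (l * V a z + - Y z) = iexp (l * V a z) * iexp (- Y z)"
          by (simp_all only: of_real_add distrib_left exp_add)
        moreover have "(\<Sum>i\<in>I. mu i * V i z) = Y z" "(\<Sum>i\<in>I. - mu i * V i z) = - Y z"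
          by (simp_all add: Y_def sum_negf)
        ultimately show ?thesis
          by (simp only: u_def of_real_add of_real_mult) (simp add: field_simps del: of_real_minus of_real_add)
      qed
      then have "(\<integral>z. cr (u z) * iexp (l * V a z) \<partial>M) =
         (\<integral>z. ?E (\<lambda>_. 0) z \<partial>M) + (exp (\<i> * th) / 2 * (\<integral>z. ?E mu z \<partial>M) + exp (- (\<i> * th)) / 2 * (\<integral>z. ?E (\<lambda>i. - mu i) z \<partial>M))"
        by (simp only: lin[OF Eint Eint Eint])
      also have "\<dots> = c * char (\<gamma> a) l * K"
      proof -
        have "(\<Prod>i\<in>I. char (\<gamma> i) 0) = 1"
          using insert.prems by (intro prod.neutral) (auto simp: real_distribution.char_zero)
        then show ?thesis unfolding hI by (simp add: K_def algebra_simps add_divide_distrib)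
      qed
      finally show ?thesis .
    qed
    have "(\<integral>z. u z * indicator (C a) (V a z) \<partial>M) = (\<integral>z. u z \<partial>M) * measure (\<gamma> a) (C a)"
    proof (rule char_factor_one[OF uint u0])
      fix l
      show "(\<integral>z. cr (u z) * iexp (l * V a z) \<partial>M) = cr (\<integral>z. u z \<partial>M) * char (\<gamma> a) l"
        using uK[of l] uK[of 0] by (simp add: ga.char_zero mult.commute mult.left_commute)
    qed (auto intro: ga.real_distribution_axioms)
    moreover have "(\<integral>z. u z * indicator (C a) (V a z) \<partial>M) = (\<integral>z. w' z + w' z * cos (Y z + th) \<partial>M)"
      by (intro Bochner_Integration.integral_cong) (auto simp: u_def w'_def algebra_simps)
    ultimately show ?thesis
      using one w by (simp add: u_def Y_def[symmetric] w'_def[symmetric] cosint w'int algebra_simps)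
  qed
  have E_cs: "(\<integral>z. cr (v z) * iexp (Y z) \<partial>M) =
      Complex (\<integral>z. v z * cos (Y z + 0) \<partial>M) (\<integral>z. v z * cos (Y z + - (pi / 2)) \<partial>M)"
    if "integrable M v" "Y \<in> borel_measurable M" for v Y :: "'a \<Rightarrow> real"
  proof -
    have "cr (v z) * iexp (Y z) = cr (v z * cos (Y z + 0)) + \<i> * cr (v z * cos (Y z + - (pi / 2)))" for z
      by (simp add: cis_conv_exp[symmetric] complex_eq_iff cos_diff)
    then have "(\<integral>z. cr (v z) * iexp (Y z) \<partial>M) =
       (\<integral>z. cr (v z * cos (Y z + 0)) \<partial>M) + \<i> * (\<integral>z. cr (v z * cos (Y z + - (pi / 2))) \<partial>M)"
      using cosint[OF that(1), of "\<lambda>z. Y z + 0"] cosint[OF that(1), of "\<lambda>z. Y z + - (pi / 2)"] that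
      by (simp only:) (subst Bochner_Integration.integral_add; simp del: of_real_mult)
    then show ?thesis by (simp only: integral_complex_of_real) (simp add: complex_eq_iff)
  qed
  have "(\<integral>z. w' z * (\<Prod>i\<in>I. indicator (C i) (V i z)) \<partial>M) = (\<integral>z. w' z \<partial>M) * (\<Prod>i\<in>I. measure (\<gamma> i) (C i))"
  proof (rule insert.IH[OF w'int])
    show "0 \<le> w' z" for z using w by (simp add: w'_def)
    fix mu
    have Ym: "(\<lambda>z. \<Sum>i\<in>I. mu i * V i z) \<in> borel_measurable M" by measurable
    have "(\<integral>z. cr (w' z) * iexp (\<Sum>i\<in>I. mu i * V i z) \<partial>M) =
      measure (\<gamma> a) (C a) * (\<integral>z. cr (w z) * iexp (\<Sum>i\<in>I. mu i * V i z) \<partial>M)"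
      unfolding E_cs[OF w'int Ym] E_cs[OF w(1) Ym] cosw by (simp add: complex_eq_iff)
    also have "(\<integral>z. cr (w z) * iexp (\<Sum>i\<in>I. mu i * V i z) \<partial>M) = c * (\<Prod>i\<in>I. char (\<gamma> i) (mu i))"
      using hI[of 0 mu] by (simp add: ga.char_zero)
    also have "measure (\<gamma> a) (C a) * (c * (\<Prod>i\<in>I. char (\<gamma> i) (mu i))) = cr (\<integral>z. w' z \<partial>M) * (\<Prod>i\<in>I. char (\<gamma> i) (mu i))"
      using one by (simp add: w'_def[abs_def] c_def)
    finally show "(\<integral>z. cr (w' z) * iexp (\<Sum>i\<in>I. mu i * V i z) \<partial>M) = cr (\<integral>z. w' z \<partial>M) * (\<Prod>i\<in>I. char (\<gamma> i) (mu i))" .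
  qed (use insert.prems in auto)
  then show ?case
    using insert.hyps one by (simp add: w'_def mult.assoc[symmetric] w'_def[abs_def])
qed simp

section \<open>Centred Gaussian laws, parametrized by the variance\<close>

definition gauss :: "real \<Rightarrow> real measure" where
  "gauss v = density lborel (\<lambda>x. ennreal (normal_density 0 (sqrt v) x))"

lemma space_gauss [simp]: "space (gauss v) = UNIV"
  and sets_gauss [simp, measurable_cong]: "sets (gauss v) = sets borel"
  by (auto simp: gauss_def)

lemma prob_space_gauss: "v > 0 \<Longrightarrow> prob_space (gauss v)"
  unfolding gauss_def by (rule prob_space_normal_density) simp

lemma real_distribution_gauss: "v > 0 \<Longrightarrow> real_distribution (gauss v)"
  using prob_space_gauss[of v] by (simp add: real_distribution_def real_distribution_axioms_def)

lemma char_gauss: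
  assumes v: "v > 0"
  shows "char (gauss v) l = exp (- (v * l\<^sup>2 / 2))"
proof -
  have "char (gauss v) l = (\<integral>x. normal_density 0 (sqrt v) x *\<^sub>R iexp (l * x) \<partial>lborel)"
    by (simp add: char_def gauss_def integral_density)
  also have "\<dots> = sqrt v *\<^sub>R (\<integral>x. normal_density 0 (sqrt v) (0 + sqrt v * x) *\<^sub>R iexp (l * (0 + sqrt v * x)) \<partial>lborel)"
    using v by (subst lborel_integral_real_affine[where c="sqrt v" and t=0]) auto
  also have "\<dots> = (\<integral>x. sqrt v *\<^sub>R (normal_density 0 (sqrt v) (0 + sqrt v * x) *\<^sub>R iexp (l * (0 + sqrt v * x))) \<partial>lborel)"
    by (rule integral_scaleR_right[symmetric])
  also have "\<dots> = (\<integral>x. std_normal_density x *\<^sub>R iexp ((l * sqrt v) * x) \<partial>lborel)"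
    using v by (intro Bochner_Integration.integral_cong refl)
      (simp add: normal_density_def power_mult_distrib real_sqrt_mult mult.assoc)
  also have "\<dots> = char std_normal_distribution (l * sqrt v)"
    by (simp add: char_def integral_density)
  also have "\<dots> = exp (- (v * l\<^sup>2 / 2))"
    using v by (simp add: char_std_normal_distribution power_mult_distrib mult.commute)
  finally show ?thesis .
qed

text \<open>Girsanov's theorem for a single Gaussian variable, by completing the square: the weight
  shifts the density by -th v, so x + th v is again centred with variance v under the weighted
  law.\<close>

lemma integral_gauss_shift:
  assumes v: "v > 0"
  shows "(\<integral>x. cr (exp (- (th * x) - th\<^sup>2 * v / 2)) * iexp (l * (x + th * v)) \<partial>gauss v) = exp (- (v * l\<^sup>2 / 2))" (is ?g1)
    and "integrable (gauss v) (\<lambda>x. exp (- (th * x) - th\<^sup>2 * v / 2))" (is ?g2)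
    and "(\<integral>x. exp (- (th * x) - th\<^sup>2 * v / 2) \<partial>gauss v) = 1" (is ?g3)
proof -
  have dens: "normal_density 0 (sqrt v) x * exp (- (th * x) - th\<^sup>2 * v / 2) = normal_density 0 (sqrt v) (th * v + 1 * x)" for x
  proof -
    have "- x\<^sup>2 / (2 * v) + (- (th * x) - th\<^sup>2 * v / 2) = - (th * v + 1 * x)\<^sup>2 / (2 * v)"
      using v by (simp add: field_simps power2_eq_square)
    then show ?thesis
      using v by (simp add: normal_density_def exp_add[symmetric])
  qed
  have "(\<integral>x. cr (exp (- (th * x) - th\<^sup>2 * v / 2)) * iexp (l * (x + th * v)) \<partial>gauss v) =
     (\<integral>x. normal_density 0 (sqrt v) x *\<^sub>R (cr (exp (- (th * x) - th\<^sup>2 * v / 2)) * iexp (l * (x + th * v))) \<partial>lborel)"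
    by (simp add: gauss_def integral_density)
  also have "\<dots> = (\<integral>x. normal_density 0 (sqrt v) (th * v + 1 * x) *\<^sub>R iexp (l * (th * v + 1 * x)) \<partial>lborel)"
    by (intro Bochner_Integration.integral_cong refl, subst dens[symmetric]) (simp add: scaleR_conv_of_real add.commute)
  also have "\<dots> = (\<integral>x. normal_density 0 (sqrt v) x *\<^sub>R iexp (l * x) \<partial>lborel)"
    using lborel_integral_real_affine[of 1 "\<lambda>x. normal_density 0 (sqrt v) x *\<^sub>R iexp (l * x)" "th * v"] by simp
  also have "\<dots> = char (gauss v) l"
    by (simp add: char_def gauss_def integral_density)
  finally show ?g1
    using char_gauss[OF v] by simp
  have i: "integrable lborel (\<lambda>x. normal_density 0 (sqrt v) (th * v + 1 * x))"
    using lborel_integrable_real_affine[of "normal_density 0 (sqrt v)" 1 "th * v"] v by simp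
  then show ?g2
    using dens by (simp add: gauss_def integrable_density)
  have "(\<integral>x. exp (- (th * x) - th\<^sup>2 * v / 2) \<partial>gauss v) = (\<integral>x. normal_density 0 (sqrt v) (th * v + 1 * x) \<partial>lborel)"
    using dens by (simp add: gauss_def integral_density)
  also have "\<dots> = (\<integral>x. normal_density 0 (sqrt v) x \<partial>lborel)"
    using lborel_integral_real_affine[of 1 "normal_density 0 (sqrt v)" "th * v"] by simp
  finally show ?g3 using v by simp
qed

lemma gauss_moments:
  assumes v: "v > 0"
  shows "integrable (gauss v) (\<lambda>x. x)" "(\<integral>x. x \<partial>gauss v) = 0"
    "integrable (gauss v) (\<lambda>x. x\<^sup>2)" "(\<integral>x. x\<^sup>2 \<partial>gauss v) = v" (is ?g1)
proof -
  have s: "sqrt v > 0" using v by simp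
  show "integrable (gauss v) (\<lambda>x. x)"
    using integrable_normal_moment_nz_1[OF s, of 0] by (simp add: gauss_def integrable_density)
  show "(\<integral>x. x \<partial>gauss v) = 0"
    using integral_normal_moment_nz_1[OF s, of 0] by (simp add: gauss_def integral_density)
  show "integrable (gauss v) (\<lambda>x. x\<^sup>2)"
    using integrable_normal_moment[OF s, of 0 2] by (simp add: gauss_def integrable_density)
  show ?g1
    using integral_normal_moment_even[OF s, of 0 1] v by (simp add: gauss_def integral_density)
qed

section \<open>Gaussian increments on dyadic grids\<close>

text \<open>The factor of one cell: the density of the tilt by \<open>th\<close> times the character
  of the shifted increment v + th d. With l = 0 only the density is left. The number d is the cell
  length, hence the variance.\<close>

definition gkernel :: "real \<Rightarrow> real \<Rightarrow> real \<Rightarrow> real \<Rightarrow> complex" where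
  "gkernel d th l v = cr (exp (- (th * v) - th\<^sup>2 * d / 2)) * iexp (l * (v + th * d))"

lemma gkernel_measurable [measurable]:
  assumes [measurable]: "f \<in> borel_measurable N" "g \<in> borel_measurable N"
  shows "(\<lambda>x. gkernel d (f x) l (g x)) \<in> borel_measurable N"
  unfolding gkernel_def by measurable

lemma norm_gkernel: "norm (gkernel d th l v) = exp (- (th * v) - th\<^sup>2 * d / 2)"
  unfolding gkernel_def norm_mult by (simp only: norm_of_real norm_exp_i_times abs_exp_cancel mult_1_right)

lemma integrable_gkernel: "d > 0 \<Longrightarrow> integrable (gauss d) (gkernel d th l)"
  by (rule L1_bound[OF integral_gauss_shift(2)[of d th]])
     (auto simp: norm_gkernel)

lemma integral_gkernel: "d > 0 \<Longrightarrow> (\<integral>v. gkernel d th l v \<partial>gauss d) = exp (- (d * l\<^sup>2 / 2))"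
  using integral_gauss_shift(1)[of d th l] by (simp add: gkernel_def)

text \<open>\<open>B_char\<close> says that, given the past, the increments over a dyadic cell are
  independent Gaussians, jointly in finitely many components. Stated with characteristic functions
  against past events, the property passes to limits in which densities converge in L1; this is how
  it is established after the change of measure.\<close>

locale gauss_grid = prob_space M for M :: "'a measure" +
  fixes F :: "real \<Rightarrow> 'a measure" and T :: real and B :: "nat \<Rightarrow> real \<Rightarrow> 'a \<Rightarrow> real"
  assumes T_pos: "T > 0"
    and F_sub: "\<And>t. t \<in> {0..T} \<Longrightarrow> subalgebra M (F t)"
    and F_mono: "\<And>s t. 0 \<le> s \<Longrightarrow> s \<le> t \<Longrightarrow> t \<le> T \<Longrightarrow> sets (F s) \<subseteq> sets (F t)"
    and B_adapted: "\<And>n t. n \<ge> 1 \<Longrightarrow> t \<in> {0..T} \<Longrightarrow> B n t \<in> borel_measurable (F t)"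
    and B_char: "\<And>S j m A mu. finite S \<Longrightarrow> S \<subseteq> {1..} \<Longrightarrow> j < 2 ^ m \<Longrightarrow> A \<in> sets (F (dy T m j)) \<Longrightarrow>
       (\<integral>z. cr (indicator A z) * iexp (\<Sum>n\<in>S. mu n * (B n (dy T m (Suc j)) z - B n (dy T m j) z)) \<partial>M)
       = cr (measure M A) * (\<Prod>n\<in>S. cr (exp (- (T / 2 ^ m * (mu n)\<^sup>2 / 2))))"
begin

definition dB :: "nat \<Rightarrow> nat \<Rightarrow> nat \<Rightarrow> 'a \<Rightarrow> real" where
  "dB m j n z = B n (dy T m (Suc j)) z - B n (dy T m j) z"

abbreviation dt :: "nat \<Rightarrow> real" where "dt m \<equiv> T / 2 ^ m"

lemma dt_pos: "dt m > 0"
  using T_pos by simp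

lemma F_measurable_le:
  assumes "f \<in> measurable (F s) N" "0 \<le> s" "s \<le> t" "t \<le> T"
  shows "f \<in> measurable (F t) N"
proof -
  have "space (F s) = space (F t)"
    using F_sub[of s] F_sub[of t] assms by (auto simp: subalgebra_def)
  then have "subalgebra (F t) (F s)"
    using F_mono[of s t] assms by (auto simp: subalgebra_def)
  then show ?thesis using assms(1) by (rule measurable_from_subalg)
qed

lemma F_measurable_M: "f \<in> measurable (F s) N \<Longrightarrow> s \<in> {0..T} \<Longrightarrow> f \<in> measurable M N"
  using F_sub measurable_from_subalg by blast

lemma F_measurable_dy:
  assumes "f \<in> measurable (F (dy T m i)) N" "i \<le> j" "j \<le> 2 ^ m"
  shows "f \<in> measurable (F (dy T m j)) N"
  using assms T_pos by (intro F_measurable_le[OF assms(1)]) (auto intro: dy_nonneg dy_mono dy_le)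

lemma F_dy_M: "f \<in> measurable (F (dy T m j)) N \<Longrightarrow> j \<le> 2 ^ m \<Longrightarrow> f \<in> measurable M N"
  using F_measurable_M dy_mem[OF T_pos] by blast

lemma space_F: "t \<in> {0..T} \<Longrightarrow> space (F t) = space M"
  using F_sub by (auto simp: subalgebra_def)

lemma dB_adapted: "n \<ge> 1 \<Longrightarrow> j < 2 ^ m \<Longrightarrow> dB m j n \<in> borel_measurable (F (dy T m (Suc j)))"
  unfolding dB_def[abs_def] using dy_mem[OF T_pos, of "Suc j" m] dy_mem[OF T_pos, of j m]
  by (intro borel_measurable_diff B_adapted F_measurable_dy[OF B_adapted]) auto

lemma dB_measurable: "n \<ge> 1 \<Longrightarrow> j < 2 ^ m \<Longrightarrow> dB m j n \<in> borel_measurable M"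
  using F_dy_M[OF dB_adapted] by simp

lemma sets_F_M: "A \<in> sets (F t) \<Longrightarrow> t \<in> {0..T} \<Longrightarrow> A \<in> sets M"
  using F_sub by (auto simp: subalgebra_def)

lemma dB_box:
  assumes S: "finite S" "S \<subseteq> {1..}" and j: "j < 2 ^ m" and A: "A \<in> sets (F (dy T m j))"
    and C: "\<And>n. n \<in> S \<Longrightarrow> C n \<in> sets borel"
  shows "measure M (A \<inter> {z\<in>space M. \<forall>n\<in>S. dB m j n z \<in> C n}) = measure M A * (\<Prod>n\<in>S. measure (gauss (dt m)) (C n))"
proof -
  have [measurable]: "A \<in> sets M" using sets_F_M[OF A] dy_mem[OF T_pos] j by simp
  have "(\<integral>z. indicator A z * (\<Prod>n\<in>S. indicator (C n) (dB m j n z)) \<partial>M) = (\<integral>z. indicator A z \<partial>M) * (\<Prod>n\<in>S. measure (gauss (dt m)) (C n))"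
  proof (rule char_factor_box[OF S(1)])
    show "integrable M (indicat_real A)" by (rule integrable_const_bound[where B=1]) auto
    show "real_distribution (gauss (dt m))" for n using dt_pos by (rule real_distribution_gauss)
    show "(\<integral>z. cr (indicator A z) * iexp (\<Sum>n\<in>S. mu n * dB m j n z) \<partial>M)
       = cr (\<integral>z. indicator A z \<partial>M) * (\<Prod>n\<in>S. char (gauss (dt m)) (mu n))" for mu
      using B_char[OF S j A, of mu] char_gauss[OF dt_pos[of m]] by (simp add: dB_def)
  qed (use S j C in \<open>auto intro!: dB_measurable\<close>)
  moreover have "indicator A z * (\<Prod>n\<in>S. indicator (C n) (dB m j n z)) = indicat_real (A \<inter> {z\<in>space M. \<forall>n\<in>S. dB m j n z \<in> C n}) z" if "z \<in> space M" for z
  proof (cases "\<forall>n\<in>S. dB m j n z \<in> C n")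
    case True then show ?thesis using that by (auto simp: indicator_def)
  next
    case False
    then have "(\<Prod>n\<in>S. indicator (C n) (dB m j n z)) = (0::real)" using S by (intro prod_zero) (auto simp: indicator_def)
    then show ?thesis using False by (auto simp: indicator_def)
  qed
  moreover have [measurable]: "{z\<in>space M. \<forall>n\<in>S. dB m j n z \<in> C n} \<in> sets M"
  proof (rule sets.sets_Collect_finite_All[OF _ S(1)])
    fix n assume n: "n \<in> S"
    then have "dB m j n -` C n \<inter> space M \<in> sets M"
      using S j C by (intro measurable_sets[OF dB_measurable]) auto
    also have "dB m j n -` C n \<inter> space M = {z\<in>space M. dB m j n z \<in> C n}" by auto
    finally show "{z\<in>space M. dB m j n z \<in> C n} \<in> sets M" .
  qed
  ultimately show ?thesis by (simp cong: Bochner_Integration.integral_cong)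
qed

definition vB :: "nat set \<Rightarrow> nat \<Rightarrow> nat \<Rightarrow> 'a \<Rightarrow> nat \<Rightarrow> real" where
  "vB S m j z = (\<lambda>n\<in>S. dB m j n z)"

lemma vB_measurable:
  assumes "S \<subseteq> {1..}" "j < 2 ^ m"
  shows "vB S m j \<in> measurable M (PiM S (\<lambda>_. gauss (dt m)))"
  unfolding vB_def[abs_def]
proof (rule measurable_restrict)
  fix n assume "n \<in> S"
  then have "dB m j n \<in> borel_measurable M" using assms by (intro dB_measurable) auto
  then show "dB m j n \<in> measurable M (gauss (dt m))"
    by (simp add: measurable_cong_sets[OF refl sets_gauss])
qed

lemma product_prob_gauss: "product_prob_space (\<lambda>_. gauss (dt m))"
  using prob_space_gauss[OF dt_pos[of m]]
  by (simp add: product_prob_space_def product_prob_space_axioms_def product_sigma_finite_def prob_space_imp_sigma_finite)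

text \<open>The first factor is the measure restricted to the past, and z is mapped into it by the
  identity: only past events are visible there, and of these the increments are independent. This
  equality of laws allows past quantities to be frozen while increments are integrated.\<close>

lemma increment_pair_law:
  assumes S: "finite S" "S \<subseteq> {1..}" and j: "j < 2 ^ m"
  shows "restr_to_subalg M (F (dy T m j)) \<Otimes>\<^sub>M PiM S (\<lambda>_. gauss (dt m)) =
    distr M (restr_to_subalg M (F (dy T m j)) \<Otimes>\<^sub>M PiM S (\<lambda>_. gauss (dt m))) (\<lambda>z. (z, vB S m j z))"
    (is "?N \<Otimes>\<^sub>M ?G = ?D")
proof (rule pair_measure_eqI)
  interpret G: product_prob_space "\<lambda>_. gauss (dt m)" S by (rule product_prob_gauss)
  have sub: "subalgebra M (F (dy T m j))" using F_sub dy_mem[OF T_pos] j by simp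
  show "sigma_finite_measure ?N"
    using prob_space_restr_to_subalg[OF sub] prob_space_axioms prob_space_imp_sigma_finite by blast
  show "sigma_finite_measure ?G"
    by (rule prob_space_imp_sigma_finite[OF G.prob_space_axioms])
  show "sets (?N \<Otimes>\<^sub>M ?G) = sets ?D" by simp
  have id: "(\<lambda>z. z) \<in> measurable M ?N"
    using sub by (auto simp: measurable_def space_restr_to_subalg sets_restr_to_subalg subalgebra_def)
  note [measurable] = vB_measurable[OF S(2) j]
  fix A C assume A: "A \<in> sets ?N" and C: "C \<in> sets ?G"
  have AF: "A \<in> sets (F (dy T m j))" using A sub by (simp add: sets_restr_to_subalg)
  have [measurable]: "A \<in> sets M" using AF sub by (auto simp: subalgebra_def)
  \<comment> \<open>For a fixed past event both sides are finite measures in the increment variable,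
    so agreement on boxes, which is \<open>dB_box\<close>, is enough.\<close>
  have "distr (density M (indicator A)) ?G (vB S m j) = scale_measure (emeasure M A) ?G"
  proof (rule measure_eqI_PiM_finite[OF S(1)])
    fix C assume C: "\<And>i. i \<in> S \<Longrightarrow> C i \<in> sets (gauss (dt m))"
    then have [measurable]: "Pi\<^sub>E S C \<in> sets ?G" by (intro sets_PiM_I_finite S)
    have "emeasure (distr (density M (indicator A)) ?G (vB S m j)) (Pi\<^sub>E S C) = emeasure (density M (indicator A)) (vB S m j -` (Pi\<^sub>E S C) \<inter> space M)"
      by (subst emeasure_distr) auto
    also have "\<dots> = emeasure M (A \<inter> (vB S m j -` (Pi\<^sub>E S C) \<inter> space M))"
      by (subst emeasure_density) (auto simp: indicator_inter_arith[symmetric])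
    also have "A \<inter> (vB S m j -` (Pi\<^sub>E S C) \<inter> space M) = A \<inter> {z\<in>space M. \<forall>n\<in>S. dB m j n z \<in> C n}"
      by (auto simp: vB_def)
    also have "emeasure M \<dots> = emeasure M A * (\<Prod>n\<in>S. emeasure (gauss (dt m)) (C n))"
    proof -
      have "(\<Prod>n\<in>S. emeasure (gauss (dt m)) (C n)) = ennreal (\<Prod>n\<in>S. measure (gauss (dt m)) (C n))"
        by (subst prod_ennreal[symmetric]) (auto simp: G.M.emeasure_eq_measure)
      then show ?thesis
        using dB_box[OF S j AF, of C] C by (simp add: emeasure_eq_measure ennreal_mult prod_nonneg)
    qed
    also have "\<dots> = emeasure (scale_measure (emeasure M A) ?G) (Pi\<^sub>E S C)"
      using C by (simp add: G.emeasure_PiM S)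
    finally show "emeasure (distr (density M (indicator A)) ?G (vB S m j)) (Pi\<^sub>E S C) = emeasure (scale_measure (emeasure M A) ?G) (Pi\<^sub>E S C)" .
  next
    show "range (\<lambda>_::nat. \<Pi>\<^sub>E n\<in>S. UNIV) \<subseteq> prod_algebra S (\<lambda>_. gauss (dt m))"
      using S by (auto intro!: prod_algebraI_finite)
    show "(\<Union>i::nat. \<Pi>\<^sub>E n\<in>S. UNIV) = space ?G" by (simp add: space_PiM)
    show "emeasure (distr (density M (indicator A)) ?G (vB S m j)) (\<Pi>\<^sub>E n\<in>S. UNIV) \<noteq> \<infinity>" for i :: nat
    proof -
      have [measurable]: "(\<Pi>\<^sub>E n\<in>S. UNIV) \<in> sets ?G" by (intro sets_PiM_I_finite S) auto
      show ?thesis by (subst emeasure_distr) (auto simp: emeasure_density emeasure_eq_measure indicator_inter_arith[symmetric])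
    qed
  qed auto
  then have "emeasure (distr (density M (indicator A)) ?G (vB S m j)) C = emeasure M A * emeasure ?G C"
    using C by simp
  moreover have "emeasure (distr (density M (indicator A)) ?G (vB S m j)) C = emeasure M (A \<inter> (vB S m j -` C \<inter> space M))"
    using C by (subst emeasure_distr) (auto simp: emeasure_density indicator_inter_arith[symmetric])
  moreover have "emeasure ?D (A \<times> C) = emeasure M (A \<inter> (vB S m j -` C \<inter> space M))"
    using A C id by (subst emeasure_distr) (auto intro!: arg_cong[where f="emeasure M"] dest: sets.sets_into_space)
  ultimately show "emeasure ?N A * emeasure ?G C = emeasure ?D (A \<times> C)"
    using emeasure_restr_to_subalg[OF sub AF] by simp
qed

text \<open>Freezing lemma, by Fubini for the product in \<open>increment_pair_law\<close>.
  Integrability is asked of the iterated norm because that is what can be computed for exponential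
  integrands.\<close>

lemma increment_Fubini:
  fixes f :: "'a \<times> (nat \<Rightarrow> real) \<Rightarrow> 'b::{banach, second_countable_topology}"
  assumes S: "finite S" "S \<subseteq> {1..}" and j: "j < 2 ^ m"
    and f: "f \<in> borel_measurable (F (dy T m j) \<Otimes>\<^sub>M PiM S (\<lambda>_. gauss (dt m)))"
    and i1: "\<And>z. z \<in> space M \<Longrightarrow> integrable (PiM S (\<lambda>_. gauss (dt m))) (\<lambda>v. f (z, v))"
    and i2: "integrable M (\<lambda>z. \<integral>v. norm (f (z, v)) \<partial>PiM S (\<lambda>_. gauss (dt m)))"
  shows "integrable M (\<lambda>z. f (z, vB S m j z))"
    and "(\<integral>z. f (z, vB S m j z) \<partial>M) = (\<integral>z. \<integral>v. f (z, v) \<partial>PiM S (\<lambda>_. gauss (dt m)) \<partial>M)"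
proof -
  let ?N = "restr_to_subalg M (F (dy T m j))" and ?G = "PiM S (\<lambda>_. gauss (dt m))"
  interpret G: product_prob_space "\<lambda>_. gauss (dt m)" S by (rule product_prob_gauss)
  have sub: "subalgebra M (F (dy T m j))" using F_sub dy_mem[OF T_pos] j by simp
  interpret N: prob_space ?N by (rule prob_space_restr_to_subalg[OF sub prob_space_axioms])
  interpret P: pair_sigma_finite ?N ?G ..
  have setsN: "sets ?N = sets (F (dy T m j))" using sub by (simp add: sets_restr_to_subalg)
  have fm[measurable]: "f \<in> borel_measurable (?N \<Otimes>\<^sub>M ?G)"
    using f by (simp add: measurable_cong_sets[OF sets_pair_measure_cong[OF setsN refl] refl])
  have fF: "h \<in> borel_measurable ?N \<Longrightarrow> h \<in> borel_measurable (F (dy T m j))" for h :: "'a \<Rightarrow> 'c::{banach, second_countable_topology}"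
    by (simp add: measurable_cong_sets[OF setsN refl])
  have n1: "(\<lambda>z. \<integral>v. norm (f (z, v)) \<partial>?G) \<in> borel_measurable ?N" by measurable
  have int: "integrable (?N \<Otimes>\<^sub>M ?G) f"
  proof (rule P.Fubini_integrable[OF fm])
    show "integrable ?N (\<lambda>z. \<integral>v. norm (f (z, v)) \<partial>?G)"
      by (rule integrable_in_subalg[OF sub fF[OF n1] i2])
    show "AE z in ?N. integrable ?G (\<lambda>v. f (z, v))"
      by (rule AE_I2) (use i1 sub in \<open>simp add: space_restr_to_subalg\<close>)
  qed
  have id: "(\<lambda>z. z) \<in> measurable M ?N"
    using sub by (auto simp: measurable_def space_restr_to_subalg sets_restr_to_subalg subalgebra_def)
  note [measurable] = vB_measurable[OF S(2) j]
  have pm: "(\<lambda>z. (z, vB S m j z)) \<in> measurable M (?N \<Otimes>\<^sub>M ?G)"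
    using id by measurable
  have "integrable (distr M (?N \<Otimes>\<^sub>M ?G) (\<lambda>z. (z, vB S m j z))) f"
    using int increment_pair_law[OF S j] by simp
  then show "integrable M (\<lambda>z. f (z, vB S m j z))"
    by (simp add: integrable_distr_eq[OF pm fm])
  have "(\<integral>z. f (z, vB S m j z) \<partial>M) = integral\<^sup>L (distr M (?N \<Otimes>\<^sub>M ?G) (\<lambda>z. (z, vB S m j z))) f"
    by (rule integral_distr[OF pm fm, symmetric])
  also have "\<dots> = integral\<^sup>L (?N \<Otimes>\<^sub>M ?G) f"
    using increment_pair_law[OF S j] by simp
  also have "\<dots> = (\<integral>z. \<integral>v. f (z, v) \<partial>?G \<partial>?N)" by (rule P.integral_fst'[OF int, symmetric])
  also have "\<dots> = (\<integral>z. \<integral>v. f (z, v) \<partial>?G \<partial>M)"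
    by (rule integral_subalgebra2[OF sub fF]) measurable
  finally show "(\<integral>z. f (z, vB S m j z) \<partial>M) = (\<integral>z. \<integral>v. f (z, v) \<partial>?G \<partial>M)" .
qed

text \<open>With the past frozen, each kernel integrates to the Gaussian characteristic function
  whatever the value of \<open>th\<close>, so random tilts leave no trace in the mean. The norm of a
  kernel integrates to 1, which settles integrability for arbitrary adapted tilts.\<close>

lemma exp_step:
  assumes S: "finite S" "S \<subseteq> {1..}" and j: "j < 2 ^ m"
    and g: "integrable M g" "g \<in> borel_measurable (F (dy T m j))"
    and th: "\<And>n. n \<in> S \<Longrightarrow> th n \<in> borel_measurable (F (dy T m j))"
  shows "integrable M (\<lambda>z. g z * (\<Prod>n\<in>S. gkernel (dt m) (th n z) (l n) (dB m j n z)))" (is ?g1)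
    and "(\<integral>z. g z * (\<Prod>n\<in>S. gkernel (dt m) (th n z) (l n) (dB m j n z)) \<partial>M) =
       (\<integral>z. g z \<partial>M) * (\<Prod>n\<in>S. cr (exp (- (dt m * (l n)\<^sup>2 / 2))))" (is ?g2)
proof -
  let ?G = "PiM S (\<lambda>_. gauss (dt m))"
  interpret G: product_prob_space "\<lambda>_. gauss (dt m)" S by (rule product_prob_gauss)
  define f where "f = (\<lambda>(z, v). g z * (\<Prod>n\<in>S. gkernel (dt m) (th n z) (l n) (v n)))"
  have [measurable]: "g \<in> borel_measurable (F (dy T m j))" "\<And>n. n \<in> S \<Longrightarrow> th n \<in> borel_measurable (F (dy T m j))"
    by fact+
  have comp: "(\<lambda>x. snd x n) \<in> borel_measurable (F (dy T m j) \<Otimes>\<^sub>M ?G)" if "n \<in> S" for n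
    using measurable_compose[OF measurable_snd measurable_component_singleton[OF that, of "\<lambda>_. gauss (dt m)"], of "F (dy T m j)"]
    by (simp add: measurable_cong_sets[OF refl sets_gauss])
  have fm: "f \<in> borel_measurable (F (dy T m j) \<Otimes>\<^sub>M ?G)"
    unfolding f_def case_prod_beta by (intro borel_measurable_times borel_measurable_prod gkernel_measurable comp) measurable
  have kp: "integrable ?G (\<lambda>v. \<Prod>n\<in>S. gkernel (dt m) (th n z) (l n) (v n))" for z
    by (intro G.product_integrable_prod S integrable_gkernel dt_pos)
  have ki: "(\<integral>v. f (z, v) \<partial>?G) = g z * (\<Prod>n\<in>S. cr (exp (- (dt m * (l n)\<^sup>2 / 2))))" for z
  proof -
    have "(\<integral>v. f (z, v) \<partial>?G) = g z * (\<integral>v. (\<Prod>n\<in>S. gkernel (dt m) (th n z) (l n) (v n)) \<partial>?G)"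
      unfolding f_def by simp
    also have "(\<integral>v. (\<Prod>n\<in>S. gkernel (dt m) (th n z) (l n) (v n)) \<partial>?G) = (\<Prod>n\<in>S. \<integral>v. gkernel (dt m) (th n z) (l n) v \<partial>gauss (dt m))"
      by (rule G.product_integral_prod[OF S(1) integrable_gkernel[OF dt_pos]])
    also have "\<dots> = (\<Prod>n\<in>S. cr (exp (- (dt m * (l n)\<^sup>2 / 2))))"
      by (intro prod.cong refl integral_gkernel[OF dt_pos])
    finally show ?thesis .
  qed
  have kn: "(\<integral>v. norm (f (z, v)) \<partial>?G) = norm (g z)" for z
  proof -
    have "(\<integral>v. norm (f (z, v)) \<partial>?G) = (\<integral>v. norm (g z) * (\<Prod>n\<in>S. exp (- (th n z * v n) - (th n z)\<^sup>2 * dt m / 2)) \<partial>?G)"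
      by (simp only: f_def prod.case norm_mult prod_norm[symmetric] norm_gkernel)
    also have "\<dots> = norm (g z) * (\<integral>v. (\<Prod>n\<in>S. exp (- (th n z * v n) - (th n z)\<^sup>2 * dt m / 2)) \<partial>?G)"
      by (rule integral_mult_right_zero)
    also have "(\<integral>v. (\<Prod>n\<in>S. exp (- (th n z * v n) - (th n z)\<^sup>2 * dt m / 2)) \<partial>?G) =
        (\<Prod>n\<in>S. \<integral>v. exp (- (th n z * v) - (th n z)\<^sup>2 * dt m / 2) \<partial>gauss (dt m))"
      by (rule G.product_integral_prod[OF S(1) integral_gauss_shift(2)[OF dt_pos]])
    also have "\<dots> = 1"
      by (intro prod.neutral ballI integral_gauss_shift(3)[OF dt_pos])
    finally show ?thesis by simp
  qed
  have "z \<in> space M \<Longrightarrow> integrable ?G (\<lambda>v. f (z, v))" for z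
    using kp by (simp add: f_def)
  note Fub = increment_Fubini[OF S j fm this]
  have eq: "f (z, vB S m j z) = g z * (\<Prod>n\<in>S. gkernel (dt m) (th n z) (l n) (dB m j n z))" for z
    by (auto simp: f_def vB_def intro!: prod.cong)
  show ?g1
    using Fub(1) g(1) unfolding kn eq by simp
  show ?g2
    using Fub(2) g(1) unfolding kn eq ki by simp
qed

text \<open>The three conclusions form one induction: the product up to b is the integrable, adapted
  weight for the step at b.\<close>

lemma exp_steps:
  assumes S: "finite S" "S \<subseteq> {1..}" and ab: "a \<le> b" "b \<le> 2 ^ m"
    and g: "integrable M g" "g \<in> borel_measurable (F (dy T m a))"
    and th: "\<And>j n. j < 2 ^ m \<Longrightarrow> n \<in> S \<Longrightarrow> th j n \<in> borel_measurable (F (dy T m j))"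
  shows "integrable M (\<lambda>z. g z * (\<Prod>j=a..<b. \<Prod>n\<in>S. gkernel (dt m) (th j n z) (l j n) (dB m j n z)))
     \<and> (\<lambda>z. g z * (\<Prod>j=a..<b. \<Prod>n\<in>S. gkernel (dt m) (th j n z) (l j n) (dB m j n z))) \<in> borel_measurable (F (dy T m b))
     \<and> (\<integral>z. g z * (\<Prod>j=a..<b. \<Prod>n\<in>S. gkernel (dt m) (th j n z) (l j n) (dB m j n z)) \<partial>M) =
       (\<integral>z. g z \<partial>M) * (\<Prod>j=a..<b. \<Prod>n\<in>S. cr (exp (- (dt m * (l j n)\<^sup>2 / 2))))"
  using ab
proof (induction b rule: dec_induct)
  case base
  then show ?case using g by simp
next
  case (step b)
  let ?H = "\<lambda>b z. g z * (\<Prod>j=a..<b. \<Prod>n\<in>S. gkernel (dt m) (th j n z) (l j n) (dB m j n z))"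
  have b: "b < 2 ^ m" using step by simp
  have IH: "integrable M (?H b)" "?H b \<in> borel_measurable (F (dy T m b))"
    "(\<integral>z. ?H b z \<partial>M) = (\<integral>z. g z \<partial>M) * (\<Prod>j=a..<b. \<Prod>n\<in>S. cr (exp (- (dt m * (l j n)\<^sup>2 / 2))))"
    using step by auto
  have eq: "?H (Suc b) = (\<lambda>z. ?H b z * (\<Prod>n\<in>S. gkernel (dt m) (th b n z) (l b n) (dB m b n z)))"
    using step.hyps by (simp add: mult.assoc)
  note st = exp_step[OF S b IH(1,2) th[OF b]]
  have m: "(\<lambda>z. gkernel (dt m) (th b n z) (l b n) (dB m b n z)) \<in> borel_measurable (F (dy T m (Suc b)))" if "n \<in> S" for n
  proof (rule gkernel_measurable)
    show "th b n \<in> borel_measurable (F (dy T m (Suc b)))"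
      using b by (intro F_measurable_dy[OF th[OF b that]]) auto
    show "dB m b n \<in> borel_measurable (F (dy T m (Suc b)))"
      using that S b by (intro dB_adapted) auto
  qed
  have "?H (Suc b) \<in> borel_measurable (F (dy T m (Suc b)))"
    unfolding eq
  proof (rule borel_measurable_times)
    show "?H b \<in> borel_measurable (F (dy T m (Suc b)))"
      using b by (intro F_measurable_dy[OF IH(2)]) auto
    show "(\<lambda>z. \<Prod>n\<in>S. gkernel (dt m) (th b n z) (l b n) (dB m b n z)) \<in> borel_measurable (F (dy T m (Suc b)))"
      by (rule borel_measurable_prod) (rule m)
  qed
  moreover have "integrable M (?H (Suc b))"
    unfolding eq by (rule st(1))
  moreover have "(\<integral>z. ?H (Suc b) z \<partial>M) = (\<integral>z. g z \<partial>M) * (\<Prod>j=a..<Suc b. \<Prod>n\<in>S. cr (exp (- (dt m * (l j n)\<^sup>2 / 2))))"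
  proof -
    have "(\<integral>z. ?H (Suc b) z \<partial>M) = (\<integral>z. ?H b z \<partial>M) * (\<Prod>n\<in>S. cr (exp (- (dt m * (l b n)\<^sup>2 / 2))))"
      unfolding eq by (rule st(2))
    also note IH(3)
    finally show ?thesis
      unfolding prod.atLeastLessThan_Suc[OF step.hyps(1)] by (simp only: mult.assoc)
  qed
  ultimately show ?case by (intro conjI)
qed

end

section \<open>Moments and smallness from exponential bounds\<close>

context prob_space
begin

text \<open>Add the bounds for q and -q and compare terms of order q^2 as q tends to 0. The factor 2
  stems from the crude lower bound 2 + x^2/2 for exp x + exp (-x). In return no moment of
  \<open>D\<close> has to be known beforehand.\<close>

lemma second_moment_le:
  fixes D A :: "'a \<Rightarrow> real"
  assumes [measurable]: "D \<in> borel_measurable M" and A: "integrable M A"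
    and h: "\<And>q. integrable M (\<lambda>z. exp (q * D z - q\<^sup>2 * A z / 2))"
      "\<And>q. (\<integral>z. exp (q * D z - q\<^sup>2 * A z / 2) \<partial>M) \<le> 1"
  shows "integrable M (\<lambda>z. (D z)\<^sup>2)" "(\<integral>z. (D z)\<^sup>2 \<partial>M) \<le> 2 * (\<integral>z. A z \<partial>M)" (is ?g1)
proof -
  have [measurable]: "A \<in> borel_measurable M" using A by auto
  define q where "q k = 1 / real (Suc k)" for k :: nat
  have q: "q k > 0" for k by (simp add: q_def)
  define f where "f k z = (D z)\<^sup>2 * exp (- ((q k)\<^sup>2 * A z / 2))" for k z
  have exp_lower: "2 + x\<^sup>2 / 2 \<le> exp x + exp (- x)" for x :: real
  proof -
    have "1 + \<bar>x\<bar> + \<bar>x\<bar>\<^sup>2 / 2 \<le> exp \<bar>x\<bar>" by (rule exp_lower_Taylor_quadratic) simp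
    moreover have "1 + - \<bar>x\<bar> \<le> exp (- \<bar>x\<bar>)" by (rule exp_ge_add_one_self)
    moreover have "exp \<bar>x\<bar> + exp (- \<bar>x\<bar>) = exp x + exp (- x)" by (cases "x \<ge> 0") auto
    moreover have "\<bar>x\<bar>\<^sup>2 = x\<^sup>2" by simp
    ultimately show ?thesis by linarith
  qed
  \<comment> \<open>The mean of \<open>G k\<close> involves only the two exponential bounds, whose
    sum cancels against the 2, and leaves at most q^2 times the mean of \<open>A\<close>.\<close>
  define G where "G k z = exp (q k * D z - (q k)\<^sup>2 * A z / 2) + (exp (- q k * D z - (- q k)\<^sup>2 * A z / 2) + ((q k)\<^sup>2 * A z - 2))" for k z
  have fG: "(q k)\<^sup>2 / 2 * f k z \<le> G k z" for k z
  proof -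
    let ?E = "exp (- ((q k)\<^sup>2 * A z / 2))"
    have "(2 + (q k * D z)\<^sup>2 / 2) * ?E \<le> (exp (q k * D z) + exp (- (q k * D z))) * ?E"
      by (intro mult_right_mono exp_lower) auto
    also have "\<dots> = exp (q k * D z - (q k)\<^sup>2 * A z / 2) + exp (- q k * D z - (- q k)\<^sup>2 * A z / 2)"
      by (simp add: distrib_right exp_add[symmetric])
    finally have 1: "2 * ?E + (q k)\<^sup>2 / 2 * f k z \<le> exp (q k * D z - (q k)\<^sup>2 * A z / 2) + exp (- q k * D z - (- q k)\<^sup>2 * A z / 2)"
      by (simp add: f_def power_mult_distrib algebra_simps)
    have "1 + - ((q k)\<^sup>2 * A z / 2) \<le> ?E" by (rule exp_ge_add_one_self)
    with 1 show ?thesis by (simp add: G_def)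
  qed
  have Gint: "integrable M (G k)" for k
    unfolding G_def[abs_def] by (intro L1_add L1_diff h) (use A in auto)
  have f0: "0 \<le> f k z" for k z by (simp add: f_def)
  have fint: "integrable M (f k)" for k
  proof (rule L1_bound)
    show "integrable M (\<lambda>z. 2 / (q k)\<^sup>2 * G k z)" using Gint by simp
    show "AE z in M. norm (f k z) \<le> norm (2 / (q k)\<^sup>2 * G k z)"
    proof (rule AE_I2)
      fix z
      have "f k z \<le> 2 / (q k)\<^sup>2 * G k z" using fG[of k z] q[of k] by (simp add: field_simps)
      then show "norm (f k z) \<le> norm (2 / (q k)\<^sup>2 * G k z)" using f0[of k z] by (simp del: times_divide_eq_left)
    qed
  qed (simp add: f_def[abs_def])
  have le: "(\<integral>z. f k z \<partial>M) \<le> 2 * (\<integral>z. A z \<partial>M)" for k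
  proof -
    have "(q k)\<^sup>2 / 2 * (\<integral>z. f k z \<partial>M) \<le> (\<integral>z. G k z \<partial>M)"
      by (subst integral_mult_right_zero[symmetric], intro integral_mono Gint) (use fG fint in auto)
    also have "\<dots> = (\<integral>z. exp (q k * D z - (q k)\<^sup>2 * A z / 2) \<partial>M) + ((\<integral>z. exp (- q k * D z - (- q k)\<^sup>2 * A z / 2) \<partial>M) + ((q k)\<^sup>2 * (\<integral>z. A z \<partial>M) - 2))"
      unfolding G_def using h(1)[of "q k"] h(1)[of "- q k"] A
      by (subst Bochner_Integration.integral_add Bochner_Integration.integral_diff; auto simp: prob_space)+
    also have "\<dots> \<le> (q k)\<^sup>2 * (\<integral>z. A z \<partial>M)"
      using h(2)[of "q k"] h(2)[of "- q k"] by linarith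
    finally show ?thesis using q[of k] by (simp add: field_simps)
  qed
  have qlim: "q \<longlonglongrightarrow> 0" unfolding q_def[abs_def] using LIMSEQ_inverse_real_of_nat by (simp add: inverse_eq_divide)
  have lim: "AE z in M. (\<lambda>k. f k z) \<longlonglongrightarrow> (D z)\<^sup>2"
  proof (rule AE_I2)
    fix z
    have "(\<lambda>k. f k z) \<longlonglongrightarrow> (D z)\<^sup>2 * exp (- (0\<^sup>2 * A z / 2))"
      unfolding f_def by (intro tendsto_intros qlim) simp
    then show "(\<lambda>k. f k z) \<longlonglongrightarrow> (D z)\<^sup>2" by simp
  qed
  show "integrable M (\<lambda>z. (D z)\<^sup>2)" ?g1
    using integral_Fatou_le[where f=f, OF fint AE_I2[OF f0] le tendsto_const lim] by auto
qed

text \<open>Fatou along an almost everywhere convergent subsequence. Only the inequality survives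
  the limit, and it is all that the moment bounds use.\<close>

lemma exp_supermartingale_limit:
  assumes h: "\<And>m. integrable M (\<lambda>z. exp (q * D m z - q\<^sup>2 * A m z / 2))"
      "\<And>m. (\<integral>z. exp (q * D m z - q\<^sup>2 * A m z / 2) \<partial>M) \<le> 1"
    and D: "conv_prob M D D'" and A: "AE z in M. (\<lambda>m. A m z) \<longlonglongrightarrow> A' z" and [measurable]: "A' \<in> borel_measurable M"
  shows "integrable M (\<lambda>z. exp (q * D' z - q\<^sup>2 * A' z / 2))" (is ?g1) "(\<integral>z. exp (q * D' z - q\<^sup>2 * A' z / 2) \<partial>M) \<le> 1" (is ?g2)
proof -
  note [measurable] = conv_prob_measurable[OF D]
  obtain r :: "nat \<Rightarrow> nat" where r: "strict_mono r" "AE z in M. \<forall>i\<in>{()}. (\<lambda>k. D (r k) z) \<longlonglongrightarrow> D' z"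
    using conv_prob_AE_subseq[of "{()}" "\<lambda>_. D" "\<lambda>_. D'"] D by auto
  have lim: "AE z in M. (\<lambda>k. exp (q * D (r k) z - q\<^sup>2 * A (r k) z / 2)) \<longlonglongrightarrow> exp (q * D' z - q\<^sup>2 * A' z / 2)"
    using r(2) A
  proof eventually_elim
    case (elim z)
    have "(\<lambda>k. A (r k) z) \<longlonglongrightarrow> A' z" using LIMSEQ_subseq_LIMSEQ[OF elim(2) r(1)] by (simp add: o_def)
    then show ?case using elim(1) by (intro tendsto_intros) auto
  qed
  show ?g1 ?g2
    using integral_Fatou_le[where f="\<lambda>k z. exp (q * D (r k) z - q\<^sup>2 * A (r k) z / 2)", OF h(1) _ h(2) tendsto_const lim] by auto
qed

text \<open>A Lenglart-type domination: the exponential bound with a large \<open>q\<close> turns smallness of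
  the bracket \<open>A\<close> in probability into smallness of \<open>D\<close>, without any integrability.\<close>

lemma conv_prob_bracket:
  assumes D[measurable]: "\<And>m. D m \<in> borel_measurable M" and A: "conv_prob M A (\<lambda>_. 0)"
    and h: "\<And>q m. integrable M (\<lambda>z. exp (q * D m z - q\<^sup>2 * A m z / 2))"
      "\<And>q m. (\<integral>z. exp (q * D m z - q\<^sup>2 * A m z / 2) \<partial>M) \<le> 1"
  shows "conv_prob M D (\<lambda>_. 0)"
proof (rule conv_probI_measure)
  note [measurable] = conv_prob_measurable[OF A]
  fix e :: real assume e: "e > 0"
  show "(\<lambda>m. measure M {z\<in>space M. \<bar>D m z - 0\<bar> > e}) \<longlonglongrightarrow> 0"
  proof (rule LIMSEQ_I)
    fix r :: real assume r: "r > 0"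
    \<comment> \<open>Large enough that 2 exp (1/2 - q e), the bound for the part of the event on
      which the bracket is small, lies below r/2.\<close>
    define q where "q = (1 / 2 + \<bar>ln (4 / r)\<bar> + 1) / e"
    have q: "q > 0" using e by (auto simp: q_def intro!: divide_pos_pos)
    have "1 / 2 - q * e < - ln (4 / r)" using e by (simp add: q_def)
    then have "exp (1 / 2 - q * e) < exp (- ln (4 / r))" by simp
    also have "\<dots> = r / 4" using r by (simp add: exp_minus)
    finally have qr: "2 * exp (1 / 2 - q * e) < r / 2" by simp
    \<comment> \<open>The level of the bracket up to which q^2 A / 2 costs at most 1/2 in the
      exponent. The cap at 1 in \<open>\<eta>'\<close> makes Markov's inequality usable for the
      truncated mean of \<open>A\<close>.\<close>
    define \<eta> where "\<eta> = 1 / q\<^sup>2"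
    have \<eta>: "\<eta> > 0" "q\<^sup>2 * \<eta> = 1" using q by (auto simp: \<eta>_def)
    define \<eta>' where "\<eta>' = min 1 \<eta>"
    have \<eta>': "\<eta>' > 0" using \<eta> by (simp add: \<eta>'_def)
    have lim: "(\<lambda>m. (\<integral>z. min 1 \<bar>A m z - 0\<bar> \<partial>M) / \<eta>') \<longlonglongrightarrow> 0 / \<eta>'"
      using A \<eta>' by (intro tendsto_intros) (auto simp: conv_prob_def)
    have "\<forall>\<^sub>F m in sequentially. (\<integral>z. min 1 \<bar>A m z - 0\<bar> \<partial>M) / \<eta>' < r / 2"
      by (rule order_tendstoD(2)[OF lim]) (use r in simp)
    then obtain n0 where n0: "\<And>m. m \<ge> n0 \<Longrightarrow> (\<integral>z. min 1 \<bar>A m z - 0\<bar> \<partial>M) / \<eta>' < r / 2"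
      unfolding eventually_sequentially by blast
    have "measure M {z\<in>space M. \<bar>D m z - 0\<bar> > e} < r" if m: "m \<ge> n0" for m
    proof -
      let ?X = "\<lambda>q z. exp (q * D m z - q\<^sup>2 * A m z / 2)"
      have minint: "integrable M (\<lambda>z. min 1 \<bar>A m z\<bar>)" by (rule integrable_min1) measurable
      have "measure M {z\<in>space M. \<bar>D m z - 0\<bar> > e} = (\<integral>z. indicator {z\<in>space M. \<bar>D m z - 0\<bar> > e} z \<partial>M)"
        by simp
      also have "\<dots> \<le> (\<integral>z. min 1 \<bar>A m z\<bar> / \<eta>' + exp (1 / 2 - q * e) * (?X q z + ?X (- q) z) \<partial>M)"
      proof (rule integral_mono)
        show "integrable M (indicat_real {z\<in>space M. \<bar>D m z - 0\<bar> > e})"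
          by (intro integrable_real_indicator) (auto simp: emeasure_eq_measure)
        show "integrable M (\<lambda>z. min 1 \<bar>A m z\<bar> / \<eta>' + exp (1 / 2 - q * e) * (?X q z + ?X (- q) z))"
          by (intro L1_add integrable_mult_right h integrable_divide minint)
        fix z assume w: "z \<in> space M"
        have ind: "indicat_real {z\<in>space M. \<bar>D m z - 0\<bar> > e} z \<le> 1" by (simp add: indicator_def)
        have nn: "0 \<le> min 1 \<bar>A m z\<bar> / \<eta>'" "0 \<le> exp (1 / 2 - q * e) * (?X q z + ?X (- q) z)"
          using \<eta>' by (auto intro!: add_nonneg_nonneg)
        show "indicat_real {z\<in>space M. \<bar>D m z - 0\<bar> > e} z \<le> min 1 \<bar>A m z\<bar> / \<eta>' + exp (1 / 2 - q * e) * (?X q z + ?X (- q) z)"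
        proof (cases "\<bar>D m z\<bar> > e")
          case True
          show ?thesis
          proof (cases "\<bar>A m z\<bar> > \<eta>")
            case True
            then have "1 \<le> min 1 \<bar>A m z\<bar> / \<eta>'" using \<eta>' by (auto simp: \<eta>'_def field_simps)
            then show ?thesis using nn ind by linarith
          next
            case False
            then have "q\<^sup>2 * A m z \<le> q\<^sup>2 * \<eta>" using q by (intro mult_left_mono) auto
            then have a: "q\<^sup>2 * A m z / 2 \<le> 1 / 2" using \<eta> by simp
            define s where "s = (if D m z > 0 then q else - q)"
            have sD: "s * D m z = q * \<bar>D m z\<bar>" and s2: "s\<^sup>2 = q\<^sup>2" by (auto simp: s_def)
            have "q * e \<le> s * D m z" unfolding sD using True q by (intro mult_left_mono) auto
            then have "1 \<le> exp (1 / 2 - q * e + (s * D m z - s\<^sup>2 * A m z / 2))" using a s2 by simp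
            also have "\<dots> = exp (1 / 2 - q * e) * ?X s z" by (rule exp_add)
            also have "\<dots> \<le> exp (1 / 2 - q * e) * (?X q z + ?X (- q) z)"
              by (intro mult_left_mono) (auto simp: s_def)
            finally show ?thesis using nn ind by linarith
          qed
        next
          case False
          then have "indicat_real {z\<in>space M. \<bar>D m z - 0\<bar> > e} z = 0" by (simp add: indicator_def)
          then show ?thesis using nn by linarith
        qed
      qed
      also have "\<dots> = (\<integral>z. min 1 \<bar>A m z\<bar> \<partial>M) / \<eta>' + exp (1 / 2 - q * e) * ((\<integral>z. ?X q z \<partial>M) + (\<integral>z. ?X (- q) z \<partial>M))"
      proof -
        have "integrable M (?X q)" "integrable M (?X (- q))" by (rule h)+
        then show ?thesis
          by (subst Bochner_Integration.integral_add) (auto intro!: minint simp del: power2_minus)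
      qed
      also have "\<dots> \<le> (\<integral>z. min 1 \<bar>A m z - 0\<bar> \<partial>M) / \<eta>' + exp (1 / 2 - q * e) * 2"
      proof -
        have "(\<integral>z. ?X q z \<partial>M) + (\<integral>z. ?X (- q) z \<partial>M) \<le> 2"
          using h(2)[of q m] h(2)[of "- q" m] by linarith
        then have "exp (1 / 2 - q * e) * ((\<integral>z. ?X q z \<partial>M) + (\<integral>z. ?X (- q) z \<partial>M)) \<le> exp (1 / 2 - q * e) * 2"
          by (intro mult_left_mono) auto
        then show ?thesis by simp
      qed
      also have "\<dots> < r / 2 + r / 2" by (rule add_strict_mono[OF n0[OF m]]) (use qr in \<open>simp only: mult.commute\<close>)
      also have "\<dots> = r" by simp
      finally show ?thesis .
    qed
    then show "\<exists>no. \<forall>m\<ge>no. norm (measure M {z\<in>space M. \<bar>D m z - 0\<bar> > e} - 0) < r"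
      by auto
  qed
qed (auto simp: D)

end

section \<open>Exponential means and second moments of grid sums\<close>

context gauss_grid
begin

text \<open>The case l = 0 of \<open>exp_steps\<close>. The kernel tilts by exp (- th v), hence the
  tilt is taken to be -q th.\<close>

lemma exp_mart:
  assumes S: "finite S" "S \<subseteq> {1..}" and ab: "a \<le> b" "b \<le> 2 ^ m"
    and th: "\<And>j n. j < 2 ^ m \<Longrightarrow> n \<in> S \<Longrightarrow> th j n \<in> borel_measurable (F (dy T m j))"
  shows "integrable M (\<lambda>z. exp (q * (\<Sum>j=a..<b. \<Sum>n\<in>S. th j n z * dB m j n z) - q\<^sup>2 * (\<Sum>j=a..<b. \<Sum>n\<in>S. (th j n z)\<^sup>2 * dt m) / 2))" (is "integrable M ?f")
    and "(\<integral>z. exp (q * (\<Sum>j=a..<b. \<Sum>n\<in>S. th j n z * dB m j n z) - q\<^sup>2 * (\<Sum>j=a..<b. \<Sum>n\<in>S. (th j n z)\<^sup>2 * dt m) / 2) \<partial>M) = 1"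
proof -
  have eq: "cr (?f z) = 1 * (\<Prod>j=a..<b. \<Prod>n\<in>S. gkernel (dt m) (- q * th j n z) 0 (dB m j n z))" for z
  proof -
    have "(\<Prod>j=a..<b. \<Prod>n\<in>S. gkernel (dt m) (- q * th j n z) 0 (dB m j n z)) =
      cr (\<Prod>j=a..<b. \<Prod>n\<in>S. exp (q * (th j n z * dB m j n z) - q\<^sup>2 * ((th j n z)\<^sup>2 * dt m) / 2))"
      by (simp add: gkernel_def power_mult_distrib mult.assoc)
    also have "(\<Prod>j=a..<b. \<Prod>n\<in>S. exp (q * (th j n z * dB m j n z) - q\<^sup>2 * ((th j n z)\<^sup>2 * dt m) / 2)) = ?f z"
      by (simp add: exp_sum[symmetric] S sum_subtractf sum_distrib_left sum_divide_distrib)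
    finally show ?thesis by simp
  qed
  have *: "integrable M (\<lambda>z. cr (?f z)) \<and> (\<integral>z. cr (?f z) \<partial>M) = 1"
    unfolding eq using exp_steps[OF S ab, of "\<lambda>_. 1" "\<lambda>j n z. - q * th j n z" "\<lambda>_ _. 0"] th by (simp add: prob_space)
  then show "integrable M ?f" using complex_of_real_integrable_eq by blast
  have "cr (\<integral>z. ?f z \<partial>M) = 1" using * by (simp only: integral_complex_of_real)
  then show "(\<integral>z. ?f z \<partial>M) = 1" by (simp only: of_real_eq_1_iff)
qed

text \<open>Every integrand is a product over \<open>S\<close> of functions of one coordinate each:
  \<open>\<phi>1\<close> is the identity in coordinate n, and \<open>\<phi>2\<close> collects the
  coordinates n and k, all other factors being 1.\<close>

lemma increment_moments:
  assumes S: "finite S" "S \<subseteq> {1..}" and j: "j < 2 ^ m" and X: "integrable M X" "X \<in> borel_measurable (F (dy T m j))"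
    and n: "n \<in> S" and k: "k \<in> S"
  shows "integrable M (\<lambda>z. X z * dB m j n z)" "(\<integral>z. X z * dB m j n z \<partial>M) = (0::real)"
    "integrable M (\<lambda>z. X z * (dB m j n z * dB m j k z))" (is ?g1)
    "(\<integral>z. X z * (dB m j n z * dB m j k z) \<partial>M) = (if n = k then dt m * (\<integral>z. X z \<partial>M) else 0)" (is ?g2)
proof -
  let ?G = "PiM S (\<lambda>_. gauss (dt m))"
  interpret G: product_prob_space "\<lambda>_. gauss (dt m)" S by (rule product_prob_gauss)
  have [measurable]: "X \<in> borel_measurable (F (dy T m j))" by fact
  note mom = gauss_moments[OF dt_pos[of m]]
  have g1: "integrable (gauss (dt m)) (\<lambda>x. 1 :: real)" by simp
  have fub: "integrable M (\<lambda>z. X z * (\<Prod>i\<in>S. \<phi> i (dB m j i z)))"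
      "(\<integral>z. X z * (\<Prod>i\<in>S. \<phi> i (dB m j i z)) \<partial>M) = (\<integral>z. X z \<partial>M) * (\<Prod>i\<in>S. \<integral>x. \<phi> i x \<partial>gauss (dt m))"
    if \<phi>: "\<And>i. i \<in> S \<Longrightarrow> integrable (gauss (dt m)) (\<phi> i)" for \<phi> :: "nat \<Rightarrow> real \<Rightarrow> real"
  proof -
    define P where "P v = (\<Prod>i\<in>S. \<phi> i (v i))" for v
    have Pint: "integrable ?G P" unfolding P_def[abs_def] by (rule G.product_integrable_prod[OF S(1) \<phi>])
    have [measurable]: "P \<in> borel_measurable ?G" using Pint by auto
    define f where "f = (\<lambda>(z, v). X z * P v)"
    have fm: "f \<in> borel_measurable (F (dy T m j) \<Otimes>\<^sub>M ?G)" unfolding f_def by measurable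
    have "z \<in> space M \<Longrightarrow> integrable ?G (\<lambda>v. f (z, v))" for z using Pint by (simp add: f_def)
    note Fub = increment_Fubini[OF S j fm this]
    have eq: "f (z, vB S m j z) = X z * (\<Prod>i\<in>S. \<phi> i (dB m j i z))" for z
      by (auto simp: f_def P_def vB_def intro!: prod.cong)
    have "(\<lambda>z. \<integral>v. norm (f (z, v)) \<partial>?G) = (\<lambda>z. \<bar>X z\<bar> * (\<integral>v. \<bar>P v\<bar> \<partial>?G))"
      by (simp add: f_def abs_mult)
    then have i: "integrable M (\<lambda>z. \<integral>v. norm (f (z, v)) \<partial>?G)" using X by simp
    show "integrable M (\<lambda>z. X z * (\<Prod>i\<in>S. \<phi> i (dB m j i z)))" using Fub(1)[OF _ i] unfolding eq by simp
    have "(\<integral>v. P v \<partial>?G) = (\<Prod>i\<in>S. \<integral>x. \<phi> i x \<partial>gauss (dt m))"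
      unfolding P_def by (rule G.product_integral_prod[OF S(1) \<phi>])
    then have "(\<integral>v. f (z, v) \<partial>?G) = X z * (\<Prod>i\<in>S. \<integral>x. \<phi> i x \<partial>gauss (dt m))" for z
      by (simp add: f_def)
    then show "(\<integral>z. X z * (\<Prod>i\<in>S. \<phi> i (dB m j i z)) \<partial>M) = (\<integral>z. X z \<partial>M) * (\<Prod>i\<in>S. \<integral>x. \<phi> i x \<partial>gauss (dt m))"
      using Fub(2)[OF _ i] unfolding eq by simp
  qed
  have one: "(\<integral>x. 1 \<partial>gauss (dt m)) = (1::real)" using G.M.prob_space by simp
  define \<phi>1 where "\<phi>1 i x = (if i = n then x else 1)" for i and x :: real
  have i1: "integrable (gauss (dt m)) (\<phi>1 i)" for i unfolding \<phi>1_def[abs_def] using mom by (cases "i = n") auto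
  have "(\<Prod>i\<in>S. \<phi>1 i (v i)) = v n" for v
    using n S unfolding \<phi>1_def by (simp add: prod.delta)
  moreover have "(\<Prod>i\<in>S. \<integral>x. \<phi>1 i x \<partial>gauss (dt m)) = 0"
    using n S mom by (intro prod_zero bexI[of _ n]) (auto simp: \<phi>1_def)
  ultimately show "integrable M (\<lambda>z. X z * dB m j n z)" "(\<integral>z. X z * dB m j n z \<partial>M) = 0"
    using fub[of \<phi>1, OF i1] by simp_all
  define \<phi>2 where "\<phi>2 i x = (if i = n then x else 1) * (if i = k then x else 1)" for i and x :: real
  have i2: "integrable (gauss (dt m)) (\<phi>2 i)" for i
    unfolding \<phi>2_def[abs_def] using mom by (cases "i = n"; cases "i = k") (auto simp: power2_eq_square)
  have p2: "(\<Prod>i\<in>S. \<phi>2 i (v i)) = v n * v k" for v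
    using n k S unfolding \<phi>2_def by (simp add: prod.distrib prod.delta)
  show ?g1
    using fub(1)[of \<phi>2, OF i2] unfolding p2 .
  show ?g2
  proof (cases "n = k")
    case True
    have "(\<Prod>i\<in>S. \<integral>x. \<phi>2 i x \<partial>gauss (dt m)) = (\<Prod>i\<in>S. if i = n then dt m else 1)"
      using True mom one by (intro prod.cong) (auto simp: \<phi>2_def power2_eq_square)
    also have "\<dots> = dt m" using S n by (simp add: prod.delta)
    finally show ?thesis using fub(2)[of \<phi>2, OF i2] True unfolding p2 by simp
  next
    case False
    have "(\<Prod>i\<in>S. \<integral>x. \<phi>2 i x \<partial>gauss (dt m)) = 0"
      using n S mom False by (intro prod_zero bexI[of _ n]) (auto simp: \<phi>2_def)
    then show ?thesis using fub(2)[of \<phi>2, OF i2] False unfolding p2 by simp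
  qed
qed

lemma integrable_prod_of_squares:
  fixes X Y :: "'a \<Rightarrow> real"
  assumes "integrable M (\<lambda>z. (X z)\<^sup>2)" "integrable M (\<lambda>z. (Y z)\<^sup>2)"
    and [measurable]: "X \<in> borel_measurable M" "Y \<in> borel_measurable M"
  shows "integrable M (\<lambda>z. X z * Y z)"
proof (rule L1_bound)
  show "integrable M (\<lambda>z. (X z)\<^sup>2 + (Y z)\<^sup>2)" using assms by simp
  show "AE z in M. norm (X z * Y z) \<le> norm ((X z)\<^sup>2 + (Y z)\<^sup>2)"
  proof (rule AE_I2)
    fix z
    have "0 \<le> (\<bar>X z\<bar> - \<bar>Y z\<bar>)\<^sup>2" by simp
    then have "2 * (\<bar>X z\<bar> * \<bar>Y z\<bar>) \<le> (X z)\<^sup>2 + (Y z)\<^sup>2" by (simp add: power2_eq_square algebra_simps)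
    moreover have "0 \<le> \<bar>X z\<bar> * \<bar>Y z\<bar>" "norm (X z * Y z) = \<bar>X z\<bar> * \<bar>Y z\<bar>"
        "norm ((X z)\<^sup>2 + (Y z)\<^sup>2) = (X z)\<^sup>2 + (Y z)\<^sup>2"
      by (simp_all add: abs_mult)
    ultimately show "norm (X z * Y z) \<le> norm ((X z)\<^sup>2 + (Y z)\<^sup>2)" by linarith
  qed
qed measurable

text \<open>Expanding the square, terms linear in the increments have mean 0 and mixed products
  vanish by independence. The isometry is exact, and the energy balance of the Picard iterates
  depends on that.\<close>

lemma L2_step:
  assumes S: "finite S" "S \<subseteq> {1..}" and j: "j < 2 ^ m"
    and Y: "Y \<in> borel_measurable (F (dy T m j))" "integrable M (\<lambda>z. (Y z)\<^sup>2)"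
    and U: "\<And>n. n \<in> S \<Longrightarrow> U n \<in> borel_measurable (F (dy T m j))" "\<And>n. n \<in> S \<Longrightarrow> integrable M (\<lambda>z. (U n z)\<^sup>2)"
  shows "integrable M (\<lambda>z. (Y z + (\<Sum>n\<in>S. U n z * dB m j n z))\<^sup>2)" (is ?g1)
    "(\<integral>z. (Y z + (\<Sum>n\<in>S. U n z * dB m j n z))\<^sup>2 \<partial>M) = (\<integral>z. (Y z)\<^sup>2 \<partial>M) + dt m * (\<Sum>n\<in>S. \<integral>z. (U n z)\<^sup>2 \<partial>M)" (is ?g2)
proof -
  have mM: "Y \<in> borel_measurable M" "\<And>n. n \<in> S \<Longrightarrow> U n \<in> borel_measurable M"
    using F_dy_M[OF Y(1)] F_dy_M[OF U(1)] j by auto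
  have YU: "integrable M (\<lambda>z. (2 * Y z) * U n z)" if "n \<in> S" for n
    using integrable_prod_of_squares[OF Y(2) U(2)[OF that] mM(1) mM(2)[OF that]] by (simp add: mult.assoc)
  have UU: "integrable M (\<lambda>z. U n z * U k z)" if "n \<in> S" "k \<in> S" for n k
    by (rule integrable_prod_of_squares) (use that U mM in auto)
  have YUm: "(\<lambda>z. (2 * Y z) * U n z) \<in> borel_measurable (F (dy T m j))" if "n \<in> S" for n
    using Y(1) U(1)[OF that] by measurable
  have UUm: "(\<lambda>z. U n z * U k z) \<in> borel_measurable (F (dy T m j))" if "n \<in> S" "k \<in> S" for n k
    using U(1)[OF that(1)] U(1)[OF that(2)] by measurable
  note mom1 = increment_moments[OF S j YU YUm]
  note mom2 = increment_moments[OF S j UU UUm]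
  have eq: "(Y z + (\<Sum>n\<in>S. U n z * dB m j n z))\<^sup>2 = (Y z)\<^sup>2 + ((\<Sum>n\<in>S. 2 * Y z * U n z * dB m j n z) +
      (\<Sum>n\<in>S. \<Sum>k\<in>S. U n z * U k z * (dB m j n z * dB m j k z)))" for z
    by (simp add: power2_sum power2_eq_square[of "\<Sum>n\<in>S. _ n"] sum_product sum_distrib_left mult_ac)
  have i1: "integrable M (\<lambda>z. \<Sum>n\<in>S. 2 * Y z * U n z * dB m j n z)"
    by (intro L1_sum mom1(1)) auto
  have i2: "integrable M (\<lambda>z. \<Sum>n\<in>S. \<Sum>k\<in>S. U n z * U k z * (dB m j n z * dB m j k z))"
    by (intro L1_sum mom2(3)) auto
  show ?g1
    unfolding eq by (intro L1_add Y i1 i2)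
  have "(\<integral>z. (Y z + (\<Sum>n\<in>S. U n z * dB m j n z))\<^sup>2 \<partial>M) = (\<integral>z. (Y z)\<^sup>2 \<partial>M) +
      ((\<integral>z. (\<Sum>n\<in>S. 2 * Y z * U n z * dB m j n z) \<partial>M) + (\<integral>z. (\<Sum>n\<in>S. \<Sum>k\<in>S. U n z * U k z * (dB m j n z * dB m j k z)) \<partial>M))"
    unfolding eq using Y(2) i1 i2 by simp
  also have "(\<integral>z. (\<Sum>n\<in>S. 2 * Y z * U n z * dB m j n z) \<partial>M) = (\<Sum>n\<in>S. \<integral>z. 2 * Y z * U n z * dB m j n z \<partial>M)"
    by (rule Bochner_Integration.integral_sum) (rule mom1(1))
  also have "\<dots> = 0" by (intro sum.neutral ballI mom1(2))
  also have "(\<integral>z. (\<Sum>n\<in>S. \<Sum>k\<in>S. U n z * U k z * (dB m j n z * dB m j k z)) \<partial>M) = (\<Sum>n\<in>S. \<integral>z. (\<Sum>k\<in>S. U n z * U k z * (dB m j n z * dB m j k z)) \<partial>M)"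
    by (intro Bochner_Integration.integral_sum L1_sum) (rule mom2(3))
  also have "\<dots> = (\<Sum>n\<in>S. \<Sum>k\<in>S. \<integral>z. U n z * U k z * (dB m j n z * dB m j k z) \<partial>M)"
    by (intro sum.cong refl Bochner_Integration.integral_sum) (rule mom2(3))
  also have "\<dots> = (\<Sum>n\<in>S. \<Sum>k\<in>S. if n = k then dt m * (\<integral>z. U n z * U k z \<partial>M) else 0)"
    by (intro sum.cong refl mom2(4))
  also have "\<dots> = dt m * (\<Sum>n\<in>S. \<integral>z. (U n z)\<^sup>2 \<partial>M)"
    using S by (simp add: sum.delta sum_distrib_left power2_eq_square)
  finally show ?g2
    by simp
qed

lemma L2_sum:
  assumes S: "finite S" "S \<subseteq> {1..}" and ab: "a \<le> b" "b \<le> 2 ^ m"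
    and U: "\<And>j n. j < 2 ^ m \<Longrightarrow> n \<in> S \<Longrightarrow> U j n \<in> borel_measurable (F (dy T m j))"
      "\<And>j n. j < 2 ^ m \<Longrightarrow> n \<in> S \<Longrightarrow> integrable M (\<lambda>z. (U j n z)\<^sup>2)"
  shows "(\<lambda>z. \<Sum>j=a..<b. \<Sum>n\<in>S. U j n z * dB m j n z) \<in> borel_measurable (F (dy T m b)) \<and>
    integrable M (\<lambda>z. (\<Sum>j=a..<b. \<Sum>n\<in>S. U j n z * dB m j n z)\<^sup>2) \<and>
    (\<integral>z. (\<Sum>j=a..<b. \<Sum>n\<in>S. U j n z * dB m j n z)\<^sup>2 \<partial>M) = dt m * (\<Sum>j=a..<b. \<Sum>n\<in>S. \<integral>z. (U j n z)\<^sup>2 \<partial>M)"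
  using ab
proof (induction b rule: dec_induct)
  case (step b)
  have b: "b < 2 ^ m" using step by simp
  let ?D = "\<lambda>b z. \<Sum>j=a..<b. \<Sum>n\<in>S. U j n z * dB m j n z"
  have IH: "?D b \<in> borel_measurable (F (dy T m b))" "integrable M (\<lambda>z. (?D b z)\<^sup>2)"
    "(\<integral>z. (?D b z)\<^sup>2 \<partial>M) = dt m * (\<Sum>j=a..<b. \<Sum>n\<in>S. \<integral>z. (U j n z)\<^sup>2 \<partial>M)"
    using step by auto
  have eq: "?D (Suc b) z = ?D b z + (\<Sum>n\<in>S. U b n z * dB m b n z)" for z
    using step.hyps by simp
  note st = L2_step[OF S b IH(1,2) U(1)[OF b] U(2)[OF b]]
  have "?D (Suc b) \<in> borel_measurable (F (dy T m (Suc b)))"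
    unfolding eq
  proof (rule borel_measurable_add[OF _ borel_measurable_sum[OF borel_measurable_times]])
    show "?D b \<in> borel_measurable (F (dy T m (Suc b)))"
      using b by (intro F_measurable_dy[OF IH(1)]) auto
    fix n assume n: "n \<in> S"
    show "U b n \<in> borel_measurable (F (dy T m (Suc b)))"
      using b by (intro F_measurable_dy[OF U(1)[OF b n]]) auto
    show "dB m b n \<in> borel_measurable (F (dy T m (Suc b)))"
      using n S b by (intro dB_adapted) auto
  qed
  moreover have "integrable M (\<lambda>z. (?D (Suc b) z)\<^sup>2)"
    unfolding eq by (rule st(1))
  moreover have "(\<integral>z. (?D (Suc b) z)\<^sup>2 \<partial>M) = dt m * (\<Sum>j=a..<Suc b. \<Sum>n\<in>S. \<integral>z. (U j n z)\<^sup>2 \<partial>M)"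
  proof -
    have "(\<integral>z. (?D (Suc b) z)\<^sup>2 \<partial>M) = (\<integral>z. (?D b z)\<^sup>2 \<partial>M) + dt m * (\<Sum>n\<in>S. \<integral>z. (U b n z)\<^sup>2 \<partial>M)"
      unfolding eq by (rule st(2))
    also note IH(3)
    finally show ?thesis
      unfolding sum.atLeastLessThan_Suc[OF step.hyps(1)] by (simp only: distrib_left)
  qed
  ultimately show ?case by (intro conjI)
qed simp

text \<open>Membership in the filtration is proved along the way because the event up to b is the
  past event for the next cell.\<close>

lemma increments_box:
  assumes S: "finite S" "S \<subseteq> {1..}" and b: "b \<le> 2 ^ m" and C: "\<And>j n. C j n \<in> sets borel"
  shows "{z\<in>space M. \<forall>j<b. \<forall>n\<in>S. dB m j n z \<in> C j n} \<in> sets (F (dy T m b)) \<and>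
    measure M {z\<in>space M. \<forall>j<b. \<forall>n\<in>S. dB m j n z \<in> C j n} = (\<Prod>j<b. \<Prod>n\<in>S. measure (gauss (dt m)) (C j n))"
  using b
proof (induction b)
  case 0
  have "{0..T} \<noteq> {}" using T_pos by auto
  then have "space (F 0) = space M" using space_F T_pos by auto
  then show ?case using sets.top[of "F 0"] by (simp add: prob_space)
next
  case (Suc b)
  let ?A = "\<lambda>b. {z\<in>space M. \<forall>j<b. \<forall>n\<in>S. dB m j n z \<in> C j n}"
  have b: "b < 2 ^ m" using Suc.prems by simp
  have IH: "?A b \<in> sets (F (dy T m b))" "measure M (?A b) = (\<Prod>j<b. \<Prod>n\<in>S. measure (gauss (dt m)) (C j n))"
    using Suc.IH b by (blast intro: less_imp_le)+
  have eq: "?A (Suc b) = ?A b \<inter> {z\<in>space M. \<forall>n\<in>S. dB m b n z \<in> C b n}"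
    by (auto simp: less_Suc_eq)
  have sp: "space (F (dy T m (Suc b))) = space M" using b by (intro space_F dy_mem T_pos) auto
  have B: "{z\<in>space M. \<forall>n\<in>S. dB m b n z \<in> C b n} \<in> sets (F (dy T m (Suc b)))"
    unfolding sp[symmetric]
  proof (rule sets.sets_Collect_finite_All[OF _ S(1)])
    fix n assume n: "n \<in> S"
    then have "dB m b n -` C b n \<inter> space (F (dy T m (Suc b))) \<in> sets (F (dy T m (Suc b)))"
      using S b C by (intro measurable_sets[OF dB_adapted]) auto
    also have "dB m b n -` C b n \<inter> space (F (dy T m (Suc b))) = {z\<in>space (F (dy T m (Suc b))). dB m b n z \<in> C b n}" by auto
    finally show "{z\<in>space (F (dy T m (Suc b))). dB m b n z \<in> C b n} \<in> sets (F (dy T m (Suc b)))" .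
  qed
  have A: "?A b \<in> sets (F (dy T m (Suc b)))"
  proof -
    have "sets (F (dy T m b)) \<subseteq> sets (F (dy T m (Suc b)))"
      by (rule F_mono) (use b T_pos in \<open>auto intro: dy_nonneg dy_mono dy_le\<close>)
    then show ?thesis using IH(1) by blast
  qed
  have "?A (Suc b) \<in> sets (F (dy T m (Suc b)))" unfolding eq by (rule sets.Int[OF A B])
  moreover have "measure M (?A (Suc b)) = (\<Prod>j<Suc b. \<Prod>n\<in>S. measure (gauss (dt m)) (C j n))"
    unfolding eq using dB_box[OF S b IH(1), of "C b"] C IH(2) by simp
  ultimately show ?case by (rule conjI)
qed

text \<open>Left-point sums along the uniform dyadic partition of \<open>[0,t]\<close> and along the partition
  of \<open>[0,T]\<close> restricted to \<open>[0,t]\<close> differ by an integral with vanishing bracket.\<close>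

lemma grid_change:
  fixes H :: "real \<Rightarrow> 'a \<Rightarrow> real"
  assumes H: "\<And>z. z \<in> space M \<Longrightarrow> continuous_on {0..T} (\<lambda>t. H t z)" "\<And>t. t \<in> {0..T} \<Longrightarrow> H t \<in> borel_measurable (F t)"
    and n: "n \<ge> 1" and c: "c \<le> 2 ^ b" and t: "t = dy T b c"
    and conv: "conv_prob M (\<lambda>m z. \<Sum>j<2 ^ m. H (t * real j / 2 ^ m) z * (B n (t * real (Suc j) / 2 ^ m) z - B n (t * real j / 2 ^ m) z)) I"
  shows "conv_prob M (\<lambda>m z. \<Sum>l<c * 2 ^ m. H (dy T (b + m) l) z * dB (b + m) l n z) I"
proof -
  let ?t = "\<lambda>m. dy T (b + m)"
  have S: "finite {n}" "{n} \<subseteq> {1..}" using n by auto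
  have lt: "l < 2 ^ (b + m)" if "l < c * 2 ^ m" for l m
  proof -
    have "c * 2 ^ m \<le> 2 ^ b * 2 ^ m" using c by (rule mult_le_mono1)
    from less_le_trans[OF that this] show ?thesis by (simp only: power_add)
  qed
  have tj: "t * real j / 2 ^ m = ?t m (c * j)" for j m
    by (simp add: t dy_def power_add field_simps)
  \<comment> \<open>As t = c T / 2^b, each interval of the uniform partition of [0, t] at level m
    consists of c cells of the grid of level b + m. \<open>H'\<close> holds the integrand at its
    value at the start of the block that contains cell l.\<close>
  define H' where "H' m l z = H (?t m (c * (l div c))) z" for m l z
  have coarse: "(\<Sum>j<2 ^ m. H (t * real j / 2 ^ m) z * (B n (t * real (Suc j) / 2 ^ m) z - B n (t * real j / 2 ^ m) z))
      = (\<Sum>l<c * 2 ^ m. H' m l z * dB (b + m) l n z)" for m z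
  proof (cases "c = 0")
    case True
    then show ?thesis by (simp add: t)
  next
    case False
    have "(\<Sum>l<c * 2 ^ m. H' m l z * dB (b + m) l n z) = (\<Sum>j<2 ^ m. \<Sum>l=j * c..<j * c + c. H' m l z * dB (b + m) l n z)"
      by (subst sum.nat_group) (simp add: mult.commute)
    also have "\<dots> = (\<Sum>j<2 ^ m. H (?t m (c * j)) z * (\<Sum>l=j * c..<j * c + c. dB (b + m) l n z))"
    proof (rule sum.cong[OF refl])
      fix j
      have "l div c = j" if "l \<in> {j * c..<j * c + c}" for l
        using that False by (intro div_nat_eqI) (auto simp: mult.commute)
      then show "(\<Sum>l=j * c..<j * c + c. H' m l z * dB (b + m) l n z) = H (?t m (c * j)) z * (\<Sum>l=j * c..<j * c + c. dB (b + m) l n z)"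
        by (simp add: sum_distrib_left H'_def)
    qed
    also have "\<dots> = (\<Sum>j<2 ^ m. H (?t m (c * j)) z * (B n (?t m (c * Suc j)) z - B n (?t m (c * j)) z))"
    proof (intro sum.cong refl)
      fix j
      have "(\<Sum>l=j * c..<j * c + c. dB (b + m) l n z) = B n (?t m (j * c + c)) z - B n (?t m (j * c)) z"
        unfolding dB_def by (rule sum_Suc_diff') simp
      then show "H (?t m (c * j)) z * (\<Sum>l=j * c..<j * c + c. dB (b + m) l n z) =
          H (?t m (c * j)) z * (B n (?t m (c * Suc j)) z - B n (?t m (c * j)) z)"
        by (simp add: mult.commute add.commute)
    qed
    finally show ?thesis by (simp only: tj)
  qed
  define U where "U m l z = H (?t m l) z - H' m l z" for m l z
  have div_le: "c * (l div c) \<le> l" for l by simp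
  have tmem: "?t m l \<in> {0..T}" if "l < c * 2 ^ m" for l m using lt[OF that] by (intro dy_mem T_pos) auto
  have Um: "U m l \<in> borel_measurable (F (?t m l))" if "l < c * 2 ^ m" for m l
    unfolding U_def[abs_def] H'_def[abs_def]
  proof (rule borel_measurable_diff)
    have cm: "?t m (c * (l div c)) \<in> {0..T}"
      by (intro dy_mem T_pos order.trans[OF div_le less_imp_le[OF lt[OF that]]])
    show "H (?t m (c * (l div c))) \<in> borel_measurable (F (?t m l))"
      using lt[OF that] by (intro F_measurable_dy[OF H(2)[OF cm]] div_le) auto
  qed (rule H(2)[OF tmem[OF that]])
  \<comment> \<open>Extended by 0 beyond t, so that adaptedness holds for every index.\<close>
  define V where "V m l k z = (if l < c * 2 ^ m then U m l z else 0)" for m l and k :: nat and z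
  have Vm: "V m l k \<in> borel_measurable (F (?t m l))" for m l k
    unfolding V_def[abs_def] using Um[of l m] by (cases "l < c * 2 ^ m") auto
  define D where "D m z = (\<Sum>l=0..<c * 2 ^ m. \<Sum>k\<in>{n}. V m l k z * dB (b + m) l k z)" for m z
  define A where "A m z = (\<Sum>l=0..<c * 2 ^ m. \<Sum>k\<in>{n}. (V m l k z)\<^sup>2 * dt (b + m))" for m z
  have le: "c * 2 ^ m \<le> 2 ^ (b + m)" for m using c by (simp add: power_add)
  have VM: "V m l k \<in> borel_measurable M" if "l < c * 2 ^ m" for m l k
    using F_dy_M[OF Vm[of m l k]] lt[OF that] by auto
  have Dm: "D m \<in> borel_measurable M" for m
    unfolding D_def[abs_def] using n by (intro borel_measurable_sum borel_measurable_times VM dB_measurable lt) auto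
  have Am: "A m \<in> borel_measurable M" for m
    unfolding A_def[abs_def] by (intro borel_measurable_sum borel_measurable_times borel_measurable_power borel_measurable_const VM) auto
  have "conv_prob M D (\<lambda>_. 0)"
  proof (rule conv_prob_bracket[where A=A, OF Dm])
    show "integrable M (\<lambda>z. exp (q * D m z - q\<^sup>2 * A m z / 2))" "(\<integral>z. exp (q * D m z - q\<^sup>2 * A m z / 2) \<partial>M) \<le> 1" for q m
      unfolding D_def A_def using exp_mart[OF S le0 le[of m], where th="V m" and q=q] Vm by simp_all
    show "conv_prob M A (\<lambda>_. 0)"
    proof (rule AE_imp_conv_prob[OF Am])
      show "AE z in M. (\<lambda>m. A m z) \<longlonglongrightarrow> 0"
      proof (rule AE_I2)
        fix z assume w: "z \<in> space M"
        have "(\<lambda>m. \<Sum>l<c * 2 ^ m. (V m l n z)\<^sup>2 * (T / 2 ^ (b + m))) \<longlonglongrightarrow> integral {0..dy T b c} (\<lambda>_. 0)"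
        proof (rule riemann_limit[OF continuous_on_const T_pos c, where K=0])
          fix e :: real assume e: "e > 0"
          then have "sqrt e > 0" by simp
          from eventually_small_oscillation[OF H(1)[OF w] T_pos this, of "real c"]
          show "\<forall>\<^sub>F m in sequentially. \<forall>l. 0 < l \<longrightarrow> l < c * 2 ^ m \<longrightarrow> \<bar>(V m l n z)\<^sup>2 - 0\<bar> \<le> e"
          proof eventually_elim
            case (elim m)
            show ?case
            proof (intro allI impI)
              fix l assume l: "0 < l" "l < c * 2 ^ m"
              have cm: "?t m (c * (l div c)) \<in> {0..T}"
                by (intro dy_mem T_pos order.trans[OF div_le less_imp_le[OF lt[OF l(2)]]])
              have "\<bar>?t m (c * (l div c)) - ?t m l\<bar> \<le> real c * T / 2 ^ (b + m)"
              proof (rule dy_diff_le[OF T_pos div_le])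
                have "l mod c \<le> c" using l by (intro less_imp_le mod_less_divisor) (auto intro: gr0I)
                then have "l \<le> c * (l div c) + c" using mult_div_mod_eq[of c l] by linarith
                then have "real l \<le> real (c * (l div c) + c)" by (simp only: of_nat_le_iff)
                then show "real l - real (c * (l div c)) \<le> real c" by (simp only: of_nat_add)
              qed
              also have "\<dots> \<le> real c * T / 2 ^ m"
                using T_pos by (intro divide_left_mono) (auto simp: power_add)
              finally have "\<bar>V m l n z\<bar> \<le> sqrt e"
                using elim cm tmem[OF l(2)] l by (auto simp: V_def U_def H'_def abs_minus_commute)
              then have "\<bar>V m l n z\<bar>\<^sup>2 \<le> (sqrt e)\<^sup>2" by (intro power_mono) auto
              then show "\<bar>(V m l n z)\<^sup>2 - 0\<bar> \<le> e" using e by simp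
            qed
          qed
        qed (auto simp: V_def U_def H'_def)
        then show "(\<lambda>m. A m z) \<longlonglongrightarrow> 0" by (simp add: A_def atLeast0LessThan)
      qed
    qed auto
  qed
  from conv_prob_add[OF conv this]
  have "conv_prob M (\<lambda>m z. (\<Sum>l<c * 2 ^ m. H' m l z * dB (b + m) l n z) + D m z) I"
    by (simp only: coarse add_0_right)
  also have "(\<lambda>m z. (\<Sum>l<c * 2 ^ m. H' m l z * dB (b + m) l n z) + D m z) = (\<lambda>m z. \<Sum>l<c * 2 ^ m. H (?t m l) z * dB (b + m) l n z)"
    by (intro ext) (simp add: D_def V_def U_def atLeast0LessThan sum.distrib[symmetric] algebra_simps)
  finally show ?thesis .
qed

end

section \<open>Independent Brownian motions form a Gaussian grid\<close>

lemma measurable_cnj [measurable]: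
  fixes f :: "'a \<Rightarrow> complex"
  assumes "f \<in> borel_measurable N"
  shows "(\<lambda>x. cnj (f x)) \<in> borel_measurable N"
  by (rule measurable_compose[OF assms]) (intro borel_measurable_continuous_onI continuous_intros)

text \<open>Independence splits each mixed mean in the squared sum, and orthogonality of the
  \<open>b i\<close> removes all but the diagonal. With \<alpha> and \<beta> of order 1/L the L
  remaining terms add up to order 1/L.\<close>

lemma (in prob_space) orthogonal_sum_bound:
  fixes a b :: "nat \<Rightarrow> 'a \<Rightarrow> complex"
  assumes m[measurable]: "\<And>i. i < L \<Longrightarrow> a i \<in> borel_measurable M" "\<And>i. i < L \<Longrightarrow> b i \<in> borel_measurable M"
    and bd: "\<And>i z. i < L \<Longrightarrow> z \<in> space M \<Longrightarrow> norm (a i z) \<le> K" "\<And>i z. i < L \<Longrightarrow> z \<in> space M \<Longrightarrow> norm (b i z) \<le> K"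
    and ind: "\<And>i j. i < L \<Longrightarrow> j < L \<Longrightarrow> (\<integral>z. (a i z * cnj (a j z)) * (b i z * cnj (b j z)) \<partial>M)
         = (\<integral>z. a i z * cnj (a j z) \<partial>M) * (\<integral>z. b i z * cnj (b j z) \<partial>M)"
    and orth: "\<And>i j. i < L \<Longrightarrow> j < i \<Longrightarrow> (\<integral>z. b i z * cnj (b j z) \<partial>M) = 0"
    and \<alpha>: "\<And>i. i < L \<Longrightarrow> norm (\<integral>z. a i z * cnj (a i z) \<partial>M) \<le> \<alpha>"
    and \<beta>: "\<And>i. i < L \<Longrightarrow> norm (\<integral>z. b i z * cnj (b i z) \<partial>M) \<le> \<beta>"
  shows "(\<integral>z. (norm (\<Sum>i<L. a i z * b i z))\<^sup>2 \<partial>M) \<le> real L * (\<alpha> * \<beta>)"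
proof -
  have orth': "(\<integral>z. b i z * cnj (b j z) \<partial>M) = 0" if "i < L" "j < L" "i \<noteq> j" for i j
  proof (cases "j < i")
    case False
    then have "(\<integral>z. b j z * cnj (b i z) \<partial>M) = 0" using orth that by simp
    moreover have "(\<integral>z. b i z * cnj (b j z) \<partial>M) = cnj (\<integral>z. b j z * cnj (b i z) \<partial>M)"
      by (simp only: Bochner_Integration.integral_cnj[symmetric]) (simp add: mult.commute)
    ultimately show ?thesis by simp
  qed (use orth that in simp)
  have int: "integrable M (\<lambda>z. (a i z * cnj (a j z)) * (b i z * cnj (b j z)))" if "i < L" "j < L" for i j
  proof (rule integrable_const_bound[where B="(K * K) * (K * K)"])
    show "AE z in M. norm ((a i z * cnj (a j z)) * (b i z * cnj (b j z))) \<le> (K * K) * (K * K)"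
    proof (rule AE_I2)
      fix z assume w: "z \<in> space M"
      then have "0 \<le> K" using bd(1)[OF that(1) w] norm_ge_zero order_trans by blast
      then show "norm ((a i z * cnj (a j z)) * (b i z * cnj (b j z))) \<le> (K * K) * (K * K)"
        unfolding norm_mult complex_mod_cnj using bd that w by (intro mult_mono mult_nonneg_nonneg) auto
    qed
  qed (use that in measurable)
  have "cr (\<integral>z. (norm (\<Sum>i<L. a i z * b i z))\<^sup>2 \<partial>M) = (\<integral>z. cr ((norm (\<Sum>i<L. a i z * b i z))\<^sup>2) \<partial>M)"
    by (rule integral_complex_of_real[symmetric])
  also have "\<dots> = (\<integral>z. (\<Sum>i<L. \<Sum>j<L. (a i z * cnj (a j z)) * (b i z * cnj (b j z))) \<partial>M)"
    by (intro Bochner_Integration.integral_cong refl)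
      (simp only: complex_norm_square cnj_sum sum_product complex_cnj_mult mult.assoc mult.left_commute)
  also have "\<dots> = (\<Sum>i<L. \<Sum>j<L. \<integral>z. (a i z * cnj (a j z)) * (b i z * cnj (b j z)) \<partial>M)"
    by (subst Bochner_Integration.integral_sum; (intro sum.cong refl Bochner_Integration.integral_sum L1_sum int)?; simp)
  also have "\<dots> = (\<Sum>i<L. \<Sum>j<L. if i = j then (\<integral>z. a i z * cnj (a i z) \<partial>M) * (\<integral>z. b i z * cnj (b i z) \<partial>M) else 0)"
    by (intro sum.cong refl) (auto simp: ind orth')
  also have "\<dots> = (\<Sum>i<L. (\<integral>z. a i z * cnj (a i z) \<partial>M) * (\<integral>z. b i z * cnj (b i z) \<partial>M))"
    by (simp add: sum.delta)
  finally have eq: "cr (\<integral>z. (norm (\<Sum>i<L. a i z * b i z))\<^sup>2 \<partial>M) = \<dots>" .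
  have "(\<integral>z. (norm (\<Sum>i<L. a i z * b i z))\<^sup>2 \<partial>M) \<le> norm (cr (\<integral>z. (norm (\<Sum>i<L. a i z * b i z))\<^sup>2 \<partial>M))"
    by (simp only: norm_of_real abs_ge_self)
  also have "\<dots> \<le> (\<Sum>i<L. \<alpha> * \<beta>)"
    unfolding eq
  proof (rule order.trans[OF norm_sum sum_mono])
    fix i assume "i \<in> {..<L}"
    then show "norm ((\<integral>z. a i z * cnj (a i z) \<partial>M) * (\<integral>z. b i z * cnj (b i z) \<partial>M)) \<le> \<alpha> * \<beta>"
      unfolding norm_mult using \<alpha>[of i] \<beta>[of i] order_trans[OF norm_ge_zero \<alpha>[of i]] by (intro mult_mono) auto
  qed
  finally show ?thesis by simp
qed

text \<open>Each motion has increments independent of the filtration, and the motions are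
  independent of each other. That the increments of several motions are jointly independent of the
  filtration is not immediate from this; \<open>xi_mean\<close> is the step that proves it.\<close>

locale indep_brownian = prob_space M for M :: "'a measure" +
  fixes F :: "real \<Rightarrow> 'a measure" and T :: real and W :: "nat \<Rightarrow> real \<Rightarrow> 'a \<Rightarrow> real"
  assumes T_pos: "T > 0"
    and F_sub: "\<And>t. t \<in> {0..T} \<Longrightarrow> subalgebra M (F t)"
    and F_mono: "\<And>s t. 0 \<le> s \<Longrightarrow> s \<le> t \<Longrightarrow> t \<le> T \<Longrightarrow> sets (F s) \<subseteq> sets (F t)"
    and bm: "\<And>n. n \<ge> 1 \<Longrightarrow> brownian_motion_on T M F (W n)"
    and indep: "indep_vars (\<lambda>_. path_space T) (\<lambda>n. path_of T (W n)) {1..}"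
begin

text \<open>The exponential martingale with imaginary exponent, as a multiplicative increment from s
  to t. It is a function of a family of paths, not of outcomes, so that independence of the
  path-valued variables can be applied to it.\<close>

definition ee :: "(nat \<Rightarrow> real) \<Rightarrow> nat \<Rightarrow> real \<Rightarrow> real \<Rightarrow> (nat \<Rightarrow> real \<Rightarrow> real) \<Rightarrow> complex" where
  "ee mu n s t p = iexp (mu n * (p n t - p n s)) * cr (exp ((mu n)\<^sup>2 * (t - s) / 2))"

definition xi :: "(nat \<Rightarrow> real) \<Rightarrow> nat set \<Rightarrow> real \<Rightarrow> real \<Rightarrow> (nat \<Rightarrow> real \<Rightarrow> real) \<Rightarrow> complex" where
  "xi mu S s t p = (\<Prod>n\<in>S. ee mu n s t p)"

definition pw :: "'a \<Rightarrow> nat \<Rightarrow> real \<Rightarrow> real" where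
  "pw z = (\<lambda>n t. W n t z)"

lemma F_measurable_le:
  assumes "f \<in> measurable (F s) N" "0 \<le> s" "s \<le> t" "t \<le> T"
  shows "f \<in> measurable (F t) N"
proof -
  have "space (F s) = space (F t)"
    using F_sub[of s] F_sub[of t] assms by (auto simp: subalgebra_def)
  then have "subalgebra (F t) (F s)"
    using F_mono[of s t] assms by (auto simp: subalgebra_def)
  then show ?thesis using assms(1) by (rule measurable_from_subalg)
qed

lemma F_measurable_M: "f \<in> measurable (F s) N \<Longrightarrow> s \<in> {0..T} \<Longrightarrow> f \<in> measurable M N"
  using F_sub measurable_from_subalg by blast

lemma W_adapted: "n \<ge> 1 \<Longrightarrow> t \<in> {0..T} \<Longrightarrow> W n t \<in> borel_measurable (F t)"
  using bm by (auto simp: brownian_motion_on_def)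

lemma W_measurable: "n \<ge> 1 \<Longrightarrow> t \<in> {0..T} \<Longrightarrow> W n t \<in> borel_measurable M"
  using W_adapted F_measurable_M by blast

lemma norm_ee: "norm (ee mu n s t p) = exp ((mu n)\<^sup>2 * (t - s) / 2)"
  unfolding ee_def norm_mult by (simp only: norm_of_real norm_exp_i_times abs_exp_cancel mult_1_left)

lemma ee_refl [simp]: "ee mu n s s p = 1"
  by (simp add: ee_def)

lemma ee_cocycle: "ee mu n s u p * ee mu n u t p = ee mu n s t p"
proof -
  have "iexp (mu n * (p n u - p n s)) * iexp (mu n * (p n t - p n u)) = iexp (mu n * (p n t - p n s))"
    by (simp add: exp_add[symmetric] algebra_simps)
  moreover have "exp ((mu n)\<^sup>2 * (u - s) / 2) * exp ((mu n)\<^sup>2 * (t - u) / 2) = exp ((mu n)\<^sup>2 * (t - s) / 2)"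
    unfolding exp_add[symmetric] by (simp add: right_diff_distrib diff_divide_distrib)
  moreover have "ee mu n s u p * ee mu n u t p = (iexp (mu n * (p n u - p n s)) * iexp (mu n * (p n t - p n u))) *
      cr (exp ((mu n)\<^sup>2 * (u - s) / 2) * exp ((mu n)\<^sup>2 * (t - u) / 2))"
    unfolding ee_def of_real_mult[of "exp _" "exp _"] by (simp only: mult_ac)
  ultimately show ?thesis by (simp only: ee_def)
qed

lemma xi_refl [simp]: "xi mu S s s p = 1"
  by (simp add: xi_def)

lemma xi_cocycle: "xi mu S s u p * xi mu S u t p = xi mu S s t p"
  by (simp add: xi_def prod.distrib[symmetric] ee_cocycle)

lemma norm_xi: "norm (xi mu S s t p) = exp ((\<Sum>n\<in>S. (mu n)\<^sup>2) * (t - s) / 2)" if "finite S"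
  unfolding xi_def prod_norm[symmetric] norm_ee
  using that by (simp add: exp_sum[symmetric] sum_distrib_right sum_divide_distrib)

lemma ee_adapted:
  assumes "n \<ge> 1" "0 \<le> s" "s \<le> t" "t \<le> T"
  shows "(\<lambda>z. ee mu n s t (pw z)) \<in> borel_measurable (F t)"
proof -
  have [measurable]: "W n t \<in> borel_measurable (F t)" using assms by (intro W_adapted) auto
  have [measurable]: "W n s \<in> borel_measurable (F t)"
    using assms by (intro F_measurable_le[OF W_adapted]) auto
  show ?thesis unfolding ee_def pw_def by measurable
qed

lemma xi_adapted:
  assumes "S \<subseteq> {1..}" "0 \<le> s" "s \<le> t" "t \<le> T"
  shows "(\<lambda>z. xi mu S s t (pw z)) \<in> borel_measurable (F t)"
  unfolding xi_def by (intro borel_measurable_prod ee_adapted) (use assms in auto)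

lemma bounded_integrable:
  fixes g :: "'a \<Rightarrow> complex"
  assumes "g \<in> borel_measurable M" "\<And>z. norm (g z) \<le> K"
  shows "integrable M g"
  by (rule integrable_const_bound[where B=K]) (use assms in auto)

text \<open>The Brownian property gives the product rule for events; identifying the joint law with
  the product law turns it into independence. The increment is read as a complex number so that both
  variables take values in one type.\<close>

lemma increment_indep:
  fixes g :: "'a \<Rightarrow> complex"
  assumes n: "n \<ge> 1" and st: "0 \<le> s" "s < t" "t \<le> T" and g: "g \<in> borel_measurable (F s)"
  shows "indep_var borel g borel (\<lambda>z. cr (W n t z - W n s z))"
proof -
  let ?V' = "\<lambda>z. W n t z - W n s z"
  let ?V = "\<lambda>z. cr (?V' z)"
  have [measurable]: "W n t \<in> borel_measurable M" "W n s \<in> borel_measurable M"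
    using n st by (auto intro!: W_measurable)
  have [measurable]: "g \<in> borel_measurable M" using g st by (intro F_measurable_M[OF g]) auto
  interpret N1: prob_space "distr M borel g" by (rule prob_space_distr) simp
  interpret N2: prob_space "distr M borel ?V" by (rule prob_space_distr) simp
  have "distr M borel g \<Otimes>\<^sub>M distr M borel ?V = distr M (borel \<Otimes>\<^sub>M borel) (\<lambda>z. (g z, ?V z))"
  proof (rule pair_measure_eqI)
    fix A B assume "A \<in> sets (distr M borel g)" "B \<in> sets (distr M borel ?V)"
    then have [measurable]: "A \<in> sets borel" "B \<in> sets borel" by auto
    have sp: "space (F s) = space M" using F_sub[of s] st by (auto simp: subalgebra_def)
    have "g -` A \<inter> space (F s) \<in> sets (F s)" by (rule measurable_sets[OF g]) simp
    moreover have "cr -` B \<in> sets borel"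
      using measurable_sets[of cr borel borel B] by simp
    ultimately have "measure M ((g -` A \<inter> space M) \<inter> {z\<in>space M. ?V' z \<in> cr -` B}) =
        measure M (g -` A \<inter> space M) * measure M {z\<in>space M. ?V' z \<in> cr -` B}"
      using bm[OF n] st unfolding sp brownian_motion_on_def by blast
    then have "measure M ((g -` A \<inter> space M) \<inter> {z\<in>space M. ?V z \<in> B}) = measure M (g -` A \<inter> space M) * measure M {z\<in>space M. ?V z \<in> B}"
      by (simp only: vimage_eq)
    moreover have "(g -` A \<inter> space M) \<inter> {z\<in>space M. ?V z \<in> B} = (\<lambda>z. (g z, ?V z)) -` (A \<times> B) \<inter> space M"
      "{z\<in>space M. ?V z \<in> B} = ?V -` B \<inter> space M" by auto
    ultimately show "emeasure (distr M borel g) A * emeasure (distr M borel ?V) B = emeasure (distr M (borel \<Otimes>\<^sub>M borel) (\<lambda>z. (g z, ?V z))) (A \<times> B)"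
      by (simp add: emeasure_distr emeasure_eq_measure ennreal_mult)
  next
    show "sigma_finite_measure (distr M borel g)" by (rule N1.sigma_finite_measure_axioms)
    show "sigma_finite_measure (distr M borel ?V)" by (rule N2.sigma_finite_measure_axioms)
  qed simp
  then show ?thesis unfolding indep_var_distribution_eq by simp
qed

lemma ee_mean:
  fixes g :: "'a \<Rightarrow> complex"
  assumes n: "n \<ge> 1" and st: "0 \<le> s" "s \<le> t" "t \<le> T" and g: "g \<in> borel_measurable (F s)" "\<And>z. norm (g z) \<le> K"
  shows "(\<integral>z. g z * ee mu n s t (pw z) \<partial>M) = (\<integral>z. g z \<partial>M)"
proof (cases "s = t")
  case False
  then have st': "s < t" using st by simp
  let ?V = "\<lambda>z. W n t z - W n s z"
  have [measurable]: "W n t \<in> borel_measurable M" "W n s \<in> borel_measurable M"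
    using n st by (auto intro!: W_measurable)
  have gM[measurable]: "g \<in> borel_measurable M" using st by (intro F_measurable_M[OF g(1)]) auto
  have "distributed M lborel ?V (normal_density 0 (sqrt (t - s)))"
    using bm[OF n] st st' by (auto simp: brownian_motion_on_def)
  then have "distr M lborel ?V = gauss (t - s)"
    by (simp add: distributed_def gauss_def)
  then have distr: "distr M borel ?V = gauss (t - s)"
    by (simp cong: distr_cong)
  have Ei: "(\<integral>z. iexp (mu n * ?V z) \<partial>M) = exp (- ((t - s) * (mu n)\<^sup>2 / 2))"
  proof -
    have "(\<integral>z. iexp (mu n * ?V z) \<partial>M) = char (distr M borel ?V) (mu n)"
      by (simp add: char_def integral_distr)
    then show ?thesis using st' by (simp add: distr char_gauss)
  qed
  have iv: "indep_var borel g borel (\<lambda>z. iexp (mu n * ?V z))"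
    using indep_var_compose[OF increment_indep[OF n st(1) st' st(3) g(1)], of "\<lambda>x. x" borel "\<lambda>v. iexp (mu n * Re v)" borel]
    by (simp add: o_def del: of_real_mult of_real_diff)
  have "(\<integral>z. g z * iexp (mu n * ?V z) \<partial>M) = (\<integral>z. g z \<partial>M) * (\<integral>z. iexp (mu n * ?V z) \<partial>M)"
    by (rule indep_var_lebesgue_integral[OF iv bounded_integrable[OF gM g(2)] bounded_integrable[where K=1]])
       (simp_all only: norm_exp_i_times order.refl, measurable)
  then have "(\<integral>z. g z * iexp (mu n * ?V z) \<partial>M) * cr (exp ((mu n)\<^sup>2 * (t - s) / 2)) = (\<integral>z. g z \<partial>M) *
      (cr (exp (- ((t - s) * (mu n)\<^sup>2 / 2))) * cr (exp ((mu n)\<^sup>2 * (t - s) / 2)))"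
    unfolding Ei by simp
  also have "cr (exp (- ((t - s) * (mu n)\<^sup>2 / 2))) * cr (exp ((mu n)\<^sup>2 * (t - s) / 2)) = 1"
    by (simp add: of_real_mult[symmetric] exp_add[symmetric] mult.commute del: of_real_mult)
  finally show ?thesis
    by (simp add: ee_def pw_def mult.assoc[symmetric] del: of_real_mult of_real_diff)
qed simp

text \<open>Products of the exponential martingales of independent Brownian motions stay martingales: in
  \<open>d(XY) = X dY + Y dX + dX dY\<close> the last sum over \<open>L\<close> steps is, by independence of \<open>dX\<close> and \<open>dY\<close>, of order \<open>L\<^sup>-\<^sup>1\<^sup>/\<^sup>2\<close> in \<open>L\<^sup>2\<close>.\<close>

lemma xi_mean:
  assumes "finite S" "S \<subseteq> {1..}" and "0 \<le> s" "s \<le> t" "t \<le> T"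
    and "g \<in> borel_measurable (F s)" "\<And>z. norm (g z :: complex) \<le> K"
  shows "(\<integral>z. g z * xi mu S s t (pw z) \<partial>M) = (\<integral>z. g z \<partial>M)"
  using assms
proof (induction S arbitrary: s t g K)
  case empty
  then show ?case by (simp add: xi_def)
next
  case (insert a S)
  note st = insert.prems(2-4)
  have a: "a \<ge> 1" "a \<notin> S" and S: "finite S" "S \<subseteq> {1..}" using insert by auto
  note IH = insert.IH[OF S(2)]
  define C where "C = (\<Sum>n\<in>insert a S. (mu n)\<^sup>2)"
  have CS: "(\<Sum>n\<in>S. (mu n)\<^sup>2) \<le> C" "(mu a)\<^sup>2 \<le> C" "0 \<le> C"
    using S a by (auto simp: C_def sum_nonneg)
  \<comment> \<open>Without the factor 1/2 in the exponent, \<open>E\<close> bounds not only the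
    norms of the martingale increments but also their squares, which enter the size of the steps
    below.\<close>
  define E where "E = exp (C * (t - s))"
  have E1: "1 \<le> E" using CS st by (simp add: E_def)
  have nx: "norm (xi mu S u v p) \<le> E" "norm (ee mu a u v p) \<le> E" if "s \<le> u" "u \<le> v" "v \<le> t" for u v p
  proof -
    have "D * (v - u) / 2 \<le> C * (t - s)" if D: "0 \<le> D" "D \<le> C" for D
    proof -
      have "D * (v - u) \<le> C * (t - s)" using D \<open>s \<le> u\<close> \<open>u \<le> v\<close> \<open>v \<le> t\<close> by (intro mult_mono) auto
      moreover have "0 \<le> D * (v - u)" using D \<open>u \<le> v\<close> by simp
      ultimately show ?thesis by simp
    qed
    then show "norm (xi mu S u v p) \<le> E" "norm (ee mu a u v p) \<le> E"
      using CS S by (auto simp: norm_xi norm_ee E_def sum_nonneg)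
  qed
  have gs: "g \<in> borel_measurable (F s)" and gK: "\<And>z. norm (g z) \<le> K" using insert.prems by auto
  have K0: "0 \<le> K" using order_trans[OF norm_ge_zero gK] .
  have gM[measurable]: "g \<in> borel_measurable M" using st by (intro F_measurable_M[OF gs]) auto
  \<comment> \<open>The left side does not depend on the number L of steps, so an error of order
    L^(-1/2) forces it to be 0.\<close>
  have bound: "norm ((\<integral>z. g z * xi mu (insert a S) s t (pw z) \<partial>M) - (\<integral>z. g z \<partial>M)) \<le> K * (1 + (E * E * C * (t - s) * E)\<^sup>2) / sqrt (real L)"
    if L: "L > 0" for L :: nat
  proof -
    define d where "d = (t - s) / real L"
    define u where "u i = s + real i * d" for i :: nat
    have d0: "0 \<le> d" using st L by (simp add: d_def)
    have u0: "u 0 = s" and uL: "u L = t" and uSuc: "u (Suc i) = u i + d" for i using L by (simp_all add: u_def d_def field_simps)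
    have um: "u i \<le> u j" if "i \<le> j" for i j using that d0 by (simp add: u_def mult_right_mono)
    have ub: "s \<le> u i \<and> u i \<le> t" if "i \<le> L" for i using um[of 0 i] um[of i L] that u0 uL by simp
    have ub': "0 \<le> u i" "u i \<le> T" if "i \<le> L" for i using ub[OF that] st by auto
    define X where "X i z = xi mu S s (u i) (pw z)" for i z
    define Y where "Y i z = ee mu a s (u i) (pw z)" for i z
    have Xa: "X i \<in> borel_measurable (F (u i))" "Y i \<in> borel_measurable (F (u i))" if "i \<le> L" for i
      unfolding X_def[abs_def] Y_def[abs_def] using ub[OF that] st S a by (auto intro!: xi_adapted ee_adapted)
    have XM[measurable]: "X i \<in> borel_measurable M" "Y i \<in> borel_measurable M" if "i \<le> L" for i
      using Xa[OF that] ub'[OF that] by (auto intro: F_measurable_M)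
    have Xn: "norm (X i z) \<le> E" "norm (Y i z) \<le> E" if "i \<le> L" for i z
      unfolding X_def Y_def using ub[OF that] by (auto intro!: nx)
    have Xstep: "X (Suc i) z = X i z * xi mu S (u i) (u (Suc i)) (pw z)"
      "Y (Suc i) z = Y i z * ee mu a (u i) (u (Suc i)) (pw z)" for i z
      by (simp_all add: X_def Y_def xi_cocycle ee_cocycle)
    define dX where "dX i z = X (Suc i) z - X i z" for i z
    define dY where "dY i z = Y (Suc i) z - Y i z" for i z
    have dm[measurable]: "dX i \<in> borel_measurable M" "dY i \<in> borel_measurable M" if "i < L" for i
      unfolding dX_def[abs_def] dY_def[abs_def] using XM[of i] XM[of "Suc i"] that by auto
    have dn: "norm (dX i z) \<le> 2 * E" "norm (dY i z) \<le> 2 * E" if "i < L" for i z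
      unfolding dX_def dY_def
      using norm_triangle_ineq4[of "X (Suc i) z" "X i z"] norm_triangle_ineq4[of "Y (Suc i) z" "Y i z"] Xn[of i z] Xn[of "Suc i" z] that by auto
    have mean0: "(\<integral>z. h z * dX i z \<partial>M) = 0" "(\<integral>z. h z * dY i z \<partial>M) = 0"
      if i: "i < L" and h: "h \<in> borel_measurable (F (u i))" "\<And>z. norm (h z) \<le> B" for i h B
    proof -
      have i': "i \<le> L" "Suc i \<le> L" using i by auto
      have B0: "0 \<le> B" using order_trans[OF norm_ge_zero h(2)] .
      have hM[measurable]: "h \<in> borel_measurable M" using F_measurable_M[OF h(1)] ub'[OF i'(1)] by simp
      have m: "(\<lambda>z. h z * X i z) \<in> borel_measurable (F (u i))" "(\<lambda>z. h z * Y i z) \<in> borel_measurable (F (u i))"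
        using h(1) Xa[OF i'(1)] by measurable
      have n: "norm (h z * X j z) \<le> B * E" "norm (h z * Y j z) \<le> B * E" if "j \<le> L" for j z
        unfolding norm_mult using h(2) Xn[OF that] B0 by (auto intro!: mult_mono)
      have it: "integrable M (\<lambda>z. h z * X j z)" "integrable M (\<lambda>z. h z * Y j z)" if "j \<le> L" for j
        using XM[OF that] n[OF that] by (auto intro!: bounded_integrable)
      have "(\<integral>z. h z * X (Suc i) z \<partial>M) = (\<integral>z. h z * X i z \<partial>M)"
        unfolding Xstep mult.assoc[symmetric] using um[of i "Suc i"]
        by (intro IH[OF ub'(1)[OF i'(1)] _ ub'(2)[OF i'(2)] m(1) n(1)[OF i'(1)]]) auto
      then show "(\<integral>z. h z * dX i z \<partial>M) = 0"
        unfolding dX_def right_diff_distrib using it i' by simp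
      have "(\<integral>z. h z * Y (Suc i) z \<partial>M) = (\<integral>z. h z * Y i z \<partial>M)"
        unfolding Xstep mult.assoc[symmetric] using um[of i "Suc i"]
        by (intro ee_mean[OF a(1) ub'(1)[OF i'(1)] _ ub'(2)[OF i'(2)] m(2) n(2)[OF i'(1)]]) auto
      then show "(\<integral>z. h z * dY i z \<partial>M) = 0"
        unfolding dY_def right_diff_distrib using it i' by simp
    qed
    \<comment> \<open>Bound for the mean square of one increment of either martingale: it is at most
      E^2 (exp (D d) - 1), which is of order d, that is 1/L.\<close>
    define \<alpha> where "\<alpha> = E * E * C * d * E"
    have sq_bound: "norm (\<integral>z. (G z * (e z - 1)) * cnj (G z * (e z - 1)) \<partial>M) \<le> \<alpha>"
      if [measurable]: "G \<in> borel_measurable M" "e \<in> borel_measurable M" and G: "\<And>z. norm (G z) \<le> E"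
        and D: "0 \<le> D" "D \<le> C" and e: "\<And>z. norm (e z) = exp (D * d / 2)" and e1: "(\<integral>z. e z \<partial>M) = 1" for G e :: "'a \<Rightarrow> complex" and D
    proof -
      have eint: "integrable M e" by (rule bounded_integrable[where K="exp (D * d / 2)"]) (simp_all add: e)
      have "norm (\<integral>z. (G z * (e z - 1)) * cnj (G z * (e z - 1)) \<partial>M) \<le> (\<integral>z. norm ((G z * (e z - 1)) * cnj (G z * (e z - 1))) \<partial>M)"
        by (rule integral_norm_bound)
      also have "\<dots> \<le> (\<integral>z. E * E * (exp (D * d) + 1 - 2 * Re (e z)) \<partial>M)"
      proof (rule integral_mono)
        show i2: "integrable M (\<lambda>z. E * E * (exp (D * d) + 1 - 2 * Re (e z)))" using eint by simp
        fix z
        have "norm (e z - 1) * norm (e z - 1) = (norm (e z))\<^sup>2 + 1 - 2 * Re (e z)"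
          by (simp only: power2_eq_square[symmetric] cmod_power2) (simp add: power2_eq_square algebra_simps)
        also have "(norm (e z))\<^sup>2 = exp (D * d)" by (simp add: e power2_eq_square exp_add[symmetric])
        finally have n2: "norm (e z - 1) * norm (e z - 1) = exp (D * d) + 1 - 2 * Re (e z)" .
        have "norm ((G z * (e z - 1)) * cnj (G z * (e z - 1))) = (norm (G z) * norm (G z)) * (norm (e z - 1) * norm (e z - 1))"
          by (simp only: norm_mult complex_mod_cnj mult_ac)
        also have "\<dots> \<le> (E * E) * (norm (e z - 1) * norm (e z - 1))"
          using G[of z] E1 by (intro mult_right_mono mult_mono) auto
        finally show "norm ((G z * (e z - 1)) * cnj (G z * (e z - 1))) \<le> E * E * (exp (D * d) + 1 - 2 * Re (e z))"
          unfolding n2 .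
      next
        show "integrable M (\<lambda>z. norm ((G z * (e z - 1)) * cnj (G z * (e z - 1))))"
        proof (intro integrable_norm bounded_integrable)
          fix z
          have "norm (e z - 1) \<le> exp (D * d / 2) + 1" using norm_triangle_ineq4[of "e z" 1] e by simp
          then show "norm ((G z * (e z - 1)) * cnj (G z * (e z - 1))) \<le> (E * (exp (D * d / 2) + 1)) * (E * (exp (D * d / 2) + 1))"
            unfolding norm_mult complex_mod_cnj using G[of z] E1 by (intro mult_mono) (auto intro!: mult_nonneg_nonneg add_nonneg_nonneg)
        qed measurable
      qed
      also have "\<dots> = E * E * (exp (D * d) - 1)"
      proof -
        have "(\<integral>z. Re (e z) \<partial>M) = 1" using integral_Re[OF eint] e1 by simp
        then show ?thesis using eint by (simp add: prob_space)
      qed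
      also have "exp (D * d) - 1 \<le> C * d * E"
      proof -
        have "D * d \<le> C * (t - s)"
        proof (rule mult_mono)
          have "(t - s) / real L \<le> (t - s) / 1" using L st by (intro divide_left_mono) auto
          then show "d \<le> t - s" by (simp add: d_def)
        qed (use D d0 CS in auto)
        then have e1: "exp (D * d) \<le> E" by (simp add: E_def)
        have "1 + - (D * d) \<le> exp (- (D * d))" by (rule exp_ge_add_one_self)
        then have "(1 - D * d) * exp (D * d) \<le> exp (- (D * d)) * exp (D * d)" by (intro mult_right_mono) auto
        then have "exp (D * d) - 1 \<le> D * d * exp (D * d)" by (simp add: exp_minus left_diff_distrib)
        also have "\<dots> \<le> C * d * E" using D d0 e1 CS by (intro mult_mono mult_right_mono mult_nonneg_nonneg) auto
        finally show ?thesis .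
      qed
      finally show ?thesis using E1 by (simp add: \<alpha>_def mult_left_mono mult.assoc)
    qed
    have emean: "(\<integral>z. xi mu S (u i) (u (Suc i)) (pw z) \<partial>M) = 1" "(\<integral>z. ee mu a (u i) (u (Suc i)) (pw z) \<partial>M) = 1" if i: "i < L" for i
      using IH[of "u i" "u (Suc i)" "\<lambda>_. 1" 1] ee_mean[OF a(1), of "u i" "u (Suc i)" "\<lambda>_. 1" 1] ub'[of i] ub'[of "Suc i"] um[of i "Suc i"] i
      by (auto simp: prob_space)
    define R where "R z = (\<Sum>i<L. dX i z * dY i z)" for z
    have [measurable]: "R \<in> borel_measurable M" unfolding R_def[abs_def] by (intro borel_measurable_sum borel_measurable_times dm) auto
    have "(\<integral>z. (norm (R z))\<^sup>2 \<partial>M) \<le> real L * (\<alpha> * \<alpha>)"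
      unfolding R_def
    proof (rule orthogonal_sum_bound[where K="2 * E"])
      fix i j assume ij: "i < L" "j < L"
      \<comment> \<open>\<open>f1\<close> reads only the paths in \<open>S\<close>,
        \<open>f2\<close> only the path with index \<open>a\<close>; hence the means of products of
        increments of the two martingales factorize.\<close>
      define f1 where "f1 p = (xi mu S s (u (Suc i)) p - xi mu S s (u i) p) * cnj (xi mu S s (u (Suc j)) p - xi mu S s (u j) p)" for p
      define f2 where "f2 p = (ee mu a s (u (Suc i)) p - ee mu a s (u i) p) * cnj (ee mu a s (u (Suc j)) p - ee mu a s (u j) p)" for p
      have cm: "(\<lambda>p. p n v) \<in> borel_measurable (PiM A (\<lambda>_. path_space T))" if "n \<in> A" "v \<in> {0..T}" for n v and A :: "nat set"
      proof -
        have 1: "(\<lambda>p. p n) \<in> measurable (PiM A (\<lambda>_. path_space T)) (path_space T)"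
          using that(1) by (rule measurable_component_singleton)
        have 2: "(\<lambda>q. q v) \<in> borel_measurable (path_space T)"
          unfolding path_space_def using that(2) by (rule measurable_component_singleton)
        from measurable_compose[OF 1 2] show ?thesis .
      qed
      have um': "u l \<in> {0..T}" if "l \<le> L" for l using ub'[OF that] by simp
      have mem: "s \<in> {0..T}" "u i \<in> {0..T}" "u j \<in> {0..T}" "u (Suc i) \<in> {0..T}" "u (Suc j) \<in> {0..T}"
        using st ij um'[of i] um'[of j] um'[of "Suc i"] um'[of "Suc j"] by simp_all
      have eem: "(\<lambda>p. ee mu n s v p) \<in> borel_measurable (PiM A (\<lambda>_. path_space T))" if "n \<in> A" "v \<in> {0..T}" for n v and A :: "nat set"
        unfolding ee_def using cm[OF that] cm[OF that(1) mem(1)] by measurable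
      have f1m: "f1 \<in> borel_measurable (PiM S (\<lambda>_. path_space T))"
        unfolding f1_def[abs_def] xi_def
        by (intro borel_measurable_times borel_measurable_diff borel_measurable_prod eem mem
            measurable_cnj) auto
      have f2m: "f2 \<in> borel_measurable (PiM {a} (\<lambda>_. path_space T))"
        unfolding f2_def[abs_def]
        by (intro borel_measurable_times borel_measurable_diff eem mem
            measurable_cnj) auto
      have iv: "indep_var borel (f1 \<circ> (\<lambda>z. restrict (\<lambda>n. path_of T (W n) z) S)) borel (f2 \<circ> (\<lambda>z. restrict (\<lambda>n. path_of T (W n) z) {a}))"
        by (rule indep_var_compose[OF indep_var_restrict[OF indep] f1m f2m]) (use S a in auto)
      have xiW: "xi mu S s v (\<lambda>n\<in>S. path_of T (W n) z) = xi mu S s v (pw z)" "ee mu a s v (\<lambda>n\<in>{a}. path_of T (W n) z) = ee mu a s v (pw z)"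
        if "v \<in> {0..T}" for v z
        unfolding xi_def using that mem(1) by (auto simp: ee_def path_of_def pw_def intro!: prod.cong)
      have c1: "f1 \<circ> (\<lambda>z. restrict (\<lambda>n. path_of T (W n) z) S) = (\<lambda>z. dX i z * cnj (dX j z))"
        by (simp only: fun_eq_iff o_apply f1_def xiW mem dX_def X_def simp_thms)
      have c2: "f2 \<circ> (\<lambda>z. restrict (\<lambda>n. path_of T (W n) z) {a}) = (\<lambda>z. dY i z * cnj (dY j z))"
        by (simp only: fun_eq_iff o_apply f2_def xiW mem dY_def Y_def simp_thms)
      have b4: "norm (x * cnj y) \<le> (2 * E) * (2 * E)" if "norm x \<le> 2 * E" "norm y \<le> 2 * E" for x y :: complex
        unfolding norm_mult complex_mod_cnj using that E1 by (intro mult_mono) auto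
      show "(\<integral>z. (dX i z * cnj (dX j z)) * (dY i z * cnj (dY j z)) \<partial>M)
         = (\<integral>z. dX i z * cnj (dX j z) \<partial>M) * (\<integral>z. dY i z * cnj (dY j z) \<partial>M)"
      proof (rule indep_var_lebesgue_integral[OF iv[unfolded c1 c2]])
        show "integrable M (\<lambda>z. dX i z * cnj (dX j z))" "integrable M (\<lambda>z. dY i z * cnj (dY j z))"
          by (rule bounded_integrable[OF borel_measurable_times[OF dm(1)[OF ij(1)] measurable_cnj[OF dm(1)[OF ij(2)]]] b4[OF dn(1)[OF ij(1)] dn(1)[OF ij(2)]]],
              rule bounded_integrable[OF borel_measurable_times[OF dm(2)[OF ij(1)] measurable_cnj[OF dm(2)[OF ij(2)]]] b4[OF dn(2)[OF ij(1)] dn(2)[OF ij(2)]]])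
      qed
    next
      fix i j assume ij: "i < L" "j < i"
      have "(\<integral>z. cnj (dY j z) * dY i z \<partial>M) = 0"
      proof (rule mean0(2)[OF ij(1)])
        show "norm (cnj (dY j z)) \<le> 2 * E" for z using dn(2)[of j z] ij by simp
        have "Y j \<in> borel_measurable (F (u i))" "Y (Suc j) \<in> borel_measurable (F (u i))"
          by (rule F_measurable_le[OF Xa(2) ub'(1) um ub'(2)], use ij in simp_all)+
        then show "(\<lambda>z. cnj (dY j z)) \<in> borel_measurable (F (u i))"
          unfolding dY_def by (intro measurable_cnj borel_measurable_diff)
      qed
      then show "(\<integral>z. dY i z * cnj (dY j z) \<partial>M) = 0" by (simp add: mult.commute)
    next
      fix i assume i: "i < L"
      have sM: "(\<lambda>z. xi mu S (u i) (u (Suc i)) (pw z)) \<in> borel_measurable M" "(\<lambda>z. ee mu a (u i) (u (Suc i)) (pw z)) \<in> borel_measurable M"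
        by (rule F_measurable_M[OF xi_adapted[OF S(2) ub'(1) um ub'(2)]], use i ub'[of "Suc i"] in simp_all,
            rule F_measurable_M[OF ee_adapted[OF a(1) ub'(1) um ub'(2)]], use i ub'[of "Suc i"] in simp_all)
      have eqX: "dX i z = X i z * (xi mu S (u i) (u (Suc i)) (pw z) - 1)" "dY i z = Y i z * (ee mu a (u i) (u (Suc i)) (pw z) - 1)" for z
        by (simp_all add: dX_def dY_def Xstep right_diff_distrib)
      show "norm (\<integral>z. dX i z * cnj (dX i z) \<partial>M) \<le> \<alpha>"
        unfolding eqX
        by (rule sq_bound[of _ _ "\<Sum>n\<in>S. (mu n)\<^sup>2"]) (use i sM XM(1)[of i] Xn(1)[of i] CS emean(1)[OF i] S in \<open>simp_all add: norm_xi uSuc sum_nonneg\<close>)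
      show "norm (\<integral>z. dY i z * cnj (dY i z) \<partial>M) \<le> \<alpha>"
        unfolding eqX
        by (rule sq_bound[of _ _ "(mu a)\<^sup>2"]) (use i sM XM(2)[of i] Xn(2)[of i] CS emean(2)[OF i] in \<open>simp_all add: norm_ee uSuc\<close>)
    qed (use dm dn in auto)
    then have R2: "(\<integral>z. (norm (R z))\<^sup>2 \<partial>M) \<le> real L * (\<alpha> * \<alpha>)" .
    have Rn: "norm (R z) \<le> real L * ((2 * E) * (2 * E))" for z
    proof -
      have "norm (R z) \<le> (\<Sum>i<L. (2 * E) * (2 * E))"
        unfolding R_def by (rule order.trans[OF norm_sum sum_mono]) (unfold norm_mult, intro mult_mono dn, use E1 in auto)
      then show ?thesis by simp
    qed
    have R2i: "integrable M (\<lambda>z. (norm (R z))\<^sup>2)"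
      by (rule integrable_const_bound[where B="(real L * ((2 * E) * (2 * E)))\<^sup>2"]) (use Rn in \<open>auto intro!: power_mono\<close>)
    have "(\<integral>z. g z * xi mu (insert a S) s t (pw z) \<partial>M) - (\<integral>z. g z \<partial>M) = (\<integral>z. g z * R z \<partial>M)"
    proof -
      have X0: "X 0 z = 1" "Y 0 z = 1" for z by (simp_all add: X_def Y_def u0)
      \<comment> \<open>Summation by parts for the product. In the first two sums the undifferenced
        factor is known at the start of the step, so their means vanish; the third sum is
        \<open>R\<close>.\<close>
      have tel: "X l z * Y l z = 1 + (\<Sum>i<l. X i z * dY i z) + (\<Sum>i<l. Y i z * dX i z) + (\<Sum>i<l. dX i z * dY i z)" for l z
      proof (induction l)
        case (Suc l)
        have "X (Suc l) z * Y (Suc l) z = X l z * Y l z + X l z * dY l z + Y l z * dX l z + dX l z * dY l z"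
          by (simp add: dX_def dY_def algebra_simps)
        then show ?case unfolding Suc by (simp add: algebra_simps)
      qed (simp add: X0)
      have xiXY: "xi mu (insert a S) s t (pw z) = X L z * Y L z" for z
        using a S by (simp add: xi_def X_def Y_def uL mult.commute)
      have gX: "(\<lambda>z. g z * X i z) \<in> borel_measurable (F (u i))" "(\<lambda>z. g z * Y i z) \<in> borel_measurable (F (u i))"
          "norm (g z * X i z) \<le> K * E" "norm (g z * Y i z) \<le> K * E" if i: "i < L" for i z
      proof -
        have gi: "g \<in> borel_measurable (F (u i))" using i ub[of i] ub'[of i] st by (intro F_measurable_le[OF gs]) auto
        show "(\<lambda>z. g z * X i z) \<in> borel_measurable (F (u i))" "(\<lambda>z. g z * Y i z) \<in> borel_measurable (F (u i))"
          using i by (intro borel_measurable_times gi Xa; simp)+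
        show "norm (g z * X i z) \<le> K * E" "norm (g z * Y i z) \<le> K * E"
          unfolding norm_mult using gK[of z] Xn[of i z] K0 i by (auto intro!: mult_mono)
      qed
      have i1: "integrable M (\<lambda>z. g z * X i z * dY i z)" "integrable M (\<lambda>z. g z * Y i z * dX i z)" if i: "i < L" for i
      proof -
        have "norm (g z * X i z * dY i z) \<le> (K * E) * (2 * E)" "norm (g z * Y i z * dX i z) \<le> (K * E) * (2 * E)" for z
          unfolding norm_mult[of "g z * X i z"] norm_mult[of "g z * Y i z"] using gX(3,4)[OF i] dn[OF i] K0 E1 by (auto intro!: mult_mono)
        then show "integrable M (\<lambda>z. g z * X i z * dY i z)" "integrable M (\<lambda>z. g z * Y i z * dX i z)"
          using i by (auto intro!: bounded_integrable[where K="(K * E) * (2 * E)"] borel_measurable_times gM XM dm)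
      qed
      have iR: "integrable M (\<lambda>z. g z * R z)"
        by (rule bounded_integrable[where K="K * (real L * ((2 * E) * (2 * E)))"]) (use gK Rn K0 in \<open>auto simp: norm_mult intro!: mult_mono\<close>)
      have ig: "integrable M g" by (rule bounded_integrable[OF gM gK])
      have "g z * xi mu (insert a S) s t (pw z) = g z + ((\<Sum>i<L. g z * X i z * dY i z) + ((\<Sum>i<L. g z * Y i z * dX i z) + g z * R z))" for z
        unfolding xiXY tel[of L] R_def by (simp add: distrib_left sum_distrib_left mult.assoc)
      then have "(\<integral>z. g z * xi mu (insert a S) s t (pw z) \<partial>M) = (\<integral>z. g z + ((\<Sum>i<L. g z * X i z * dY i z) + ((\<Sum>i<L. g z * Y i z * dX i z) + g z * R z)) \<partial>M)"
        by simp
      also have "\<dots> = (\<integral>z. g z \<partial>M) + ((\<integral>z. (\<Sum>i<L. g z * X i z * dY i z) \<partial>M) + ((\<integral>z. (\<Sum>i<L. g z * Y i z * dX i z) \<partial>M) + (\<integral>z. g z * R z \<partial>M)))"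
      proof -
        have "integrable M (\<lambda>z. \<Sum>i<L. g z * X i z * dY i z)" "integrable M (\<lambda>z. \<Sum>i<L. g z * Y i z * dX i z)"
          by (auto intro!: L1_sum i1)
        then show ?thesis using ig iR by (simp add: L1_add)
      qed
      also have "(\<integral>z. (\<Sum>i<L. g z * X i z * dY i z) \<partial>M) = 0"
        by (subst Bochner_Integration.integral_sum) (auto intro!: i1 sum.neutral mean0(2)[OF _ gX(1,3)])
      also have "(\<integral>z. (\<Sum>i<L. g z * Y i z * dX i z) \<partial>M) = 0"
        by (subst Bochner_Integration.integral_sum) (auto intro!: i1 sum.neutral mean0(1)[OF _ gX(2,4)])
      finally show ?thesis by simp
    qed
    also have "norm (\<integral>z. g z * R z \<partial>M) \<le> (\<integral>z. norm (g z * R z) \<partial>M)" by (rule integral_norm_bound)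
    also have "\<dots> \<le> (\<integral>z. K * (1 / sqrt (real L) + sqrt (real L) * (norm (R z))\<^sup>2) \<partial>M)"
    proof (rule integral_mono)
      have sL: "sqrt (real L) > 0" using L by simp
      fix z
      \<comment> \<open>The parameter 1 / sqrt L balances the two terms, the mean square of
        \<open>R\<close> being of order 1/L.\<close>
      have "norm (R z) \<le> 1 / sqrt (real L) + sqrt (real L) * (norm (R z))\<^sup>2"
        using abs_le_young[of "1 / sqrt (real L)" "norm (R z)"] sL by (simp add: mult.commute)
      then show "norm (g z * R z) \<le> K * (1 / sqrt (real L) + sqrt (real L) * (norm (R z))\<^sup>2)"
        unfolding norm_mult using gK[of z] K0 by (intro mult_mono) auto
    next
      show "integrable M (\<lambda>z. norm (g z * R z))"
        by (intro integrable_norm bounded_integrable[where K="K * (real L * ((2 * E) * (2 * E)))"]) (use gK Rn K0 in \<open>auto simp: norm_mult intro!: mult_mono\<close>)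
      show "integrable M (\<lambda>z. K * (1 / sqrt (real L) + sqrt (real L) * (norm (R z))\<^sup>2))" using R2i by simp
    qed
    also have "\<dots> = K * (1 / sqrt (real L) + sqrt (real L) * (\<integral>z. (norm (R z))\<^sup>2 \<partial>M))"
      using R2i by (simp add: prob_space)
    also have "\<dots> \<le> K * (1 / sqrt (real L) + sqrt (real L) * (real L * (\<alpha> * \<alpha>)))"
      using R2 K0 by (intro mult_left_mono add_left_mono) auto
    also have "\<dots> \<le> K * (1 + (E * E * C * (t - s) * E)\<^sup>2) / sqrt (real L)"
    proof -
      have \<alpha>L: "\<alpha> = (E * E * C * (t - s) * E) / real L" by (simp add: \<alpha>_def d_def)
      have r: "sqrt (real L) * (real L / (real L * real L)) = 1 / sqrt (real L)"
        using L by (simp add: real_div_sqrt field_simps)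
      have "sqrt (real L) * (real L * (\<alpha> * \<alpha>)) = (E * E * C * (t - s) * E)\<^sup>2 * (sqrt (real L) * (real L / (real L * real L)))"
        unfolding \<alpha>L power2_eq_square by simp
      then show ?thesis unfolding r by (simp add: add_divide_distrib distrib_left)
    qed
    finally show ?thesis .
  qed
  have lim: "(\<lambda>L. K * (1 + (E * E * C * (t - s) * E)\<^sup>2) / sqrt (real (Suc L))) \<longlonglongrightarrow> 0"
  proof -
    have "(\<lambda>L. 1 / sqrt (real (Suc L))) \<longlonglongrightarrow> 0"
      using tendsto_real_sqrt[OF LIMSEQ_inverse_real_of_nat] by (simp add: real_sqrt_inverse inverse_eq_divide real_sqrt_divide)
    from tendsto_mult[OF tendsto_const this, of "K * (1 + (E * E * C * (t - s) * E)\<^sup>2)"] show ?thesis by simp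
  qed
  have "norm ((\<integral>z. g z * xi mu (insert a S) s t (pw z) \<partial>M) - (\<integral>z. g z \<partial>M)) \<le> 0"
    by (rule LIMSEQ_le_const[OF lim]) (intro exI[of _ 0] allI impI bound zero_less_Suc)
  then show ?case by simp
qed

text \<open>Dividing the martingale identity by the deterministic normalizing factor inside
  \<open>xi\<close> leaves the Gaussian characteristic function.\<close>

lemma gauss_grid: "gauss_grid M F T W"
proof
  fix S :: "nat set" and j m A and mu :: "nat \<Rightarrow> real" assume S: "finite S" "S \<subseteq> {1..}" and j: "j < (2 :: nat) ^ m" and A: "A \<in> sets (F (dy T m j))"
  let ?s = "dy T m j" and ?t = "dy T m (Suc j)"
  have st: "0 \<le> ?s" "?s \<le> ?t" "?t \<le> T" using T_pos j by (auto intro!: dy_nonneg dy_mono dy_le)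
  have "(\<integral>z. indicator A z * xi mu S ?s ?t (pw z) \<partial>M) = (\<integral>z. indicator A z \<partial>M)"
    by (rule xi_mean[OF S st, where K=1]) (use A in \<open>auto simp: indicator_def\<close>)
  moreover have "indicator A z * xi mu S ?s ?t (pw z) = (cr (indicator A z) * iexp (\<Sum>n\<in>S. mu n * (W n ?t z - W n ?s z))) *
     (\<Prod>n\<in>S. cr (exp (T / 2 ^ m * (mu n)\<^sup>2 / 2)))" for z
  proof -
    have "xi mu S ?s ?t (pw z) = (\<Prod>n\<in>S. iexp (mu n * (W n ?t z - W n ?s z))) * (\<Prod>n\<in>S. cr (exp (T / 2 ^ m * (mu n)\<^sup>2 / 2)))"
      by (simp add: xi_def ee_def pw_def prod.distrib dy_Suc mult.commute)
    also have "(\<Prod>n\<in>S. iexp (mu n * (W n ?t z - W n ?s z))) = iexp (\<Sum>n\<in>S. mu n * (W n ?t z - W n ?s z))"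
      using S by (simp add: exp_sum[symmetric] sum_distrib_left)
    finally show ?thesis by (simp add: indicator_def)
  qed
  moreover have "(\<integral>z. indicator A z \<partial>M) = cr (measure M A)"
  proof -
    have "(\<integral>z. indicator A z \<partial>M) = (\<integral>z. cr (indicator A z) \<partial>M)"
      by (intro Bochner_Integration.integral_cong) (auto simp: indicator_def)
    also have "\<dots> = cr (measure M (A \<inter> space M))" by (simp only: integral_complex_of_real) simp
    also have "A \<inter> space M = A"
      using A F_sub[of ?s] st sets.sets_into_space[of A "F ?s"] by (auto simp: subalgebra_def)
    finally show ?thesis .
  qed
  ultimately have *: "(\<integral>z. cr (indicator A z) * iexp (\<Sum>n\<in>S. mu n * (W n ?t z - W n ?s z)) \<partial>M) *
     (\<Prod>n\<in>S. cr (exp (T / 2 ^ m * (mu n)\<^sup>2 / 2))) = cr (measure M A)"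
    by simp
  have "(\<Prod>n\<in>S. cr (exp (T / 2 ^ m * (mu n)\<^sup>2 / 2))) * (\<Prod>n\<in>S. cr (exp (- (T / 2 ^ m * (mu n)\<^sup>2 / 2)))) = 1"
    unfolding prod.distrib[symmetric] by (simp add: of_real_mult[symmetric] exp_add[symmetric] del: of_real_mult)
  then show "(\<integral>z. cr (indicator A z) * iexp (\<Sum>n\<in>S. mu n * (W n ?t z - W n ?s z)) \<partial>M) =
     cr (measure M A) * (\<Prod>n\<in>S. cr (exp (- (T / 2 ^ m * (mu n)\<^sup>2 / 2))))"
    unfolding *[symmetric] by (simp only: mult.assoc mult_1_right)
qed (use T_pos F_sub F_mono W_adapted in auto)

end

section \<open>The Girsanov density\<close>

text \<open>The difference is (f - g) e + g (e - e'): the first part is small in L1 because e is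
  bounded by 1, the second by domination with |g|.\<close>

lemma (in prob_space) integral_L1_bounded_limit:
  fixes f :: "nat \<Rightarrow> 'a \<Rightarrow> real" and e :: "nat \<Rightarrow> 'a \<Rightarrow> complex"
  assumes f: "\<And>k. integrable M (f k)" "integrable M g" and L1: "(\<lambda>k. \<integral>z. \<bar>f k z - g z\<bar> \<partial>M) \<longlonglongrightarrow> 0"
    and e[measurable]: "\<And>k. e k \<in> borel_measurable M" "e' \<in> borel_measurable M"
    and bd: "\<And>k z. norm (e k z) \<le> 1" "\<And>z. norm (e' z) \<le> 1" and lim: "AE z in M. (\<lambda>k. e k z) \<longlonglongrightarrow> e' z"
  shows "(\<lambda>k. \<integral>z. cr (f k z) * e k z \<partial>M) \<longlonglongrightarrow> (\<integral>z. cr (g z) * e' z \<partial>M)"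
proof -
  have [measurable]: "f k \<in> borel_measurable M" "g \<in> borel_measurable M" for k using f by auto
  have int: "integrable M (\<lambda>z. cr (h z) * d z)" if "integrable M h" "d \<in> borel_measurable M" "\<And>z. norm (d z) \<le> 1" for h d
  proof -
    have [measurable]: "h \<in> borel_measurable M" "d \<in> borel_measurable M" using that by auto
    show ?thesis
      by (rule L1_bound[OF that(1)]) (use that(3) in \<open>auto simp: norm_mult intro!: mult_left_le\<close>)
  qed
  have 1: "(\<lambda>k. \<integral>z. cr (g z) * e k z \<partial>M) \<longlonglongrightarrow> (\<integral>z. cr (g z) * e' z \<partial>M)"
  proof (rule integral_dominated_convergence[where w="\<lambda>z. \<bar>g z\<bar>"])
    show "AE z in M. (\<lambda>k. cr (g z) * e k z) \<longlonglongrightarrow> cr (g z) * e' z"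
      using lim by eventually_elim (intro tendsto_intros)
    show "AE z in M. norm (cr (g z) * e k z) \<le> \<bar>g z\<bar>" for k
      using bd(1) by (auto simp: norm_mult intro!: mult_left_le)
  qed (use f in auto)
  have 2: "(\<lambda>k. \<integral>z. cr (f k z - g z) * e k z \<partial>M) \<longlonglongrightarrow> 0"
  proof (rule Lim_null_comparison[OF _ L1], rule always_eventually, rule allI)
    fix k
    have "norm (\<integral>z. cr (f k z - g z) * e k z \<partial>M) \<le> (\<integral>z. norm (cr (f k z - g z) * e k z) \<partial>M)"
      by (rule integral_norm_bound)
    also have "\<dots> \<le> (\<integral>z. \<bar>f k z - g z\<bar> \<partial>M)"
      using f bd(1) by (intro integral_mono integrable_norm int) (auto simp: norm_mult simp del: of_real_diff intro!: mult_left_le)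
    finally show "norm (\<integral>z. cr (f k z - g z) * e k z \<partial>M) \<le> (\<integral>z. \<bar>f k z - g z\<bar> \<partial>M)" .
  qed
  have "(\<integral>z. cr (f k z - g z) * e k z \<partial>M) + (\<integral>z. cr (g z) * e k z \<partial>M) = (\<integral>z. cr (f k z) * e k z \<partial>M)" for k
    using int[OF f(1) e(1) bd(1), of k k] int[OF f(2) e(1) bd(1), of k]
    by (simp add: left_diff_distrib)
  with tendsto_add[OF 2 1] show ?thesis by simp
qed

text \<open>The exponent \<open>exp A\<close> in the hypothesis is what makes the densities uniformly integrable:
  \<open>exp (- D - A/2) = exp (- D - A) * exp (A/2)\<close>, and the first factor is bounded in \<open>L\<^sup>2\<close>.\<close>

lemma (in prob_space) stochastic_exponential_L1:
  fixes D A :: "nat \<Rightarrow> 'a \<Rightarrow> real" and D' A' B :: "'a \<Rightarrow> real"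
  assumes D[measurable]: "\<And>k. D k \<in> borel_measurable M" "D' \<in> borel_measurable M"
    and A[measurable]: "\<And>k. A k \<in> borel_measurable M" "A' \<in> borel_measurable M"
    and le: "\<And>k. AE z in M. A k z \<le> B z" and B: "integrable M (\<lambda>z. exp (B z))"
    and e2: "\<And>k. integrable M (\<lambda>z. exp (- 2 * D k z - 2 * A k z))" "\<And>k. (\<integral>z. exp (- 2 * D k z - 2 * A k z) \<partial>M) \<le> 1"
    and lim: "AE z in M. (\<lambda>k. D k z) \<longlonglongrightarrow> D' z" "AE z in M. (\<lambda>k. A k z) \<longlonglongrightarrow> A' z"
  shows "integrable M (\<lambda>z. exp (- D' z - A' z / 2))" (is ?g1) "\<And>k. integrable M (\<lambda>z. exp (- D k z - A k z / 2))"
    "(\<lambda>k. \<integral>z. \<bar>exp (- D k z - A k z / 2) - exp (- D' z - A' z / 2)\<bar> \<partial>M) \<longlonglongrightarrow> 0" (is ?g2)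
proof -
  have young: "exp (- D k z - A k z / 2) \<le> c * exp (- 2 * D k z - 2 * A k z) + exp (B z) / (4 * c)"
    if c: "c > 0" and "A k z \<le> B z" for c k z
  proof -
    \<comment> \<open>Here x^2 is the exponential at q = -2, whose mean is at most 1, and y^2 = exp
      A is dominated by exp B. The free constant c decides how the product is divided between
      them.\<close>
    define x where "x = exp (- D k z - A k z)"
    define y where "y = exp (A k z / 2)"
    have xy: "x * y = exp (- D k z - A k z / 2)" by (simp add: x_def y_def exp_add[symmetric])
    have x2: "x\<^sup>2 = exp (- 2 * D k z - 2 * A k z)" by (simp add: x_def power2_eq_square exp_add[symmetric])
    have y2: "y\<^sup>2 = exp (A k z)" by (simp add: y_def power2_eq_square exp_add[symmetric])
    have "0 \<le> (2 * c * x - y)\<^sup>2 / (4 * c)" using c by simp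
    also have "\<dots> = c * x\<^sup>2 + y\<^sup>2 / (4 * c) - x * y" using c by (simp add: power2_eq_square field_simps)
    finally have "x * y \<le> c * x\<^sup>2 + y\<^sup>2 / (4 * c)" by simp
    also have "\<dots> \<le> c * x\<^sup>2 + exp (B z) / (4 * c)" unfolding y2 using c that by (simp add: divide_right_mono)
    finally show ?thesis unfolding xy x2 .
  qed
  have [measurable]: "(\<lambda>z. exp (B z)) \<in> borel_measurable M" using B by auto
  show int: "integrable M (\<lambda>z. exp (- D k z - A k z / 2))" for k
  proof (rule L1_bound)
    show "integrable M (\<lambda>z. 1 * exp (- 2 * D k z - 2 * A k z) + exp (B z) / (4 * 1))"
      using e2(1)[of k] B by simp
    show "AE z in M. norm (exp (- D k z - A k z / 2)) \<le> norm (1 * exp (- 2 * D k z - 2 * A k z) + exp (B z) / (4 * 1))"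
      using le[of k]
    proof eventually_elim
      case (elim z)
      show ?case using young[OF zero_less_one elim] by (simp add: abs_of_nonneg add_nonneg_nonneg)
    qed
  qed measurable
  have lim': "AE z in M. (\<lambda>k. exp (- D k z - A k z / 2)) \<longlonglongrightarrow> exp (- D' z - A' z / 2)"
    using lim by eventually_elim (intro tendsto_exp tendsto_diff tendsto_minus tendsto_divide tendsto_const, simp_all)
  \<comment> \<open>Above the fixed function exp B / (4 e) at most e times the exponential at q = -2
    remains, and this has mean at most e.\<close>
  have ui: "\<exists>h. integrable M h \<and> (\<forall>z. 0 \<le> h z) \<and> (\<forall>k. (\<integral>z. max 0 (exp (- D k z - A k z / 2) - h z) \<partial>M) \<le> e)" if e: "e > 0" for e
    proof (intro exI[of _ "\<lambda>z. exp (B z) / (4 * e)"] conjI allI)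
      show "integrable M (\<lambda>z. exp (B z) / (4 * e))" using B by simp
      show "0 \<le> exp (B z) / (4 * e)" for z using e by simp
      fix k
      have "(\<integral>z. max 0 (exp (- D k z - A k z / 2) - exp (B z) / (4 * e)) \<partial>M) \<le> (\<integral>z. e * exp (- 2 * D k z - 2 * A k z) \<partial>M)"
      proof (rule integral_mono_AE)
        show "integrable M (\<lambda>z. max 0 (exp (- D k z - A k z / 2) - exp (B z) / (4 * e)))"
          using int B by (intro integrable_max L1_diff) auto
        show "integrable M (\<lambda>z. e * exp (- 2 * D k z - 2 * A k z))" using e2(1)[of k] by simp
        show "AE z in M. max 0 (exp (- D k z - A k z / 2) - exp (B z) / (4 * e)) \<le> e * exp (- 2 * D k z - 2 * A k z)"
          using le[of k]
        proof eventually_elim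
          case (elim z)
          show ?case using young[OF e elim] e by simp
        qed
      qed
      also have "\<dots> = e * (\<integral>z. exp (- 2 * D k z - 2 * A k z) \<partial>M)" by simp
      also have "\<dots> \<le> e * 1" using e e2(2)[of k] by (intro mult_left_mono) auto
      finally show "(\<integral>z. max 0 (exp (- D k z - A k z / 2) - exp (B z) / (4 * e)) \<partial>M) \<le> e" by simp
    qed
  note L1 = uniformly_integrable_L1[where f="\<lambda>k z. exp (- D k z - A k z / 2)" and g="\<lambda>z. exp (- D' z - A' z / 2)", OF int _ lim' _ _ ui]
  show ?g1 by (rule L1(1)) auto
  show ?g2
    by (rule L1(2)) auto
qed

lemma eventually_lagavg_square:
  assumes f: "continuous_on {0..T} f" and T: "T > 0" and e: "e > 0"
  shows "\<forall>\<^sub>F m in sequentially. \<forall>l. 0 < l \<longrightarrow> l \<le> 2 ^ m \<longrightarrow> \<bar>(lagavg T f m l)\<^sup>2 - (f (dy T m l))\<^sup>2\<bar> \<le> e"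
proof -
  have "compact (f ` {0..T})" by (intro compact_continuous_image f) simp
  then obtain K where K: "\<And>t. t \<in> {0..T} \<Longrightarrow> \<bar>f t\<bar> \<le> K"
    by (metis bounded_real compact_imp_bounded imageI)
  have K0: "0 \<le> K" using K[of 0] T by auto
  define \<eta> where "\<eta> = min 1 (e / (2 * K + 1))"
  have \<eta>: "\<eta> > 0" "\<eta> \<le> 1" "\<eta> * (2 * K + 1) \<le> e"
  proof -
    show "\<eta> > 0" "\<eta> \<le> 1" using e K0 by (auto simp: \<eta>_def)
    have "\<eta> * (2 * K + 1) \<le> e / (2 * K + 1) * (2 * K + 1)" using K0 by (intro mult_right_mono) (auto simp: \<eta>_def)
    then show "\<eta> * (2 * K + 1) \<le> e" using K0 by simp
  qed
  show ?thesis
    using eventually_lagavg[OF f T \<eta>(1)]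
  proof eventually_elim
    case (elim m)
    show ?case
    proof (intro allI impI)
      fix l assume l: "0 < l" "l \<le> (2::nat) ^ m"
      let ?x = "lagavg T f m l" and ?y = "f (dy T m l)"
      have y: "\<bar>?y\<bar> \<le> K" using K dy_mem[OF T l(2)] by blast
      have d: "\<bar>?x - ?y\<bar> \<le> \<eta>" using elim l by blast
      have "\<bar>?x\<^sup>2 - ?y\<^sup>2\<bar> = \<bar>?x - ?y\<bar> * \<bar>?x + ?y\<bar>"
        by (simp add: power2_eq_square square_diff_square_factored abs_mult mult.commute)
      also have "\<dots> \<le> \<eta> * (2 * K + 1)" using d y \<eta> by (intro mult_mono) auto
      finally show "\<bar>?x\<^sup>2 - ?y\<^sup>2\<bar> \<le> e" using \<eta> by linarith
    qed
  qed
qed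

text \<open>\<open>I n\<close> is the stochastic integral of \<open>th n\<close> over [0, T],
  available only as a limit in probability, and \<open>A\<close> is the total energy of all
  components. Novikov's criterion asks for exp (A/2); integrability of exp A lets uniform
  integrability be proved by elementary inequalities and leaves room to control the energies under
  the new measure.\<close>

locale girsanov = gauss_grid M F T W for M :: "'a measure" and F and T :: real and W :: "nat \<Rightarrow> real \<Rightarrow> 'a \<Rightarrow> real" +
  fixes th :: "nat \<Rightarrow> real \<Rightarrow> 'a \<Rightarrow> real" and I :: "nat \<Rightarrow> 'a \<Rightarrow> real" and A :: "'a \<Rightarrow> real"
  assumes th_cont: "\<And>n z. n \<ge> 1 \<Longrightarrow> z \<in> space M \<Longrightarrow> continuous_on {0..T} (\<lambda>t. th n t z)"
    and th_adapted: "\<And>n t. n \<ge> 1 \<Longrightarrow> t \<in> {0..T} \<Longrightarrow> th n t \<in> borel_measurable (F t)"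
    and I_conv: "\<And>n. n \<ge> 1 \<Longrightarrow> conv_prob M (\<lambda>m z. \<Sum>j<2 ^ m. th n (dy T m j) z * dB m j n z) (I n)"
    and A_sums: "AE z in M. (\<lambda>n. integral {0..T} (\<lambda>t. (th (Suc n) t z)\<^sup>2)) sums A z"
    and A_meas[measurable]: "A \<in> borel_measurable M"
    and exp_A: "integrable M (\<lambda>z. exp (A z))"
begin

definition V :: "nat \<Rightarrow> 'a \<Rightarrow> real" where "V n z = integral {0..T} (\<lambda>t. (th n t z)\<^sup>2)"
definition bar :: "nat \<Rightarrow> nat \<Rightarrow> nat \<Rightarrow> 'a \<Rightarrow> real" where "bar m j n z = lagavg T (\<lambda>t. th n t z) m j"

lemma integral_th_adapted:
  assumes "n \<ge> 1" "0 \<le> a" "b \<le> T" "b \<le> c" "c \<le> T"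
  shows "(\<lambda>z. integral {a..b} (\<lambda>t. th n t z)) \<in> borel_measurable (F c)"
proof (cases "a \<le> b")
  case True
  show ?thesis
  proof (rule measurable_integral_continuous)
    fix z assume "z \<in> space (F c)"
    then have "z \<in> space M" using space_F[of c] assms True by auto
    then show "continuous_on {a..b} (\<lambda>t. th n t z)"
      using assms by (intro continuous_on_subset[OF th_cont]) auto
  next
    fix u assume u: "u \<in> {a..b}"
    show "th n u \<in> borel_measurable (F c)"
      by (rule F_measurable_le[OF th_adapted]) (use assms u in auto)
  qed
qed simp

lemma bar_adapted:
  assumes "n \<ge> 1" "j \<le> 2 ^ m"
  shows "bar m j n \<in> borel_measurable (F (dy T m j))"
  unfolding bar_def[abs_def] lagavg_def using assms T_pos
  by (intro borel_measurable_times borel_measurable_const integral_th_adapted) (auto intro: dy_nonneg dy_le dy_mono)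

lemma V_measurable [measurable]: "n \<ge> 1 \<Longrightarrow> V n \<in> borel_measurable M"
  unfolding V_def[abs_def]
proof (rule measurable_integral_continuous)
  assume n: "n \<ge> 1"
  show "continuous_on {0..T} (\<lambda>u. (th n u z)\<^sup>2)" if "z \<in> space M" for z
    by (intro continuous_intros th_cont n that)
  show "(\<lambda>z. (th n u z)\<^sup>2) \<in> borel_measurable M" if "u \<in> {0..T}" for u
    by (intro borel_measurable_power F_measurable_M[OF th_adapted] n that)
qed

lemma V_nonneg: "n \<ge> 1 \<Longrightarrow> z \<in> space M \<Longrightarrow> 0 \<le> V n z"
  unfolding V_def
  by (intro Henstock_Kurzweil_Integration.integral_nonneg integrable_continuous_real continuous_intros th_cont) auto

lemma A_sums_V: "AE z in M. (\<lambda>n. V (Suc n) z) sums A z"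
  using A_sums by (simp add: V_def)

lemma sum_V_le_A:
  assumes "finite S" "S \<subseteq> {1..}"
  shows "AE z in M. (\<Sum>n\<in>S. V n z) \<le> A z"
  using A_sums_V AE_space
proof eventually_elim
  case (elim z)
  obtain N where N: "S \<subseteq> {..N}" using assms(1) finite_nat_iff_bounded_le by auto
  have "(\<Sum>n\<in>S. V n z) \<le> (\<Sum>n\<in>Suc ` {..<N}. V n z)"
  proof (rule sum_mono2)
    show "S \<subseteq> Suc ` {..<N}"
    proof
      fix n assume "n \<in> S"
      then have "n \<le> N" "1 \<le> n" using N assms by auto
      then have "n = Suc (n - 1)" "n - 1 < N" by auto
      then show "n \<in> Suc ` {..<N}" by blast
    qed
  qed (use elim V_nonneg in auto)
  also have "\<dots> = (\<Sum>n<N. V (Suc n) z)" by (simp add: sum.reindex)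
  also have "\<dots> \<le> A z"
    by (rule sum_le_suminf[OF sums_summable[OF elim(1)], of "{..<N}", simplified, folded sums_unique[OF elim(1)], THEN order.trans]) (use elim V_nonneg sums_unique[OF elim(1)] in auto)
  finally show ?case .
qed

lemma A_nonneg: "AE z in M. 0 \<le> A z"
  using sum_V_le_A[of "{}"] by simp

lemma V_le_A: "n \<ge> 1 \<Longrightarrow> AE z in M. V n z \<le> A z"
  using sum_V_le_A[of "{n}"] by simp

lemma integrable_A: "integrable M A"
proof (rule L1_bound[OF exp_A])
  show "AE z in M. norm (A z) \<le> norm (exp (A z))"
    using A_nonneg
  proof eventually_elim
    case (elim z)
    have "1 + A z \<le> exp (A z)" by (rule exp_ge_add_one_self)
    with elim have "A z \<le> exp (A z)" by linarith
    with elim show ?case by simp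
  qed
qed simp

lemma sum_V_integrable: "finite S \<Longrightarrow> S \<subseteq> {1..} \<Longrightarrow> integrable M (\<lambda>z. \<Sum>n\<in>S. V n z)"
proof (rule L1_bound[OF integrable_A])
  assume S: "finite S" "S \<subseteq> {1..}"
  then show "(\<lambda>z. \<Sum>n\<in>S. V n z) \<in> borel_measurable M" by (intro borel_measurable_sum V_measurable) auto
  show "AE z in M. norm (\<Sum>n\<in>S. V n z) \<le> norm (A z)"
    using sum_V_le_A[OF S] AE_space
  proof eventually_elim
    case (elim z)
    have "0 \<le> (\<Sum>n\<in>S. V n z)" using S elim by (intro sum_nonneg V_nonneg) auto
    with elim show ?case by simp
  qed
qed

lemma bar_measurable: "n \<ge> 1 \<Longrightarrow> j \<le> 2 ^ m \<Longrightarrow> bar m j n \<in> borel_measurable M"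
  by (rule F_dy_M[OF bar_adapted])

text \<open>Lagged averages and left-end values differ by an adapted integrand whose bracket tends
  to 0 on every path, so by \<open>conv_prob_bracket\<close> both give the same integral.\<close>

lemma bar_conv:
  assumes n: "n \<ge> 1"
  shows "conv_prob M (\<lambda>m z. \<Sum>j<2 ^ m. bar m j n z * dB m j n z) (I n)"
proof -
  have S: "finite {n}" "{n} \<subseteq> {1..}" using n by auto
  define U where "U m j k z = bar m j n z - th n (dy T m j) z" for m j and k :: nat and z
  have Ua: "U m j k \<in> borel_measurable (F (dy T m j))" if "j < 2 ^ m" for m j k
    unfolding U_def[abs_def] using that n by (intro borel_measurable_diff bar_adapted th_adapted dy_mem T_pos) auto
  have UM: "U m j k \<in> borel_measurable M" if "j < 2 ^ m" for m j k using F_dy_M[OF Ua[OF that]] that by simp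
  define D where "D m z = (\<Sum>j=0..<2 ^ m. \<Sum>k\<in>{n}. U m j k z * dB m j k z)" for m z
  define Q where "Q m z = (\<Sum>j=0..<2 ^ m. \<Sum>k\<in>{n}. (U m j k z)\<^sup>2 * dt m)" for m z
  have Dm: "D m \<in> borel_measurable M" for m
    unfolding D_def[abs_def] using n by (intro borel_measurable_sum borel_measurable_times UM dB_measurable) auto
  have Qm: "Q m \<in> borel_measurable M" for m
    unfolding Q_def[abs_def] by (intro borel_measurable_sum borel_measurable_times borel_measurable_power borel_measurable_const UM) auto
  have "conv_prob M D (\<lambda>_. 0)"
  proof (rule conv_prob_bracket[where A=Q, OF Dm])
    show "integrable M (\<lambda>z. exp (q * D m z - q\<^sup>2 * Q m z / 2))" "(\<integral>z. exp (q * D m z - q\<^sup>2 * Q m z / 2) \<partial>M) \<le> 1" for q m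
      unfolding D_def Q_def using exp_mart[OF S le0 order.refl, of m "U m" q] Ua by simp_all
    show "conv_prob M Q (\<lambda>_. 0)"
    proof (rule AE_imp_conv_prob[OF Qm])
      show "AE z in M. (\<lambda>m. Q m z) \<longlonglongrightarrow> 0"
      proof (rule AE_I2)
        fix z assume w: "z \<in> space M"
        \<comment> \<open>At l = 0 the lagged average is 0, so the difference there is minus the
          initial value of \<open>th n\<close>: bounded but not small. This is the exceptional cell
          allowed by \<open>riemann_limit\<close>.\<close>
        have "(\<lambda>m. \<Sum>l<1 * 2 ^ m. (U m l n z)\<^sup>2 * (T / 2 ^ (0 + m))) \<longlonglongrightarrow> integral {0..dy T 0 1} (\<lambda>_. 0)"
        proof (rule riemann_limit[OF continuous_on_const T_pos, where K="(th n 0 z)\<^sup>2"])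
          fix e :: real assume e: "e > 0"
          then have "sqrt e > 0" by simp
          from eventually_lagavg[OF th_cont[OF n w] T_pos this]
          show "\<forall>\<^sub>F m in sequentially. \<forall>l. 0 < l \<longrightarrow> l < 1 * 2 ^ m \<longrightarrow> \<bar>(U m l n z)\<^sup>2 - 0\<bar> \<le> e"
          proof eventually_elim
            case (elim m)
            show ?case
            proof (intro allI impI)
              fix l :: nat assume "0 < l" "l < 1 * 2 ^ m"
              then have "\<bar>U m l n z\<bar> \<le> sqrt e" using elim by (auto simp: U_def bar_def)
              then have "\<bar>U m l n z\<bar>\<^sup>2 \<le> (sqrt e)\<^sup>2" by (intro power_mono) auto
              then show "\<bar>(U m l n z)\<^sup>2 - 0\<bar> \<le> e" using e by simp
            qed
          qed
        qed (auto simp: U_def bar_def)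
        then show "(\<lambda>m. Q m z) \<longlonglongrightarrow> 0" by (simp add: Q_def atLeast0LessThan)
      qed
    qed auto
  qed
  from conv_prob_add[OF I_conv[OF n] this]
  have "conv_prob M (\<lambda>m z. (\<Sum>j<2 ^ m. th n (dy T m j) z * dB m j n z) + D m z) (I n)"
    by (simp only: add_0_right)
  also have "(\<lambda>m z. (\<Sum>j<2 ^ m. th n (dy T m j) z * dB m j n z) + D m z) = (\<lambda>m z. \<Sum>j<2 ^ m. bar m j n z * dB m j n z)"
    by (intro ext) (simp add: D_def U_def atLeast0LessThan sum.distrib[symmetric] algebra_simps)
  finally show ?thesis .
qed

text \<open>Both this sum and its bracket \<open>Am\<close> use lagged averages, so that the bracket
  stays below the true energies.\<close>

definition Dm :: "nat set \<Rightarrow> nat \<Rightarrow> 'a \<Rightarrow> real" where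
  "Dm S m z = (\<Sum>j=0..<2 ^ m. \<Sum>n\<in>S. bar m j n z * dB m j n z)"
definition Am :: "nat set \<Rightarrow> nat \<Rightarrow> 'a \<Rightarrow> real" where
  "Am S m z = (\<Sum>j=0..<2 ^ m. \<Sum>n\<in>S. (bar m j n z)\<^sup>2 * dt m)"

lemma Dm_conv:
  assumes "finite S" "S \<subseteq> {1..}"
  shows "conv_prob M (Dm S) (\<lambda>z. \<Sum>n\<in>S. I n z)"
proof -
  have "conv_prob M (\<lambda>m z. \<Sum>n\<in>S. \<Sum>j<2 ^ m. bar m j n z * dB m j n z) (\<lambda>z. \<Sum>n\<in>S. I n z)"
    by (rule conv_prob_sum) (use assms in \<open>auto intro!: bar_conv\<close>)
  also have "(\<lambda>m z. \<Sum>n\<in>S. \<Sum>j<2 ^ m. bar m j n z * dB m j n z) = Dm S"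
    unfolding Dm_def[abs_def] atLeast0LessThan by (subst sum.swap) simp
  finally show ?thesis .
qed

lemma Am_lim:
  assumes S: "finite S" "S \<subseteq> {1..}" and w: "z \<in> space M"
  shows "(\<lambda>m. Am S m z) \<longlonglongrightarrow> (\<Sum>n\<in>S. V n z)"
proof -
  have "(\<lambda>m. \<Sum>n\<in>S. \<Sum>j<2 ^ m. (bar m j n z)\<^sup>2 * dt m) \<longlonglongrightarrow> (\<Sum>n\<in>S. V n z)"
  proof (rule tendsto_sum)
    fix n assume "n \<in> S"
    then have n: "n \<ge> 1" using S by auto
    have c: "continuous_on {0..T} (\<lambda>t. th n t z)" by (rule th_cont[OF n w])
    have "(\<lambda>m. \<Sum>l<1 * 2 ^ m. (bar m l n z)\<^sup>2 * (T / 2 ^ (0 + m))) \<longlonglongrightarrow> integral {0..dy T 0 1} (\<lambda>t. (th n t z)\<^sup>2)"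
    proof (rule riemann_limit[OF _ T_pos, where K=0])
      show "continuous_on {0..T} (\<lambda>t. (th n t z)\<^sup>2)" by (intro continuous_intros c)
      fix e :: real assume e: "e > 0"
      from eventually_lagavg_square[OF c T_pos this]
      show "\<forall>\<^sub>F m in sequentially. \<forall>l. 0 < l \<longrightarrow> l < 1 * 2 ^ m \<longrightarrow> \<bar>(bar m l n z)\<^sup>2 - (th n (dy T (0 + m) l) z)\<^sup>2\<bar> \<le> e"
        by eventually_elim (auto simp: bar_def)
    qed (auto simp: bar_def)
    then show "(\<lambda>m. \<Sum>j<2 ^ m. (bar m j n z)\<^sup>2 * dt m) \<longlonglongrightarrow> V n z"
      by (simp add: V_def dy_def)
  qed
  also have "(\<lambda>m. \<Sum>n\<in>S. \<Sum>j<2 ^ m. (bar m j n z)\<^sup>2 * dt m) = (\<lambda>m. Am S m z)"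
    unfolding Am_def atLeast0LessThan by (subst sum.swap) simp
  finally show ?thesis .
qed

lemma Am_le:
  assumes S: "finite S" "S \<subseteq> {1..}" and w: "z \<in> space M"
  shows "Am S m z \<le> (\<Sum>n\<in>S. V n z)"
proof -
  have "Am S m z = (\<Sum>n\<in>S. \<Sum>j<2 ^ m. (bar m j n z)\<^sup>2 * dt m)"
    unfolding Am_def atLeast0LessThan by (rule sum.swap)
  also have "\<dots> \<le> (\<Sum>n\<in>S. V n z)"
    unfolding V_def bar_def using S w by (intro sum_mono sum_lagavg_square_le th_cont T_pos) auto
  finally show ?thesis .
qed

lemma Dm_measurable: "finite S \<Longrightarrow> S \<subseteq> {1..} \<Longrightarrow> Dm S m \<in> borel_measurable M"
  unfolding Dm_def[abs_def] by (intro borel_measurable_sum borel_measurable_times bar_measurable dB_measurable) auto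

lemma Am_measurable: "finite S \<Longrightarrow> S \<subseteq> {1..} \<Longrightarrow> Am S m \<in> borel_measurable M"
  unfolding Am_def[abs_def] by (intro borel_measurable_sum borel_measurable_times borel_measurable_power borel_measurable_const bar_measurable) auto

lemma exp_Dm:
  assumes S: "finite S" "S \<subseteq> {1..}"
  shows "integrable M (\<lambda>z. exp (q * Dm S m z - q\<^sup>2 * Am S m z / 2))" (is ?g1) "(\<integral>z. exp (q * Dm S m z - q\<^sup>2 * Am S m z / 2) \<partial>M) = 1" (is ?g2)
proof -
  have ad: "bar m j n \<in> borel_measurable (F (dy T m j))" if "j < 2 ^ m" "n \<in> S" for j n
    using that S by (intro bar_adapted) auto
  show ?g1 ?g2
    unfolding Dm_def Am_def by (rule exp_mart[OF S le0 order.refl ad]; assumption)+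
qed

definition IS :: "nat set \<Rightarrow> 'a \<Rightarrow> real" where "IS S z = (\<Sum>n\<in>S. I n z)"
definition VS :: "nat set \<Rightarrow> 'a \<Rightarrow> real" where "VS S z = (\<Sum>n\<in>S. V n z)"

lemma IS_measurable: "finite S \<Longrightarrow> S \<subseteq> {1..} \<Longrightarrow> IS S \<in> borel_measurable M"
  using conv_prob_measurable(2)[OF Dm_conv] by (simp add: IS_def[abs_def])

lemma VS_measurable: "finite S \<Longrightarrow> S \<subseteq> {1..} \<Longrightarrow> VS S \<in> borel_measurable M"
  using sum_V_integrable by (auto simp: VS_def[abs_def])

lemma exp_IS:
  assumes S: "finite S" "S \<subseteq> {1..}"
  shows "integrable M (\<lambda>z. exp (q * IS S z - q\<^sup>2 * VS S z / 2))" "(\<integral>z. exp (q * IS S z - q\<^sup>2 * VS S z / 2) \<partial>M) \<le> 1"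
  using exp_supermartingale_limit[where D="Dm S" and A="Am S" and D'="IS S" and A'="VS S" and q=q]
    exp_Dm[OF S] Dm_conv[OF S] Am_lim[OF S] VS_measurable[OF S] by (auto simp: IS_def[abs_def] VS_def[abs_def])

lemma IS_second_moment:
  assumes S: "finite S" "S \<subseteq> {1..}"
  shows "integrable M (\<lambda>z. (IS S z)\<^sup>2)" "(\<integral>z. (IS S z)\<^sup>2 \<partial>M) \<le> 2 * (\<integral>z. VS S z \<partial>M)" (is ?g1)
proof -
  have "integrable M (VS S)" using sum_V_integrable[OF S] by (simp add: VS_def[abs_def])
  note * = second_moment_le[OF IS_measurable[OF S] this exp_IS[OF S]]
  show "integrable M (\<lambda>z. (IS S z)\<^sup>2)" ?g1
    by (rule *)+
qed

lemma VS_limit: "AE z in M. (\<lambda>N. VS {1..N} z) \<longlonglongrightarrow> A z"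
  using A_sums_V
  proof eventually_elim
    case (elim z)
    have "(\<lambda>N. \<Sum>n<N. V (Suc n) z) = (\<lambda>N. VS {1..N} z)"
      by (simp add: VS_def sum.atLeast1_atMost_eq)
    then show ?case using elim by (simp add: sums_def)
  qed

text \<open>Second moments of blocks of components are bounded by tails of the total energy, which
  makes the partial sums Cauchy in L1. Almost everywhere convergence along a subsequence serves the
  limit of densities; convergence of the full sequence in probability is kept because the
  subsequence may differ between two solutions while their approximations must match.\<close>

lemma IS_limit:
  obtains r :: "nat \<Rightarrow> nat" and Y where "strict_mono r" "Y \<in> borel_measurable M" "AE z in M. (\<lambda>k. IS {1..r k} z) \<longlonglongrightarrow> Y z"
    "conv_prob M (\<lambda>N. IS {1..N}) Y"
proof -
  have fs: "finite {1..N}" "{1..N} \<subseteq> {1::nat..}" for N by auto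
  define a where "a N = (\<integral>z. A z - VS {1..N} z \<partial>M)" for N
  have VSint: "integrable M (VS S)" if "finite S" "S \<subseteq> {1..}" for S
    using sum_V_integrable[OF that] by (simp add: VS_def[abs_def])
  note VSlim = VS_limit
  have alim: "a \<longlonglongrightarrow> 0"
  proof -
    have "a \<longlonglongrightarrow> (\<integral>z. 0 \<partial>M)"
      unfolding a_def
    proof (rule integral_dominated_convergence[where w="A"])
      show "AE z in M. (\<lambda>N. A z - VS {1..N} z) \<longlonglongrightarrow> 0"
        using VSlim
      proof eventually_elim
        case (elim z)
        have "(\<lambda>N. A z - VS {1..N} z) \<longlonglongrightarrow> A z - A z" by (intro tendsto_intros elim)
        then show ?case by simp
      qed
      show "AE z in M. norm (A z - VS {1..N} z) \<le> A z" for N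
        using sum_V_le_A[OF fs, of N] AE_space
      proof eventually_elim
        case (elim z)
        have "0 \<le> VS {1..N} z" unfolding VS_def using elim by (intro sum_nonneg V_nonneg) auto
        then show ?case using elim by (simp add: VS_def)
      qed
    qed (use integrable_A VS_measurable[OF fs] in auto)
    then show ?thesis by simp
  qed
  have ISint: "integrable M (IS S)" if "finite S" "S \<subseteq> {1..}" for S
    by (rule square_integrable_imp_integrable[OF IS_measurable[OF that] IS_second_moment(1)[OF that]])
  \<comment> \<open>The two sums differ by the components in {j<..i}, whose second moment is at most
    twice their mean energy, hence at most 2 \<open>a j\<close>.\<close>
  have diff: "(\<integral>z. norm (IS {1..i} z - IS {1..j} z) \<partial>M) \<le> e + 2 * a j / e" if "j \<le> i" and e: "e > 0" for i j e
  proof -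
    let ?S = "{j<..i}"
    have S: "finite ?S" "?S \<subseteq> {1..}" by auto
    have un: "{1..i} = {1..j} \<union> ?S" "{1..j} \<inter> ?S = {}" using that by auto
    have d: "IS {1..i} z - IS {1..j} z = IS ?S z" "VS {1..i} z - VS {1..j} z = VS ?S z" for z
    proof -
      have "sum f {1..i} = sum f {1..j} + sum f ?S" for f :: "nat \<Rightarrow> real"
        unfolding un(1) by (rule sum.union_disjoint) (use un(2) in auto)
      then show "IS {1..i} z - IS {1..j} z = IS ?S z" "VS {1..i} z - VS {1..j} z = VS ?S z"
        by (simp_all add: IS_def VS_def)
    qed
    have "(\<integral>z. norm (IS {1..i} z - IS {1..j} z) \<partial>M) \<le> (\<integral>z. e + (IS ?S z)\<^sup>2 / e \<partial>M)"
      unfolding d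
    proof (rule integral_mono)
      show "integrable M (\<lambda>z. norm (IS ?S z))" using ISint[OF S] by simp
      show "integrable M (\<lambda>z. e + (IS ?S z)\<^sup>2 / e)" using IS_second_moment(1)[OF S] by simp
      fix z
      show "norm (IS ?S z) \<le> e + (IS ?S z)\<^sup>2 / e" unfolding real_norm_def by (rule abs_le_young[OF e])
    qed
    also have "\<dots> = e + (\<integral>z. (IS ?S z)\<^sup>2 \<partial>M) / e" using IS_second_moment(1)[OF S] by (simp add: prob_space)
    also have "\<dots> \<le> e + 2 * (\<integral>z. VS ?S z \<partial>M) / e"
      using IS_second_moment(2)[OF S] e by (simp add: divide_right_mono)
    also have "\<dots> \<le> e + 2 * a j / e"
    proof -
      have "(\<integral>z. VS ?S z \<partial>M) \<le> a j"
        unfolding a_def d(2)[symmetric]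
      proof (intro integral_mono_AE L1_diff integrable_A VSint[OF fs])
        show "AE z in M. VS {1..i} z - VS {1..j} z \<le> A z - VS {1..j} z"
          using sum_V_le_A[OF fs, of i] by eventually_elim (simp add: VS_def)
      qed
      then show ?thesis using e by (simp add: divide_right_mono)
    qed
    finally show ?thesis .
  qed
  obtain r where r: "strict_mono r" "AE z in M. Cauchy (\<lambda>k. IS {1..r k} z)"
  proof (rule cauchy_L1_AE_cauchy_subseq[of M "\<lambda>N. IS {1..N}"])
    show "integrable M (IS {1..N})" for N by (rule ISint[OF fs])
    fix e :: real assume e: "e > 0"
    then have "\<forall>\<^sub>F N in sequentially. a N < e * e / 16" by (intro order_tendstoD(2)[OF alim]) auto
    then obtain N where N: "\<And>n. n \<ge> N \<Longrightarrow> a n < e * e / 16" by (auto simp: eventually_sequentially)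
    have *: "(\<integral>z. norm (IS {1..i} z - IS {1..j} z) \<partial>M) < e" if "N \<le> j" "j \<le> i" for i j
    proof -
      have "2 * a j / (e / 4) < e / 2" using N[OF that(1)] e by (simp add: field_simps)
      then show ?thesis using diff[OF that(2), of "e / 4"] e by simp
    qed
    show "\<exists>N. \<forall>i\<ge>N. \<forall>j\<ge>N. (\<integral>z. norm (IS {1..i} z - IS {1..j} z) \<partial>M) < e"
    proof (intro exI[of _ N] allI impI)
      fix i j assume ij: "N \<le> i" "N \<le> j"
      show "(\<integral>z. norm (IS {1..i} z - IS {1..j} z) \<partial>M) < e"
        using *[of j i] *[of i j] ij by (cases "j \<le> i") (auto simp: abs_minus_commute)
    qed
  qed auto
  define Y where "Y z = lim (\<lambda>k. IS {1..r k} z)" for z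
  have Ym: "Y \<in> borel_measurable M"
    unfolding Y_def[abs_def] by (rule borel_measurable_lim_metric) (rule IS_measurable[OF fs])
  have Ylim: "AE z in M. (\<lambda>k. IS {1..r k} z) \<longlonglongrightarrow> Y z"
    using r(2) by eventually_elim (simp add: Y_def Cauchy_convergent_iff convergent_LIMSEQ_iff)
  \<comment> \<open>Fatou along the subsequence carries the Cauchy estimate over to the limit and so
    yields L1 convergence of the full sequence.\<close>
  have Y1: "integrable M (\<lambda>z. norm (Y z - IS {1..N} z))" "e > 0 \<Longrightarrow> (\<integral>z. norm (Y z - IS {1..N} z) \<partial>M) \<le> e + 2 * a N / e" for N e
  proof -
    let ?f = "\<lambda>k z. norm (IS {1..r (k + N)} z - IS {1..N} z)"
    have i: "integrable M (?f k)" for k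
      by (intro Bochner_Integration.integrable_norm L1_diff ISint[OF fs])
    have le: "N \<le> r (k + N)" for k using seq_suble[OF r(1), of "k + N"] by simp
    have l: "AE z in M. (\<lambda>k. ?f k z) \<longlonglongrightarrow> norm (Y z - IS {1..N} z)"
      using Ylim
    proof eventually_elim
      case (elim z)
      show ?case by (intro tendsto_norm tendsto_diff tendsto_const LIMSEQ_ignore_initial_segment[OF elim])
    qed
    have m: "(\<lambda>z. norm (Y z - IS {1..N} z)) \<in> borel_measurable M"
      using Ym IS_measurable[OF fs, of N] by measurable
    note F = integral_Fatou_le[where f="?f", OF i _ diff[OF le] tendsto_const l m]
    show "integrable M (\<lambda>z. norm (Y z - IS {1..N} z))" by (rule F(1)[of 1]) auto
    show "e > 0 \<Longrightarrow> (\<integral>z. norm (Y z - IS {1..N} z) \<partial>M) \<le> e + 2 * a N / e" by (rule F(2)) auto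
  qed
  have "(\<lambda>N. \<integral>z. norm (Y z - IS {1..N} z) \<partial>M) \<longlonglongrightarrow> 0"
  proof (rule tendstoI)
    fix e :: real assume e: "e > 0"
    then have "\<forall>\<^sub>F N in sequentially. a N < e * e / 8" by (intro order_tendstoD(2)[OF alim]) auto
    then show "\<forall>\<^sub>F N in sequentially. dist (\<integral>z. norm (Y z - IS {1..N} z) \<partial>M) 0 < e"
    proof eventually_elim
      case (elim N)
      have "2 * a N / (e / 2) < e / 2" using elim e by (simp add: field_simps)
      moreover have "0 \<le> (\<integral>z. norm (Y z - IS {1..N} z) \<partial>M)" by simp
      ultimately show ?case using Y1(2)[of "e / 2" N] e by (simp add: dist_real_def)
    qed
  qed
  then have "conv_prob M (\<lambda>N. IS {1..N}) Y"
    by (rule conv_prob_leI[OF IS_measurable[OF fs] Ym _ Y1(1)]) (simp add: abs_minus_commute)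
  then show ?thesis using r(1) Ym Ylim that by blast
qed

end

lemma (in prob_space) integral_L1_limit:
  fixes f :: "nat \<Rightarrow> 'a \<Rightarrow> real"
  assumes f: "\<And>k. integrable M (f k)" "integrable M g" and L1: "(\<lambda>k. \<integral>z. \<bar>f k z - g z\<bar> \<partial>M) \<longlonglongrightarrow> 0"
  shows "(\<lambda>k. \<integral>z. f k z \<partial>M) \<longlonglongrightarrow> (\<integral>z. g z \<partial>M)"
proof (rule LIM_zero_cancel, rule Lim_null_comparison[OF _ L1], rule always_eventually, rule allI)
  fix k
  show "norm ((\<integral>z. f k z \<partial>M) - (\<integral>z. g z \<partial>M)) \<le> (\<integral>z. \<bar>f k z - g z\<bar> \<partial>M)"
    using integral_norm_bound[of M "\<lambda>z. f k z - g z"] f by simp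
qed

section \<open>From discrete densities to the Girsanov measure\<close>

context girsanov
begin

definition Bq :: "nat \<Rightarrow> real \<Rightarrow> 'a \<Rightarrow> real" where
  "Bq n t z = W n t z + integral {0..t} (\<lambda>u. th n u z)"

definition ZN :: "nat set \<Rightarrow> 'a \<Rightarrow> real" where
  "ZN S z = exp (- IS S z - VS S z / 2)"

text \<open>Collecting exponents: the density factors of all cells combine to the full discrete
  density, while characters occur only from cell \<open>a\<close> on.\<close>

lemma gkernel_product:
  fixes l :: "nat \<Rightarrow> nat \<Rightarrow> real"
  assumes S: "finite S" and a: "a \<le> 2 ^ L"
  shows "(\<Prod>i=0..<a. \<Prod>n\<in>S. gkernel (dt L) (bar L i n z) 0 (dB L i n z)) * (\<Prod>i=a..<2 ^ L. \<Prod>n\<in>S. gkernel (dt L) (bar L i n z) (l i n) (dB L i n z))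
    = cr (exp (- Dm S L z - Am S L z / 2)) * iexp (\<Sum>i=a..<2 ^ L. \<Sum>n\<in>S. l i n * (dB L i n z + bar L i n z * dt L))"
proof -
  let ?r = "\<lambda>i n. exp (- (bar L i n z * dB L i n z) - (bar L i n z)\<^sup>2 * dt L / 2)"
  let ?s = "\<lambda>i n. iexp (l i n * (dB L i n z + bar L i n z * dt L))"
  have 1: "(\<Prod>i=0..<a. \<Prod>n\<in>S. gkernel (dt L) (bar L i n z) 0 (dB L i n z)) = (\<Prod>i=0..<a. \<Prod>n\<in>S. cr (?r i n))"
    by (simp add: gkernel_def)
  have 2: "(\<Prod>i=a..<2 ^ L. \<Prod>n\<in>S. gkernel (dt L) (bar L i n z) (l i n) (dB L i n z)) =
      (\<Prod>i=a..<2 ^ L. \<Prod>n\<in>S. cr (?r i n)) * (\<Prod>i=a..<2 ^ L. \<Prod>n\<in>S. ?s i n)"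
    by (simp only: gkernel_def prod.distrib)
  have 3: "(\<Prod>i=a..<2 ^ L. \<Prod>n\<in>S. ?s i n) = iexp (\<Sum>i=a..<2 ^ L. \<Sum>n\<in>S. l i n * (dB L i n z + bar L i n z * dt L))"
    using S by (simp only: exp_sum[symmetric] finite_atLeastLessThan of_real_sum sum_distrib_left)
  have 4: "(\<Prod>i=0..<a. \<Prod>n\<in>S. cr (?r i n)) * (\<Prod>i=a..<2 ^ L. \<Prod>n\<in>S. cr (?r i n)) = (\<Prod>i=0..<2 ^ L. \<Prod>n\<in>S. cr (?r i n))"
    using a by (rule prod.atLeastLessThan_concat[OF le0])
  have 5: "(\<Prod>i=0..<2 ^ L. \<Prod>n\<in>S. cr (?r i n)) = cr (exp (- Dm S L z - Am S L z / 2))"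
  proof -
    have "(\<Prod>i=0..<2 ^ L. \<Prod>n\<in>S. ?r i n) = exp (\<Sum>i=0..<2 ^ L. \<Sum>n\<in>S. - (bar L i n z * dB L i n z) - (bar L i n z)\<^sup>2 * dt L / 2)"
      using S by (simp only: exp_sum[symmetric] finite_atLeastLessThan)
    also have "(\<Sum>i=0..<2 ^ L. \<Sum>n\<in>S. - (bar L i n z * dB L i n z) - (bar L i n z)\<^sup>2 * dt L / 2) = - Dm S L z - Am S L z / 2"
      by (simp only: Dm_def Am_def sum_subtractf sum_negf sum_divide_distrib)
    finally show ?thesis by (simp only: of_real_prod[symmetric])
  qed
  show ?thesis unfolding 1 2 3 mult.assoc[symmetric] 4 5 ..
qed

text \<open>An exact identity on each grid, before any limit. The density of the cells before
  \<open>a\<close> joins the past event in the weight \<open>G\<close>; the cells of the coarse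
  interval carry the character; the later cells carry density only and integrate to 1.\<close>

lemma discrete_char:
  assumes S: "finite S" "S \<subseteq> {1..}" and j: "j < 2 ^ b" and A: "A' \<in> sets (F (dy T b j))"
  shows "(\<integral>z. cr (exp (- Dm S (b + m) z - Am S (b + m) z / 2)) * (cr (indicator A' z) *
       iexp (\<Sum>n\<in>S. mu n * (W n (dy T b (Suc j)) z - W n (dy T b j) z + (\<Sum>i=j * 2 ^ m..<Suc j * 2 ^ m. bar (b + m) i n z * dt (b + m))))) \<partial>M)
    = (\<integral>z. cr (exp (- Dm S (b + m) z - Am S (b + m) z / 2)) * cr (indicator A' z) \<partial>M) *
      (\<Prod>n\<in>S. cr (exp (- (dt b * (mu n)\<^sup>2 / 2))))"
proof -
  define L where "L = b + m"
  define a where "a = j * 2 ^ m"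
  define c where "c = Suc j * 2 ^ m"
  have cL: "c \<le> 2 ^ L"
  proof -
    have "Suc j * 2 ^ m \<le> 2 ^ b * 2 ^ m" using j by (intro mult_le_mono1) simp
    then show ?thesis by (simp only: c_def L_def power_add)
  qed
  have ac: "a \<le> c" by (simp add: a_def c_def)
  have aL: "a \<le> 2 ^ L" using ac cL by simp
  have ta: "dy T L a = dy T b j" "dy T L c = dy T b (Suc j)"
    by (simp_all only: L_def a_def c_def dy_refine)
  have ad: "bar L i n \<in> borel_measurable (F (dy T L i))" if "i < 2 ^ L" "n \<in> S" for i n
    using that S by (intro bar_adapted) auto
  define K0 where "K0 z = (\<Prod>i=0..<a. \<Prod>n\<in>S. gkernel (dt L) (bar L i n z) 0 (dB L i n z))" for z
  have K0: "integrable M K0" "K0 \<in> borel_measurable (F (dy T L a))"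
    using exp_steps[OF S le0 aL, of "\<lambda>_. 1" "bar L" "\<lambda>_ _. 0"] ad by (simp_all add: K0_def[abs_def])
  define G where "G z = cr (indicator A' z) * K0 z" for z
  have Am: "(\<lambda>z. cr (indicator A' z)) \<in> borel_measurable (F (dy T L a))"
    unfolding ta using A by simp
  have Gm: "G \<in> borel_measurable (F (dy T L a))"
    unfolding G_def[abs_def] by (rule borel_measurable_times[OF Am K0(2)])
  have Gi: "integrable M G"
  proof (rule L1_bound[OF K0(1)])
    show "G \<in> borel_measurable M" by (rule F_dy_M[OF Gm aL])
  qed (auto simp: G_def norm_mult indicator_def)
  define l where "l i n = (if i < c then mu n else 0)" for i n :: nat
  have R: "G z * (\<Prod>i=a..<2 ^ L. \<Prod>n\<in>S. gkernel (dt L) (bar L i n z) (l' i n) (dB L i n z)) =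
     cr (exp (- Dm S L z - Am S L z / 2)) * (cr (indicator A' z) *
       iexp (\<Sum>i=a..<2 ^ L. \<Sum>n\<in>S. l' i n * (dB L i n z + bar L i n z * dt L)))" for z l'
    unfolding G_def K0_def mult.assoc gkernel_product[OF S(1) aL] by (rule mult.left_commute)
  have lsum: "(\<Sum>i=a..<2 ^ L. \<Sum>n\<in>S. l i n * (dB L i n z + bar L i n z * dt L)) =
     (\<Sum>n\<in>S. mu n * (W n (dy T b (Suc j)) z - W n (dy T b j) z + (\<Sum>i=a..<c. bar L i n z * dt L)))" for z
  proof -
    have "(\<Sum>i=a..<2 ^ L. \<Sum>n\<in>S. l i n * (dB L i n z + bar L i n z * dt L)) =
      (\<Sum>i=a..<c. \<Sum>n\<in>S. l i n * (dB L i n z + bar L i n z * dt L)) + (\<Sum>i=c..<2 ^ L. \<Sum>n\<in>S. l i n * (dB L i n z + bar L i n z * dt L))"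
      by (rule sum.atLeastLessThan_concat[OF ac cL, symmetric])
    also have "\<dots> = (\<Sum>i=a..<c. \<Sum>n\<in>S. mu n * (dB L i n z + bar L i n z * dt L))"
      by (simp add: l_def)
    also have "\<dots> = (\<Sum>n\<in>S. mu n * ((\<Sum>i=a..<c. dB L i n z) + (\<Sum>i=a..<c. bar L i n z * dt L)))"
      by (subst sum.swap) (simp only: sum_distrib_left[symmetric] sum.distrib)
    also have "\<dots> = (\<Sum>n\<in>S. mu n * (W n (dy T b (Suc j)) z - W n (dy T b j) z + (\<Sum>i=a..<c. bar L i n z * dt L)))"
      unfolding dB_def ta[symmetric] by (simp only: sum_Suc_diff'[OF ac, of "\<lambda>i. W _ (dy T L i) z"])
    finally show ?thesis .
  qed
  have "(\<Prod>i=a..<2 ^ L. \<Prod>n\<in>S. cr (exp (- (dt L * (l i n)\<^sup>2 / 2)))) = (\<Prod>n\<in>S. cr (exp (- (dt b * (mu n)\<^sup>2 / 2))))"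
  proof -
    have "(\<Prod>i=a..<2 ^ L. \<Prod>n\<in>S. cr (exp (- (dt L * (l i n)\<^sup>2 / 2)))) =
       (\<Prod>i=a..<c. \<Prod>n\<in>S. cr (exp (- (dt L * (l i n)\<^sup>2 / 2)))) * (\<Prod>i=c..<2 ^ L. \<Prod>n\<in>S. cr (exp (- (dt L * (l i n)\<^sup>2 / 2))))"
      by (rule prod.atLeastLessThan_concat[OF ac cL, symmetric])
    also have "\<dots> = (\<Prod>i=a..<c. \<Prod>n\<in>S. cr (exp (- (dt L * (mu n)\<^sup>2 / 2))))"
      by (simp add: l_def)
    also have "\<dots> = (\<Prod>n\<in>S. cr (exp (- (dt L * (mu n)\<^sup>2 / 2)) ^ (c - a)))"
      by (simp add: prod_power_distrib)
    also have "\<dots> = (\<Prod>n\<in>S. cr (exp (- (dt b * (mu n)\<^sup>2 / 2))))"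
    proof (rule prod.cong[OF refl])
      fix n
      have ca: "c - a = 2 ^ m" by (simp add: a_def c_def)
      have "exp (- (dt L * (mu n)\<^sup>2 / 2)) ^ (2 ^ m) = exp (real (2 ^ m) * (- (dt L * (mu n)\<^sup>2 / 2)))"
        by (rule exp_of_nat_mult[symmetric])
      also have "real (2 ^ m) * (- (dt L * (mu n)\<^sup>2 / 2)) = - (dt b * (mu n)\<^sup>2 / 2)"
        by (simp add: L_def power_add)
      finally show "cr (exp (- (dt L * (mu n)\<^sup>2 / 2)) ^ (c - a)) = cr (exp (- (dt b * (mu n)\<^sup>2 / 2)))"
        unfolding ca by simp
    qed
    finally show ?thesis .
  qed
  moreover have "(\<integral>z. G z * (\<Prod>i=a..<2 ^ L. \<Prod>n\<in>S. gkernel (dt L) (bar L i n z) (l i n) (dB L i n z)) \<partial>M) =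
     (\<integral>z. G z \<partial>M) * (\<Prod>i=a..<2 ^ L. \<Prod>n\<in>S. cr (exp (- (dt L * (l i n)\<^sup>2 / 2))))"
    using exp_steps[OF S aL order.refl Gi Gm, of "bar L" l] ad by simp
  \<comment> \<open>Frequency 0 shows that completing \<open>G\<close> to the full discrete density
    does not change its mean, which brings the right-hand side into the stated form.\<close>
  moreover have "(\<integral>z. G z * (\<Prod>i=a..<2 ^ L. \<Prod>n\<in>S. gkernel (dt L) (bar L i n z) 0 (dB L i n z)) \<partial>M) = (\<integral>z. G z \<partial>M)"
    using exp_steps[OF S aL order.refl Gi Gm, of "bar L" "\<lambda>_ _. 0"] ad by simp
  moreover have "G z * (\<Prod>i=a..<2 ^ L. \<Prod>n\<in>S. gkernel (dt L) (bar L i n z) 0 (dB L i n z)) =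
     cr (exp (- Dm S L z - Am S L z / 2)) * cr (indicator A' z)" for z
    using R[of z "\<lambda>_ _. 0"] by simp
  ultimately show ?thesis
    unfolding R lsum L_def[symmetric] a_def[symmetric] c_def[symmetric] by simp
qed

lemma Bq_increment_limit:
  assumes n: "n \<ge> 1" and w: "z \<in> space M" and j: "j < 2 ^ b"
  shows "(\<lambda>m. W n (dy T b (Suc j)) z - W n (dy T b j) z + (\<Sum>i=j * 2 ^ m..<Suc j * 2 ^ m. bar (b + m) i n z * dt (b + m)))
    \<longlonglongrightarrow> Bq n (dy T b (Suc j)) z - Bq n (dy T b j) z"
proof -
  let ?f = "\<lambda>t. th n t z"
  have c: "continuous_on {0..T} ?f" by (rule th_cont[OF n w])
  have lim: "(\<lambda>m. \<Sum>i<c * 2 ^ m. bar (b + m) i n z * dt (b + m)) \<longlonglongrightarrow> integral {0..dy T b c} ?f" if c2: "c \<le> 2 ^ b" for c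
  proof (rule riemann_limit[OF c T_pos c2, where K=0])
    fix e :: real assume e: "e > 0"
    define P where "P m = (\<forall>l. 0 < l \<longrightarrow> l \<le> 2 ^ m \<longrightarrow> \<bar>lagavg T ?f m l - ?f (dy T m l)\<bar> \<le> e)" for m
    have "\<forall>\<^sub>F m in sequentially. P m"
      using eventually_lagavg[OF c T_pos e] by (simp add: P_def)
    then have "\<forall>\<^sub>F m in sequentially. P (m + b)"
      by (simp only: eventually_sequentially_seg)
    then show "\<forall>\<^sub>F m in sequentially. \<forall>l. 0 < l \<longrightarrow> l < c * 2 ^ m \<longrightarrow> \<bar>bar (b + m) l n z - ?f (dy T (b + m) l)\<bar> \<le> e"
    proof eventually_elim
      case (elim m)
      have "c * 2 ^ m \<le> 2 ^ (m + b)" using c2 by (simp add: power_add mult.commute)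
      with elim show ?case by (auto simp: P_def bar_def add.commute)
    qed
  qed (simp add: bar_def)
  have eq: "(\<Sum>i=j * 2 ^ m..<Suc j * 2 ^ m. bar (b + m) i n z * dt (b + m)) =
      (\<Sum>i<Suc j * 2 ^ m. bar (b + m) i n z * dt (b + m)) - (\<Sum>i<j * 2 ^ m. bar (b + m) i n z * dt (b + m))" for m
    using sum.atLeastLessThan_concat[of 0 "j * 2 ^ m" "Suc j * 2 ^ m" "\<lambda>i. bar (b + m) i n z * dt (b + m)"]
    by (simp add: atLeast0LessThan)
  have "(\<lambda>m. W n (dy T b (Suc j)) z - W n (dy T b j) z + ((\<Sum>i<Suc j * 2 ^ m. bar (b + m) i n z * dt (b + m)) - (\<Sum>i<j * 2 ^ m. bar (b + m) i n z * dt (b + m))))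
      \<longlonglongrightarrow> W n (dy T b (Suc j)) z - W n (dy T b j) z + (integral {0..dy T b (Suc j)} ?f - integral {0..dy T b j} ?f)"
    using j by (intro tendsto_add tendsto_diff tendsto_const lim) auto
  then show ?thesis unfolding eq Bq_def by (simp add: algebra_simps)
qed

lemma Bq_adapted: "n \<ge> 1 \<Longrightarrow> t \<in> {0..T} \<Longrightarrow> Bq n t \<in> borel_measurable (F t)"
  unfolding Bq_def[abs_def] by (intro borel_measurable_add B_adapted integral_th_adapted) auto

lemma Bq_measurable: "n \<ge> 1 \<Longrightarrow> t \<in> {0..T} \<Longrightarrow> Bq n t \<in> borel_measurable M"
  by (rule F_measurable_M[OF Bq_adapted])

text \<open>The limit of \<open>discrete_char\<close> under refinement of the grid: the discrete
  densities converge in L1 along a subsequence, and the characters are bounded and converge almost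
  everywhere.\<close>

lemma ZN_char:
  assumes S: "finite S" "S \<subseteq> {1..}" and j: "j < 2 ^ b" and A: "A' \<in> sets (F (dy T b j))"
  shows "integrable M (ZN S)" "(\<integral>z. ZN S z \<partial>M) = 1"
    "(\<integral>z. cr (ZN S z) * (cr (indicator A' z) * iexp (\<Sum>n\<in>S. mu n * (Bq n (dy T b (Suc j)) z - Bq n (dy T b j) z))) \<partial>M)
     = (\<integral>z. cr (ZN S z) * cr (indicator A' z) \<partial>M) * (\<Prod>n\<in>S. cr (exp (- (dt b * (mu n)\<^sup>2 / 2))))" (is ?g1)
proof -
  have "conv_prob M (\<lambda>m. Dm S (b + m)) (IS S)"
    using conv_prob_subseq[OF Dm_conv[OF S], of "\<lambda>m. b + m"] by (simp add: IS_def[abs_def] strict_mono_def)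
  then obtain r :: "nat \<Rightarrow> nat" where r: "strict_mono r" and rl: "AE z in M. (\<lambda>k. Dm S (b + r k) z) \<longlonglongrightarrow> IS S z"
    using conv_prob_AE_subseq[of "{()}" "\<lambda>_ m. Dm S (b + m)" "\<lambda>_. IS S"] by auto
  have sub: "(\<lambda>k. g (r k)) \<longlonglongrightarrow> x" if "g \<longlonglongrightarrow> x" for g :: "nat \<Rightarrow> real" and x
    using LIMSEQ_subseq_LIMSEQ[OF that r] by (simp add: o_def)
  have rA: "AE z in M. (\<lambda>k. Am S (b + r k) z) \<longlonglongrightarrow> VS S z"
  proof (rule AE_I2)
    fix z assume w: "z \<in> space M"
    have "(\<lambda>m. Am S (b + m) z) \<longlonglongrightarrow> VS S z"
      using LIMSEQ_ignore_initial_segment[OF Am_lim[OF S w], of b] by (simp add: VS_def add.commute)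
    then show "(\<lambda>k. Am S (b + r k) z) \<longlonglongrightarrow> VS S z" by (rule sub)
  qed
  \<comment> \<open>Here the lagged averages pay off: the discrete brackets lie below
    \<open>A\<close> on almost every path, so the one integrable function exp A serves all
    grids.\<close>
  have le: "AE z in M. Am S m z \<le> A z" for m
    using sum_V_le_A[OF S] AE_space by eventually_elim (use Am_le[OF S] in \<open>blast intro: order_trans\<close>)
  have e2: "integrable M (\<lambda>z. exp (- 2 * Dm S m z - 2 * Am S m z))" "(\<integral>z. exp (- 2 * Dm S m z - 2 * Am S m z) \<partial>M) \<le> 1" for m
    using exp_Dm[OF S, of "- 2" m] by simp_all
  note L1 = stochastic_exponential_L1[where D="\<lambda>k. Dm S (b + r k)" and A="\<lambda>k. Am S (b + r k)" and D'="IS S" and A'="VS S" and B=A,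
      OF Dm_measurable[OF S] IS_measurable[OF S] Am_measurable[OF S] VS_measurable[OF S] le exp_A e2 rl rA]
  show ZNint: "integrable M (ZN S)" using L1(1) by (simp add: ZN_def[abs_def])
  have L1': "(\<lambda>k. \<integral>z. \<bar>exp (- Dm S (b + r k) z - Am S (b + r k) z / 2) - ZN S z\<bar> \<partial>M) \<longlonglongrightarrow> 0"
    using L1(3) by (simp add: ZN_def)
  have ind: "(\<lambda>z. cr (indicator A' z)) \<in> borel_measurable M"
    using sets_F_M[OF A] dy_mem[OF T_pos, of j b] j by simp
  have wm: "(\<lambda>z. W n (dy T b i) z) \<in> borel_measurable M" if "n \<in> S" "i \<le> 2 ^ b" for n i
    using that S by (intro F_measurable_M[OF B_adapted] dy_mem T_pos) auto
  define e where "e m z = cr (indicator A' z) *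
       iexp (\<Sum>n\<in>S. mu n * (W n (dy T b (Suc j)) z - W n (dy T b j) z + (\<Sum>i=j * 2 ^ m..<Suc j * 2 ^ m. bar (b + m) i n z * dt (b + m))))" for m z
  define e' where "e' z = cr (indicator A' z) * iexp (\<Sum>n\<in>S. mu n * (Bq n (dy T b (Suc j)) z - Bq n (dy T b j) z))" for z
  have em: "e m \<in> borel_measurable M" for m
  proof -
    have bm: "bar (b + m) i n \<in> borel_measurable M" if "n \<in> S" "i \<in> {j * 2 ^ m..<Suc j * 2 ^ m}" for i n
    proof (rule bar_measurable)
      have "Suc j * 2 ^ m \<le> 2 ^ b * 2 ^ m" using j by (intro mult_le_mono1) simp
      then show "i \<le> 2 ^ (b + m)" using that by (simp only: power_add atLeastLessThan_iff) linarith
    qed (use that S in auto)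
    have "(\<lambda>z. \<Sum>n\<in>S. mu n * (W n (dy T b (Suc j)) z - W n (dy T b j) z + (\<Sum>i=j * 2 ^ m..<Suc j * 2 ^ m. bar (b + m) i n z * dt (b + m)))) \<in> borel_measurable M"
      using j by (intro borel_measurable_sum borel_measurable_times borel_measurable_add borel_measurable_diff borel_measurable_const wm bm) auto
    from measurable_compose[OF this, of iexp borel] show ?thesis
      unfolding e_def[abs_def] by (intro borel_measurable_times ind) simp
  qed
  have e'm: "e' \<in> borel_measurable M"
  proof -
    have "(\<lambda>z. \<Sum>n\<in>S. mu n * (Bq n (dy T b (Suc j)) z - Bq n (dy T b j) z)) \<in> borel_measurable M"
      using j S by (intro borel_measurable_sum borel_measurable_times borel_measurable_diff borel_measurable_const Bq_measurable dy_mem T_pos) auto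
    from measurable_compose[OF this, of iexp borel] show ?thesis
      unfolding e'_def[abs_def] by (intro borel_measurable_times ind) simp
  qed
  have bd: "norm (cr (indicator A' z) * iexp x) \<le> 1" for z x
    unfolding norm_mult by (simp only: norm_exp_i_times) (simp add: indicator_def)
  have elim: "AE z in M. (\<lambda>k. e (r k) z) \<longlonglongrightarrow> e' z"
  proof (rule AE_I2)
    fix z assume w: "z \<in> space M"
    have "(\<lambda>k. \<Sum>n\<in>S. mu n * (W n (dy T b (Suc j)) z - W n (dy T b j) z + (\<Sum>i=j * 2 ^ r k..<Suc j * 2 ^ r k. bar (b + r k) i n z * dt (b + r k))))
       \<longlonglongrightarrow> (\<Sum>n\<in>S. mu n * (Bq n (dy T b (Suc j)) z - Bq n (dy T b j) z))"
      by (rule sub, intro tendsto_sum tendsto_mult tendsto_const Bq_increment_limit w j) (use S in auto)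
    then show "(\<lambda>k. e (r k) z) \<longlonglongrightarrow> e' z"
      unfolding e_def e'_def by (intro tendsto_mult tendsto_const tendsto_exp tendsto_of_real)
  qed
  have lhs: "(\<lambda>k. \<integral>z. cr (exp (- Dm S (b + r k) z - Am S (b + r k) z / 2)) * e (r k) z \<partial>M) \<longlonglongrightarrow> (\<integral>z. cr (ZN S z) * e' z \<partial>M)"
    by (rule integral_L1_bounded_limit[OF L1(2) ZNint L1' em e'm _ _ elim]) (simp_all only: e_def e'_def bd)
  have rhs: "(\<lambda>k. \<integral>z. cr (exp (- Dm S (b + r k) z - Am S (b + r k) z / 2)) * cr (indicator A' z) \<partial>M)
      \<longlonglongrightarrow> (\<integral>z. cr (ZN S z) * cr (indicator A' z) \<partial>M)"
    by (rule integral_L1_bounded_limit[OF L1(2) ZNint L1' ind ind]) (auto simp: indicator_def)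
  have "(\<lambda>k. \<integral>z. cr (exp (- Dm S (b + r k) z - Am S (b + r k) z / 2)) * e (r k) z \<partial>M)
      \<longlonglongrightarrow> (\<integral>z. cr (ZN S z) * cr (indicator A' z) \<partial>M) * (\<Prod>n\<in>S. cr (exp (- (dt b * (mu n)\<^sup>2 / 2))))"
    unfolding e_def discrete_char[OF S j A] by (intro tendsto_mult rhs tendsto_const)
  from LIMSEQ_unique[OF lhs this]
  show ?g1
    by (simp only: e'_def)
  have "(\<integral>z. exp (- Dm S (b + r k) z - Am S (b + r k) z / 2) \<partial>M) = 1" for k
    using exp_Dm(2)[OF S, of "- 1" "b + r k"] by simp
  moreover have "(\<lambda>k. \<integral>z. exp (- Dm S (b + r k) z - Am S (b + r k) z / 2) \<partial>M) \<longlonglongrightarrow> (\<integral>z. ZN S z \<partial>M)"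
    by (rule integral_L1_limit[OF L1(2) ZNint L1'])
  ultimately have "(\<lambda>k::nat. 1) \<longlonglongrightarrow> (\<integral>z. ZN S z \<partial>M)" by simp
  from LIMSEQ_unique[OF this tendsto_const] show "(\<integral>z. ZN S z \<partial>M) = 1" .
qed

text \<open>The constant is 12^3: cube the inequality x/12 <= exp (x/12).\<close>

lemma cube_le_exp: "0 \<le> x \<Longrightarrow> x ^ 3 \<le> 1728 * exp (x / 4)" for x :: real
proof -
  assume x: "0 \<le> x"
  have "x / 12 \<le> exp (x / 12)" using exp_ge_add_one_self[of "x / 12"] by linarith
  then have "(x / 12) ^ 3 \<le> exp (x / 12) ^ 3" using x by (intro power_mono) auto
  also have "exp (x / 12) ^ 3 = exp (x / 4)" by (simp add: exp_of_nat_mult[symmetric])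
  finally show ?thesis by (simp add: power_divide)
qed

text \<open>The energies of the components under the new measure are controlled by Young's inequality
  with exponents 3/2 and 3, for which \<open>exp (3 A / 4)\<close> leaves room below the assumed \<open>exp A\<close>.\<close>

lemma V_under_density:
  assumes Y[measurable]: "Y \<in> borel_measurable M"
    and e: "integrable M (\<lambda>z. exp (- (3/2) * Y z - 9/8 * A z))" "(\<integral>z. exp (- (3/2) * Y z - 9/8 * A z) \<partial>M) \<le> 1"
  shows "n \<ge> 1 \<Longrightarrow> integrable M (\<lambda>z. exp (- Y z - A z / 2) * V n z)"
    "(\<lambda>n. \<integral>z. exp (- Y z - A z / 2) * V (Suc n) z \<partial>M) \<longlonglongrightarrow> 0"
proof -
  let ?Z = "\<lambda>z. exp (- Y z - A z / 2)" and ?E = "\<lambda>z. exp (- (3/2) * Y z - 9/8 * A z)"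
  have young: "?Z z * v \<le> c * ?E z + exp (3/4 * A z) * v ^ 3 / c\<^sup>2" if c: "c > 0" and v: "0 \<le> v" for c v z
  proof -
    define s where "s = root 3 c"
    have s: "s > 0" "s ^ 3 = c" using c by (auto simp: s_def)
    \<comment> \<open>Young in the form 3 a^2 b <= 2 a^3 + b^3, which is (a - b)^2 (2 a + b) >= 0.
      Then a^3 is c times the exponential at q = -3/2, where 9/8 = q^2/2; b^3 carries the energy;
      and the cube root \<open>s\<close> of c distributes the constant.\<close>
    define a where "a = s * exp ((- Y z - 3/4 * A z) / 2)"
    define b where "b = exp (A z / 4) * v / s\<^sup>2"
    have ab: "0 \<le> a" "0 \<le> b" using s v by (auto simp: a_def b_def)
    have "0 \<le> (a - b)\<^sup>2 * (2 * a + b)" using ab by simp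
    then have "3 * (a\<^sup>2 * b) \<le> 2 * a ^ 3 + b ^ 3" by (simp add: power2_eq_square power3_eq_cube algebra_simps)
    moreover have "a\<^sup>2 * b = ?Z z * v"
    proof -
      have "(exp ((- Y z - 3/4 * A z) / 2))\<^sup>2 * exp (A z / 4) = ?Z z"
        by (simp add: power2_eq_square exp_add[symmetric])
      then show ?thesis using s by (simp add: a_def b_def power_mult_distrib)
    qed
    moreover have "a ^ 3 = c * ?E z"
      using s by (simp add: a_def power_mult_distrib exp_of_nat_mult[symmetric])
    moreover have "b ^ 3 = exp (3/4 * A z) * v ^ 3 / c\<^sup>2"
    proof -
      have "(s\<^sup>2) ^ 3 = c\<^sup>2" using s by (simp add: power_mult[symmetric] mult.commute flip: s(2))
      then show ?thesis by (simp add: b_def power_divide power_mult_distrib exp_of_nat_mult[symmetric])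
    qed
    moreover have "0 \<le> c * ?E z" "0 \<le> exp (3/4 * A z) * v ^ 3 / c\<^sup>2" using c v by auto
    ultimately show ?thesis by linarith
  qed
  \<comment> \<open>The energy of one component is at most A, and A^3 costs only exp (A/4) up to a
    constant, so the product stays within exp A.\<close>
  have dom: "AE z in M. exp (3/4 * A z) * (V n z) ^ 3 \<le> 1728 * exp (A z)" if n: "n \<ge> 1" for n
    using V_le_A[OF n] AE_space
  proof eventually_elim
    case (elim z)
    have v: "0 \<le> V n z" by (rule V_nonneg[OF n elim(2)])
    have "(V n z) ^ 3 \<le> (A z) ^ 3" using elim v by (intro power_mono) auto
    also have "\<dots> \<le> 1728 * exp (A z / 4)" using elim v by (intro cube_le_exp) auto
    finally have "exp (3/4 * A z) * (V n z) ^ 3 \<le> exp (3/4 * A z) * (1728 * exp (A z / 4))" by (intro mult_left_mono) auto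
    also have "\<dots> = 1728 * exp (A z)" by (simp add: exp_add[symmetric])
    finally show ?case .
  qed
  have i3: "integrable M (\<lambda>z. exp (3/4 * A z) * (V n z) ^ 3)" if n: "n \<ge> 1" for n
  proof (rule L1_bound)
    show "integrable M (\<lambda>z. 1728 * exp (A z))" using exp_A by simp
    show "(\<lambda>z. exp (3/4 * A z) * (V n z) ^ 3) \<in> borel_measurable M" using V_measurable[OF n] by measurable
    show "AE z in M. norm (exp (3/4 * A z) * (V n z) ^ 3) \<le> norm (1728 * exp (A z))"
      using dom[OF n] AE_space
    proof eventually_elim
      case (elim z)
      then show ?case using V_nonneg[OF n elim(2)] by (simp add: abs_mult)
    qed
  qed
  show int: "integrable M (\<lambda>z. ?Z z * V n z)" if n: "n \<ge> 1" for n
  proof (rule L1_bound)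
    show "integrable M (\<lambda>z. 1 * ?E z + exp (3/4 * A z) * (V n z) ^ 3 / 1\<^sup>2)" using e i3[OF n] by simp
    show "(\<lambda>z. ?Z z * V n z) \<in> borel_measurable M" using V_measurable[OF n] by measurable
    show "AE z in M. norm (?Z z * V n z) \<le> norm (1 * ?E z + exp (3/4 * A z) * (V n z) ^ 3 / 1\<^sup>2)"
    proof (rule AE_I2)
      fix z assume w: "z \<in> space M"
      have v: "0 \<le> V n z" by (rule V_nonneg[OF n w])
      have "0 \<le> ?Z z * V n z" using v by simp
      with young[OF zero_less_one v, of z] show "norm (?Z z * V n z) \<le> norm (1 * ?E z + exp (3/4 * A z) * (V n z) ^ 3 / 1\<^sup>2)"
        by (simp only: real_norm_def)
    qed
  qed
  have lim3: "(\<lambda>n. \<integral>z. exp (3/4 * A z) * (V (Suc n) z) ^ 3 \<partial>M) \<longlonglongrightarrow> 0"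
  proof -
    have "(\<lambda>n. \<integral>z. exp (3/4 * A z) * (V (Suc n) z) ^ 3 \<partial>M) \<longlonglongrightarrow> (\<integral>z. 0 \<partial>M)"
    proof (rule integral_dominated_convergence[where w="\<lambda>z. 1728 * exp (A z)"])
      show "AE z in M. (\<lambda>n. exp (3/4 * A z) * (V (Suc n) z) ^ 3) \<longlonglongrightarrow> 0"
        using A_sums_V
      proof eventually_elim
        case (elim z)
        have "(\<lambda>n. V (Suc n) z) \<longlonglongrightarrow> 0" using elim by (rule summable_LIMSEQ_zero[OF sums_summable])
        from tendsto_mult[OF tendsto_const tendsto_power[OF this, of 3]] show ?case by simp
      qed
      show "AE z in M. norm (exp (3/4 * A z) * (V (Suc n) z) ^ 3) \<le> 1728 * exp (A z)" for n
      proof -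
        have "1 \<le> Suc n" by simp
        from dom[OF this] AE_space show ?thesis
        proof eventually_elim
          case (elim z)
          then show ?case using V_nonneg[of "Suc n" z] by (simp add: abs_mult)
        qed
      qed
      show "(\<lambda>z. exp (3/4 * A z) * (V (Suc n) z) ^ 3) \<in> borel_measurable M" for n using V_measurable[of "Suc n"] by measurable
    qed (use exp_A in auto)
    then show ?thesis by simp
  qed
  show "(\<lambda>n. \<integral>z. ?Z z * V (Suc n) z \<partial>M) \<longlonglongrightarrow> 0"
  proof (rule LIMSEQ_I)
    fix \<epsilon> :: real assume \<epsilon>: "\<epsilon> > 0"
    define c where "c = \<epsilon> / 2"
    have c: "c > 0" using \<epsilon> by (simp add: c_def)
    have "(\<lambda>n. (\<integral>z. exp (3/4 * A z) * (V (Suc n) z) ^ 3 \<partial>M) / c\<^sup>2) \<longlonglongrightarrow> 0 / c\<^sup>2"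
      by (intro tendsto_divide lim3 tendsto_const) (use c in auto)
    then have "\<forall>\<^sub>F n in sequentially. (\<integral>z. exp (3/4 * A z) * (V (Suc n) z) ^ 3 \<partial>M) / c\<^sup>2 < \<epsilon> / 2"
      using \<epsilon> by (intro order_tendstoD(2)) auto
    then obtain n0 where n0: "\<And>n. n \<ge> n0 \<Longrightarrow> (\<integral>z. exp (3/4 * A z) * (V (Suc n) z) ^ 3 \<partial>M) / c\<^sup>2 < \<epsilon> / 2"
      by (auto simp: eventually_sequentially)
    have "norm ((\<integral>z. ?Z z * V (Suc n) z \<partial>M) - 0) < \<epsilon>" if n: "n \<ge> n0" for n
    proof -
      have "(\<integral>z. ?Z z * V (Suc n) z \<partial>M) \<le> (\<integral>z. c * ?E z + exp (3/4 * A z) * (V (Suc n) z) ^ 3 / c\<^sup>2 \<partial>M)"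
        by (intro integral_mono young c V_nonneg int L1_add integrable_mult_right integrable_divide e i3) auto
      also have "\<dots> = c * (\<integral>z. ?E z \<partial>M) + (\<integral>z. exp (3/4 * A z) * (V (Suc n) z) ^ 3 \<partial>M) / c\<^sup>2"
        using e i3[of "Suc n"] by simp
      also have "\<dots> \<le> c * 1 + (\<integral>z. exp (3/4 * A z) * (V (Suc n) z) ^ 3 \<partial>M) / c\<^sup>2"
        using e(2) c by (intro add_right_mono mult_left_mono) auto
      also have "\<dots> < c * 1 + \<epsilon> / 2" by (rule add_strict_left_mono[OF n0[OF n]])
      also have "\<dots> = \<epsilon>" by (simp add: c_def)
      finally have "(\<integral>z. ?Z z * V (Suc n) z \<partial>M) < \<epsilon>" .
      moreover have "0 \<le> (\<integral>z. ?Z z * V (Suc n) z \<partial>M)"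
        by (intro integral_nonneg_AE AE_I2 mult_nonneg_nonneg V_nonneg) auto
      ultimately show ?thesis by simp
    qed
    then show "\<exists>no. \<forall>n\<ge>no. norm ((\<integral>z. ?Z z * V (Suc n) z \<partial>M) - 0) < \<epsilon>" by blast
  qed
qed

text \<open>Passage from finitely many components to all of them, again by L1 convergence of
  densities. Three further conclusions serve later steps: \<open>- ln Z\<close> as a limit along the
  full sequence, so that both solutions use matching approximations, and integrability and decay in
  n of the energies under the new measure.\<close>

theorem girsanov_density:
  obtains Z :: "'a \<Rightarrow> real" where "Z \<in> borel_measurable M" "\<And>z. 0 < Z z"
    "integrable M Z" "(\<integral>z. Z z \<partial>M) = 1"
    "conv_prob M (\<lambda>N z. IS {1..N} z + 1 / 2 * VS {1..N} z) (\<lambda>z. - ln (Z z))"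
    "gauss_grid (density M (\<lambda>z. ennreal (Z z))) F T Bq"
    "\<And>n. n \<ge> 1 \<Longrightarrow> integrable M (\<lambda>z. Z z * V n z)"
    "(\<lambda>n. \<integral>z. Z z * V (Suc n) z \<partial>M) \<longlonglongrightarrow> 0"
proof -
  obtain r Y where r: "strict_mono r" and Y[measurable]: "Y \<in> borel_measurable M" and rY: "AE z in M. (\<lambda>k. IS {1..r k} z) \<longlonglongrightarrow> Y z"
      and Yc: "conv_prob M (\<lambda>N. IS {1..N}) Y"
    using IS_limit by blast
  have fs: "finite {1..N}" "{1..N} \<subseteq> {1::nat..}" for N by auto
  have rV: "AE z in M. (\<lambda>k. VS {1..r k} z) \<longlonglongrightarrow> A z"
    using VS_limit
  proof eventually_elim
    case (elim z)
    then show ?case using LIMSEQ_subseq_LIMSEQ[OF elim r] by (simp add: o_def)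
  qed
  define Z where "Z z = exp (- Y z - A z / 2)" for z
  have Zm[measurable]: "Z \<in> borel_measurable M" unfolding Z_def[abs_def] by measurable
  have Z0: "0 < Z z" for z by (simp add: Z_def)
  have "conv_prob M (\<lambda>N. VS {1..N}) A"
    by (rule AE_imp_conv_prob[OF VS_measurable[OF fs] A_meas VS_limit])
  from conv_prob_add[OF Yc conv_prob_cmult[OF this, of "1 / 2"]]
  have lnZ: "conv_prob M (\<lambda>N z. IS {1..N} z + 1 / 2 * VS {1..N} z) (\<lambda>z. - ln (Z z))"
    by (simp add: Z_def[abs_def] add.commute)
  have le: "AE z in M. VS {1..r k} z \<le> A z" for k
    using sum_V_le_A[OF fs] by (simp add: VS_def)
  have e2: "integrable M (\<lambda>z. exp (- 2 * IS {1..r k} z - 2 * VS {1..r k} z))" "(\<integral>z. exp (- 2 * IS {1..r k} z - 2 * VS {1..r k} z) \<partial>M) \<le> 1" for k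
    using exp_IS[OF fs, of "- 2" "r k"] by simp_all
  note L1 = stochastic_exponential_L1[where D="\<lambda>k. IS {1..r k}" and A="\<lambda>k. VS {1..r k}" and D'=Y and A'=A and B=A,
      OF IS_measurable[OF fs] Y VS_measurable[OF fs] A_meas le exp_A e2 rY rV]
  have Zint: "integrable M Z" using L1(1) by (simp add: Z_def[abs_def])
  have L1': "(\<lambda>k. \<integral>z. \<bar>ZN {1..r k} z - Z z\<bar> \<partial>M) \<longlonglongrightarrow> 0"
    using L1(3) by (simp add: ZN_def Z_def)
  have "{0..T} \<noteq> {}" using T_pos by auto
  have top0: "{} \<in> sets (F (dy T 0 0))" by simp
  have ZNi: "integrable M (ZN {1..r k})" "(\<integral>z. ZN {1..r k} z \<partial>M) = 1" for k
    by (rule ZN_char(1,2)[OF fs _ top0]; simp)+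
  have Z1: "(\<integral>z. Z z \<partial>M) = 1"
  proof -
    have "(\<lambda>k. \<integral>z. ZN {1..r k} z \<partial>M) \<longlonglongrightarrow> (\<integral>z. Z z \<partial>M)"
      by (rule integral_L1_limit[OF ZNi(1) Zint L1'])
    then have "(\<lambda>k::nat. 1) \<longlonglongrightarrow> (\<integral>z. Z z \<partial>M)" by (simp only: ZNi(2))
    from LIMSEQ_unique[OF this tendsto_const] show ?thesis .
  qed
  \<comment> \<open>The exponential at q = -3/2, carried to the limit by Fatou.\<close>
  have "integrable M (\<lambda>z. exp (- (3/2) * Y z - 9/8 * A z)) \<and> (\<integral>z. exp (- (3/2) * Y z - 9/8 * A z) \<partial>M) \<le> 1"
  proof -
    have e: "integrable M (\<lambda>z. exp (- (3/2) * IS {1..r k} z - 9/8 * VS {1..r k} z))" "(\<integral>z. exp (- (3/2) * IS {1..r k} z - 9/8 * VS {1..r k} z) \<partial>M) \<le> 1" for k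
      using exp_IS[OF fs, of "- (3/2)" "r k"] by (simp_all add: power2_eq_square)
    have l: "AE z in M. (\<lambda>k. exp (- (3/2) * IS {1..r k} z - 9/8 * VS {1..r k} z)) \<longlonglongrightarrow> exp (- (3/2) * Y z - 9/8 * A z)"
      using rY rV by eventually_elim (intro tendsto_exp tendsto_diff tendsto_mult tendsto_const)
    show ?thesis
      using integral_Fatou_le[OF e(1) _ e(2) tendsto_const l] by auto
  qed
  note V = V_under_density[OF Y conjunct1[OF this] conjunct2[OF this]]
  let ?Q = "density M (\<lambda>z. ennreal (Z z))"
  have probQ: "prob_space ?Q"
  proof (rule prob_spaceI)
    have "emeasure ?Q (space ?Q) = (\<integral>\<^sup>+z. ennreal (Z z) \<partial>M)"
      by (simp add: emeasure_density cong: nn_integral_cong)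
    also have "\<dots> = ennreal (\<integral>z. Z z \<partial>M)"
      using Z0 by (intro nn_integral_eq_integral Zint AE_I2 less_imp_le)
    finally show "emeasure ?Q (space ?Q) = 1" by (simp add: Z1)
  qed
  have "gauss_grid ?Q F T Bq"
  proof (rule gauss_grid.intro[OF probQ gauss_grid_axioms.intro])
    show "T > 0" by (rule T_pos)
    show "subalgebra ?Q (F t)" if "t \<in> {0..T}" for t using F_sub[OF that] by (simp add: subalgebra_def)
    show "sets (F s) \<subseteq> sets (F t)" if "0 \<le> s" "s \<le> t" "t \<le> T" for s t using F_mono that by blast
    show "Bq n t \<in> borel_measurable (F t)" if "n \<ge> 1" "t \<in> {0..T}" for n t using Bq_adapted that by blast
    fix S :: "nat set" and j m A' and mu :: "nat \<Rightarrow> real"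
    assume S: "finite S" "S \<subseteq> {1..}" and j: "j < 2 ^ m" and A: "A' \<in> sets (F (dy T m j))"
    have A'M[measurable]: "A' \<in> sets M" using sets_F_M[OF A] dy_mem[OF T_pos, of j m] j by simp
    define e where "e z = cr (indicator A' z) * iexp (\<Sum>n\<in>S. mu n * (Bq n (dy T m (Suc j)) z - Bq n (dy T m j) z))" for z
    \<comment> \<open>Extending the frequencies by 0 lets the identity for {1..r k} be used for
      \<open>S\<close> as soon as r k covers it.\<close>
    define mu' where "mu' n = (if n \<in> S then mu n else 0)" for n
    obtain N where N: "S \<subseteq> {..N}" using S(1) finite_nat_iff_bounded_le by auto
    have em: "e \<in> borel_measurable M"
    proof -
      have "(\<lambda>z. \<Sum>n\<in>S. mu n * (Bq n (dy T m (Suc j)) z - Bq n (dy T m j) z)) \<in> borel_measurable M"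
        using j S by (intro borel_measurable_sum borel_measurable_times borel_measurable_diff borel_measurable_const Bq_measurable dy_mem T_pos) auto
      from measurable_compose[OF this, of iexp borel] show ?thesis
        unfolding e_def[abs_def] by (intro borel_measurable_times) simp_all
    qed
    have bd: "norm (e z) \<le> 1" for z
      unfolding e_def norm_mult by (simp only: norm_exp_i_times) (simp add: indicator_def)
    have eq: "(\<integral>z. cr (ZN {1..r k} z) * e z \<partial>M) =
        (\<integral>z. cr (ZN {1..r k} z) * cr (indicator A' z) \<partial>M) * (\<Prod>n\<in>S. cr (exp (- (dt m * (mu n)\<^sup>2 / 2))))"
      if k: "k \<ge> N" for k
    proof -
      have sub: "S \<subseteq> {1..r k}" using N S k seq_suble[OF r, of k] by force
      have s: "(\<Sum>n\<in>{1..r k}. mu' n * (Bq n (dy T m (Suc j)) z - Bq n (dy T m j) z)) = (\<Sum>n\<in>S. mu n * (Bq n (dy T m (Suc j)) z - Bq n (dy T m j) z))" for z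
        using sub by (intro sum.mono_neutral_cong_right) (auto simp: mu'_def)
      have p: "(\<Prod>n\<in>{1..r k}. cr (exp (- (dt m * (mu' n)\<^sup>2 / 2)))) = (\<Prod>n\<in>S. cr (exp (- (dt m * (mu n)\<^sup>2 / 2))))"
        using sub by (intro prod.mono_neutral_cong_right) (auto simp: mu'_def)
      show ?thesis using ZN_char(3)[OF fs j A, of "r k" mu'] unfolding s p e_def .
    qed
    have "(\<lambda>k. \<integral>z. cr (ZN {1..r k} z) * e z \<partial>M) \<longlonglongrightarrow> (\<integral>z. cr (Z z) * e z \<partial>M)"
      by (rule integral_L1_bounded_limit[OF ZNi(1) Zint L1' em em bd bd]) simp
    moreover have "(\<lambda>k. \<integral>z. cr (ZN {1..r k} z) * e z \<partial>M) \<longlonglongrightarrow>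
        (\<integral>z. cr (Z z) * cr (indicator A' z) \<partial>M) * (\<Prod>n\<in>S. cr (exp (- (dt m * (mu n)\<^sup>2 / 2))))"
    proof (rule Lim_transform_eventually)
      show "(\<lambda>k. (\<integral>z. cr (ZN {1..r k} z) * cr (indicator A' z) \<partial>M) * (\<Prod>n\<in>S. cr (exp (- (dt m * (mu n)\<^sup>2 / 2)))))
        \<longlonglongrightarrow> (\<integral>z. cr (Z z) * cr (indicator A' z) \<partial>M) * (\<Prod>n\<in>S. cr (exp (- (dt m * (mu n)\<^sup>2 / 2))))"
        by (intro tendsto_mult tendsto_const integral_L1_bounded_limit[OF ZNi(1) Zint L1']) (auto simp: indicator_def)
      show "\<forall>\<^sub>F k in sequentially. (\<integral>z. cr (ZN {1..r k} z) * cr (indicator A' z) \<partial>M) * (\<Prod>n\<in>S. cr (exp (- (dt m * (mu n)\<^sup>2 / 2)))) = (\<integral>z. cr (ZN {1..r k} z) * e z \<partial>M)"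
        using eq by (intro eventually_sequentiallyI[of N]) simp
    qed
    ultimately have id: "(\<integral>z. cr (Z z) * e z \<partial>M) = (\<integral>z. cr (Z z) * cr (indicator A' z) \<partial>M) * (\<Prod>n\<in>S. cr (exp (- (dt m * (mu n)\<^sup>2 / 2))))"
      by (rule LIMSEQ_unique)
    have Qint: "(\<integral>z. h z \<partial>?Q) = (\<integral>z. cr (Z z) * h z \<partial>M)" if "h \<in> borel_measurable M" for h :: "'a \<Rightarrow> complex"
      using that Z0 by (subst integral_density) (auto simp: less_imp_le scaleR_conv_of_real)
    have "cr (measure ?Q A') = (\<integral>z. cr (indicator A' z) \<partial>?Q)"
    proof -
      have "(\<integral>z. cr (indicator A' z) \<partial>?Q) = cr (measure ?Q (A' \<inter> space ?Q))"
        by (simp only: integral_complex_of_real) simp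
      moreover have "A' \<inter> space ?Q = A'" using sets.sets_into_space[OF A'M] by auto
      ultimately show ?thesis by simp
    qed
    also have "\<dots> = (\<integral>z. cr (Z z) * cr (indicator A' z) \<partial>M)" by (rule Qint) simp
    finally show "(\<integral>z. cr (indicator A' z) * iexp (\<Sum>n\<in>S. mu n * (Bq n (dy T m (Suc j)) z - Bq n (dy T m j) z)) \<partial>?Q)
       = cr (measure ?Q A') * (\<Prod>n\<in>S. cr (exp (- (T / 2 ^ m * (mu n)\<^sup>2 / 2))))"
      using Qint[OF em] id by (simp only: e_def)
  qed
  from that[OF Zm Z0 Zint Z1 lnZ this] V show ?thesis by (simp add: Z_def)
qed

end

section \<open>The linear system under the new measure\<close>

text \<open>Coefficient of the i-th noise in the equation of component n: only the noises n and n -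
  1 act on it, the former through component n + 1 and the latter through component n - 1. Noise sums
  run over i = 1..n.\<close>

definition cf :: "real \<Rightarrow> (nat \<Rightarrow> real) \<Rightarrow> nat \<Rightarrow> nat \<Rightarrow> (nat \<Rightarrow> real) \<Rightarrow> real" where
  "cf \<sigma> k n i y = (if i = n then - (\<sigma> * k n * y (Suc n)) else if Suc i = n then \<sigma> * k i * y i else 0)"

text \<open>The damping from the Stratonovich correction. Twice this number is \<sigma>^2 (k_n^2 +
  k_{n-1}^2), exactly the total weight with which the neighbours enter the bracket of component
  n.\<close>

definition cn :: "real \<Rightarrow> (nat \<Rightarrow> real) \<Rightarrow> nat \<Rightarrow> real" where
  "cn \<sigma> k n = \<sigma>\<^sup>2 / 2 * ((k n)\<^sup>2 + (k (n - 1))\<^sup>2)"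

lemma cn_nonneg: "0 \<le> cn \<sigma> k n"
  by (simp add: cn_def)

lemma cf_diff: "cf \<sigma> k n i (\<lambda>p. y p - z p) = cf \<sigma> k n i y - cf \<sigma> k n i z"
  by (simp add: cf_def algebra_simps)

text \<open>For n = 1 the sum has no term with i = n - 1; \<open>k 0 = 0\<close> makes the formula
  right in that case too.\<close>

lemma sum_cf_square:
  assumes "k 0 = 0" "n \<ge> 1"
  shows "(\<Sum>i=1..n. (cf \<sigma> k n i y)\<^sup>2) = \<sigma>\<^sup>2 * ((k (n - 1))\<^sup>2 * (y (n - 1))\<^sup>2 + (k n)\<^sup>2 * (y (Suc n))\<^sup>2)"
proof -
  obtain q where q: "n = Suc q" using assms(2) by (cases n) auto
  show ?thesis
  proof (cases "q = 0")
    case True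
    then show ?thesis using assms(1) by (simp add: q cf_def power_mult_distrib)
  next
    case False
    have "(\<Sum>i=1..n. (cf \<sigma> k n i y)\<^sup>2) = (\<Sum>i\<in>{q, Suc q}. (cf \<sigma> k n i y)\<^sup>2)"
      using False by (intro sum.mono_neutral_right) (auto simp: q cf_def)
    then show ?thesis by (simp add: q cf_def power_mult_distrib algebra_simps)
  qed
qed

lemma sum_group_div:
  fixes f :: "nat \<Rightarrow> real"
  shows "(\<Sum>l<c * q. f l) = (\<Sum>j<c. \<Sum>l=j * q..<j * q + q. f l)"
  by (rule sum.nat_group[symmetric])

lemma sum_div_const:
  fixes f :: "nat \<Rightarrow> real"
  assumes "q > 0"
  shows "(\<Sum>l<c * q. f (l div q)) = real q * (\<Sum>j<c. f j)"
proof -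
  have "(\<Sum>l<c * q. f (l div q)) = (\<Sum>j<c. \<Sum>l=j * q..<j * q + q. f (l div q))" by (rule sum_group_div)
  also have "\<dots> = (\<Sum>j<c. real q * f j)"
  proof (rule sum.cong[OF refl])
    fix j
    have "l div q = j" if "l \<in> {j * q..<j * q + q}" for l
      using that assms by (intro div_nat_eqI) (auto simp: mult.commute)
    then show "(\<Sum>l=j * q..<j * q + q. f (l div q)) = real q * f j" by simp
  qed
  finally show ?thesis by (simp add: sum_distrib_left)
qed

lemma power2_sum_le: "(a + b)\<^sup>2 \<le> 2 * a\<^sup>2 + 2 * (b::real)\<^sup>2"
  using sum_squares_ge_zero[of "a - b" 0] by (simp add: power2_eq_square algebra_simps)

text \<open>The equation is demanded at dyadic times, with the stochastic part as a limit in
  probability of left-end sums. The uniqueness class is given by \<open>X_int\<close> and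
  \<open>X_vanish\<close>. Moments at a fixed time are not part of the assumptions and have to be
  derived.\<close>

locale linear_system = gauss_grid M F T B for M :: "'a measure" and F and T :: real and B :: "nat \<Rightarrow> real \<Rightarrow> 'a \<Rightarrow> real" +
  fixes \<sigma> :: real and k x :: "nat \<Rightarrow> real" and X :: "nat \<Rightarrow> real \<Rightarrow> 'a \<Rightarrow> real"
  assumes \<sigma>: "\<sigma> \<noteq> 0" and k0: "k 0 = 0" and kpos: "\<And>n. n \<ge> 1 \<Longrightarrow> k n > 0"
    and X0: "\<And>t z. X 0 t z = 0"
    and X_cont: "\<And>n z. z \<in> space M \<Longrightarrow> continuous_on {0..T} (\<lambda>t. X n t z)"
    and X_adapted: "\<And>n t. t \<in> {0..T} \<Longrightarrow> X n t \<in> borel_measurable (F t)"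
    and X_int: "\<And>n. integrable M (\<lambda>z. integral {0..T} (\<lambda>u. (X n u z)\<^sup>2))"
    and X_vanish: "(\<lambda>n. \<integral>z. integral {0..T} (\<lambda>u. (X n u z)\<^sup>2) \<partial>M) \<longlonglongrightarrow> 0"
    and X_eq: "\<And>n b c. n \<ge> 1 \<Longrightarrow> c \<le> 2 ^ b \<Longrightarrow>
      conv_prob M (\<lambda>m z. \<Sum>l<c * 2 ^ m. \<Sum>i=1..n. cf \<sigma> k n i (\<lambda>p. X p (dy T (b + m) l) z) * dB (b + m) l i z)
        (\<lambda>z. X n (dy T b c) z - x n + cn \<sigma> k n * integral {0..dy T b c} (\<lambda>u. X n u z))"
begin

abbreviation c :: "nat \<Rightarrow> real" where "c \<equiv> cn \<sigma> k"

definition sq :: "nat \<Rightarrow> real \<Rightarrow> real \<Rightarrow> 'a \<Rightarrow> real" where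
  "sq n s t z = integral {s..t} (\<lambda>u. (X n u z)\<^sup>2)"

text \<open>The bracket over [s, t] of the martingale part \<open>N n\<close>.\<close>

definition en :: "nat \<Rightarrow> real \<Rightarrow> real \<Rightarrow> 'a \<Rightarrow> real" where
  "en n s t z = \<sigma>\<^sup>2 * ((k (n - 1))\<^sup>2 * sq (n - 1) s t z + (k n)\<^sup>2 * sq (Suc n) s t z)"

definition N :: "nat \<Rightarrow> real \<Rightarrow> 'a \<Rightarrow> real" where
  "N n t z = X n t z - x n + c n * integral {0..t} (\<lambda>u. X n u z)"

definition w :: "nat \<Rightarrow> nat \<Rightarrow> nat \<Rightarrow> nat \<Rightarrow> 'a \<Rightarrow> real" where
  "w n m l i z = cf \<sigma> k n i (\<lambda>p. X p (dy T m l) z)"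

lemma cf_adapted:
  assumes "\<And>p. p = i \<or> p = Suc n \<Longrightarrow> (\<lambda>z. y p z) \<in> borel_measurable N'"
  shows "(\<lambda>z. cf \<sigma> k n i (\<lambda>p. y p z)) \<in> borel_measurable N'"
proof -
  have [measurable]: "(\<lambda>z. y i z) \<in> borel_measurable N'" "(\<lambda>z. y (Suc n) z) \<in> borel_measurable N'"
    using assms by auto
  show ?thesis unfolding cf_def by measurable
qed

lemma X_measurable: "t \<in> {0..T} \<Longrightarrow> X n t \<in> borel_measurable M"
  by (rule F_measurable_M[OF X_adapted])

lemma w_adapted: "l \<le> 2 ^ m \<Longrightarrow> w n m l i \<in> borel_measurable (F (dy T m l))"
  unfolding w_def[abs_def] by (intro cf_adapted X_adapted dy_mem T_pos)

lemma w_measurable: "l \<le> 2 ^ m \<Longrightarrow> w n m l i \<in> borel_measurable M"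
  by (rule F_dy_M[OF w_adapted])

lemma X_integrable_on:
  assumes "z \<in> space M" "0 \<le> s" "t \<le> T"
  shows "(\<lambda>u. X n u z) integrable_on {s..t}" "(\<lambda>u. (X n u z)\<^sup>2) integrable_on {s..t}"
  by (intro integrable_continuous_real continuous_intros continuous_on_subset[OF X_cont] assms; use assms in auto)+

lemma sq_nonneg: "z \<in> space M \<Longrightarrow> 0 \<le> s \<Longrightarrow> t \<le> T \<Longrightarrow> 0 \<le> sq n s t z"
  unfolding sq_def by (intro Henstock_Kurzweil_Integration.integral_nonneg X_integrable_on) auto

lemma sq_add: "z \<in> space M \<Longrightarrow> 0 \<le> s \<Longrightarrow> s \<le> t \<Longrightarrow> t \<le> u \<Longrightarrow> u \<le> T \<Longrightarrow> sq n s t z + sq n t u z = sq n s u z"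
  unfolding sq_def by (intro Henstock_Kurzweil_Integration.integral_combine X_integrable_on) auto

lemma sq_measurable: "0 \<le> s \<Longrightarrow> t \<le> T \<Longrightarrow> sq n s t \<in> borel_measurable M"
  unfolding sq_def[abs_def]
proof (rule measurable_integral_continuous)
  assume st: "0 \<le> s" "t \<le> T"
  show "continuous_on {s..t} (\<lambda>u. (X n u z)\<^sup>2)" if "z \<in> space M" for z
    by (intro continuous_intros continuous_on_subset[OF X_cont[OF that]]) (use st in auto)
  show "(\<lambda>z. (X n u z)\<^sup>2) \<in> borel_measurable M" if "u \<in> {s..t}" for u
    using that st by (intro borel_measurable_power X_measurable) auto
qed

lemma sq_integrable:
  assumes "0 \<le> s" "s \<le> t" "t \<le> T"
  shows "integrable M (sq n s t)"
proof (rule L1_bound[OF X_int[of n]])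
  show "sq n s t \<in> borel_measurable M" using assms by (intro sq_measurable)
  show "AE z in M. norm (sq n s t z) \<le> norm (integral {0..T} (\<lambda>u. (X n u z)\<^sup>2))"
  proof (rule AE_I2)
    fix z assume w: "z \<in> space M"
    have "sq n 0 s z + (sq n s t z + sq n t T z) = sq n 0 T z"
      using assms by (simp add: sq_add w)
    moreover have "0 \<le> sq n 0 s z" "0 \<le> sq n s t z" "0 \<le> sq n t T z" using assms by (auto intro!: sq_nonneg w)
    ultimately show "norm (sq n s t z) \<le> norm (integral {0..T} (\<lambda>u. (X n u z)\<^sup>2))" by (simp add: sq_def)
  qed
qed

text \<open>Additive in time, hence summable over grid cells without loss. It combines what bounds
  the noise (\<open>en\<close>) with what bounds the drift (\<open>sq\<close>).\<close>

definition E :: "nat \<Rightarrow> real \<Rightarrow> real \<Rightarrow> real" where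
  "E n s t = (\<integral>z. en n s t z + sq n s t z \<partial>M)"

lemma en_integrable: "0 \<le> s \<Longrightarrow> s \<le> t \<Longrightarrow> t \<le> T \<Longrightarrow> integrable M (en n s t)"
  unfolding en_def[abs_def] by (intro integrable_mult_right L1_add sq_integrable)

lemma en_nonneg: "z \<in> space M \<Longrightarrow> 0 \<le> s \<Longrightarrow> t \<le> T \<Longrightarrow> 0 \<le> en n s t z"
  unfolding en_def by (intro mult_nonneg_nonneg add_nonneg_nonneg sq_nonneg) auto

lemma E_nonneg: "0 \<le> s \<Longrightarrow> t \<le> T \<Longrightarrow> 0 \<le> E n s t"
  unfolding E_def by (intro integral_nonneg_AE AE_I2 add_nonneg_nonneg en_nonneg sq_nonneg)

lemma E_add:
  assumes "0 \<le> s" "s \<le> t" "t \<le> u" "u \<le> T"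
  shows "E n s t + E n t u = E n s u"
proof -
  have i: "integrable M (\<lambda>z. en n s t z + sq n s t z)" "integrable M (\<lambda>z. en n t u z + sq n t u z)"
    using assms by (auto intro!: L1_add en_integrable sq_integrable)
  have "E n s t + E n t u = (\<integral>z. (en n s t z + sq n s t z) + (en n t u z + sq n t u z) \<partial>M)"
    unfolding E_def by (rule Bochner_Integration.integral_add[OF i, symmetric])
  also have "\<dots> = E n s u"
    unfolding E_def
  proof (rule Bochner_Integration.integral_cong[OF refl])
    fix z assume w: "z \<in> space M"
    have "sq p s u z = sq p s t z + sq p t u z" for p using sq_add[OF w assms] by simp
    then show "(en n s t z + sq n s t z) + (en n t u z + sq n t u z) = en n s u z + sq n s u z"
      by (simp add: en_def algebra_simps)
  qed
  finally show ?thesis .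
qed

lemma E_mono: "0 \<le> s' \<Longrightarrow> s' \<le> s \<Longrightarrow> s \<le> t \<Longrightarrow> t \<le> t' \<Longrightarrow> t' \<le> T \<Longrightarrow> E n s t \<le> E n s' t'"
  using E_add[of s' s t n] E_add[of s' t t' n] E_nonneg[of s' s n] E_nonneg[of t t' n] by linarith

lemma sum_E_grid:
  assumes "c' \<le> 2 ^ b"
  shows "(\<Sum>j<c'. E n (dy T b j) (dy T b (Suc j))) = E n 0 (dy T b c')"
  using assms
proof (induction c')
  case 0
  have "E n 0 0 + E n 0 0 = E n 0 0" using T_pos by (intro E_add) auto
  then show ?case by simp
next
  case (Suc c')
  have "E n 0 (dy T b c') + E n (dy T b c') (dy T b (Suc c')) = E n 0 (dy T b (Suc c'))"
    using Suc.prems T_pos by (intro E_add) (auto intro: dy_nonneg dy_mono dy_le)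
  with Suc show ?case by simp
qed

lemma sum_E_grid_le: "c' \<le> 2 ^ b \<Longrightarrow> (\<Sum>j<c'. E n (dy T b j) (dy T b (Suc j))) \<le> E n 0 T"
  using T_pos by (subst sum_E_grid) (auto intro!: E_mono dy_nonneg dy_le)

lemma mult_pow_le: "c' \<le> 2 ^ b \<Longrightarrow> c' * 2 ^ m \<le> (2::nat) ^ (b + m)"
  by (simp add: power_add)

lemma increment_conv:
  assumes n: "n \<ge> 1" and ac: "a \<le> c'" "c' \<le> 2 ^ b"
  shows "conv_prob M (\<lambda>m z. \<Sum>l=a * 2 ^ m..<c' * 2 ^ m. \<Sum>i=1..n. w n (b + m) l i z * dB (b + m) l i z)
    (\<lambda>z. N n (dy T b c') z - N n (dy T b a) z)"
proof -
  have *: "conv_prob M (\<lambda>m z. \<Sum>l<d * 2 ^ m. \<Sum>i=1..n. w n (b + m) l i z * dB (b + m) l i z) (N n (dy T b d))" if "d \<le> 2 ^ b" for d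
    using X_eq[OF n that] by (simp add: w_def N_def[abs_def])
  have eq: "(\<Sum>l=a * 2 ^ m..<c' * 2 ^ m. f l) = (\<Sum>l<c' * 2 ^ m. f l) - (\<Sum>l<a * 2 ^ m. f l)" for m and f :: "nat \<Rightarrow> real"
    using sum.atLeastLessThan_concat[of 0 "a * 2 ^ m" "c' * 2 ^ m" f] ac by (simp add: atLeast0LessThan)
  show ?thesis unfolding eq by (intro conv_prob_diff *) (use ac in auto)
qed

lemma increment_bracket:
  assumes n: "n \<ge> 1" and ac: "a \<le> c'" "c' \<le> 2 ^ b" and z: "z \<in> space M"
  shows "(\<lambda>m. \<Sum>l=a * 2 ^ m..<c' * 2 ^ m. \<Sum>i=1..n. (w n (b + m) l i z)\<^sup>2 * dt (b + m)) \<longlonglongrightarrow> en n (dy T b a) (dy T b c') z"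
proof -
  let ?S = "\<lambda>p m. \<Sum>l=a * 2 ^ m..<c' * 2 ^ m. (X p (dy T (b + m) l) z)\<^sup>2 * dt (b + m)"
  have lim: "(\<lambda>m. \<Sum>l=a * 2 ^ m..<c' * 2 ^ m. (X p (dy T (b + m) l) z)\<^sup>2 * dt (b + m)) \<longlonglongrightarrow> sq p (dy T b a) (dy T b c') z" for p
    unfolding sq_def by (rule riemann_limit_interval[where f="\<lambda>u. (X p u z)\<^sup>2", OF _ T_pos ac(2,1)]) (intro continuous_intros X_cont z)
  have "(\<Sum>l=a * 2 ^ m..<c' * 2 ^ m. \<Sum>i=1..n. (w n (b + m) l i z)\<^sup>2 * dt (b + m)) =
     \<sigma>\<^sup>2 * ((k (n - 1))\<^sup>2 * ?S (n - 1) m + (k n)\<^sup>2 * ?S (Suc n) m)" for m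
    unfolding sum_distrib_right[symmetric] w_def sum_cf_square[of k, OF k0 n]
    by (simp only: sum_distrib_left sum_distrib_right sum.distrib[symmetric]) (simp add: algebra_simps)
  moreover have "(\<lambda>m. \<sigma>\<^sup>2 * ((k (n - 1))\<^sup>2 * ?S (n - 1) m + (k n)\<^sup>2 * ?S (Suc n) m))
      \<longlonglongrightarrow> en n (dy T b a) (dy T b c') z"
    unfolding en_def by (intro tendsto_mult tendsto_add tendsto_const lim)
  ultimately show ?thesis by simp
qed

text \<open>The isometry cannot be used yet, since the left-end values of \<open>X\<close> are not
  known to be square integrable. The exponential bounds need no integrability of the integrand and
  give the second moment of the limit with a factor 2.\<close>

lemma N_increment:
  assumes n: "n \<ge> 1" and ac: "a \<le> c'" "c' \<le> 2 ^ b"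
  shows "integrable M (\<lambda>z. (N n (dy T b c') z - N n (dy T b a) z)\<^sup>2)" (is ?g1)
    "(\<integral>z. (N n (dy T b c') z - N n (dy T b a) z)\<^sup>2 \<partial>M) \<le> 2 * (\<integral>z. en n (dy T b a) (dy T b c') z \<partial>M)"
proof -
  let ?s = "dy T b a" and ?t = "dy T b c'"
  have st: "0 \<le> ?s" "?s \<le> ?t" "?t \<le> T" using ac T_pos by (auto intro: dy_nonneg dy_mono dy_le)
  have S: "finite {1..n}" "{1..n} \<subseteq> {1..}" by auto
  let ?D = "\<lambda>m z. \<Sum>l=a * 2 ^ m..<c' * 2 ^ m. \<Sum>i=1..n. w n (b + m) l i z * dB (b + m) l i z"
  let ?A = "\<lambda>m z. \<Sum>l=a * 2 ^ m..<c' * 2 ^ m. \<Sum>i=1..n. (w n (b + m) l i z)\<^sup>2 * dt (b + m)"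
  note conv = increment_conv[OF n ac]
  have ex: "integrable M (\<lambda>z. exp (q * ?D m z - q\<^sup>2 * ?A m z / 2))"
    "(\<integral>z. exp (q * ?D m z - q\<^sup>2 * ?A m z / 2) \<partial>M) \<le> 1" for q m
  proof -
    have "a * 2 ^ m \<le> c' * 2 ^ m" using ac(1) by simp
    from exp_mart[OF S this mult_pow_le[OF ac(2)], of "w n (b + m)" q] w_adapted
    show "integrable M (\<lambda>z. exp (q * ?D m z - q\<^sup>2 * ?A m z / 2))" "(\<integral>z. exp (q * ?D m z - q\<^sup>2 * ?A m z / 2) \<partial>M) \<le> 1"
      by auto
  qed
  have eni: "integrable M (en n ?s ?t)" by (rule en_integrable[OF st])
  have lim: "AE z in M. (\<lambda>m. ?A m z) \<longlonglongrightarrow> en n ?s ?t z"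
    by (rule AE_I2) (rule increment_bracket[OF n ac])
  have eM: "en n ?s ?t \<in> borel_measurable M" using eni by auto
  note ex' = exp_supermartingale_limit[OF ex conv lim eM]
  show ?g1
    "(\<integral>z. (N n (dy T b c') z - N n (dy T b a) z)\<^sup>2 \<partial>M) \<le> 2 * (\<integral>z. en n ?s ?t z \<partial>M)"
    using second_moment_le[OF conv_prob_measurable(2)[OF conv] eni ex'] by auto
qed

text \<open>The number 4 is 2 times 2, from splitting an increment into noise and drift and from
  \<open>N_increment\<close>. The other summand is the drift, by Cauchy-Schwarz on an interval of
  length at most \<open>T\<close>.\<close>

definition C :: "nat \<Rightarrow> real" where "C n = 4 + 2 * (c n)\<^sup>2 * T"

lemma C_pos: "C n > 0"
  using T_pos by (simp add: C_def add_pos_nonneg)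

text \<open>The first moment information at fixed times: increments between grid points are square
  integrable even before \<open>X\<close> itself is known to be. The trivial case n = 0 is included
  because component 0 is a neighbour of component 1.\<close>

lemma X_increment:
  assumes ac: "a \<le> c'" "c' \<le> 2 ^ b"
  shows "integrable M (\<lambda>z. (X n (dy T b c') z - X n (dy T b a) z)\<^sup>2)" (is ?g1)
    "(\<integral>z. (X n (dy T b c') z - X n (dy T b a) z)\<^sup>2 \<partial>M) \<le> C n * E n (dy T b a) (dy T b c')" (is ?g2)
proof -
  let ?s = "dy T b a" and ?t = "dy T b c'"
  have st: "0 \<le> ?s" "?s \<le> ?t" "?t \<le> T" using ac T_pos by (auto intro: dy_nonneg dy_mono dy_le)
  have m: "X n ?s \<in> borel_measurable M" "X n ?t \<in> borel_measurable M" using st by (auto intro!: X_measurable)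
  have "integrable M (\<lambda>z. (X n ?t z - X n ?s z)\<^sup>2) \<and> (\<integral>z. (X n ?t z - X n ?s z)\<^sup>2 \<partial>M) \<le> C n * E n ?s ?t"
  proof (cases "n = 0")
    case True
    then show ?thesis using E_nonneg[OF st(1,3), of n] C_pos[of n] by (simp add: X0)
  next
    case False
    then have n: "n \<ge> 1" by simp
    note Ni = N_increment[OF n ac]
    have pw: "(X n ?t z - X n ?s z)\<^sup>2 \<le> 2 * (N n ?t z - N n ?s z)\<^sup>2 + 2 * (c n)\<^sup>2 * T * sq n ?s ?t z" if w: "z \<in> space M" for z
    proof -
      have "integral {0..?s} (\<lambda>u. X n u z) + integral {?s..?t} (\<lambda>u. X n u z) = integral {0..?t} (\<lambda>u. X n u z)"
        using st by (intro Henstock_Kurzweil_Integration.integral_combine X_integrable_on w) auto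
      then have "X n ?t z - X n ?s z = (N n ?t z - N n ?s z) + - (c n * integral {?s..?t} (\<lambda>u. X n u z))"
        by (simp add: N_def algebra_simps flip: distrib_left)
      then have "(X n ?t z - X n ?s z)\<^sup>2 \<le> 2 * (N n ?t z - N n ?s z)\<^sup>2 + 2 * (- (c n * integral {?s..?t} (\<lambda>u. X n u z)))\<^sup>2"
        by (simp only: power2_sum_le)
      also have "(- (c n * integral {?s..?t} (\<lambda>u. X n u z)))\<^sup>2 = (c n)\<^sup>2 * (integral {?s..?t} (\<lambda>u. X n u z))\<^sup>2"
        by (simp add: power_mult_distrib)
      also have "(integral {?s..?t} (\<lambda>u. X n u z))\<^sup>2 \<le> T * sq n ?s ?t z"
      proof -
        have "(integral {?s..?t} (\<lambda>u. X n u z))\<^sup>2 \<le> (?t - ?s) * sq n ?s ?t z"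
          unfolding sq_def by (rule square_integral_le[OF continuous_on_subset[OF X_cont[OF w]]]) (use st in auto)
        also have "\<dots> \<le> T * sq n ?s ?t z" using st by (intro mult_right_mono sq_nonneg w) auto
        finally show ?thesis .
      qed
      finally show ?thesis by (simp add: mult.assoc mult_left_mono)
    qed
    have ib: "integrable M (\<lambda>z. 2 * (N n ?t z - N n ?s z)\<^sup>2 + 2 * (c n)\<^sup>2 * T * sq n ?s ?t z)"
      using Ni(1) sq_integrable[OF st] by simp
    have i: "integrable M (\<lambda>z. (X n ?t z - X n ?s z)\<^sup>2)"
    proof (rule L1_bound[OF ib])
      show "(\<lambda>z. (X n ?t z - X n ?s z)\<^sup>2) \<in> borel_measurable M" using m by measurable
      show "AE z in M. norm ((X n ?t z - X n ?s z)\<^sup>2) \<le> norm (2 * (N n ?t z - N n ?s z)\<^sup>2 + 2 * (c n)\<^sup>2 * T * sq n ?s ?t z)"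
      proof (rule AE_I2)
        fix z assume "z \<in> space M"
        from pw[OF this] show "norm ((X n ?t z - X n ?s z)\<^sup>2) \<le> norm (2 * (N n ?t z - N n ?s z)\<^sup>2 + 2 * (c n)\<^sup>2 * T * sq n ?s ?t z)"
          by (simp only: real_norm_def abs_power2)
      qed
    qed
    have "(\<integral>z. (X n ?t z - X n ?s z)\<^sup>2 \<partial>M) \<le> (\<integral>z. 2 * (N n ?t z - N n ?s z)\<^sup>2 + 2 * (c n)\<^sup>2 * T * sq n ?s ?t z \<partial>M)"
      by (rule integral_mono[OF i ib pw])
    also have "\<dots> = 2 * (\<integral>z. (N n ?t z - N n ?s z)\<^sup>2 \<partial>M) + 2 * (c n)\<^sup>2 * T * (\<integral>z. sq n ?s ?t z \<partial>M)"
      using Ni(1) sq_integrable[OF st] by simp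
    also have "\<dots> \<le> 4 * (\<integral>z. en n ?s ?t z \<partial>M) + 2 * (c n)\<^sup>2 * T * (\<integral>z. sq n ?s ?t z \<partial>M)"
      using Ni(2) by simp
    also have "\<dots> \<le> C n * (\<integral>z. en n ?s ?t z \<partial>M) + C n * (\<integral>z. sq n ?s ?t z \<partial>M)"
    proof (intro add_mono mult_right_mono)
      show "0 \<le> (\<integral>z. en n ?s ?t z \<partial>M)" "0 \<le> (\<integral>z. sq n ?s ?t z \<partial>M)"
        using st by (auto intro!: integral_nonneg_AE AE_I2 en_nonneg sq_nonneg)
    qed (use T_pos in \<open>auto simp: C_def\<close>)
    also have "\<dots> = C n * E n ?s ?t"
      using en_integrable[OF st] sq_integrable[OF st] by (simp add: E_def distrib_left)
    finally show ?thesis using i by blast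
  qed
  then show ?g1
    ?g2 by auto
qed

text \<open>Both times are grid points of level b + m, and monotonicity of \<open>E\<close> enlarges
  the interval to the whole coarse cell, so that the bound depends on l only through its
  cell.\<close>

lemma fine_coarse:
  assumes l: "l < c' * 2 ^ m" and c': "c' \<le> 2 ^ b"
  shows "integrable M (\<lambda>z. (X n (dy T (b + m) l) z - X n (dy T b (l div 2 ^ m)) z)\<^sup>2)"
    "(\<integral>z. (X n (dy T (b + m) l) z - X n (dy T b (l div 2 ^ m)) z)\<^sup>2 \<partial>M) \<le> C n * E n (dy T b (l div 2 ^ m)) (dy T b (Suc (l div 2 ^ m)))"
proof -
  let ?j = "l div 2 ^ m"
  have j: "?j < c'" using l by (simp add: less_mult_imp_div_less)
  have le: "?j * 2 ^ m \<le> l" by (rule div_times_less_eq_dividend)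
  have "l mod 2 ^ m \<le> 2 ^ m" by simp
  then have "?j * 2 ^ m + l mod 2 ^ m \<le> ?j * 2 ^ m + 2 ^ m" by (rule add_left_mono)
  then have le2: "l \<le> Suc ?j * 2 ^ m" by (metis add.commute div_mult_mod_eq mult_Suc)
  have lb: "l \<le> 2 ^ (b + m)" using l mult_pow_le[OF c', of m] by linarith
  note * = X_increment[OF le lb, of n]
  show "integrable M (\<lambda>z. (X n (dy T (b + m) l) z - X n (dy T b ?j) z)\<^sup>2)"
    using *(1) by (simp only: dy_refine)
  have "(\<integral>z. (X n (dy T (b + m) l) z - X n (dy T b ?j) z)\<^sup>2 \<partial>M) \<le> C n * E n (dy T b ?j) (dy T (b + m) l)"
    using *(2) by (simp only: dy_refine)
  also have "\<dots> \<le> C n * E n (dy T b ?j) (dy T b (Suc ?j))"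
  proof (intro mult_left_mono E_mono)
    show "dy T b ?j \<le> dy T (b + m) l" using dy_mono[OF T_pos le, of "b + m"] by (simp only: dy_refine)
    show "dy T (b + m) l \<le> dy T b (Suc ?j)" using dy_mono[OF T_pos le2, of "b + m"] by (simp only: dy_refine)
  qed (use j c' T_pos C_pos[of n] in \<open>auto intro: dy_nonneg dy_le\<close>)
  finally show "(\<integral>z. (X n (dy T (b + m) l) z - X n (dy T b ?j) z)\<^sup>2 \<partial>M) \<le> C n * E n (dy T b ?j) (dy T b (Suc ?j))" .
qed

definition D :: "nat \<Rightarrow> real" where
  "D n = \<sigma>\<^sup>2 * ((k (n - 1))\<^sup>2 * (C (n - 1) * E (n - 1) 0 T) + (k n)\<^sup>2 * (C (Suc n) * E (Suc n) 0 T))"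

text \<open>On a finer grid the difference of integrands consists of increments of \<open>X\<close>
  within a coarse cell. These are square integrable, so the exact isometry applies. Summing the
  bounds by additivity of \<open>E\<close> leaves one factor \<open>dt b\<close>, and Fatou removes
  the fine grid.\<close>

lemma noise_error:
  assumes n: "n \<ge> 1" and c': "c' \<le> 2 ^ b"
  defines "\<epsilon> \<equiv> \<lambda>z. N n (dy T b c') z - (\<Sum>l<c'. \<Sum>i=1..n. w n b l i z * dB b l i z)"
  shows "integrable M (\<lambda>z. (\<epsilon> z)\<^sup>2)" (is ?g1) "(\<integral>z. (\<epsilon> z)\<^sup>2 \<partial>M) \<le> D n * dt b" (is ?g2)
proof -
  have S: "finite {1..n}" "{1..n} \<subseteq> {1..}" by auto
  define U where "U m l i z = (if l < c' * 2 ^ m then w n (b + m) l i z - w n b (l div 2 ^ m) i z else 0)" for m l i z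
  define Dm where "Dm m z = (\<Sum>l=0..<c' * 2 ^ m. \<Sum>i=1..n. U m l i z * dB (b + m) l i z)" for m z
  have jl: "l div 2 ^ m < c'" "l div 2 ^ m \<le> 2 ^ b" "l \<le> 2 ^ (b + m)" "l div 2 ^ m * 2 ^ m \<le> l" if "l < c' * 2 ^ m" for l m
  proof -
    show *: "l div 2 ^ m < c'" using that by (simp add: less_mult_imp_div_less)
    show "l div 2 ^ m \<le> 2 ^ b" using * c' by linarith
    show "l \<le> 2 ^ (b + m)" using that mult_pow_le[OF c', of m] by linarith
  qed simp
  have Uad: "U m l i \<in> borel_measurable (F (dy T (b + m) l))" for m l i
  proof (cases "l < c' * 2 ^ m")
    case True
    have "w n b (l div 2 ^ m) i \<in> borel_measurable (F (dy T (b + m) (l div 2 ^ m * 2 ^ m)))"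
      unfolding dy_refine by (rule w_adapted[OF jl(2)[OF True]])
    then have "w n b (l div 2 ^ m) i \<in> borel_measurable (F (dy T (b + m) l))"
      by (rule F_measurable_dy) (use jl(3,4)[OF True] in auto)
    moreover have "w n (b + m) l i \<in> borel_measurable (F (dy T (b + m) l))" by (rule w_adapted[OF jl(3)[OF True]])
    ultimately show ?thesis using True unfolding U_def[abs_def] by simp
  qed (simp add: U_def[abs_def])
  have Ucf: "U m l i z = cf \<sigma> k n i (\<lambda>p. X p (dy T (b + m) l) z - X p (dy T b (l div 2 ^ m)) z)" if "l < c' * 2 ^ m" for m l i z
    using that by (simp add: U_def w_def cf_diff)
  have Usq: "(\<Sum>i=1..n. (U m l i z)\<^sup>2) = \<sigma>\<^sup>2 * ((k (n - 1))\<^sup>2 * (X (n - 1) (dy T (b + m) l) z - X (n - 1) (dy T b (l div 2 ^ m)) z)\<^sup>2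
      + (k n)\<^sup>2 * (X (Suc n) (dy T (b + m) l) z - X (Suc n) (dy T b (l div 2 ^ m)) z)\<^sup>2)" if "l < c' * 2 ^ m" for m l z
    unfolding Ucf[OF that] by (rule sum_cf_square[of k, OF k0 n])
  have Uint: "integrable M (\<lambda>z. (U m l i z)\<^sup>2)" if l: "l < 2 ^ (b + m)" and i: "i \<in> {1..n}" for m l i
  proof (cases "l < c' * 2 ^ m")
    case True
    have ib: "integrable M (\<lambda>z. \<Sum>i=1..n. (U m l i z)\<^sup>2)"
      unfolding Usq[OF True] using fine_coarse(1)[OF True c'] by simp
    show ?thesis
    proof (rule L1_bound[OF ib])
      show "(\<lambda>z. (U m l i z)\<^sup>2) \<in> borel_measurable M"
        by (intro borel_measurable_power F_dy_M[OF Uad]) (use l in simp)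
      show "AE z in M. norm ((U m l i z)\<^sup>2) \<le> norm (\<Sum>i=1..n. (U m l i z)\<^sup>2)"
      proof (rule AE_I2)
        fix z
        have "(U m l i z)\<^sup>2 \<le> (\<Sum>i=1..n. (U m l i z)\<^sup>2)" by (rule member_le_sum[OF i]) auto
        then show "norm ((U m l i z)\<^sup>2) \<le> norm (\<Sum>i=1..n. (U m l i z)\<^sup>2)" by simp
      qed
    qed
  qed (simp add: U_def)
  let ?W = "\<lambda>j. \<sigma>\<^sup>2 * ((k (n - 1))\<^sup>2 * (C (n - 1) * E (n - 1) (dy T b j) (dy T b (Suc j))) + (k n)\<^sup>2 * (C (Suc n) * E (Suc n) (dy T b j) (dy T b (Suc j))))"
  have L2: "integrable M (\<lambda>z. (Dm m z)\<^sup>2)" "(\<integral>z. (Dm m z)\<^sup>2 \<partial>M) \<le> D n * dt b" for m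
  proof -
    note L2s = L2_sum[OF S le0 mult_pow_le[OF c', of m], of "U m"]
    show "integrable M (\<lambda>z. (Dm m z)\<^sup>2)" unfolding Dm_def using L2s Uad Uint by blast
    have "(\<integral>z. (Dm m z)\<^sup>2 \<partial>M) = dt (b + m) * (\<Sum>l=0..<c' * 2 ^ m. \<Sum>i=1..n. \<integral>z. (U m l i z)\<^sup>2 \<partial>M)"
      unfolding Dm_def using L2s Uad Uint by blast
    also have "\<dots> \<le> dt (b + m) * (\<Sum>l=0..<c' * 2 ^ m. ?W (l div 2 ^ m))"
    proof (intro mult_left_mono sum_mono)
      fix l assume "l \<in> {0..<c' * 2 ^ m}"
      then have l: "l < c' * 2 ^ m" by simp
      then have l2: "l < 2 ^ (b + m)" using mult_pow_le[OF c', of m] by linarith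
      have "(\<Sum>i=1..n. \<integral>z. (U m l i z)\<^sup>2 \<partial>M) = (\<integral>z. (\<Sum>i=1..n. (U m l i z)\<^sup>2) \<partial>M)"
        by (rule Bochner_Integration.integral_sum[symmetric]) (rule Uint[OF l2])
      also have "\<dots> = \<sigma>\<^sup>2 * ((k (n - 1))\<^sup>2 * (\<integral>z. (X (n - 1) (dy T (b + m) l) z - X (n - 1) (dy T b (l div 2 ^ m)) z)\<^sup>2 \<partial>M)
          + (k n)\<^sup>2 * (\<integral>z. (X (Suc n) (dy T (b + m) l) z - X (Suc n) (dy T b (l div 2 ^ m)) z)\<^sup>2 \<partial>M))"
        unfolding Usq[OF l] using fine_coarse(1)[OF l c'] by simp
      also have "\<dots> \<le> ?W (l div 2 ^ m)"
        by (intro mult_left_mono add_mono fine_coarse(2)[OF l c']) auto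
      finally show "(\<Sum>i=1..n. \<integral>z. (U m l i z)\<^sup>2 \<partial>M) \<le> ?W (l div 2 ^ m)" .
    qed (use dt_pos[of "b + m"] in simp)
    also have "\<dots> = dt (b + m) * (real (2 ^ m) * (\<Sum>j<c'. ?W j))"
      unfolding atLeast0LessThan by (subst sum_div_const) auto
    also have "\<dots> = dt b * (\<Sum>j<c'. ?W j)"
    proof -
      have "dt (b + m) * real (2 ^ m) = dt b" by (simp add: power_add)
      then show ?thesis by (simp only: mult.assoc[symmetric])
    qed
    also have "(\<Sum>j<c'. ?W j) = \<sigma>\<^sup>2 * ((k (n - 1))\<^sup>2 * (C (n - 1) * (\<Sum>j<c'. E (n - 1) (dy T b j) (dy T b (Suc j)))) + (k n)\<^sup>2 * (C (Suc n) * (\<Sum>j<c'. E (Suc n) (dy T b j) (dy T b (Suc j)))))"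
      by (simp only: sum.distrib flip: sum_distrib_left)
    also have "dt b * \<dots> \<le> dt b * D n"
      unfolding D_def using dt_pos[of b] C_pos
      by (intro mult_left_mono add_mono sum_E_grid_le[OF c']) (auto intro: less_imp_le)
    finally show "(\<integral>z. (Dm m z)\<^sup>2 \<partial>M) \<le> D n * dt b" by (simp only: mult.commute)
  qed
  define Cs where "Cs z = (\<Sum>l<c'. \<Sum>i=1..n. w n b l i z * dB b l i z)" for z
  have Csm: "Cs \<in> borel_measurable M"
    unfolding Cs_def[abs_def] using c' by (intro borel_measurable_sum borel_measurable_times w_measurable dB_measurable) auto
  \<comment> \<open>At time 0 the equation has an empty noise sum, so \<open>X n\<close> starts at
    \<open>x n\<close> almost everywhere.\<close>
  have N0: "AE z in M. N n (dy T b 0) z = 0"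
  proof -
    have "conv_prob M (\<lambda>m z. 0) (N n 0)" using X_eq[OF n, of 0 b] by (simp add: N_def[abs_def])
    then obtain r :: "nat \<Rightarrow> nat" where "AE z in M. \<forall>i\<in>{()}. (\<lambda>k. 0) \<longlonglongrightarrow> N n 0 z"
      using conv_prob_AE_subseq[of "{()}" "\<lambda>_ m z. 0" "\<lambda>_. N n 0"] by auto
    then show ?thesis by (eventually_elim) (auto dest: LIMSEQ_unique[OF tendsto_const])
  qed
  have fine: "(\<Sum>l<c' * 2 ^ m. \<Sum>i=1..n. w n (b + m) l i z * dB (b + m) l i z) - Cs z = Dm m z" for m z
  proof -
    have "Cs z = (\<Sum>l<c' * 2 ^ m. \<Sum>i=1..n. w n b (l div 2 ^ m) i z * dB (b + m) l i z)"
    proof -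
      have "(\<Sum>l<c' * 2 ^ m. \<Sum>i=1..n. w n b (l div 2 ^ m) i z * dB (b + m) l i z) =
        (\<Sum>j<c'. \<Sum>l=j * 2 ^ m..<j * 2 ^ m + 2 ^ m. \<Sum>i=1..n. w n b (l div 2 ^ m) i z * dB (b + m) l i z)"
        by (rule sum_group_div)
      also have "\<dots> = (\<Sum>j<c'. \<Sum>i=1..n. w n b j i z * dB b j i z)"
      proof (rule sum.cong[OF refl])
        fix j :: nat
        have dv: "l div 2 ^ m = j" if "l \<in> {j * 2 ^ m..<j * 2 ^ m + 2 ^ m}" for l
          using that by (intro div_nat_eqI) (auto simp: mult.commute)
        have tel: "(\<Sum>l=j * 2 ^ m..<j * 2 ^ m + 2 ^ m. dB (b + m) l i z) = dB b j i z" for i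
        proof -
          have "(\<Sum>l=j * 2 ^ m..<j * 2 ^ m + 2 ^ m. dB (b + m) l i z) = B i (dy T (b + m) (j * 2 ^ m + 2 ^ m)) z - B i (dy T (b + m) (j * 2 ^ m)) z"
            unfolding dB_def by (rule sum_Suc_diff') simp
          moreover have "j * 2 ^ m + 2 ^ m = Suc j * 2 ^ m" by simp
          ultimately show ?thesis unfolding dB_def by (simp only: dy_refine)
        qed
        have "(\<Sum>l=j * 2 ^ m..<j * 2 ^ m + 2 ^ m. \<Sum>i=1..n. w n b (l div 2 ^ m) i z * dB (b + m) l i z) =
          (\<Sum>l=j * 2 ^ m..<j * 2 ^ m + 2 ^ m. \<Sum>i=1..n. w n b j i z * dB (b + m) l i z)"
          by (intro sum.cong refl) (simp only: dv)
        also have "\<dots> = (\<Sum>i=1..n. w n b j i z * (\<Sum>l=j * 2 ^ m..<j * 2 ^ m + 2 ^ m. dB (b + m) l i z))"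
          by (subst sum.swap) (simp only: sum_distrib_left)
        finally show "(\<Sum>l=j * 2 ^ m..<j * 2 ^ m + 2 ^ m. \<Sum>i=1..n. w n b (l div 2 ^ m) i z * dB (b + m) l i z) = (\<Sum>i=1..n. w n b j i z * dB b j i z)"
          by (simp only: tel)
      qed
      finally show ?thesis by (simp only: Cs_def)
    qed
    then show ?thesis
      by (simp add: Dm_def U_def atLeast0LessThan sum_subtractf[symmetric] left_diff_distrib)
  qed
  have "conv_prob M (\<lambda>m z. (\<Sum>l<c' * 2 ^ m. \<Sum>i=1..n. w n (b + m) l i z * dB (b + m) l i z) - Cs z) (\<lambda>z. (N n (dy T b c') z - N n (dy T b 0) z) - Cs z)"
    using conv_prob_diff[OF increment_conv[OF n le0 c'] conv_prob_const[OF Csm]] by (simp add: atLeast0LessThan)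
  then have conv: "conv_prob M Dm (\<lambda>z. (N n (dy T b c') z - N n (dy T b 0) z) - Cs z)" by (simp only: fine)
  have \<epsilon>m: "\<epsilon> \<in> borel_measurable M"
  proof -
    have "N n t \<in> borel_measurable M" if "t \<in> {0..T}" for t
      unfolding N_def[abs_def]
      by (intro borel_measurable_add borel_measurable_diff borel_measurable_times borel_measurable_const X_measurable that measurable_integral_continuous continuous_on_subset[OF X_cont]) (use that in auto)
    from borel_measurable_diff[OF this[OF dy_mem[OF T_pos c']] Csm] show ?thesis unfolding \<epsilon>_def Cs_def .
  qed
  have "conv_prob M Dm \<epsilon>"
    by (rule conv_prob_cong_AE[OF conv _ \<epsilon>m]) (use N0 in eventually_elim, simp add: \<epsilon>_def Cs_def)
  then obtain r :: "nat \<Rightarrow> nat" where "AE z in M. \<forall>i\<in>{()}. (\<lambda>k. Dm (r k) z) \<longlonglongrightarrow> \<epsilon> z"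
    using conv_prob_AE_subseq[of "{()}" "\<lambda>_. Dm" "\<lambda>_. \<epsilon>"] by auto
  then have lim: "AE z in M. (\<lambda>k. (Dm (r k) z)\<^sup>2) \<longlonglongrightarrow> (\<epsilon> z)\<^sup>2"
    by eventually_elim (intro tendsto_power, simp)
  show ?g1 ?g2
    using integral_Fatou_le[where f="\<lambda>k z. (Dm (r k) z)\<^sup>2", OF L2(1) _ L2(2) tendsto_const lim] \<epsilon>m by auto
qed

text \<open>The same comparison of fine and coarse grid as for the noise, with Cauchy-Schwarz for
  sums in place of the isometry.\<close>

lemma drift_error:
  fixes n :: nat
  assumes c': "c' \<le> 2 ^ b"
  defines "\<epsilon> \<equiv> \<lambda>z. integral {0..dy T b c'} (\<lambda>u. X n u z) - dt b * (\<Sum>l<c'. X n (dy T b l) z)"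
  shows "integrable M (\<lambda>z. (\<epsilon> z)\<^sup>2)" (is ?g1) "(\<integral>z. (\<epsilon> z)\<^sup>2 \<partial>M) \<le> T * C n * E n 0 T * dt b" (is ?g2)
proof -
  define U where "U m l z = X n (dy T (b + m) l) z - X n (dy T b (l div 2 ^ m)) z" for m l z
  define Dm where "Dm m z = dt (b + m) * (\<Sum>l<c' * 2 ^ m. U m l z)" for m z
  have Uint: "integrable M (\<lambda>z. (U m l z)\<^sup>2)" if "l < c' * 2 ^ m" for m l
    unfolding U_def by (rule fine_coarse(1)[OF that c'])
  have jl: "l div 2 ^ m \<le> 2 ^ b" "l \<le> 2 ^ (b + m)" if "l < c' * 2 ^ m" for l m
  proof -
    have *: "l div 2 ^ m < c'" using that by (simp add: less_mult_imp_div_less)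
    show "l div 2 ^ m \<le> 2 ^ b" using * c' by linarith
    show "l \<le> 2 ^ (b + m)" using that mult_pow_le[OF c', of m] by linarith
  qed
  have Um: "U m l \<in> borel_measurable M" if "l < c' * 2 ^ m" for m l
    unfolding U_def[abs_def] by (intro borel_measurable_diff X_measurable dy_mem T_pos jl[OF that])
  have pw: "(Dm m z)\<^sup>2 \<le> T * dt (b + m) * (\<Sum>l<c' * 2 ^ m. (U m l z)\<^sup>2)" for m z
  proof -
    have "(Dm m z)\<^sup>2 = (dt (b + m))\<^sup>2 * (\<Sum>l<c' * 2 ^ m. U m l z)\<^sup>2" unfolding Dm_def by (rule power_mult_distrib)
    also have "(\<Sum>l<c' * 2 ^ m. U m l z)\<^sup>2 \<le> real (c' * 2 ^ m) * (\<Sum>l<c' * 2 ^ m. (U m l z)\<^sup>2)"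
      using sum_squared_le_sum_of_squares[of "\<lambda>l. U m l z" "{..<c' * 2 ^ m}"] by (simp add: mult.commute)
    also have "(dt (b + m))\<^sup>2 * (real (c' * 2 ^ m) * (\<Sum>l<c' * 2 ^ m. (U m l z)\<^sup>2)) \<le> (dt (b + m))\<^sup>2 * (2 ^ (b + m) * (\<Sum>l<c' * 2 ^ m. (U m l z)\<^sup>2))"
    proof (intro mult_left_mono mult_right_mono)
      have "real (c' * 2 ^ m) \<le> real (2 ^ (b + m))" using mult_pow_le[OF c', of m] by (simp only: of_nat_le_iff)
      then show "real (c' * 2 ^ m) \<le> 2 ^ (b + m)" by simp
    qed (auto intro: sum_nonneg)
    also have "\<dots> = T * dt (b + m) * (\<Sum>l<c' * 2 ^ m. (U m l z)\<^sup>2)"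
      by (simp add: power2_eq_square)
    finally show ?thesis by (simp add: mult_left_mono)
  qed
  have ib: "integrable M (\<lambda>z. T * dt (b + m) * (\<Sum>l<c' * 2 ^ m. (U m l z)\<^sup>2))" for m
    by (intro integrable_mult_right L1_sum Uint) auto
  have Dm: "Dm m \<in> borel_measurable M" for m
    unfolding Dm_def[abs_def] by (intro borel_measurable_times borel_measurable_const borel_measurable_sum Um) auto
  have i: "integrable M (\<lambda>z. (Dm m z)\<^sup>2)" for m
  proof (rule L1_bound[OF ib])
    show "(\<lambda>z. (Dm m z)\<^sup>2) \<in> borel_measurable M" by (intro borel_measurable_power Dm)
    show "AE z in M. norm ((Dm m z)\<^sup>2) \<le> norm (T * dt (b + m) * (\<Sum>l<c' * 2 ^ m. (U m l z)\<^sup>2))"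
      using pw by (intro AE_I2) (simp only: real_norm_def abs_power2, rule order.trans[OF _ abs_ge_self])
  qed
  have le: "(\<integral>z. (Dm m z)\<^sup>2 \<partial>M) \<le> T * C n * E n 0 T * dt b" for m
  proof -
    have "(\<integral>z. (Dm m z)\<^sup>2 \<partial>M) \<le> (\<integral>z. T * dt (b + m) * (\<Sum>l<c' * 2 ^ m. (U m l z)\<^sup>2) \<partial>M)"
      by (rule integral_mono[OF i ib pw])
    also have "\<dots> = T * dt (b + m) * (\<Sum>l<c' * 2 ^ m. \<integral>z. (U m l z)\<^sup>2 \<partial>M)"
      using Uint by (subst integral_mult_right_zero, subst Bochner_Integration.integral_sum) auto
    also have "\<dots> \<le> T * dt (b + m) * (\<Sum>l<c' * 2 ^ m. C n * E n (dy T b (l div 2 ^ m)) (dy T b (Suc (l div 2 ^ m))))"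
      using T_pos dt_pos[of "b + m"] by (intro mult_left_mono sum_mono) (auto simp: U_def intro!: fine_coarse(2) c')
    also have "\<dots> = T * dt (b + m) * (real (2 ^ m) * (\<Sum>j<c'. C n * E n (dy T b j) (dy T b (Suc j))))"
      by (subst sum_div_const) auto
    also have "\<dots> = T * dt b * (C n * (\<Sum>j<c'. E n (dy T b j) (dy T b (Suc j))))"
      by (simp add: sum_distrib_left power_add mult.assoc)
    also have "\<dots> \<le> T * dt b * (C n * E n 0 T)"
      using T_pos dt_pos[of b] C_pos[of n] by (intro mult_left_mono sum_E_grid_le c') auto
    finally show ?thesis by (simp add: mult_ac)
  qed
  have conv: "(\<lambda>m. Dm m z) \<longlonglongrightarrow> \<epsilon> z" if w: "z \<in> space M" for z
  proof -
    have "dt b * (\<Sum>l<c'. X n (dy T b l) z) = dt (b + m) * (\<Sum>l<c' * 2 ^ m. X n (dy T b (l div 2 ^ m)) z)" for m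
      by (subst sum_div_const[where f="\<lambda>j. X n (dy T b j) z"]) (auto simp: power_add)
    then have "Dm m z = (\<Sum>l<c' * 2 ^ m. X n (dy T (b + m) l) z * dt (b + m)) - dt b * (\<Sum>l<c'. X n (dy T b l) z)" for m
      by (simp add: Dm_def U_def sum_subtractf right_diff_distrib sum_distrib_left mult.commute)
    then show ?thesis
      unfolding \<epsilon>_def using riemann_limit'[OF X_cont[OF w] T_pos c', of n] by (simp only:) (intro tendsto_diff tendsto_const)
  qed
  have \<epsilon>m: "\<epsilon> \<in> borel_measurable M"
    by (rule borel_measurable_LIMSEQ_real[OF conv Dm])
  have lim: "AE z in M. (\<lambda>m. (Dm m z)\<^sup>2) \<longlonglongrightarrow> (\<epsilon> z)\<^sup>2"
    by (intro AE_I2 tendsto_power conv)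
  show ?g1 ?g2
    using integral_Fatou_le[where f="\<lambda>m z. (Dm m z)\<^sup>2", OF i _ le tendsto_const lim] \<epsilon>m by auto
qed

end

text \<open>Asymptotic upper bounds for the time-integrated mean square distance between component n
  and its K-th Picard iterate, starting from the energies v. The weighted average of the neighbours
  comes from the energy balance; the minimum with \<open>v n\<close> keeps the bounds below the
  energies and makes them decrease in K. With \<open>k 0 = 0\<close> the quotient at n = 0 is a
  division by 0, hence 0.\<close>

fun subharmonic_iterate :: "(nat \<Rightarrow> real) \<Rightarrow> (nat \<Rightarrow> real) \<Rightarrow> nat \<Rightarrow> nat \<Rightarrow> real" where
  "subharmonic_iterate k v 0 n = v n"
| "subharmonic_iterate k v (Suc K) n = min (v n)
    (((k (n - 1))\<^sup>2 * subharmonic_iterate k v K (n - 1) + (k n)\<^sup>2 * subharmonic_iterate k v K (Suc n)) / ((k n)\<^sup>2 + (k (n - 1))\<^sup>2))"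

text \<open>Monotonicity in K gives a limit, which inherits subharmonicity and the bound v;
  monotonicity in n then squeezes this limit to 0.\<close>

lemma subharmonic_iterate_tendsto_0:
  assumes k0: "k 0 = 0" and kpos: "\<And>n. n \<ge> 1 \<Longrightarrow> k n > 0" and v: "\<And>n. 0 \<le> v n" "v \<longlonglongrightarrow> 0" and n: "n \<ge> 1"
  shows "(\<lambda>K. subharmonic_iterate k v K n) \<longlonglongrightarrow> 0"
proof -
  let ?u = "subharmonic_iterate k v"
  have nn: "0 \<le> ?u K n" for K n
    by (induction K arbitrary: n) (auto simp: v intro!: divide_nonneg_nonneg add_nonneg_nonneg)
  have dec: "?u (Suc K) n \<le> ?u K n" for K n
  proof (induction K arbitrary: n)
    case (Suc K)
    have "((k (n - 1))\<^sup>2 * ?u (Suc K) (n - 1) + (k n)\<^sup>2 * ?u (Suc K) (Suc n)) / ((k n)\<^sup>2 + (k (n - 1))\<^sup>2)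
      \<le> ((k (n - 1))\<^sup>2 * ?u K (n - 1) + (k n)\<^sup>2 * ?u K (Suc n)) / ((k n)\<^sup>2 + (k (n - 1))\<^sup>2)"
      by (intro divide_right_mono add_mono mult_left_mono Suc.IH) auto
    then show ?case by (subst (1 2) subharmonic_iterate.simps(2)) (rule min.mono[OF order.refl])
  qed simp
  then have "decseq (\<lambda>K. ?u K n)" for n by (intro decseq_SucI)
  then have "\<exists>l. (\<lambda>K. ?u K n) \<longlonglongrightarrow> l" for n
    using decseq_convergent[of "\<lambda>K. ?u K n" 0] nn by metis
  then obtain u where u: "\<And>n. (\<lambda>K. ?u K n) \<longlonglongrightarrow> u n" by metis
  have u0: "0 \<le> u n" for n by (rule LIMSEQ_le_const[OF u]) (use nn in auto)
  have uv: "u n \<le> v n" for n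
  proof (rule LIMSEQ_le_const2[OF u])
    have "?u K n \<le> v n" for K by (cases K) auto
    then show "\<exists>N. \<forall>K\<ge>N. ?u K n \<le> v n" by auto
  qed
  have sub: "((k n)\<^sup>2 + (k (n - 1))\<^sup>2) * u n \<le> (k (n - 1))\<^sup>2 * u (n - 1) + (k n)\<^sup>2 * u (Suc n)" if n: "n \<ge> 1" for n
  proof -
    have q: "(k n)\<^sup>2 + (k (n - 1))\<^sup>2 > 0" using kpos[OF n] by (simp add: add_pos_nonneg)
    have "u n \<le> ((k (n - 1))\<^sup>2 * u (n - 1) + (k n)\<^sup>2 * u (Suc n)) / ((k n)\<^sup>2 + (k (n - 1))\<^sup>2)"
    proof (rule LIMSEQ_le[OF LIMSEQ_Suc[OF u]])
      show "(\<lambda>K. ((k (n - 1))\<^sup>2 * ?u K (n - 1) + (k n)\<^sup>2 * ?u K (Suc n)) / ((k n)\<^sup>2 + (k (n - 1))\<^sup>2))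
        \<longlonglongrightarrow> ((k (n - 1))\<^sup>2 * u (n - 1) + (k n)\<^sup>2 * u (Suc n)) / ((k n)\<^sup>2 + (k (n - 1))\<^sup>2)"
        using q by (intro tendsto_intros u) auto
    qed auto
    then show ?thesis using q by (simp add: pos_le_divide_eq mult.commute)
  qed
  \<comment> \<open>Rearranged, subharmonicity says that the flux k_n^2 (u_{n+1} - u_n) does not
    decrease in n. It starts at 0 because \<open>k 0 = 0\<close>.\<close>
  have flux: "0 \<le> (k n)\<^sup>2 * (u (Suc n) - u n)" for n
  proof (induction n)
    case (Suc n)
    have "(k n)\<^sup>2 * (u (Suc n) - u n) \<le> (k (Suc n))\<^sup>2 * (u (Suc (Suc n)) - u (Suc n))"
      using sub[of "Suc n"] by (simp add: algebra_simps)
    then show ?case using Suc by linarith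
  qed (simp add: k0)
  have inc: "u n \<le> u (Suc n)" if "n \<ge> 1" for n
    using flux[of n] kpos[OF that] by (simp add: zero_le_mult_iff)
  have mono: "u n \<le> u (n + m)" for m
    by (induction m) (use n inc in \<open>auto intro: order.trans\<close>)
  have "u n \<le> 0"
  proof (rule LIMSEQ_le_const[OF v(2)])
    have "u n \<le> v m" if "m \<ge> n" for m
      using mono[of "m - n"] uv[of m] that by simp
    then show "\<exists>N. \<forall>m\<ge>N. u n \<le> v m" by auto
  qed
  then show ?thesis using u[of n] u0[of n] by simp
qed

text \<open>The damping acts on the scheme's own value, while the noise coefficients are read off
  the prescribed family z. Leaving the damping with the unknown gives the mean squares the
  contraction factor (1 - c d)^2, against which the neighbours are weighed.\<close>

fun euler :: "real \<Rightarrow> (nat \<Rightarrow> real) \<Rightarrow> real \<Rightarrow> real \<Rightarrow> nat \<Rightarrow> (nat \<Rightarrow> nat \<Rightarrow> real) \<Rightarrow> (nat \<Rightarrow> nat \<Rightarrow> real) \<Rightarrow> nat \<Rightarrow> real" where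
  "euler \<sigma> k d a n z \<beta> 0 = a"
| "euler \<sigma> k d a n z \<beta> (Suc j) = (1 - cn \<sigma> k n * d) * euler \<sigma> k d a n z \<beta> j + (\<Sum>i=1..n. cf \<sigma> k n i (\<lambda>p. z p j) * \<beta> j i)"

text \<open>Only grid increments \<beta> enter, so each iterate is an explicit measurable function
  of the noise. Iteration K + 1 reads the neighbours from iteration K.\<close>

fun picard :: "real \<Rightarrow> (nat \<Rightarrow> real) \<Rightarrow> (nat \<Rightarrow> real) \<Rightarrow> real \<Rightarrow> (nat \<Rightarrow> nat \<Rightarrow> real) \<Rightarrow> nat \<Rightarrow> nat \<Rightarrow> nat \<Rightarrow> real" where
  "picard \<sigma> k x d \<beta> 0 n j = 0"
| "picard \<sigma> k x d \<beta> (Suc K) n j = (if n = 0 then 0 else euler \<sigma> k d (x n) n (\<lambda>p l. picard \<sigma> k x d \<beta> K p l) \<beta> j)"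

lemma euler_diff:
  "euler \<sigma> k d a n z \<beta> j - euler \<sigma> k d a' n z' \<beta> j = euler \<sigma> k d (a - a') n (\<lambda>p l. z p l - z' p l) \<beta> j"
proof (induction j)
  case (Suc j)
  have "(\<Sum>i=1..n. cf \<sigma> k n i (\<lambda>p. z p j) * \<beta> j i) - (\<Sum>i=1..n. cf \<sigma> k n i (\<lambda>p. z' p j) * \<beta> j i)
    = (\<Sum>i=1..n. cf \<sigma> k n i (\<lambda>p. z p j - z' p j) * \<beta> j i)"
    by (simp add: cf_diff sum_subtractf left_diff_distrib)
  with Suc show ?case by (simp add: algebra_simps)
qed simp

lemma euler_sum:
  "euler \<sigma> k d a n z \<beta> j = a + (\<Sum>l<j. \<Sum>i=1..n. cf \<sigma> k n i (\<lambda>p. z p l) * \<beta> l i) - cn \<sigma> k n * d * (\<Sum>l<j. euler \<sigma> k d a n z \<beta> l)"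
  by (induction j) (auto simp: algebra_simps)

lemma geometric_source_le:
  fixes h e :: "nat \<Rightarrow> real"
  assumes r: "0 \<le> r" "r \<le> 1" and h: "\<And>j. j < J \<Longrightarrow> \<bar>h (Suc j)\<bar> \<le> r * \<bar>h j\<bar> + e j" and j: "j \<le> J"
  shows "\<bar>h j\<bar> \<le> \<bar>h 0\<bar> + (\<Sum>l<j. e l)"
  using j
proof (induction j)
  case (Suc j)
  have "\<bar>h (Suc j)\<bar> \<le> r * \<bar>h j\<bar> + e j" using Suc.prems by (intro h) simp
  also have "r * \<bar>h j\<bar> \<le> \<bar>h j\<bar>" using r by (simp add: mult_left_le_one_le)
  finally show ?case using Suc by simp
qed simp

lemma power2_young:
  fixes a b \<epsilon> :: real
  assumes "\<epsilon> > 0"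
  shows "(a + b)\<^sup>2 \<le> (1 + \<epsilon>) * a\<^sup>2 + (1 + 1 / \<epsilon>) * b\<^sup>2"
proof -
  have "0 \<le> (\<epsilon> * a - b)\<^sup>2 / \<epsilon>" using assms by simp
  also have "\<dots> = \<epsilon> * a\<^sup>2 - 2 * a * b + b\<^sup>2 / \<epsilon>" using assms by (simp add: power2_eq_square field_simps)
  finally show ?thesis by (simp add: power2_eq_square algebra_simps)
qed

lemma L2_add:
  fixes f g :: "'a \<Rightarrow> real"
  assumes [measurable]: "f \<in> borel_measurable M" "g \<in> borel_measurable M"
    and i: "integrable M (\<lambda>z. (f z)\<^sup>2)" "integrable M (\<lambda>z. (g z)\<^sup>2)"
  shows "integrable M (\<lambda>z. (f z + g z)\<^sup>2)" (is ?g1)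
    and "\<epsilon> > 0 \<Longrightarrow> (\<integral>z. (f z + g z)\<^sup>2 \<partial>M) \<le> (1 + \<epsilon>) * (\<integral>z. (f z)\<^sup>2 \<partial>M) + (1 + 1 / \<epsilon>) * (\<integral>z. (g z)\<^sup>2 \<partial>M)"
proof -
  have ib: "integrable M (\<lambda>z. (1 + e) * (f z)\<^sup>2 + (1 + 1 / e) * (g z)\<^sup>2)" for e using i by simp
  show i': ?g1
  proof (rule L1_bound[OF ib[of 1]])
    show "AE z in M. norm ((f z + g z)\<^sup>2) \<le> norm ((1 + 1) * (f z)\<^sup>2 + (1 + 1 / 1) * (g z)\<^sup>2)"
      using power2_young[of 1] by (intro AE_I2) (simp only: real_norm_def abs_power2, rule order.trans[OF _ abs_ge_self], simp)
  qed simp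
  assume e: "\<epsilon> > 0"
  have "(\<integral>z. (f z + g z)\<^sup>2 \<partial>M) \<le> (\<integral>z. (1 + \<epsilon>) * (f z)\<^sup>2 + (1 + 1 / \<epsilon>) * (g z)\<^sup>2 \<partial>M)"
    by (rule integral_mono[OF i' ib power2_young[OF e]])
  then show "(\<integral>z. (f z + g z)\<^sup>2 \<partial>M) \<le> (1 + \<epsilon>) * (\<integral>z. (f z)\<^sup>2 \<partial>M) + (1 + 1 / \<epsilon>) * (\<integral>z. (g z)\<^sup>2 \<partial>M)"
    using i by simp
qed

section \<open>Mean squares of the Euler scheme and moments of the solution\<close>

context linear_system
begin

definition sqi :: "nat \<Rightarrow> nat \<Rightarrow> ('a \<Rightarrow> real) \<Rightarrow> bool" where
  "sqi m j Y \<longleftrightarrow> Y \<in> borel_measurable (F (dy T m j)) \<and> integrable M (\<lambda>z. (Y z)\<^sup>2)"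

lemma sqi_measurable: "sqi m j Y \<Longrightarrow> j \<le> 2 ^ m \<Longrightarrow> Y \<in> borel_measurable M"
  unfolding sqi_def by (rule F_dy_M[OF conjunct1])

lemma sqi_cmult: "sqi m j Y \<Longrightarrow> sqi m j (\<lambda>z. a * Y z)"
  unfolding sqi_def power_mult_distrib by auto

lemma sqi_diff: "sqi m j Y \<Longrightarrow> sqi m j Z \<Longrightarrow> j \<le> 2 ^ m \<Longrightarrow> sqi m j (\<lambda>z. Y z - Z z)"
  using L2_add(1)[of Y M "\<lambda>z. - Z z", OF sqi_measurable[of m j Y] borel_measurable_uminus[OF sqi_measurable[of m j Z]]]
    borel_measurable_diff[of Y "F (dy T m j)" Z] by (simp add: sqi_def)

lemma sqi_cf:
  assumes "\<And>p. sqi m j (Z p)"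
  shows "sqi m j (\<lambda>z. cf \<sigma> k n i (\<lambda>p. Z p z))"
proof -
  have eq: "(\<lambda>z. cf \<sigma> k n i (\<lambda>p. Z p z)) = (if i = n then (\<lambda>z. - (\<sigma> * k n) * Z (Suc n) z) else if Suc i = n then (\<lambda>z. (\<sigma> * k i) * Z i z) else (\<lambda>z. 0 * Z 0 z))"
    by (auto simp: cf_def)
  show ?thesis unfolding eq by (rule sqi_cmult[OF assms] | split if_split | intro conjI impI)+
qed

text \<open>One exact isometry per step: the previous value and the coefficients are known at time
  j, the increments are independent of them. Equality matters: a constant above 1 in front of the
  source would spoil the balance in \<open>h_dissipation\<close>.\<close>

lemma euler_step:
  fixes a :: real
  assumes n: "n \<ge> 1" and J: "J \<le> 2 ^ b" and Z: "\<And>l p. l < J \<Longrightarrow> sqi b l (Z p l)"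
  defines "Y \<equiv> \<lambda>j z. euler \<sigma> k (dt b) a n (\<lambda>p l. Z p l z) (\<lambda>l i. dB b l i z) j"
  shows "j \<le> J \<Longrightarrow> sqi b j (Y j)"
    and "j < J \<Longrightarrow> (\<integral>z. (Y (Suc j) z)\<^sup>2 \<partial>M) = (1 - c n * dt b)\<^sup>2 * (\<integral>z. (Y j z)\<^sup>2 \<partial>M)
      + dt b * (\<sigma>\<^sup>2 * ((k (n - 1))\<^sup>2 * (\<integral>z. (Z (n - 1) j z)\<^sup>2 \<partial>M) + (k n)\<^sup>2 * (\<integral>z. (Z (Suc n) j z)\<^sup>2 \<partial>M)))"
proof -
  let ?U = "\<lambda>j i z. cf \<sigma> k n i (\<lambda>p. Z p j z)"
  have S: "finite {1..n}" "{1..n} \<subseteq> {1..}" by auto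
  have eq: "Y (Suc j) z = (1 - c n * dt b) * Y j z + (\<Sum>i=1..n. ?U j i z * dB b j i z)" for j z
    by (simp add: Y_def)
  have st: "integrable M (\<lambda>z. (Y (Suc j) z)\<^sup>2) \<and> (\<integral>z. (Y (Suc j) z)\<^sup>2 \<partial>M) = (1 - c n * dt b)\<^sup>2 * (\<integral>z. (Y j z)\<^sup>2 \<partial>M)
      + dt b * (\<Sum>i=1..n. \<integral>z. (?U j i z)\<^sup>2 \<partial>M)" if j: "j < J" and Y: "sqi b j (Y j)" for j
  proof -
    have jb: "j < 2 ^ b" using j J by simp
    note Yc = sqi_cmult[OF Y, of "1 - c n * dt b", unfolded sqi_def]
    note U = sqi_cf[OF Z[OF j], unfolded sqi_def]
    note L2 = L2_step[OF S jb conjunct1[OF Yc] conjunct2[OF Yc] conjunct1[OF U] conjunct2[OF U]]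
    have "(\<integral>z. ((1 - c n * dt b) * Y j z)\<^sup>2 \<partial>M) = (1 - c n * dt b)\<^sup>2 * (\<integral>z. (Y j z)\<^sup>2 \<partial>M)"
      unfolding power_mult_distrib by (rule integral_mult_right_zero)
    then show ?thesis unfolding eq using L2 by (intro conjI) (simp_all only:)
  qed
  show sq: "sqi b j (Y j)" if "j \<le> J" for j
    using that
  proof (induction j)
    case 0
    then show ?case by (simp add: sqi_def Y_def)
  next
    case (Suc j)
    then have j: "j < J" and Y: "sqi b j (Y j)" by auto
    have jb: "j < 2 ^ b" using j J by simp
    have "Y (Suc j) \<in> borel_measurable (F (dy T b (Suc j)))"
      unfolding eq[abs_def]
    proof (intro borel_measurable_add borel_measurable_sum borel_measurable_times borel_measurable_const)
      show "Y j \<in> borel_measurable (F (dy T b (Suc j)))"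
        using jb by (intro F_measurable_dy[OF conjunct1[OF Y[unfolded sqi_def]]]) auto
      fix i assume i: "i \<in> {1..n}"
      show "?U j i \<in> borel_measurable (F (dy T b (Suc j)))"
        using jb by (intro F_measurable_dy[OF conjunct1[OF sqi_cf[OF Z[OF j], unfolded sqi_def]]]) auto
      show "dB b j i \<in> borel_measurable (F (dy T b (Suc j)))" using i jb by (intro dB_adapted) auto
    qed
    then show ?case using st[OF j Y] by (simp add: sqi_def)
  qed
  show "(\<integral>z. (Y (Suc j) z)\<^sup>2 \<partial>M) = (1 - c n * dt b)\<^sup>2 * (\<integral>z. (Y j z)\<^sup>2 \<partial>M)
      + dt b * (\<sigma>\<^sup>2 * ((k (n - 1))\<^sup>2 * (\<integral>z. (Z (n - 1) j z)\<^sup>2 \<partial>M) + (k n)\<^sup>2 * (\<integral>z. (Z (Suc n) j z)\<^sup>2 \<partial>M)))" if j: "j < J" for j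
  proof -
    have U: "integrable M (\<lambda>z. (?U j i z)\<^sup>2)" for i using sqi_cf[OF Z[OF j]] by (simp add: sqi_def)
    have Zi: "integrable M (\<lambda>z. (Z p j z)\<^sup>2)" for p using Z[OF j] by (simp add: sqi_def)
    have "(\<Sum>i=1..n. \<integral>z. (?U j i z)\<^sup>2 \<partial>M) = (\<integral>z. (\<Sum>i=1..n. (?U j i z)\<^sup>2) \<partial>M)"
      by (rule Bochner_Integration.integral_sum[symmetric]) (rule U)
    also have "\<dots> = \<sigma>\<^sup>2 * ((k (n - 1))\<^sup>2 * (\<integral>z. (Z (n - 1) j z)\<^sup>2 \<partial>M) + (k n)\<^sup>2 * (\<integral>z. (Z (Suc n) j z)\<^sup>2 \<partial>M))"
      unfolding sum_cf_square[of k, OF k0 n] using Zi by simp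
    finally show ?thesis using st[OF j sq[of j]] j by simp
  qed
qed

lemma X_start: "n \<ge> 1 \<Longrightarrow> AE z in M. X n 0 z = x n"
proof -
  assume n: "n \<ge> 1"
  have "conv_prob M (\<lambda>m z. 0) (\<lambda>z. X n 0 z - x n)" using X_eq[OF n, of 0 0] by simp
  then obtain r :: "nat \<Rightarrow> nat" where "AE z in M. \<forall>i\<in>{()}. (\<lambda>m. 0) \<longlonglongrightarrow> X n 0 z - x n"
    using conv_prob_AE_subseq[of "{()}" "\<lambda>_ m z. 0" "\<lambda>_ z. X n 0 z - x n"] by auto
  then show ?thesis by eventually_elim (auto dest: LIMSEQ_unique[OF tendsto_const])
qed

definition P :: "nat \<Rightarrow> real" where "P n = 2 * (x n)\<^sup>2 + 2 * (C n * E n 0 T)"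

text \<open>The initial value is deterministic, so the bound for increments from time 0 yields
  moments at all grid times.\<close>

lemma X_second_moment:
  assumes j: "j \<le> 2 ^ b"
  shows "sqi b j (X n (dy T b j))" "(\<integral>z. (X n (dy T b j) z)\<^sup>2 \<partial>M) \<le> P n" (is ?g1)
proof -
  have m: "X n (dy T b j) \<in> borel_measurable (F (dy T b j))" by (intro X_adapted dy_mem T_pos j)
  have P0: "0 \<le> P n" unfolding P_def using C_pos[of n] E_nonneg[of 0 T n] by simp
  have "integrable M (\<lambda>z. (X n (dy T b j) z)\<^sup>2) \<and> (\<integral>z. (X n (dy T b j) z)\<^sup>2 \<partial>M) \<le> P n"
  proof (cases "n = 0")
    case True then show ?thesis using P0 by (simp add: X0)
  next
    case False
    then have n: "n \<ge> 1" by simp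
    let ?g = "\<lambda>z. X n (dy T b j) z - X n (dy T b 0) z"
    note inc = X_increment[OF le0 j, of n]
    have gm: "?g \<in> borel_measurable M" using j by (intro borel_measurable_diff X_measurable dy_mem T_pos) auto
    have ae: "AE z in M. (x n + ?g z)\<^sup>2 = (X n (dy T b j) z)\<^sup>2"
      using X_start[OF n] by eventually_elim simp
    note L = L2_add[OF borel_measurable_const gm _ inc(1), of "x n"]
    have Xm: "(\<lambda>z. (X n (dy T b j) z)\<^sup>2) \<in> borel_measurable M" by (intro borel_measurable_power X_measurable dy_mem T_pos j)
    have gm2: "(\<lambda>z. (x n + ?g z)\<^sup>2) \<in> borel_measurable M" using gm by simp
    have "integrable M (\<lambda>z. (X n (dy T b j) z)\<^sup>2)"
      using L(1) integrable_cong_AE[OF gm2 Xm ae] by simp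
    moreover have "(\<integral>z. (X n (dy T b j) z)\<^sup>2 \<partial>M) = (\<integral>z. (x n + ?g z)\<^sup>2 \<partial>M)"
      using integral_cong_AE[OF gm2 Xm ae] by simp
    moreover have "(\<integral>z. (x n + ?g z)\<^sup>2 \<partial>M) \<le> 2 * (x n)\<^sup>2 + 2 * (\<integral>z. (?g z)\<^sup>2 \<partial>M)"
      using L(2)[of 1] by (simp add: prob_space)
    moreover have "(\<integral>z. (?g z)\<^sup>2 \<partial>M) \<le> C n * E n 0 T"
    proof (rule order.trans[OF inc(2)] , rule mult_left_mono)
      show "E n (dy T b 0) (dy T b j) \<le> E n 0 T" using T_pos j by (intro E_mono) (auto intro: dy_nonneg dy_le)
    qed (use C_pos[of n] in simp)
    ultimately show ?thesis by (simp add: P_def)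
  qed
  then show "sqi b j (X n (dy T b j))" ?g1 using m by (auto simp: sqi_def)
qed

end

text \<open>The partial sums of \<open>F\<close> satisfy a recursion with factor 1 - q and source
  \<eta>, so no exponential constant of Gronwall type arises.\<close>

lemma drift_sum_le:
  fixes F \<eta> :: "nat \<Rightarrow> real"
  assumes q: "0 \<le> q" "q \<le> 1" and F: "\<And>j. j < J \<Longrightarrow> F j = \<eta> j - q * (\<Sum>l<j. F l)"
  shows "\<bar>\<Sum>l<J. F l\<bar> \<le> (\<Sum>l<J. \<bar>\<eta> l\<bar>)"
proof -
  have "\<bar>\<Sum>l<J. F l\<bar> \<le> \<bar>\<Sum>l<0. F l\<bar> + (\<Sum>l<J. \<bar>\<eta> l\<bar>)"
  proof (rule geometric_source_le[where h="\<lambda>j. \<Sum>l<j. F l", OF _ _ _ order.refl])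
    show "0 \<le> 1 - q" "1 - q \<le> 1" using q by auto
    fix j assume "j < J"
    from F[OF this] have "(\<Sum>l<Suc j. F l) = (1 - q) * (\<Sum>l<j. F l) + \<eta> j" by (simp add: algebra_simps)
    then have "\<bar>\<Sum>l<Suc j. F l\<bar> \<le> \<bar>(1 - q) * (\<Sum>l<j. F l)\<bar> + \<bar>\<eta> j\<bar>" by simp
    then show "\<bar>\<Sum>l<Suc j. F l\<bar> \<le> (1 - q) * \<bar>\<Sum>l<j. F l\<bar> + \<bar>\<eta> j\<bar>" using q by (simp add: abs_mult)
  qed
  then show ?thesis by simp
qed

lemma linear_recursion_le:
  fixes h :: "nat \<Rightarrow> real"
  assumes r: "0 \<le> r" "r \<le> 1" and e: "0 \<le> e" and h0: "h 0 \<le> 0"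
    and h: "\<And>j. j < J \<Longrightarrow> h (Suc j) \<le> r * h j + e" and j: "j \<le> J"
  shows "h j \<le> real j * e"
  using j
proof (induction j)
  case (Suc j)
  have "h (Suc j) \<le> r * h j + e" using Suc.prems by (intro h) simp
  also have "r * h j \<le> r * (real j * e)" using Suc r by (intro mult_left_mono) auto
  also have "r * (real j * e) \<le> real j * e" using r e by (intro mult_left_le_one_le) auto
  finally show ?case by (simp add: algebra_simps)
qed (use h0 in simp)

section \<open>Comparison of the solution with its Picard iterates\<close>

context linear_system
begin

abbreviation s :: "nat \<Rightarrow> real" where "s b \<equiv> sqrt (dt b)"

lemma dt_tendsto: "(\<lambda>b. dt b) \<longlonglongrightarrow> 0"
  using tendsto_mult[OF tendsto_const[of T] LIMSEQ_realpow_zero[of "1 / 2"]] by (simp add: power_one_over)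

lemma s_tendsto: "s \<longlonglongrightarrow> 0"
  using tendsto_real_sqrt[OF dt_tendsto] by simp

lemma s_pos: "s b > 0"
  using dt_pos[of b] by simp

text \<open>Young's inequality is used with weight s = sqrt dt: the main term gains only the factor
  1 + s, and an error of order dt costs a multiple of dt + s, so both corrections vanish as the grid
  is refined.\<close>

lemma s_young: "(1 + 1 / s b) * (r * dt b) = r * (dt b + s b)"
proof -
  have eq: "s b * s b = dt b" using dt_pos[of b] by (simp only: real_sqrt_mult_self abs_of_pos)
  have "s b * s b / s b = s b" by (rule nonzero_mult_div_cancel_left) (use s_pos[of b] in linarith)
  then have ds: "dt b / s b = s b" by (simp only: eq)
  have "(1 + 1 / u) * (r * d) = r * (d + d / u)" for u d :: real by (simp add: algebra_simps)
  then show ?thesis by (simp only: ds)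
qed

definition D2 :: "nat \<Rightarrow> real" where "D2 n = 2 * D n + 2 * ((c n)\<^sup>2 * (T * C n * E n 0 T))"

text \<open>The residual is the noise error plus the drift error multiplied by the damping, and both
  have mean squares of order dt.\<close>

lemma euler_residual:
  fixes n :: nat
  assumes n: "n \<ge> 1" and j: "j \<le> 2 ^ b"
  defines "\<eta> \<equiv> \<lambda>z. X n (dy T b j) z - (x n + (\<Sum>l<j. \<Sum>i=1..n. w n b l i z * dB b l i z) - c n * dt b * (\<Sum>l<j. X n (dy T b l) z))"
  shows "\<eta> \<in> borel_measurable M" "integrable M (\<lambda>z. (\<eta> z)\<^sup>2)" (is ?g1) "(\<integral>z. (\<eta> z)\<^sup>2 \<partial>M) \<le> D2 n * dt b" (is ?g2)
proof -
  let ?I = "\<lambda>z. integral {0..dy T b j} (\<lambda>u. X n u z)"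
  let ?W = "\<lambda>z. \<Sum>l<j. \<Sum>i=1..n. w n b l i z * dB b l i z"
  let ?S = "\<lambda>z. \<Sum>l<j. X n (dy T b l) z"
  let ?e1 = "\<lambda>z. N n (dy T b j) z - ?W z" and ?e2 = "\<lambda>z. - c n * (?I z - dt b * ?S z)"
  have dyj: "dy T b l \<in> {0..T}" if "l \<le> j" for l using that j by (intro dy_mem T_pos) simp
  have Xm: "X n (dy T b l) \<in> borel_measurable M" if "l \<le> j" for l by (intro X_measurable dyj that)
  have I: "?I \<in> borel_measurable M"
    using dyj[of j] by (intro measurable_integral_continuous continuous_on_subset[OF X_cont] X_measurable) auto
  have W: "?W \<in> borel_measurable M"
    using j by (intro borel_measurable_sum borel_measurable_times w_measurable dB_measurable) auto
  have S: "?S \<in> borel_measurable M" by (intro borel_measurable_sum Xm) auto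
  have e1: "?e1 \<in> borel_measurable M" unfolding N_def using I W Xm[OF order.refl] by measurable
  have e2: "?e2 \<in> borel_measurable M" using I S by measurable
  note ne = noise_error[OF n j] and de = drift_error[OF j, of n]
  have i2: "integrable M (\<lambda>z. (?e2 z)\<^sup>2)" unfolding power_mult_distrib using de(1) by simp
  have b2: "(\<integral>z. (?e2 z)\<^sup>2 \<partial>M) \<le> (c n)\<^sup>2 * (T * C n * E n 0 T * dt b)"
    unfolding power_mult_distrib integral_mult_right_zero power2_minus by (rule mult_left_mono[OF de(2)]) simp
  have eq: "\<eta> = (\<lambda>z. ?e1 z + ?e2 z)" unfolding \<eta>_def by (rule ext) (simp add: N_def algebra_simps)
  show "\<eta> \<in> borel_measurable M" unfolding eq by (rule borel_measurable_add[OF e1 e2])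
  note L = L2_add[OF e1 e2 ne(1) i2]
  show ?g1 unfolding eq by (rule L(1))
  have "(\<integral>z. (\<eta> z)\<^sup>2 \<partial>M) \<le> 2 * (\<integral>z. (?e1 z)\<^sup>2 \<partial>M) + 2 * (\<integral>z. (?e2 z)\<^sup>2 \<partial>M)"
    unfolding eq using L(2)[of 1] by (simp only: zero_less_one) simp
  also have "\<dots> \<le> 2 * (D n * dt b) + 2 * ((c n)\<^sup>2 * (T * C n * E n 0 T * dt b))"
    by (intro add_mono mult_left_mono ne(2) b2) auto
  also have "\<dots> = D2 n * dt b" by (simp only: D2_def distrib_right mult.assoc)
  finally show ?g2 .
qed

text \<open>The Euler scheme fed with the true neighbours. It stands between \<open>X\<close> and
  the next iterate: its distance to \<open>X\<close> is pure discretization error, its distance to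
  \<open>Y (Suc K)\<close> obeys an exact recursion.\<close>

definition G :: "nat \<Rightarrow> nat \<Rightarrow> nat \<Rightarrow> 'a \<Rightarrow> real" where
  "G n b j z = euler \<sigma> k (dt b) (x n) n (\<lambda>p l. X p (dy T b l) z) (\<lambda>l i. dB b l i z) j"

lemma G_sqi: "n \<ge> 1 \<Longrightarrow> j \<le> 2 ^ b \<Longrightarrow> sqi b j (G n b j)"
  unfolding G_def[abs_def] by (rule euler_step(1)[OF _ order.refl]) (auto intro: X_second_moment)

definition R :: "nat \<Rightarrow> real" where "R n = 2 * D2 n * (1 + (c n)\<^sup>2 * T\<^sup>2)"

text \<open>The scheme differs from \<open>X\<close> by the residual and by an accumulated damping
  term, which \<open>drift_sum_le\<close> bounds by the residuals. The constant \<open>R n\<close>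
  absorbs (c dt)^2 times the square of the number of steps, that is (c T)^2.\<close>

lemma euler_error:
  assumes n: "n \<ge> 1" and j: "j \<le> 2 ^ b" and small: "c n * dt b \<le> 1"
  shows "(\<integral>z. (G n b j z - X n (dy T b j) z)\<^sup>2 \<partial>M) \<le> R n * dt b"
proof -
  define \<eta> where "\<eta> j z = X n (dy T b j) z - (x n + (\<Sum>l<j. \<Sum>i=1..n. w n b l i z * dB b l i z) - c n * dt b * (\<Sum>l<j. X n (dy T b l) z))" for j z
  have \<eta>: "integrable M (\<lambda>z. (\<eta> l z)\<^sup>2)" "(\<integral>z. (\<eta> l z)\<^sup>2 \<partial>M) \<le> D2 n * dt b" if "l \<le> j" for l
    unfolding \<eta>_def using euler_residual(2,3)[OF n, of l b] that j by auto
  have jb: "real j \<le> 2 ^ b" using j of_nat_le_iff[where 'a=real, of j "2 ^ b"] by simp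
  let ?F = "\<lambda>j z. X n (dy T b j) z - G n b j z"
  let ?q = "c n * dt b"
  have q: "0 \<le> ?q" using cn_nonneg dt_pos[of b] by (intro mult_nonneg_nonneg) auto
  have F: "?F l z = \<eta> l z - ?q * (\<Sum>i<l. ?F i z)" for l z
  proof -
    have "G n b l z = x n + (\<Sum>i<l. \<Sum>ia=1..n. w n b i ia z * dB b i ia z) - ?q * (\<Sum>i<l. G n b i z)"
      unfolding G_def by (subst euler_sum) (simp add: w_def)
    then show ?thesis by (simp add: \<eta>_def sum_subtractf right_diff_distrib)
  qed
  have pw: "(G n b j z - X n (dy T b j) z)\<^sup>2 \<le> 2 * (\<eta> j z)\<^sup>2 + 2 * (?q\<^sup>2 * (2 ^ b * (\<Sum>l<j. (\<eta> l z)\<^sup>2)))" for z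
  proof -
    have "(G n b j z - X n (dy T b j) z)\<^sup>2 = (\<eta> j z + - (?q * (\<Sum>l<j. ?F l z)))\<^sup>2"
      using F[of j z] by (simp add: power2_commute)
    also have "\<dots> \<le> 2 * (\<eta> j z)\<^sup>2 + 2 * (- (?q * (\<Sum>l<j. ?F l z)))\<^sup>2" by (rule power2_sum_le)
    also have "(- (?q * (\<Sum>l<j. ?F l z)))\<^sup>2 = ?q\<^sup>2 * (\<Sum>l<j. ?F l z)\<^sup>2" by (simp only: power2_minus power_mult_distrib)
    also have "(\<Sum>l<j. ?F l z)\<^sup>2 \<le> (\<Sum>l<j. \<bar>\<eta> l z\<bar>)\<^sup>2"
      using drift_sum_le[OF q small F[of _ z], of j] by (intro abs_le_square_iff[THEN iffD1]) simp
    also have "(\<Sum>l<j. \<bar>\<eta> l z\<bar>)\<^sup>2 \<le> real j * (\<Sum>l<j. (\<eta> l z)\<^sup>2)"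
      using sum_squared_le_sum_of_squares[of "\<lambda>l. \<bar>\<eta> l z\<bar>" "{..<j}"] by (simp add: mult.commute)
    also have "\<dots> \<le> 2 ^ b * (\<Sum>l<j. (\<eta> l z)\<^sup>2)"
      by (intro mult_right_mono sum_nonneg jb) simp
    finally show ?thesis by (simp add: mult_left_mono)
  qed
  have i: "integrable M (\<lambda>z. (G n b j z - X n (dy T b j) z)\<^sup>2)"
    using sqi_diff[OF G_sqi[OF n j] X_second_moment(1)[OF j] j] by (simp add: sqi_def)
  have ib: "integrable M (\<lambda>z. 2 * (\<eta> j z)\<^sup>2 + 2 * (?q\<^sup>2 * (2 ^ b * (\<Sum>l<j. (\<eta> l z)\<^sup>2))))"
    using \<eta>(1) by (intro L1_add integrable_mult_right L1_sum) auto
  have sum_i: "integrable M (\<lambda>z. \<Sum>l<j. (\<eta> l z)\<^sup>2)"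
    using \<eta>(1) by (intro L1_sum) auto
  have sum_e: "(\<integral>z. (\<Sum>l<j. (\<eta> l z)\<^sup>2) \<partial>M) = (\<Sum>l<j. \<integral>z. (\<eta> l z)\<^sup>2 \<partial>M)"
    using \<eta>(1) by (intro Bochner_Integration.integral_sum) auto
  have "(\<integral>z. (G n b j z - X n (dy T b j) z)\<^sup>2 \<partial>M) \<le> (\<integral>z. 2 * (\<eta> j z)\<^sup>2 + 2 * (?q\<^sup>2 * (2 ^ b * (\<Sum>l<j. (\<eta> l z)\<^sup>2))) \<partial>M)"
    by (rule integral_mono[OF i ib pw])
  also have "\<dots> = 2 * (\<integral>z. (\<eta> j z)\<^sup>2 \<partial>M) + 2 * (?q\<^sup>2 * (2 ^ b * (\<Sum>l<j. \<integral>z. (\<eta> l z)\<^sup>2 \<partial>M)))"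
    using \<eta>(1)[OF order.refl] sum_i by (simp add: sum_e)
  also have "\<dots> \<le> 2 * (D2 n * dt b) + 2 * (?q\<^sup>2 * (2 ^ b * (\<Sum>l<j. D2 n * dt b)))"
    by (intro add_mono mult_left_mono sum_mono \<eta>(2)) auto
  also have "\<dots> \<le> 2 * (D2 n * dt b) + 2 * (?q\<^sup>2 * (2 ^ b * (2 ^ b * (D2 n * dt b))))"
  proof (rule add_left_mono, rule mult_left_mono, rule mult_left_mono, rule mult_left_mono)
    have "0 \<le> (\<integral>z. (\<eta> j z)\<^sup>2 \<partial>M)" by simp
    then have "0 \<le> D2 n * dt b" using \<eta>(2)[of j] by linarith
    then show "(\<Sum>l<j. D2 n * dt b) \<le> 2 ^ b * (D2 n * dt b)"
      unfolding sum_constant card_lessThan by (rule mult_right_mono[OF jb])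
  qed auto
  also have "\<dots> = R n * dt b" by (simp add: R_def power2_eq_square field_simps)
  finally show ?thesis .
qed

definition Y :: "nat \<Rightarrow> nat \<Rightarrow> nat \<Rightarrow> nat \<Rightarrow> 'a \<Rightarrow> real" where
  "Y K n b j z = picard \<sigma> k x (dt b) (\<lambda>l i. dB b l i z) K n j"

lemma Y_Suc: "n \<ge> 1 \<Longrightarrow> Y (Suc K) n b j z = euler \<sigma> k (dt b) (x n) n (\<lambda>p l. Y K p b l z) (\<lambda>l i. dB b l i z) j"
  by (simp add: Y_def)

lemma Y_0: "Y 0 n b j z = 0" "Y K 0 b j z = 0"
  by (auto simp: Y_def) (cases K; simp)

lemma Y_sqi: "j \<le> 2 ^ b \<Longrightarrow> sqi b j (Y K n b j)"
proof (induction K arbitrary: n j)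
  case 0
  then show ?case by (simp add: sqi_def Y_0(1)[abs_def])
next
  case (Suc K)
  show ?case
  proof (cases "n = 0")
    case True
    then show ?thesis by (simp add: sqi_def Y_0(2)[abs_def])
  next
    case False
    then have n: "n \<ge> 1" by simp
    show ?thesis unfolding Y_Suc[OF n, abs_def]
      by (rule euler_step(1)[OF n order.refl _ Suc.prems]) (auto intro: Suc.IH)
  qed
qed

text \<open>Of the four mean squares on the grid, \<open>h\<close> and \<open>g\<close> obey
  recursions with the same coefficients that differ only in the source: \<open>a K\<close> for
  \<open>h\<close>, \<open>p\<close> for \<open>g\<close>. This makes it possible to compare
  distances of iterates with energies of the solution.\<close>

definition p :: "nat \<Rightarrow> nat \<Rightarrow> nat \<Rightarrow> real" where "p n b j = (\<integral>z. (X n (dy T b j) z)\<^sup>2 \<partial>M)"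

definition a :: "nat \<Rightarrow> nat \<Rightarrow> nat \<Rightarrow> nat \<Rightarrow> real" where "a K n b j = (\<integral>z. (X n (dy T b j) z - Y K n b j z)\<^sup>2 \<partial>M)"

definition h :: "nat \<Rightarrow> nat \<Rightarrow> nat \<Rightarrow> nat \<Rightarrow> real" where "h K n b j = (\<integral>z. (G n b j z - Y (Suc K) n b j z)\<^sup>2 \<partial>M)"

definition g :: "nat \<Rightarrow> nat \<Rightarrow> nat \<Rightarrow> real" where "g n b j = (\<integral>z. (G n b j z)\<^sup>2 \<partial>M)"

lemma a_0: "a 0 n b j = p n b j" "a K 0 b j = 0" "p 0 b j = 0"
  by (auto simp: a_def p_def Y_0 X0)

lemma nonneg: "0 \<le> a K n b j" "0 \<le> h K n b j" "0 \<le> g n b j" "0 \<le> p n b j"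
  by (auto simp: a_def h_def g_def p_def)

lemma h_rec:
  assumes n: "n \<ge> 1"
  shows "h K n b 0 = 0"
    "j < 2 ^ b \<Longrightarrow> h K n b (Suc j) = (1 - c n * dt b)\<^sup>2 * h K n b j + dt b * (\<sigma>\<^sup>2 * ((k (n - 1))\<^sup>2 * a K (n - 1) b j + (k n)\<^sup>2 * a K (Suc n) b j))"
proof -
  have eq: "G n b j z - Y (Suc K) n b j z = euler \<sigma> k (dt b) 0 n (\<lambda>p l. X p (dy T b l) z - Y K p b l z) (\<lambda>l i. dB b l i z) j" for j z
    unfolding Y_Suc[OF n] G_def euler_diff by simp
  show "h K n b 0 = 0" unfolding h_def eq by simp
  have Z: "sqi b l (\<lambda>z. X p (dy T b l) z - Y K p b l z)" if "l < 2 ^ b" for l p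
    using that by (intro sqi_diff X_second_moment Y_sqi) auto
  show "h K n b (Suc j) = (1 - c n * dt b)\<^sup>2 * h K n b j + dt b * (\<sigma>\<^sup>2 * ((k (n - 1))\<^sup>2 * a K (n - 1) b j + (k n)\<^sup>2 * a K (Suc n) b j))" if "j < 2 ^ b"
    unfolding h_def eq a_def
    by (rule euler_step(2)[where Z="\<lambda>p l z. X p (dy T b l) z - Y K p b l z", OF n order.refl Z that])
qed

lemma g_rec:
  assumes n: "n \<ge> 1"
  shows "g n b 0 = (x n)\<^sup>2"
    "j < 2 ^ b \<Longrightarrow> g n b (Suc j) = (1 - c n * dt b)\<^sup>2 * g n b j + dt b * (\<sigma>\<^sup>2 * ((k (n - 1))\<^sup>2 * p (n - 1) b j + (k n)\<^sup>2 * p (Suc n) b j))"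
proof -
  show "g n b 0 = (x n)\<^sup>2" by (simp add: g_def G_def prob_space)
  have Z: "sqi b l (X p (dy T b l))" if "l < 2 ^ b" for l p
    using that by (intro X_second_moment) auto
  show "g n b (Suc j) = (1 - c n * dt b)\<^sup>2 * g n b j + dt b * (\<sigma>\<^sup>2 * ((k (n - 1))\<^sup>2 * p (n - 1) b j + (k n)\<^sup>2 * p (Suc n) b j))" if "j < 2 ^ b"
    unfolding g_def G_def p_def
    by (rule euler_step(2)[where Z="\<lambda>p l. X p (dy T b l)", OF n order.refl Z that])
qed

lemma a_le_h:
  assumes n: "n \<ge> 1" and j: "j \<le> 2 ^ b" and small: "c n * dt b \<le> 1"
  shows "a (Suc K) n b j \<le> (1 + s b) * h K n b j + R n * (dt b + s b)" (is ?g1)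
    and "g n b j \<le> (1 + s b) * p n b j + R n * (dt b + s b)" (is ?g2)
proof -
  have m: "G n b j \<in> borel_measurable M" "X n (dy T b j) \<in> borel_measurable M" "Y (Suc K) n b j \<in> borel_measurable M"
    using sqi_measurable[OF G_sqi[OF n j] j] sqi_measurable[OF X_second_moment(1)[OF j] j] sqi_measurable[OF Y_sqi[OF j] j] by auto
  have i1: "integrable M (\<lambda>z. (G n b j z - X n (dy T b j) z)\<^sup>2)"
    using sqi_diff[OF G_sqi[OF n j] X_second_moment(1)[OF j] j] by (simp add: sqi_def)
  have i2: "integrable M (\<lambda>z. (G n b j z - Y (Suc K) n b j z)\<^sup>2)"
    using sqi_diff[OF G_sqi[OF n j] Y_sqi[OF j] j] by (simp add: sqi_def)
  have i3: "integrable M (\<lambda>z. (X n (dy T b j) z)\<^sup>2)" using X_second_moment(1)[OF j] by (simp add: sqi_def)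
  have d: "(\<lambda>z. X n (dy T b j) z - G n b j z) \<in> borel_measurable M" "(\<lambda>z. G n b j z - X n (dy T b j) z) \<in> borel_measurable M"
      "(\<lambda>z. G n b j z - Y (Suc K) n b j z) \<in> borel_measurable M"
    using m by auto
  have err: "(1 + 1 / s b) * (\<integral>z. (G n b j z - X n (dy T b j) z)\<^sup>2 \<partial>M) \<le> R n * (dt b + s b)"
    unfolding s_young[symmetric] using s_pos[of b] by (intro mult_left_mono euler_error assms) auto
  have sw: "(X n (dy T b j) z - G n b j z)\<^sup>2 = (G n b j z - X n (dy T b j) z)\<^sup>2" for z
    by (rule power2_commute)
  have "a (Suc K) n b j = (\<integral>z. ((G n b j z - Y (Suc K) n b j z) + (X n (dy T b j) z - G n b j z))\<^sup>2 \<partial>M)"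
    unfolding a_def by simp
  also have "\<dots> \<le> (1 + s b) * h K n b j + (1 + 1 / s b) * (\<integral>z. (G n b j z - X n (dy T b j) z)\<^sup>2 \<partial>M)"
    using L2_add(2)[OF d(3,1) i2 _ s_pos] i1 unfolding sw h_def by blast
  finally show ?g1 using err by linarith
  have "g n b j = (\<integral>z. (X n (dy T b j) z + (G n b j z - X n (dy T b j) z))\<^sup>2 \<partial>M)"
    unfolding g_def by simp
  also have "\<dots> \<le> (1 + s b) * p n b j + (1 + 1 / s b) * (\<integral>z. (G n b j z - X n (dy T b j) z)\<^sup>2 \<partial>M)"
    using L2_add(2)[OF m(2) d(2) i3 i1 s_pos] unfolding p_def by blast
  finally show ?g2 using err by linarith
qed

lemma eventually_small: "\<forall>\<^sub>F b in sequentially. c n * dt b \<le> 1"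
proof -
  have "(\<lambda>b. c n * dt b) \<longlonglongrightarrow> c n * 0" by (intro tendsto_intros dt_tendsto)
  from order_tendstoD(2)[OF this, of 1] show ?thesis by (simp add: eventually_mono)
qed

definition v :: "nat \<Rightarrow> real" where "v n = (\<integral>z. sq n 0 T z \<partial>M)"

lemma v_nonneg: "0 \<le> v n"
  unfolding v_def using T_pos by (intro integral_nonneg_AE AE_I2 sq_nonneg) auto

lemma v_0: "v 0 = 0"
  by (simp add: v_def sq_def X0)

text \<open>Convergence of these Riemann sums to \<open>v n\<close> would need an interchange of
  limit and mean that is not at hand; an upper bound suffices. It is obtained pathwise against a
  grid finer by m levels, before m tends to infinity.\<close>

lemma riemann_energy_le:
  "(\<Sum>j<2 ^ b. dt b * p n b j) \<le> (1 + s b) * v n + (C n * E n 0 T) * (dt b + s b)"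
proof -
  define S where "S z = (\<Sum>j<2 ^ b. dt b * (X n (dy T b j) z)\<^sup>2)" for z
  define Q where "Q m z = (\<Sum>l<2 ^ b * 2 ^ m. (X n (dy T (b + m) l) z)\<^sup>2 * dt (b + m))" for m z
  define U where "U m l z = X n (dy T (b + m) l) z - X n (dy T b (l div 2 ^ m)) z" for m l z
  \<comment> \<open>The positive part makes Fatou applicable as m grows; \<open>?R\<close> dominates
    it with a mean that is bounded uniformly in m.\<close>
  let ?f = "\<lambda>m z. max 0 (S z - (1 + s b) * Q m z)"
  let ?R = "\<lambda>m z. (1 + 1 / s b) * (\<Sum>l<2 ^ b * 2 ^ m. dt (b + m) * (U m l z)\<^sup>2)"
  have dyl: "l \<le> 2 ^ (b + m)" if "l < 2 ^ b * 2 ^ m" for l m :: nat using that by (simp add: power_add)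
  have Xi: "integrable M (\<lambda>z. (X n (dy T b j) z)\<^sup>2)" if "j \<le> 2 ^ b" for b j
    using X_second_moment(1)[OF that] by (simp add: sqi_def)
  have Si: "integrable M S" unfolding S_def[abs_def] by (intro L1_sum integrable_mult_right Xi) auto
  have Qi: "integrable M (Q m)" for m
    unfolding Q_def[abs_def] by (intro L1_sum integrable_mult_left Xi dyl) auto
  have Ui: "integrable M (\<lambda>z. (U m l z)\<^sup>2)" "(\<integral>z. (U m l z)\<^sup>2 \<partial>M) \<le> C n * E n (dy T b (l div 2 ^ m)) (dy T b (Suc (l div 2 ^ m)))"
    if "l < 2 ^ b * 2 ^ m" for m l
    unfolding U_def using fine_coarse[OF that order.refl, of n] by auto
  have Ri: "integrable M (?R m)" for m
    by (intro integrable_mult_right L1_sum Ui) auto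
  have S_fine: "S z = (\<Sum>l<2 ^ b * 2 ^ m. dt (b + m) * (X n (dy T b (l div 2 ^ m)) z)\<^sup>2)" for m z
    unfolding S_def sum_distrib_left[symmetric] by (subst sum_div_const[where f="\<lambda>j. (X n (dy T b j) z)\<^sup>2"]) (auto simp: power_add)
  have pw: "S z - (1 + s b) * Q m z \<le> ?R m z" for m z
  proof -
    have "S z \<le> (\<Sum>l<2 ^ b * 2 ^ m. (1 + s b) * ((X n (dy T (b + m) l) z)\<^sup>2 * dt (b + m)) + (1 + 1 / s b) * (dt (b + m) * (U m l z)\<^sup>2))"
      unfolding S_fine[of z m]
    proof (rule sum_mono)
      fix l
      have "(X n (dy T b (l div 2 ^ m)) z)\<^sup>2 = (X n (dy T (b + m) l) z + - U m l z)\<^sup>2" by (simp add: U_def)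
      also have "\<dots> \<le> (1 + s b) * (X n (dy T (b + m) l) z)\<^sup>2 + (1 + 1 / s b) * (- U m l z)\<^sup>2" by (rule power2_young[OF s_pos])
      finally have "dt (b + m) * (X n (dy T b (l div 2 ^ m)) z)\<^sup>2 \<le> dt (b + m) * ((1 + s b) * (X n (dy T (b + m) l) z)\<^sup>2 + (1 + 1 / s b) * (U m l z)\<^sup>2)"
        using dt_pos[of "b + m"] by (intro mult_left_mono) auto
      also have "\<dots> = (1 + s b) * ((X n (dy T (b + m) l) z)\<^sup>2 * dt (b + m)) + (1 + 1 / s b) * (dt (b + m) * (U m l z)\<^sup>2)"
        by (simp only: distrib_left mult_ac)
      finally show "dt (b + m) * (X n (dy T b (l div 2 ^ m)) z)\<^sup>2 \<le> (1 + s b) * ((X n (dy T (b + m) l) z)\<^sup>2 * dt (b + m)) + (1 + 1 / s b) * (dt (b + m) * (U m l z)\<^sup>2)" .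
    qed
    also have "\<dots> = (1 + s b) * Q m z + ?R m z" unfolding Q_def sum_distrib_left by (rule sum.distrib)
    finally show ?thesis by linarith
  qed
  have R0: "0 \<le> ?R m z" for m z
    using s_pos[of b] dt_pos[of "b + m"] by (intro mult_nonneg_nonneg sum_nonneg) auto
  have fi: "integrable M (?f m)" for m
    by (intro integrable_max L1_diff integrable_mult_right Si Qi) auto
  have scale: "dt (b + m) * (real (2 ^ m) * A) = A * dt b" for A m by (simp add: power_add)
  have le: "(\<integral>z. ?f m z \<partial>M) \<le> (C n * E n 0 T) * (dt b + s b)" for m
  proof -
    have "(\<integral>z. ?f m z \<partial>M) \<le> (\<integral>z. ?R m z \<partial>M)"
      by (rule integral_mono[OF fi Ri]) (rule max.boundedI[OF R0 pw])
    also have "\<dots> = (1 + 1 / s b) * (\<Sum>l<2 ^ b * 2 ^ m. dt (b + m) * (\<integral>z. (U m l z)\<^sup>2 \<partial>M))"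
      using Bochner_Integration.integral_sum[of "{..<2 ^ b * 2 ^ m}" M "\<lambda>l z. dt (b + m) * (U m l z)\<^sup>2", OF integrable_mult_right[OF Ui(1)]]
      by (simp only: integral_mult_right_zero lessThan_iff)
    also have "\<dots> \<le> (1 + 1 / s b) * (\<Sum>l<2 ^ b * 2 ^ m. dt (b + m) * (C n * E n (dy T b (l div 2 ^ m)) (dy T b (Suc (l div 2 ^ m)))))"
      using s_pos[of b] dt_pos[of "b + m"] by (intro mult_left_mono sum_mono Ui) auto
    also have "\<dots> = (1 + 1 / s b) * (dt (b + m) * (real (2 ^ m) * (\<Sum>j<2 ^ b. C n * E n (dy T b j) (dy T b (Suc j)))))"
      unfolding sum_distrib_left[of "dt (b + m)", symmetric] by (subst sum_div_const[where f="\<lambda>j. C n * E n (dy T b j) (dy T b (Suc j))"]) auto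
    also have "\<dots> = (1 + 1 / s b) * ((C n * (\<Sum>j<2 ^ b. E n (dy T b j) (dy T b (Suc j)))) * dt b)"
      by (simp only: scale flip: sum_distrib_left)
    also have "\<dots> \<le> (1 + 1 / s b) * ((C n * E n 0 T) * dt b)"
      using s_pos[of b] dt_pos[of b] C_pos[of n] by (intro mult_left_mono mult_right_mono sum_E_grid_le order.refl) auto
    finally show ?thesis unfolding s_young .
  qed
  have lim: "AE z in M. (\<lambda>m. ?f m z) \<longlonglongrightarrow> max 0 (S z - (1 + s b) * sq n 0 T z)"
  proof (rule AE_I2)
    fix z assume w: "z \<in> space M"
    have "continuous_on {0..T} (\<lambda>u. (X n u z)\<^sup>2)" by (intro continuous_intros X_cont w)
    from riemann_limit'[OF this T_pos order.refl, of b] have "(\<lambda>m. Q m z) \<longlonglongrightarrow> sq n 0 T z"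
      by (simp add: Q_def sq_def dy_def)
    then show "(\<lambda>m. ?f m z) \<longlonglongrightarrow> max 0 (S z - (1 + s b) * sq n 0 T z)" by (intro tendsto_intros)
  qed
  have sqi0: "integrable M (sq n 0 T)" using T_pos by (intro sq_integrable) auto
  have m: "(\<lambda>z. max 0 (S z - (1 + s b) * sq n 0 T z)) \<in> borel_measurable M" using Si sqi0 by measurable
  note fat = integral_Fatou_le[where f="?f", OF fi _ le tendsto_const lim m]
  have i: "integrable M (\<lambda>z. max 0 (S z - (1 + s b) * sq n 0 T z))" by (rule fat(1)) auto
  have "(\<Sum>j<2 ^ b. dt b * p n b j) = (\<integral>z. S z \<partial>M)"
    using Bochner_Integration.integral_sum[of "{..<2 ^ b}" M "\<lambda>j z. dt b * (X n (dy T b j) z)\<^sup>2", OF integrable_mult_right[OF Xi]]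
    by (simp only: S_def p_def integral_mult_right_zero lessThan_iff less_imp_le)
  also have "\<dots> \<le> (\<integral>z. (1 + s b) * sq n 0 T z + max 0 (S z - (1 + s b) * sq n 0 T z) \<partial>M)"
    by (rule integral_mono[OF Si]) (use i sqi0 in auto)
  also have "\<dots> = (1 + s b) * v n + (\<integral>z. max 0 (S z - (1 + s b) * sq n 0 T z) \<partial>M)"
    unfolding v_def using i sqi0 by simp
  also have "(\<integral>z. max 0 (S z - (1 + s b) * sq n 0 T z) \<partial>M) \<le> (C n * E n 0 T) * (dt b + s b)"
    by (rule fat(2)) auto
  finally show ?thesis by simp
qed

end

lemma (in prob_space) conv_prob_L2:
  fixes f :: "nat \<Rightarrow> 'a \<Rightarrow> real"
  assumes m: "\<And>q. f q \<in> borel_measurable M" "g \<in> borel_measurable M"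
    and i: "\<And>q. integrable M (\<lambda>z. (f q z - g z)\<^sup>2)" and le: "\<And>q. (\<integral>z. (f q z - g z)\<^sup>2 \<partial>M) \<le> (e q)\<^sup>2"
    and e: "\<And>q. e q > 0" "e \<longlonglongrightarrow> 0"
  shows "conv_prob M f g"
proof (rule conv_prob_leI[OF m])
  let ?h = "\<lambda>q z. e q + (f q z - g z)\<^sup>2 / e q"
  show "integrable M (?h q)" for q using i by simp
  have "(\<integral>z. ?h q z \<partial>M) = e q + (\<integral>z. (f q z - g z)\<^sup>2 \<partial>M) / e q" for q using i by (simp add: prob_space)
  also have "\<dots> q \<le> e q + (e q)\<^sup>2 / e q" for q using le e(1)[of q] by (intro add_left_mono divide_right_mono) auto
  finally have up: "(\<integral>z. ?h q z \<partial>M) \<le> 2 * e q" for q using e(1)[of q] by (simp add: power2_eq_square)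
  have lo: "0 \<le> (\<integral>z. ?h q z \<partial>M)" for q using e(1)[of q] by (intro integral_nonneg_AE AE_I2) simp
  have "(\<lambda>q. 2 * e q) \<longlonglongrightarrow> 2 * 0" by (intro tendsto_intros e)
  then show "(\<lambda>q. \<integral>z. ?h q z \<partial>M) \<longlonglongrightarrow> 0"
    using tendsto_sandwich[OF always_eventually always_eventually tendsto_const, of 0 "\<lambda>q. \<integral>z. ?h q z \<partial>M" "\<lambda>q. 2 * e q"] up lo by simp
  fix q z
  have "\<bar>f q z - g z\<bar> \<le> e q + (f q z - g z)\<^sup>2 / e q" by (rule abs_le_young[OF e(1)])
  then show "min 1 \<bar>f q z - g z\<bar> \<le> ?h q z" by simp
qed

section \<open>Decay of the distance to the Picard iterates\<close>

context linear_system
begin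

lemma real_grid_le: "j \<le> 2 ^ b \<Longrightarrow> real j * dt b \<le> T"
  using dy_le[OF T_pos, of j b] by (simp add: dy_def mult.commute)

lemma r_bounds: "c n * dt b \<le> 1 \<Longrightarrow> 0 \<le> (1 - c n * dt b)\<^sup>2 \<and> (1 - c n * dt b)\<^sup>2 \<le> 1"
  using mult_nonneg_nonneg[OF cn_nonneg[of \<sigma> k n] less_imp_le[OF dt_pos[of b]]]
  by (intro conjI zero_le_power2 power_le_one) linarith+

text \<open>No iterate is further from the solution than the iterate \<open>0\<close>, up to discretization errors; this
  transfers the decay of the energies in \<open>n\<close> to the distances.\<close>

lemma domination:
  "\<exists>f. f \<longlonglongrightarrow> 0 \<and> (\<forall>\<^sub>F b in sequentially. \<forall>j\<le>2 ^ b. a K n b j \<le> p n b j + f b)"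
proof (induction K arbitrary: n)
  case 0
  show ?case by (intro exI[of _ "\<lambda>_. 0"]) (simp add: a_0)
next
  case (Suc K)
  show ?case
  proof (cases "n = 0")
    case True
    then show ?thesis by (intro exI[of _ "\<lambda>_. 0"]) (simp add: a_0)
  next
    case False
    then have n: "n \<ge> 1" by simp
    obtain f1 where f1: "f1 \<longlonglongrightarrow> 0" "\<forall>\<^sub>F b in sequentially. \<forall>j\<le>2 ^ b. a K (n - 1) b j \<le> p (n - 1) b j + f1 b" using Suc by blast
    obtain f2 where f2: "f2 \<longlonglongrightarrow> 0" "\<forall>\<^sub>F b in sequentially. \<forall>j\<le>2 ^ b. a K (Suc n) b j \<le> p (Suc n) b j + f2 b" using Suc by blast
    define f3 where "f3 b = \<sigma>\<^sup>2 * ((k (n - 1))\<^sup>2 * \<bar>f1 b\<bar> + (k n)\<^sup>2 * \<bar>f2 b\<bar>)" for b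
    define f where "f b = (2 * s b + (s b)\<^sup>2) * P n + (2 + s b) * (R n * (dt b + s b)) + (1 + s b) * (T * f3 b)" for b
    have "f3 \<longlonglongrightarrow> \<sigma>\<^sup>2 * ((k (n - 1))\<^sup>2 * 0 + (k n)\<^sup>2 * 0)"
      unfolding f3_def using f1(1) f2(1) by (intro tendsto_mult tendsto_add tendsto_const tendsto_rabs_zero)
    then have "f \<longlonglongrightarrow> (2 * 0 + 0\<^sup>2) * P n + (2 + 0) * (R n * (0 + 0)) + (1 + 0) * (T * 0)"
      unfolding f_def by (intro tendsto_intros s_tendsto dt_tendsto) simp
    moreover have "\<forall>\<^sub>F b in sequentially. \<forall>j\<le>2 ^ b. a (Suc K) n b j \<le> p n b j + f b"
      using f1(2) f2(2) eventually_small[of n]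
    proof eventually_elim
      case (elim b)
      show ?case
      proof (intro allI impI)
        fix j :: nat assume j: "j \<le> 2 ^ b"
        have f3: "0 \<le> f3 b" by (simp add: f3_def)
        \<comment> \<open>Both recursions have the same contraction factor, so the difference is
          driven by \<open>a K - p\<close> of the neighbours alone, and at time 0 it is minus the
          square of \<open>x n\<close>.\<close>
        have "h K n b j - g n b j \<le> real j * (dt b * f3 b)"
        proof (rule linear_recursion_le[where h="\<lambda>j. h K n b j - g n b j", OF _ _ _ _ _ j])
          show "0 \<le> (1 - c n * dt b)\<^sup>2" "(1 - c n * dt b)\<^sup>2 \<le> 1" using r_bounds[OF elim(3)] by auto
          show "0 \<le> dt b * f3 b" by (intro mult_nonneg_nonneg f3 less_imp_le[OF dt_pos])
          show "h K n b 0 - g n b 0 \<le> 0" using h_rec(1)[OF n] nonneg(3)[of n b 0] by simp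
          fix i :: nat assume i: "i < 2 ^ b"
          have "a K (n - 1) b i - p (n - 1) b i \<le> \<bar>f1 b\<bar>" "a K (Suc n) b i - p (Suc n) b i \<le> \<bar>f2 b\<bar>"
            using elim(1)[rule_format, of i] elim(2)[rule_format, of i] i by linarith+
          then have "dt b * (\<sigma>\<^sup>2 * ((k (n - 1))\<^sup>2 * (a K (n - 1) b i - p (n - 1) b i) + (k n)\<^sup>2 * (a K (Suc n) b i - p (Suc n) b i))) \<le> dt b * f3 b"
            unfolding f3_def using dt_pos[of b] by (intro mult_left_mono add_mono) auto
          then show "h K n b (Suc i) - g n b (Suc i) \<le> (1 - c n * dt b)\<^sup>2 * (h K n b i - g n b i) + dt b * f3 b"
            unfolding h_rec(2)[OF n i] g_rec(2)[OF n i] right_diff_distrib distrib_left by linarith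
        qed
        also have "\<dots> = (real j * dt b) * f3 b" by (simp only: mult.assoc)
        also have "\<dots> \<le> T * f3 b" by (rule mult_right_mono[OF real_grid_le[OF j] f3])
        finally have hg: "h K n b j \<le> g n b j + T * f3 b" by linarith
        note ah = a_le_h[OF n j elim(3)]
        have "(1 + s b) * h K n b j \<le> (1 + s b) * (((1 + s b) * p n b j + R n * (dt b + s b)) + T * f3 b)"
          using hg ah(2) s_pos[of b] by (intro mult_left_mono) auto
        also have "\<dots> = p n b j + (2 * s b + (s b)\<^sup>2) * p n b j + (1 + s b) * (R n * (dt b + s b)) + (1 + s b) * (T * f3 b)"
          unfolding power2_eq_square distrib_left distrib_right mult_1_left by (simp only: mult.assoc mult_2 add_ac distrib_right)
        also have "\<dots> \<le> p n b j + (2 * s b + (s b)\<^sup>2) * P n + (1 + s b) * (R n * (dt b + s b)) + (1 + s b) * (T * f3 b)"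
          by (rule add_right_mono, rule add_right_mono, rule add_left_mono, rule mult_left_mono)
            (use s_pos[of b] X_second_moment(2)[OF j, of n] in \<open>auto simp: p_def\<close>)
        finally have "a (Suc K) n b j \<le> p n b j + (2 * s b + (s b)\<^sup>2) * P n + (1 + s b) * (R n * (dt b + s b)) + (1 + s b) * (T * f3 b) + R n * (dt b + s b)"
          using ah(1)[of K] by linarith
        also have "\<dots> = p n b j + f b"
          unfolding f_def distrib_right[of 1] distrib_right[of 2] mult_1_left mult_2 by (simp only: add_ac)
        finally show "a (Suc K) n b j \<le> p n b j + f b" .
      qed
    qed
    ultimately show ?thesis by auto
  qed
qed

definition V :: "nat \<Rightarrow> nat \<Rightarrow> nat \<Rightarrow> real" where "V K n b = (\<Sum>j<2 ^ b. dt b * a K n b j)"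

text \<open>Summing the recursion over the grid telescopes: \<open>h\<close> starts at 0 and ends
  nonnegative, so total damping is at most total source. As 2 c_n = \<sigma>^2 (k_n^2 + k_{n-1}^2),
  this is the subharmonic inequality up to a term of order dt. The second part turns time-integrated
  bounds into bounds at each grid time.\<close>

lemma h_dissipation:
  assumes n: "n \<ge> 1"
  shows "(2 * c n - (c n)\<^sup>2 * dt b) * (\<Sum>j<2 ^ b. dt b * h K n b j) \<le> \<sigma>\<^sup>2 * ((k (n - 1))\<^sup>2 * V K (n - 1) b + (k n)\<^sup>2 * V K (Suc n) b)" (is ?g1)
    and "\<lbrakk>c n * dt b \<le> 1; j \<le> 2 ^ b\<rbrakk> \<Longrightarrow> h K n b j \<le> \<sigma>\<^sup>2 * ((k (n - 1))\<^sup>2 * V K (n - 1) b + (k n)\<^sup>2 * V K (Suc n) b)"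
proof -
  define e where "e j = dt b * (\<sigma>\<^sup>2 * ((k (n - 1))\<^sup>2 * a K (n - 1) b j + (k n)\<^sup>2 * a K (Suc n) b j))" for j
  have e0: "0 \<le> e j" for j unfolding e_def using dt_pos[of b] nonneg(1) by (intro mult_nonneg_nonneg add_nonneg_nonneg) auto
  have se: "(\<Sum>j<2 ^ b. e j) = \<sigma>\<^sup>2 * ((k (n - 1))\<^sup>2 * V K (n - 1) b + (k n)\<^sup>2 * V K (Suc n) b)"
    unfolding V_def e_def sum_distrib_left sum.distrib[symmetric] by (intro sum.cong refl) (simp only: distrib_left mult_ac)
  have rec: "h K n b (Suc j) - h K n b j = e j - (2 * c n - (c n)\<^sup>2 * dt b) * (dt b * h K n b j)" if "j < 2 ^ b" for j
  proof -
    have *: "(1 - q * d)\<^sup>2 * y = y - (2 * q - q\<^sup>2 * d) * (d * y)" for q d y :: real by (simp add: power2_eq_square algebra_simps)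
    show ?thesis unfolding h_rec(2)[OF n that] e_def * by simp
  qed
  have "0 \<le> h K n b (2 ^ b) - h K n b 0" using nonneg(2) h_rec(1)[OF n] by simp
  also have "\<dots> = (\<Sum>j<2 ^ b. h K n b (Suc j) - h K n b j)" by (rule sum_lessThan_telescope[symmetric])
  also have "\<dots> = (\<Sum>j<2 ^ b. e j - (2 * c n - (c n)\<^sup>2 * dt b) * (dt b * h K n b j))"
    by (intro sum.cong refl rec) simp
  also have "\<dots> = (\<Sum>j<2 ^ b. e j) - (2 * c n - (c n)\<^sup>2 * dt b) * (\<Sum>j<2 ^ b. dt b * h K n b j)"
    by (simp only: sum_subtractf sum_distrib_left)
  finally show ?g1
    unfolding se by simp
  show "h K n b j \<le> \<sigma>\<^sup>2 * ((k (n - 1))\<^sup>2 * V K (n - 1) b + (k n)\<^sup>2 * V K (Suc n) b)" if sm: "c n * dt b \<le> 1" and j: "j \<le> 2 ^ b"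
  proof -
    have "\<bar>h K n b j\<bar> \<le> \<bar>h K n b 0\<bar> + (\<Sum>l<j. e l)"
    proof (rule geometric_source_le[OF _ _ _ j])
      show "0 \<le> (1 - c n * dt b)\<^sup>2" "(1 - c n * dt b)\<^sup>2 \<le> 1" using r_bounds[OF sm] by auto
      fix i :: nat assume i: "i < 2 ^ b"
      show "\<bar>h K n b (Suc i)\<bar> \<le> (1 - c n * dt b)\<^sup>2 * \<bar>h K n b i\<bar> + e i"
        using nonneg(2)[of K n b i] nonneg(2)[of K n b "Suc i"] h_rec(2)[OF n i, of K] by (simp only: abs_of_nonneg e_def)
    qed
    also have "(\<Sum>l<j. e l) \<le> (\<Sum>l<2 ^ b. e l)" using j e0 by (intro sum_mono2) auto
    finally show ?thesis using nonneg(2)[of K n b j] h_rec(1)[OF n, of K b] unfolding se by simp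
  qed
qed

abbreviation u :: "nat \<Rightarrow> nat \<Rightarrow> real" where "u \<equiv> subharmonic_iterate k v"

text \<open>Each iteration has two competing bounds: \<open>F1\<close> from the energy balance and
  \<open>F2\<close> from \<open>domination\<close>. Their minimum converges to the next
  \<open>subharmonic_iterate\<close>.\<close>

lemma picard_energy:
  "\<exists>f. f \<longlonglongrightarrow> u K n \<and> (\<forall>\<^sub>F b in sequentially. V K n b \<le> f b)"
proof (induction K arbitrary: n)
  case 0
  have "(\<lambda>b. (1 + s b) * v n + (C n * E n 0 T) * (dt b + s b)) \<longlonglongrightarrow> (1 + 0) * v n + (C n * E n 0 T) * (0 + 0)"
    by (intro tendsto_intros s_tendsto dt_tendsto)
  then show ?case using riemann_energy_le[of _ n]
    by (intro exI[of _ "\<lambda>b. (1 + s b) * v n + (C n * E n 0 T) * (dt b + s b)"]) (simp add: V_def a_0)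
next
  case (Suc K)
  show ?case
  proof (cases "n = 0")
    case True
    then show ?thesis by (intro exI[of _ "\<lambda>_. 0"]) (simp add: V_def a_0 v_0 k0)
  next
    case False
    then have n: "n \<ge> 1" by simp
    obtain f1 where f1: "f1 \<longlonglongrightarrow> u K (n - 1)" "\<forall>\<^sub>F b in sequentially. V K (n - 1) b \<le> f1 b" using Suc by blast
    obtain f2 where f2: "f2 \<longlonglongrightarrow> u K (Suc n)" "\<forall>\<^sub>F b in sequentially. V K (Suc n) b \<le> f2 b" using Suc by blast
    obtain f3 where f3: "f3 \<longlonglongrightarrow> 0" "\<forall>\<^sub>F b in sequentially. \<forall>j\<le>2 ^ b. a (Suc K) n b j \<le> p n b j + f3 b" using domination by blast
    let ?q = "(k n)\<^sup>2 + (k (n - 1))\<^sup>2"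
    have q: "?q > 0" using kpos[OF n] by (simp add: add_pos_nonneg)
    have c2: "2 * c n = \<sigma>\<^sup>2 * ?q" by (simp add: cn_def)
    \<comment> \<open>The damping coefficient divided by \<sigma>^2, with the loss of order dt
      caused by the explicit scheme; it is positive once the grid is fine.\<close>
    define d where "d b = ?q - (c n)\<^sup>2 / \<sigma>\<^sup>2 * dt b" for b
    have d: "d \<longlonglongrightarrow> ?q - (c n)\<^sup>2 / \<sigma>\<^sup>2 * 0" unfolding d_def by (intro tendsto_intros dt_tendsto)
    define F1 where "F1 b = (1 + s b) * (((k (n - 1))\<^sup>2 * f1 b + (k n)\<^sup>2 * f2 b) / d b) + T * (R n * (dt b + s b))" for b
    define F2 where "F2 b = ((1 + s b) * v n + (C n * E n 0 T) * (dt b + s b)) + T * f3 b" for b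
    have lim1: "F1 \<longlonglongrightarrow> (1 + 0) * (((k (n - 1))\<^sup>2 * u K (n - 1) + (k n)\<^sup>2 * u K (Suc n)) / (?q - (c n)\<^sup>2 / \<sigma>\<^sup>2 * 0)) + T * (R n * (0 + 0))"
      unfolding F1_def by (intro tendsto_intros s_tendsto dt_tendsto f1(1) f2(1) d) (use q in linarith)
    have lim2: "F2 \<longlonglongrightarrow> ((1 + 0) * v n + (C n * E n 0 T) * (0 + 0)) + T * 0"
      unfolding F2_def by (intro tendsto_intros s_tendsto dt_tendsto f3(1))
    have "(\<lambda>b. min (F2 b) (F1 b)) \<longlonglongrightarrow> u (Suc K) n"
      using tendsto_min[OF lim2 lim1] by simp
    moreover have "\<forall>\<^sub>F b in sequentially. d b > 0" using order_tendstoD(1)[OF d, of 0] q by simp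
    with f1(2) f2(2) f3(2) eventually_small[of n] have "\<forall>\<^sub>F b in sequentially. V (Suc K) n b \<le> min (F2 b) (F1 b)"
    proof eventually_elim
      case (elim b)
      have dtsum: "(\<Sum>j<2 ^ b :: nat. dt b * A) = T * A" for A :: real by simp
      have "V (Suc K) n b \<le> (\<Sum>j<2 ^ b. dt b * (p n b j + f3 b))"
        unfolding V_def using dt_pos[of b] elim(3) by (intro sum_mono mult_left_mono) auto
      also have "\<dots> = (\<Sum>j<2 ^ b. dt b * p n b j) + T * f3 b"
        by (simp only: distrib_left sum.distrib dtsum)
      also have "\<dots> \<le> F2 b" unfolding F2_def by (intro add_right_mono riemann_energy_le)
      finally have V2: "V (Suc K) n b \<le> F2 b" .
      let ?H = "\<Sum>j<2 ^ b. dt b * h K n b j"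
      have "\<sigma>\<^sup>2 * (d b * ?H) = (2 * c n - (c n)\<^sup>2 * dt b) * ?H"
        unfolding c2 d_def using \<sigma> by (simp add: field_simps)
      also have "\<dots> \<le> \<sigma>\<^sup>2 * ((k (n - 1))\<^sup>2 * V K (n - 1) b + (k n)\<^sup>2 * V K (Suc n) b)" by (rule h_dissipation(1)[OF n])
      also have "\<dots> \<le> \<sigma>\<^sup>2 * ((k (n - 1))\<^sup>2 * f1 b + (k n)\<^sup>2 * f2 b)"
        using elim by (intro mult_left_mono add_mono) auto
      finally have "d b * ?H \<le> (k (n - 1))\<^sup>2 * f1 b + (k n)\<^sup>2 * f2 b" using \<sigma> by simp
      then have H: "?H \<le> ((k (n - 1))\<^sup>2 * f1 b + (k n)\<^sup>2 * f2 b) / d b"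
        using elim(5) by (simp add: pos_le_divide_eq mult.commute)
      have "V (Suc K) n b \<le> (\<Sum>j<2 ^ b. dt b * ((1 + s b) * h K n b j + R n * (dt b + s b)))"
        unfolding V_def using dt_pos[of b] a_le_h(1)[OF n _ elim(4)] by (intro sum_mono mult_left_mono) auto
      also have "\<dots> = (\<Sum>j<2 ^ b. (1 + s b) * (dt b * h K n b j)) + T * (R n * (dt b + s b))"
        by (simp only: distrib_left[of "dt b"] sum.distrib dtsum mult.left_commute[of "dt b" "1 + s b"])
      also have "\<dots> = (1 + s b) * ?H + T * (R n * (dt b + s b))"
        by (simp only: sum_distrib_left)
      also have "\<dots> \<le> F1 b" unfolding F1_def using H s_pos[of b] by (intro add_right_mono mult_left_mono) auto
      finally show ?case using V2 by simp
    qed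
    ultimately show ?thesis by blast
  qed
qed

lemma v_tendsto: "v \<longlonglongrightarrow> 0"
  unfolding v_def[abs_def] sq_def by (rule X_vanish)

text \<open>The order of limits matters: first K, then a grid level depending on K, since the
  discretization errors depend on K. The bound on integrated distances at K becomes a bound at every
  grid time at K + 1.\<close>

theorem picard_converges:
  assumes n: "n \<ge> 1" and \<epsilon>: "\<epsilon> > 0"
  shows "\<forall>\<^sub>F K in sequentially. \<forall>\<^sub>F b in sequentially. \<forall>j\<le>2 ^ b. a K n b j \<le> \<epsilon>"
proof -
  have u_lim: "(\<lambda>K. u K n) \<longlonglongrightarrow> 0" for n
  proof (cases "n = 0")
    case True
    have "u K 0 = 0" for K by (cases K) (simp_all add: v_0 k0)
    then show ?thesis by (simp add: True)
  qed (intro subharmonic_iterate_tendsto_0[of k v, OF k0 kpos v_nonneg v_tendsto]; simp)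
  have "(\<lambda>K. \<sigma>\<^sup>2 * ((k (n - 1))\<^sup>2 * u K (n - 1) + (k n)\<^sup>2 * u K (Suc n))) \<longlonglongrightarrow> \<sigma>\<^sup>2 * ((k (n - 1))\<^sup>2 * 0 + (k n)\<^sup>2 * 0)"
    by (intro tendsto_intros u_lim)
  then have "(\<lambda>K. \<sigma>\<^sup>2 * ((k (n - 1))\<^sup>2 * u K (n - 1) + (k n)\<^sup>2 * u K (Suc n))) \<longlonglongrightarrow> 0" by simp
  from order_tendstoD(2)[OF this \<epsilon>]
  have "\<forall>\<^sub>F K in sequentially. \<forall>\<^sub>F b in sequentially. \<forall>j\<le>2 ^ b. a (Suc K) n b j \<le> \<epsilon>"
  proof eventually_elim
    case (elim K)
    obtain f1 where f1: "f1 \<longlonglongrightarrow> u K (n - 1)" "\<forall>\<^sub>F b in sequentially. V K (n - 1) b \<le> f1 b" using picard_energy by blast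
    obtain f2 where f2: "f2 \<longlonglongrightarrow> u K (Suc n)" "\<forall>\<^sub>F b in sequentially. V K (Suc n) b \<le> f2 b" using picard_energy by blast
    have "(\<lambda>b. (1 + s b) * (\<sigma>\<^sup>2 * ((k (n - 1))\<^sup>2 * f1 b + (k n)\<^sup>2 * f2 b)) + R n * (dt b + s b))
      \<longlonglongrightarrow> (1 + 0) * (\<sigma>\<^sup>2 * ((k (n - 1))\<^sup>2 * u K (n - 1) + (k n)\<^sup>2 * u K (Suc n))) + R n * (0 + 0)"
      by (intro tendsto_intros s_tendsto dt_tendsto f1(1) f2(1))
    from order_tendstoD(2)[OF this, of \<epsilon>] elim
    have "\<forall>\<^sub>F b in sequentially. (1 + s b) * (\<sigma>\<^sup>2 * ((k (n - 1))\<^sup>2 * f1 b + (k n)\<^sup>2 * f2 b)) + R n * (dt b + s b) < \<epsilon>" by simp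
    with f1(2) f2(2) eventually_small[of n] show ?case
    proof eventually_elim
      case (elim b)
      show ?case
      proof (intro allI impI)
        fix j :: nat assume j: "j \<le> 2 ^ b"
        have "h K n b j \<le> \<sigma>\<^sup>2 * ((k (n - 1))\<^sup>2 * V K (n - 1) b + (k n)\<^sup>2 * V K (Suc n) b)"
          by (rule h_dissipation(2)[OF n elim(3) j])
        also have "\<dots> \<le> \<sigma>\<^sup>2 * ((k (n - 1))\<^sup>2 * f1 b + (k n)\<^sup>2 * f2 b)"
          using elim by (intro mult_left_mono add_mono) auto
        finally have "(1 + s b) * h K n b j \<le> (1 + s b) * (\<sigma>\<^sup>2 * ((k (n - 1))\<^sup>2 * f1 b + (k n)\<^sup>2 * f2 b))"
          using s_pos[of b] by (intro mult_left_mono) auto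
        with a_le_h(1)[OF n j elim(3), of K] elim(4) show "a (Suc K) n b j \<le> \<epsilon>" by linarith
      qed
    qed
  qed
  then show ?thesis by (rule eventually_sequentially_Suc[THEN iffD1])
qed

lemma picard_conv_prob:
  fixes K b j :: "nat \<Rightarrow> nat" and e :: "nat \<Rightarrow> real" and n :: nat and t :: real
  assumes n: "n \<ge> 1" and j: "\<And>q. j q \<le> 2 ^ b q" "\<And>q. dy T (b q) (j q) = t" and t: "t \<in> {0..T}"
    and le: "\<And>q. a (K q) n (b q) (j q) \<le> (e q)\<^sup>2" and e: "\<And>q. e q > 0" "e \<longlonglongrightarrow> 0"
  shows "conv_prob M (\<lambda>q. Y (K q) n (b q) (j q)) (X n t)"
proof (rule conv_prob_L2[OF _ X_measurable[OF t] _ _ e])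
  have sw: "(Y (K q) n (b q) (j q) z - X n t z)\<^sup>2 = (X n (dy T (b q) (j q)) z - Y (K q) n (b q) (j q) z)\<^sup>2" for q z
    unfolding j(2) by (rule power2_commute)
  fix q
  show "Y (K q) n (b q) (j q) \<in> borel_measurable M" by (rule sqi_measurable[OF Y_sqi[OF j(1)] j(1)])
  show "integrable M (\<lambda>z. (Y (K q) n (b q) (j q) z - X n t z)\<^sup>2)"
    unfolding sw using sqi_diff[OF X_second_moment(1)[OF j(1)] Y_sqi[OF j(1)] j(1)] by (simp add: sqi_def)
  show "(\<integral>z. (Y (K q) n (b q) (j q) z - X n t z)\<^sup>2 \<partial>M) \<le> (e q)\<^sup>2"
    unfolding sw using le[of q] by (simp only: a_def)
qed

lemma X_conv_prob:
  fixes r :: "nat \<Rightarrow> real" and n :: nat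
  assumes "\<And>m. r m \<in> {0..T}" "r \<longlonglongrightarrow> t" "t \<in> {0..T}"
  shows "conv_prob M (\<lambda>m. X n (r m)) (X n t)"
proof (rule AE_imp_conv_prob[OF X_measurable[OF assms(1)] X_measurable[OF assms(3)]], rule AE_I2)
  fix z assume "z \<in> space M"
  from continuous_on_tendsto_compose[OF X_cont[OF this] assms(2,3)] assms(1)
  show "(\<lambda>m. X n (r m) z) \<longlonglongrightarrow> X n t z" by simp
qed

lemma energy_conv_prob:
  "conv_prob M (\<lambda>m z. \<Sum>j<2 ^ m. X n (dy T m j) z * X n (dy T m j) z * dt m) (\<lambda>z. integral {0..T} (\<lambda>u. (X n u z)\<^sup>2))"
proof (rule AE_imp_conv_prob[OF _ _ AE_I2])
  show "(\<lambda>z. \<Sum>j<2 ^ m. X n (dy T m j) z * X n (dy T m j) z * dt m) \<in> borel_measurable M" for m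
    by (intro borel_measurable_sum borel_measurable_times borel_measurable_const X_measurable dy_mem[OF T_pos]) auto
  show "(\<lambda>z. integral {0..T} (\<lambda>u. (X n u z)\<^sup>2)) \<in> borel_measurable M" using X_int by blast
  fix z assume "z \<in> space M"
  then have "continuous_on {0..T} (\<lambda>u. (X n u z)\<^sup>2)" by (intro continuous_intros X_cont)
  from riemann_limit'[OF this T_pos, of 1 0]
  show "(\<lambda>m. \<Sum>j<2 ^ m. X n (dy T m j) z * X n (dy T m j) z * dt m) \<longlonglongrightarrow> integral {0..T} (\<lambda>u. (X n u z)\<^sup>2)"
    by (simp add: dy_def power2_eq_square)
qed

end

section \<open>Uniqueness in law\<close>

text \<open>All dyadic increments of all levels and components form one point of a product space.
  Indices without a meaning get the value 0, so that the index set is a full type.\<close>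

definition incr :: "real \<Rightarrow> (nat \<Rightarrow> real \<Rightarrow> 'a \<Rightarrow> real) \<Rightarrow> 'a \<Rightarrow> nat \<times> nat \<times> nat \<Rightarrow> real" where
  "incr T B z = (\<lambda>(m, j, n). if n \<ge> 1 \<and> j < 2 ^ m then B n (dy T m (Suc j)) z - B n (dy T m j) z else 0)"

text \<open>Recovers the increments of level m from those of a finer level \<open>M\<close>, with
  the same zeros as \<open>incr\<close>.\<close>

definition coarsen :: "nat \<Rightarrow> (nat \<times> nat \<Rightarrow> real) \<Rightarrow> nat \<times> nat \<times> nat \<Rightarrow> real" where
  "coarsen M y = (\<lambda>(m, j, n). if n \<ge> 1 \<and> j < 2 ^ m then \<Sum>l=j * 2 ^ (M - m)..<Suc j * 2 ^ (M - m). y (l, n) else 0)"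

abbreviation incr_space :: "(nat \<times> nat \<times> nat \<Rightarrow> real) measure" where
  "incr_space \<equiv> PiM UNIV (\<lambda>_. borel)"

section \<open>The law of all dyadic increments\<close>

context gauss_grid
begin

lemma incr_eq: "n \<ge> 1 \<Longrightarrow> j < 2 ^ m \<Longrightarrow> incr T B z (m, j, n) = dB m j n z"
  by (simp add: incr_def dB_def)

lemma incr_measurable: "incr T B \<in> measurable M incr_space"
proof (rule measurable_PiM_single')
  fix p :: "nat \<times> nat \<times> nat"
  obtain m j n where p: "p = (m, j, n)" by (cases p) auto
  show "(\<lambda>z. incr T B z p) \<in> borel_measurable M"
  proof (cases "n \<ge> 1 \<and> j < 2 ^ m")
    case True
    then have "(\<lambda>z. incr T B z p) = dB m j n" by (auto simp: p incr_eq)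
    then show ?thesis using True by (simp add: dB_measurable)
  next
    case False
    then have "(\<lambda>z. incr T B z p) = (\<lambda>z. 0)" by (auto simp: p incr_def)
    then show ?thesis by simp
  qed
qed simp

lemma dB_refine:
  assumes m: "m \<le> M'"
  shows "dB m j n z = (\<Sum>l=j * 2 ^ (M' - m)..<Suc j * 2 ^ (M' - m). dB M' l n z)"
proof -
  have "(\<Sum>l=j * 2 ^ (M' - m)..<Suc j * 2 ^ (M' - m). dB M' l n z) = B n (dy T M' (Suc j * 2 ^ (M' - m))) z - B n (dy T M' (j * 2 ^ (M' - m))) z"
    unfolding dB_def by (rule sum_Suc_diff') simp
  moreover have "dy T M' (i * 2 ^ (M' - m)) = dy T m i" for i
    using dy_refine[of T m "M' - m" i] m by simp
  ultimately show ?thesis unfolding dB_def by (simp only:)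
qed

text \<open>Independence over time comes from \<open>increments_box\<close>, which conditions cell
  by cell; boxes then determine the product law.\<close>

lemma increments_law:
  "distr M (PiM ({..<2 ^ m} \<times> {1..N}) (\<lambda>_. gauss (T / 2 ^ m))) (\<lambda>z. \<lambda>p\<in>{..<2 ^ m} \<times> {1..N}. dB m (fst p) (snd p) z)
    = PiM ({..<2 ^ m} \<times> {1..N}) (\<lambda>_. gauss (T / 2 ^ m))"
proof -
  let ?J = "{..<2 ^ m} \<times> {1..N} :: (nat \<times> nat) set" and ?G = "\<lambda>_ :: nat \<times> nat. gauss (T / 2 ^ m)"
  let ?y = "\<lambda>z. \<lambda>p\<in>?J. dB m (fst p) (snd p) z"
  interpret G: prob_space "gauss (T / 2 ^ m)" by (rule prob_space_gauss) (rule dt_pos)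
  interpret product_sigma_finite ?G by unfold_locales
  have y: "?y \<in> measurable M (PiM ?J ?G)"
    by (rule measurable_restrict) (auto intro!: dB_measurable simp: measurable_cong_sets[OF refl sets_gauss])
  show ?thesis
  proof (rule PiM_eqI)
    fix A :: "nat \<times> nat \<Rightarrow> real set" assume A: "\<And>p. p \<in> ?J \<Longrightarrow> A p \<in> sets (?G p)"
    define C where "C j n = (if (j, n) \<in> ?J then A (j, n) else {})" for j n
    have C: "C j n \<in> sets borel" for j n using A[of "(j, n)"] by (auto simp: C_def)
    have S: "finite {1..N}" "{1..N} \<subseteq> {1..}" by auto
    have "emeasure (distr M (PiM ?J ?G) ?y) (Pi\<^sub>E ?J A) = emeasure M (?y -` Pi\<^sub>E ?J A \<inter> space M)"
      using A by (intro emeasure_distr[OF y] sets_PiM_I_finite) auto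
    also have "?y -` Pi\<^sub>E ?J A \<inter> space M = {z\<in>space M. \<forall>j<2 ^ m. \<forall>n\<in>{1..N}. dB m j n z \<in> C j n}"
      by (auto simp: C_def PiE_iff)
    also have "emeasure M \<dots> = ennreal (\<Prod>j<2 ^ m. \<Prod>n=1..N. measure (gauss (T / 2 ^ m)) (C j n))"
      using conjunct2[OF increments_box[OF S order.refl, of C m, OF C]] by (simp only: emeasure_eq_measure)
    also have "(\<Prod>j<2 ^ m. \<Prod>n=1..N. measure (gauss (T / 2 ^ m)) (C j n)) = (\<Prod>p\<in>?J. measure (gauss (T / 2 ^ m)) (A p))"
      unfolding prod.cartesian_product by (intro prod.cong refl) (auto simp: C_def)
    also have "ennreal \<dots> = (\<Prod>p\<in>?J. emeasure (?G p) (A p))"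
      by (simp add: G.emeasure_eq_measure prod_ennreal)
    finally show "emeasure (distr M (PiM ?J ?G) ?y) (Pi\<^sub>E ?J A) = (\<Prod>p\<in>?J. emeasure (?G p) (A p))" .
  qed auto
qed

text \<open>Increments of different levels overlap and are dependent. Expressed through a level at
  least as fine as all those in \<open>J\<close>, they become sums of independent Gaussians, and the
  probability is given without reference to the space.\<close>

lemma incr_box:
  assumes J: "finite J" and bnd: "\<And>m j n. (m, j, n) \<in> J \<Longrightarrow> m \<le> M' \<and> n \<le> N" and A: "\<And>p. p \<in> J \<Longrightarrow> A p \<in> sets borel"
  shows "emeasure M {z\<in>space M. \<forall>p\<in>J. incr T B z p \<in> A p}
    = emeasure (PiM ({..<2 ^ M'} \<times> {1..N}) (\<lambda>_. gauss (T / 2 ^ M'))) {y\<in>space (PiM ({..<2 ^ M'} \<times> {1..N}) (\<lambda>_. gauss (T / 2 ^ M'))). \<forall>p\<in>J. coarsen M' y p \<in> A p}"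
proof -
  let ?I = "{..<2 ^ M'} \<times> {1..N} :: (nat \<times> nat) set" and ?G = "\<lambda>_ :: nat \<times> nat. gauss (T / 2 ^ M')"
  let ?y = "\<lambda>z. \<lambda>p\<in>?I. dB M' (fst p) (snd p) z"
  have y: "?y \<in> measurable M (PiM ?I ?G)"
    by (rule measurable_restrict) (auto intro!: dB_measurable simp: measurable_cong_sets[OF refl sets_gauss])
  have ind: "(l, n) \<in> ?I" if "(m, j, n) \<in> J" "n \<ge> 1" "j < 2 ^ m" "l < Suc j * 2 ^ (M' - m)" for m j n l
  proof -
    have "Suc j * 2 ^ (M' - m) \<le> 2 ^ m * 2 ^ (M' - m)" using that by (intro mult_le_mono1) simp
    also have "\<dots> = 2 ^ M'" using bnd[OF that(1)] by (simp flip: power_add)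
    finally show ?thesis using that bnd[OF that(1)] by auto
  qed
  have co: "coarsen M' (?y z) p = incr T B z p" if p: "p \<in> J" for p z
  proof -
    obtain m j n where p': "p = (m, j, n)" by (cases p) auto
    show ?thesis
    proof (cases "n \<ge> 1 \<and> j < 2 ^ m")
      case True
      have "m \<le> M'" using bnd p p' by blast
      have "coarsen M' (?y z) p = (\<Sum>l=j * 2 ^ (M' - m)..<Suc j * 2 ^ (M' - m). ?y z (l, n))"
        using True by (simp only: coarsen_def p' prod.case if_True simp_thms)
      also have "\<dots> = (\<Sum>l=j * 2 ^ (M' - m)..<Suc j * 2 ^ (M' - m). dB M' l n z)"
        using ind[of m j n] p True unfolding p' by (intro sum.cong refl) auto
      also have "\<dots> = incr T B z p" using True dB_refine[OF \<open>m \<le> M'\<close>] by (simp only: p' incr_eq)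
      finally show ?thesis .
    qed (auto simp: p' coarsen_def incr_def)
  qed
  have meas: "(\<lambda>y. coarsen M' y p) \<in> borel_measurable (PiM ?I ?G)" if p: "p \<in> J" for p
  proof -
    obtain m j n where p': "p = (m, j, n)" by (cases p) auto
    show ?thesis
    proof (cases "n \<ge> 1 \<and> j < 2 ^ m")
      case True
      have "(\<lambda>y. y (l, n)) \<in> borel_measurable (PiM ?I ?G)" if "l < Suc j * 2 ^ (M' - m)" for l
        using measurable_component_singleton[OF ind[of m j n l], of ?G] that True p p'
        by (simp add: measurable_cong_sets[OF refl sets_gauss])
      then have "(\<lambda>y. \<Sum>l=j * 2 ^ (M' - m)..<Suc j * 2 ^ (M' - m). y (l, n)) \<in> borel_measurable (PiM ?I ?G)"
        by (intro borel_measurable_sum) auto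
      then show ?thesis using True by (simp only: coarsen_def p' prod.case if_True simp_thms)
    next
      case False
      then have "(\<lambda>y. coarsen M' y p) = (\<lambda>y. 0)" by (auto simp: p' coarsen_def)
      then show ?thesis by simp
    qed
  qed
  let ?S = "{y\<in>space (PiM ?I ?G). \<forall>p\<in>J. coarsen M' y p \<in> A p}"
  have S: "?S \<in> sets (PiM ?I ?G)"
  proof (rule sets.sets_Collect_finite_All[OF _ J])
    fix p assume p: "p \<in> J"
    from measurable_sets[OF meas[OF p] A[OF p]] show "{y\<in>space (PiM ?I ?G). coarsen M' y p \<in> A p} \<in> sets (PiM ?I ?G)"
      by (simp add: vimage_def Int_def conj_commute)
  qed
  have "emeasure (PiM ?I ?G) ?S = emeasure (distr M (PiM ?I ?G) ?y) ?S" by (simp only: increments_law)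
  also have "\<dots> = emeasure M (?y -` ?S \<inter> space M)" by (rule emeasure_distr[OF y S])
  also have "?y -` ?S \<inter> space M = {z\<in>space M. \<forall>p\<in>J. incr T B z p \<in> A p}"
    using co measurable_space[OF y] by auto
  finally show ?thesis by simp
qed

end

text \<open>By \<open>incr_box\<close> the probability of every finite-dimensional box is given by a
  formula in which neither space occurs, only \<open>T\<close>.\<close>

theorem incr_law_unique:
  assumes "gauss_grid M1 F1 T B1" "gauss_grid M2 F2 T B2"
  shows "distr M1 incr_space (incr T B1) = distr M2 incr_space (incr T B2)"
proof -
  interpret G1: gauss_grid M1 F1 T B1 by fact
  interpret G2: gauss_grid M2 F2 T B2 by fact
  show ?thesis
  proof (rule measure_eqI_PiM_infinite)
    interpret D: prob_space "distr M1 incr_space (incr T B1)" by (rule G1.prob_space_distr[OF G1.incr_measurable])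
    show "finite_measure (distr M1 incr_space (incr T B1))" by unfold_locales
    fix A :: "nat \<times> nat \<times> nat \<Rightarrow> real set" and J :: "(nat \<times> nat \<times> nat) set"
    assume J: "finite J" and A: "\<And>p. p \<in> J \<Longrightarrow> A p \<in> sets borel"
    define M' where "M' = Max (insert 0 (fst ` J))"
    define N where "N = Max (insert 0 ((\<lambda>p. snd (snd p)) ` J))"
    have bnd: "m \<le> M' \<and> n \<le> N" if "(m, j, n) \<in> J" for m j n
      unfolding M'_def N_def using that J by (force intro!: Max_ge)
    let ?X = "prod_emb UNIV (\<lambda>_. borel) J (Pi\<^sub>E J A)"
    have X: "?X \<in> sets incr_space" using J A by (intro sets_PiM_I) auto
    have e: "incr T B' -` ?X \<inter> space M' = {z\<in>space M'. \<forall>p\<in>J. incr T B' z p \<in> A p}"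
      for B' :: "nat \<Rightarrow> real \<Rightarrow> 'c \<Rightarrow> real" and M'
      by (auto simp: prod_emb_def PiE_iff)
    note b1 = G1.incr_box[OF J bnd A] and b2 = G2.incr_box[OF J bnd A]
    show "emeasure (distr M1 incr_space (incr T B1)) ?X = emeasure (distr M2 incr_space (incr T B2)) ?X"
      unfolding emeasure_distr[OF G1.incr_measurable X] emeasure_distr[OF G2.incr_measurable X] e
      using b1 b2 by (simp only:)
  qed simp_all
qed

lemma euler_measurable:
  assumes y: "\<And>p l. (\<lambda>z. y z p l) \<in> borel_measurable N" and \<beta>: "\<And>l i. (\<lambda>z. \<beta> z l i) \<in> borel_measurable N"
  shows "(\<lambda>z. euler \<sigma> k d a n (y z) (\<beta> z) j) \<in> borel_measurable N"
proof (induction j)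
  case (Suc j)
  have "(\<lambda>z. cf \<sigma> k n i (\<lambda>p. y z p j)) \<in> borel_measurable N" for i
    using y[of "Suc n" j] y[of i j] unfolding cf_def by measurable
  then show ?case unfolding euler.simps(2)
    by (intro borel_measurable_add borel_measurable_sum borel_measurable_times borel_measurable_const Suc \<beta>)
qed simp

lemma picard_measurable:
  assumes \<beta>: "\<And>l i. (\<lambda>z. \<beta> z l i) \<in> borel_measurable N"
  shows "(\<lambda>z. picard \<sigma> k x d (\<beta> z) K n j) \<in> borel_measurable N"
proof (induction K arbitrary: n j)
  case (Suc K)
  show ?case
    using euler_measurable[where y="\<lambda>z p l. picard \<sigma> k x d (\<beta> z) K p l", OF Suc \<beta>] by (cases "n = 0") auto
qed simp

lemma euler_cong:
  assumes "\<And>p l. l < j \<Longrightarrow> z p l = z' p l" "\<And>l i. l < j \<Longrightarrow> i \<ge> 1 \<Longrightarrow> \<beta> l i = \<beta>' l i"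
  shows "euler \<sigma> k d a n z \<beta> j = euler \<sigma> k d a n z' \<beta>' j"
  using assms by (induction j) (auto intro!: sum.cong)

text \<open>The iterate at j sees only increments with l < j and i >= 1; on the grid these are the
  entries at which \<open>incr\<close> holds genuine increments.\<close>

lemma picard_cong:
  assumes "\<And>l i. l < j \<Longrightarrow> i \<ge> 1 \<Longrightarrow> \<beta> l i = \<beta>' l i"
  shows "picard \<sigma> k x d \<beta> K n j = picard \<sigma> k x d \<beta>' K n j"
  using assms
proof (induction K arbitrary: n j)
  case (Suc K)
  show ?case unfolding picard.simps(2)
    by (intro if_cong refl euler_cong Suc.IH Suc.prems) auto
qed simp

section \<open>Common functionals of the increments\<close>

locale two_grids = G1: gauss_grid M1 F1 T B1 + G2: gauss_grid M2 F2 T B2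
  for M1 :: "'a measure" and F1 T B1 and M2 :: "'b measure" and F2 B2
begin

text \<open>One functional \<Psi> has to serve both spaces. This takes the place of a strong
  solution: what is obtained from the noise by the same rule on both sides has the same law.\<close>

definition same_fun :: "('a \<Rightarrow> real) \<Rightarrow> ('b \<Rightarrow> real) \<Rightarrow> bool" where
  "same_fun U1 U2 \<longleftrightarrow> (\<exists>\<Psi>\<in>borel_measurable incr_space.
     (AE z in M1. U1 z = \<Psi> (incr T B1 z)) \<and> (AE z in M2. U2 z = \<Psi> (incr T B2 z)))"

lemma same_funI:
  assumes "\<Psi> \<in> borel_measurable incr_space" "\<And>z. U1 z = \<Psi> (incr T B1 z)" "\<And>z. U2 z = \<Psi> (incr T B2 z)"
  shows "same_fun U1 U2"
  unfolding same_fun_def using assms by auto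

lemma same_fun_const: "same_fun (\<lambda>_. a) (\<lambda>_. a)"
  by (rule same_funI[of "\<lambda>_. a"]) auto

lemma same_fun_add:
  assumes "same_fun U1 U2" "same_fun V1 V2"
  shows "same_fun (\<lambda>z. U1 z + V1 z) (\<lambda>z. U2 z + V2 z)"
proof -
  obtain \<Psi> \<Phi> where m: "\<Psi> \<in> borel_measurable incr_space" "\<Phi> \<in> borel_measurable incr_space"
    and a: "AE z in M1. U1 z = \<Psi> (incr T B1 z)" "AE z in M2. U2 z = \<Psi> (incr T B2 z)"
      "AE z in M1. V1 z = \<Phi> (incr T B1 z)" "AE z in M2. V2 z = \<Phi> (incr T B2 z)"
    using assms unfolding same_fun_def by blast
  show ?thesis unfolding same_fun_def
  proof (intro bexI[of _ "\<lambda>w. \<Psi> w + \<Phi> w"] conjI borel_measurable_add m)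
    show "AE z in M1. U1 z + V1 z = \<Psi> (incr T B1 z) + \<Phi> (incr T B1 z)" using a(1,3) by eventually_elim simp
    show "AE z in M2. U2 z + V2 z = \<Psi> (incr T B2 z) + \<Phi> (incr T B2 z)" using a(2,4) by eventually_elim simp
  qed
qed

lemma same_fun_mult:
  assumes "same_fun U1 U2" "same_fun V1 V2"
  shows "same_fun (\<lambda>z. U1 z * V1 z) (\<lambda>z. U2 z * V2 z)"
proof -
  obtain \<Psi> \<Phi> where m: "\<Psi> \<in> borel_measurable incr_space" "\<Phi> \<in> borel_measurable incr_space"
    and a: "AE z in M1. U1 z = \<Psi> (incr T B1 z)" "AE z in M2. U2 z = \<Psi> (incr T B2 z)"
      "AE z in M1. V1 z = \<Phi> (incr T B1 z)" "AE z in M2. V2 z = \<Phi> (incr T B2 z)"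
    using assms unfolding same_fun_def by blast
  show ?thesis unfolding same_fun_def
  proof (intro bexI[of _ "\<lambda>w. \<Psi> w * \<Phi> w"] conjI borel_measurable_times m)
    show "AE z in M1. U1 z * V1 z = \<Psi> (incr T B1 z) * \<Phi> (incr T B1 z)" using a(1,3) by eventually_elim simp
    show "AE z in M2. U2 z * V2 z = \<Psi> (incr T B2 z) * \<Phi> (incr T B2 z)" using a(2,4) by eventually_elim simp
  qed
qed

lemma same_fun_sum:
  assumes "finite S" "\<And>i. i \<in> S \<Longrightarrow> same_fun (U1 i) (U2 i)"
  shows "same_fun (\<lambda>z. \<Sum>i\<in>S. U1 i z) (\<lambda>z. \<Sum>i\<in>S. U2 i z)"
  using assms by (induction S rule: finite_induct) (auto intro: same_fun_const same_fun_add)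

lemma same_fun_component: "same_fun (\<lambda>z. incr T B1 z p) (\<lambda>z. incr T B2 z p)"
  by (rule same_funI[of "\<lambda>w. w p"]) auto

text \<open>A common functional needs a common subsequence: one is chosen for the first space and
  thinned out again for the second. \<open>lim\<close> gives the limit functional a value at every
  point, also where the approximations diverge.\<close>

lemma same_fun_lim:
  assumes U: "\<And>q. same_fun (U1 q) (U2 q)" and c: "conv_prob M1 U1 u1" "conv_prob M2 U2 u2"
  shows "same_fun u1 u2"
proof -
  obtain r1 :: "nat \<Rightarrow> nat" where r1: "strict_mono r1" "AE z in M1. (\<lambda>q. U1 (r1 q) z) \<longlonglongrightarrow> u1 z"
    using G1.conv_prob_AE_subseq[of "{()}" "\<lambda>_. U1" "\<lambda>_. u1"] c(1) by auto
  obtain r2 :: "nat \<Rightarrow> nat" where r2: "strict_mono r2" "AE z in M2. (\<lambda>q. U2 (r1 (r2 q)) z) \<longlonglongrightarrow> u2 z"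
    using G2.conv_prob_AE_subseq[of "{()}" "\<lambda>_ q. U2 (r1 q)" "\<lambda>_. u2"] G2.conv_prob_subseq[OF c(2) r1(1)] by auto
  have "\<forall>q. \<exists>\<Psi>. \<Psi> \<in> borel_measurable incr_space \<and> (AE z in M1. U1 q z = \<Psi> (incr T B1 z)) \<and> (AE z in M2. U2 q z = \<Psi> (incr T B2 z))"
    using U unfolding same_fun_def by blast
  from choice[OF this] obtain \<Psi> where \<Psi>: "\<And>q. \<Psi> q \<in> borel_measurable incr_space" "\<And>q. AE z in M1. U1 q z = \<Psi> q (incr T B1 z)" "\<And>q. AE z in M2. U2 q z = \<Psi> q (incr T B2 z)"
    by blast
  have all: "AE z in M1. \<forall>q. U1 q z = \<Psi> q (incr T B1 z)" "AE z in M2. \<forall>q. U2 q z = \<Psi> q (incr T B2 z)"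
    using \<Psi>(2,3) by (auto simp: AE_all_countable)
  let ?\<Phi> = "\<lambda>w. lim (\<lambda>q. \<Psi> (r1 (r2 q)) w)"
  show ?thesis unfolding same_fun_def
  proof (intro bexI[of _ ?\<Phi>] conjI)
    show "?\<Phi> \<in> borel_measurable incr_space" by (rule borel_measurable_lim_metric) (rule \<Psi>(1))
    show "AE z in M1. u1 z = ?\<Phi> (incr T B1 z)"
      using r1(2) all(1)
    proof eventually_elim
      case (elim z)
      from LIMSEQ_subseq_LIMSEQ[OF elim(1) r2(1)] elim(2) show ?case by (simp add: o_def limI)
    qed
    show "AE z in M2. u2 z = ?\<Phi> (incr T B2 z)"
      using r2(2) all(2) by eventually_elim (simp add: limI)
  qed
qed

text \<open>Both sides integrate one function of the increments against their common law. The weight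
  exp L can be carried along because L is itself such a functional; it is what undoes the change of
  measure.\<close>

lemma same_fun_law:
  assumes J: "finite J" and U: "\<And>i. i \<in> J \<Longrightarrow> same_fun (U1 i) (U2 i)" and A: "\<And>i. i \<in> J \<Longrightarrow> A i \<in> sets borel"
    and L: "same_fun L1 L2"
  shows "(\<integral>\<^sup>+z. ennreal (exp (L1 z)) * indicator {z. \<forall>i\<in>J. U1 i z \<in> A i} z \<partial>M1)
    = (\<integral>\<^sup>+z. ennreal (exp (L2 z)) * indicator {z. \<forall>i\<in>J. U2 i z \<in> A i} z \<partial>M2)"
proof -
  have "\<forall>i\<in>J. \<exists>\<Psi>. \<Psi> \<in> borel_measurable incr_space \<and> (AE z in M1. U1 i z = \<Psi> (incr T B1 z)) \<and> (AE z in M2. U2 i z = \<Psi> (incr T B2 z))"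
    using U unfolding same_fun_def by blast
  from bchoice[OF this] obtain \<Psi> where \<Psi>: "\<And>i. i \<in> J \<Longrightarrow> \<Psi> i \<in> borel_measurable incr_space" "\<And>i. i \<in> J \<Longrightarrow> AE z in M1. U1 i z = \<Psi> i (incr T B1 z)" "\<And>i. i \<in> J \<Longrightarrow> AE z in M2. U2 i z = \<Psi> i (incr T B2 z)"
    by blast
  obtain \<Phi> where \<Phi>: "\<Phi> \<in> borel_measurable incr_space" "AE z in M1. L1 z = \<Phi> (incr T B1 z)" "AE z in M2. L2 z = \<Phi> (incr T B2 z)"
    using L unfolding same_fun_def by blast
  let ?S = "{w\<in>space incr_space. \<forall>i\<in>J. \<Psi> i w \<in> A i}"
  let ?f = "\<lambda>w. ennreal (exp (\<Phi> w)) * indicator ?S w"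
  have S: "?S \<in> sets incr_space"
  proof (rule sets.sets_Collect_finite_All[OF _ J])
    fix i assume i: "i \<in> J"
    from measurable_sets[OF \<Psi>(1)[OF i] A[OF i]] show "{w\<in>space incr_space. \<Psi> i w \<in> A i} \<in> sets incr_space"
      by (simp add: vimage_def Int_def conj_commute)
  qed
  have f: "?f \<in> borel_measurable incr_space"
    using \<Phi>(1) S by measurable
  have all: "AE z in M1. \<forall>i\<in>J. U1 i z = \<Psi> i (incr T B1 z)" "AE z in M2. \<forall>i\<in>J. U2 i z = \<Psi> i (incr T B2 z)"
    using \<Psi>(2,3) J by (auto simp: AE_finite_all)
  have "(\<integral>\<^sup>+z. ennreal (exp (L1 z)) * indicator {z. \<forall>i\<in>J. U1 i z \<in> A i} z \<partial>M1) = (\<integral>\<^sup>+z. ?f (incr T B1 z) \<partial>M1)"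
    by (rule nn_integral_cong_AE) (use \<Phi>(2) all(1) in \<open>eventually_elim, auto simp: indicator_def space_PiM\<close>)
  also have "\<dots> = (\<integral>\<^sup>+w. ?f w \<partial>distr M1 incr_space (incr T B1))"
    by (subst nn_integral_distr[OF G1.incr_measurable]) (use f in simp_all)
  also have "\<dots> = (\<integral>\<^sup>+w. ?f w \<partial>distr M2 incr_space (incr T B2))"
    by (simp only: incr_law_unique[OF G1.gauss_grid_axioms G2.gauss_grid_axioms])
  also have "\<dots> = (\<integral>\<^sup>+z. ?f (incr T B2 z) \<partial>M2)"
    by (subst nn_integral_distr[OF G2.incr_measurable]) (use f in simp_all)
  also have "\<dots> = (\<integral>\<^sup>+z. ennreal (exp (L2 z)) * indicator {z. \<forall>i\<in>J. U2 i z \<in> A i} z \<partial>M2)"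
    by (rule nn_integral_cong_AE) (use \<Phi>(3) all(2) in \<open>eventually_elim, auto simp: indicator_def space_PiM\<close>)
  finally show ?thesis .
qed

end

text \<open>\<open>I n\<close> is the integral of \<open>X n\<close> against the new noise, and
  \<open>L\<close> stands for the logarithm of the density of the original measure relative to the
  new one. Passing from the old noise to the new one subtracts the full energy of \<open>X\<close> /
  \<sigma>, so the usual + 1/2 of this energy turns into - 1/2.\<close>

locale girsanov_solution = linear_system M F T B \<sigma> k x X for M :: "'a measure" and F T B \<sigma> k x X +
  fixes I :: "nat \<Rightarrow> 'a \<Rightarrow> real" and L :: "'a \<Rightarrow> real"
  assumes I_conv: "\<And>n. n \<ge> 1 \<Longrightarrow> conv_prob M (\<lambda>m z. \<Sum>j<2 ^ m. X n (dy T m j) z * dB m j n z) (I n)"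
    and L_conv: "conv_prob M (\<lambda>N z. \<Sum>n=1..N. 1 / \<sigma> * I n z + - (1 / (2 * \<sigma>\<^sup>2)) * integral {0..T} (\<lambda>u. (X n u z)\<^sup>2)) L"

locale two_solutions = S1: girsanov_solution M1 F1 T B1 \<sigma> k x X1 I1 L1 + S2: girsanov_solution M2 F2 T B2 \<sigma> k x X2 I2 L2
  for M1 :: "'a measure" and F1 T B1 \<sigma> k x X1 I1 L1 and M2 :: "'b measure" and F2 B2 X2 I2 L2
begin

sublocale two_grids M1 F1 T B1 M2 F2 B2 ..

lemma same_fun_dB:
  assumes "n \<ge> 1" "j < 2 ^ m"
  shows "same_fun (S1.dB m j n) (S2.dB m j n)"
  using same_fun_component[of "(m, j, n)"] by (simp add: S1.incr_eq[OF assms] S2.incr_eq[OF assms])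

lemma same_fun_picard:
  assumes j: "j \<le> 2 ^ b"
  shows "same_fun (S1.Y K n b j) (S2.Y K n b j)"
proof (rule same_funI[of "\<lambda>w. picard \<sigma> k x (T / 2 ^ b) (\<lambda>l i. w (b, l, i)) K n j"])
  show "(\<lambda>w. picard \<sigma> k x (T / 2 ^ b) (\<lambda>l i. w (b, l, i)) K n j) \<in> borel_measurable incr_space"
    by (rule picard_measurable) simp
  show "S1.Y K n b j z = picard \<sigma> k x (T / 2 ^ b) (\<lambda>l i. incr T B1 z (b, l, i)) K n j" for z
    unfolding S1.Y_def by (rule picard_cong) (use j in \<open>simp add: S1.incr_eq\<close>)
  show "S2.Y K n b j z = picard \<sigma> k x (T / 2 ^ b) (\<lambda>l i. incr T B2 z (b, l, i)) K n j" for z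
    unfolding S2.Y_def by (rule picard_cong) (use j in \<open>simp add: S2.incr_eq\<close>)
qed

lemma same_fun_X_dyadic:
  assumes n: "n \<ge> 1" and j: "j0 \<le> 2 ^ b0"
  shows "same_fun (X1 n (dy T b0 j0)) (X2 n (dy T b0 j0))"
proof -
  define e where "e q = 1 / real (Suc q)" for q
  have e: "e q > 0" for q by (simp add: e_def)
  have elim: "e \<longlonglongrightarrow> 0" unfolding e_def using LIMSEQ_Suc[OF lim_1_over_n] by simp
  \<comment> \<open>Both solutions must use the same iterate on the same grid, so K and b are chosen
    to satisfy the estimates of both; b at least \<open>b0\<close> keeps the given time on the
    grid.\<close>
  have "\<exists>K b. b \<ge> b0 \<and> (\<forall>j\<le>2 ^ b. S1.a K n b j \<le> (e q)\<^sup>2) \<and> (\<forall>j\<le>2 ^ b. S2.a K n b j \<le> (e q)\<^sup>2)" for q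
  proof -
    have e2: "(e q)\<^sup>2 > 0" using e[of q] by simp
    obtain K where K: "\<forall>\<^sub>F b in sequentially. \<forall>j\<le>2 ^ b. S1.a K n b j \<le> (e q)\<^sup>2" "\<forall>\<^sub>F b in sequentially. \<forall>j\<le>2 ^ b. S2.a K n b j \<le> (e q)\<^sup>2"
      using eventually_happens'[OF sequentially_bot eventually_conj[OF S1.picard_converges[OF n e2] S2.picard_converges[OF n e2]]]
      by blast
    show ?thesis
      using eventually_happens'[OF sequentially_bot eventually_conj[OF eventually_ge_at_top[of b0] eventually_conj[OF K]]] by blast
  qed
  then obtain K b where Kb: "\<And>q. b q \<ge> b0" "\<And>q j. j \<le> 2 ^ b q \<Longrightarrow> S1.a (K q) n (b q) j \<le> (e q)\<^sup>2" "\<And>q j. j \<le> 2 ^ b q \<Longrightarrow> S2.a (K q) n (b q) j \<le> (e q)\<^sup>2"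
    by metis
  define i where "i q = j0 * 2 ^ (b q - b0)" for q
  have jb: "i q \<le> 2 ^ b q" for q
  proof -
    have "i q \<le> 2 ^ b0 * 2 ^ (b q - b0)" unfolding i_def using j by (rule mult_le_mono1)
    then show ?thesis using Kb(1)[of q] by (simp flip: power_add)
  qed
  have dyj: "dy T (b q) (i q) = dy T b0 j0" for q
    using dy_refine[of T b0 "b q - b0" j0] Kb(1)[of q] by (simp add: i_def)
  note c = S1.picard_conv_prob[OF n jb dyj dy_mem[OF S1.T_pos j] _ e elim] S2.picard_conv_prob[OF n jb dyj dy_mem[OF S1.T_pos j] _ e elim]
  show ?thesis by (rule same_fun_lim[OF same_fun_picard[OF jb] c(1)[OF Kb(2)[OF jb]] c(2)[OF Kb(3)[OF jb]]])
qed

text \<open>Grid points below t, the same for both solutions, together with continuity of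
  paths.\<close>

lemma same_fun_X:
  assumes n: "n \<ge> 1" and t: "t \<in> {0..T}"
  shows "same_fun (X1 n t) (X2 n t)"
proof -
  have T: "T > 0" by (rule S1.T_pos)
  define j where "j m = nat \<lfloor>t * 2 ^ m / T\<rfloor>" for m
  have jr: "real (j m) = of_int \<lfloor>t * 2 ^ m / T\<rfloor>" for m
    unfolding j_def using t T by simp
  have jb: "j m \<le> 2 ^ m" for m
  proof -
    have "t * 2 ^ m / T \<le> 2 ^ m" using t T by (simp add: pos_divide_le_eq)
    then have "real (j m) \<le> 2 ^ m" unfolding jr by linarith
    then show ?thesis by (metis of_nat_le_iff of_nat_numeral of_nat_power)
  qed
  have lim: "(\<lambda>m. dy T m (j m)) \<longlonglongrightarrow> t"
  proof -
    have "\<bar>dy T m (j m) - t\<bar> \<le> T / 2 ^ m" for m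
    proof -
      have "dy T m (j m) - t = T / 2 ^ m * (real (j m) - t * 2 ^ m / T)" using T by (simp add: dy_def field_simps)
      moreover have "\<bar>real (j m) - t * 2 ^ m / T\<bar> \<le> 1" unfolding jr by linarith
      ultimately show ?thesis using T by (simp add: abs_mult divide_right_mono mult_left_le)
    qed
    then have "(\<lambda>m. dy T m (j m) - t) \<longlonglongrightarrow> 0"
      by (intro Lim_null_comparison[OF _ S1.dt_tendsto]) auto
    then show ?thesis by (rule LIM_zero_cancel)
  qed
  have mem: "dy T m (j m) \<in> {0..T}" for m by (rule dy_mem[OF T jb])
  show ?thesis
    by (rule same_fun_lim[OF same_fun_X_dyadic[OF n jb] S1.X_conv_prob[OF mem lim t] S2.X_conv_prob[OF mem lim t]])
qed

lemma same_fun_energy: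
  assumes n: "n \<ge> 1"
  shows "same_fun (\<lambda>z. integral {0..T} (\<lambda>u. (X1 n u z)\<^sup>2)) (\<lambda>z. integral {0..T} (\<lambda>u. (X2 n u z)\<^sup>2))"
  by (rule same_fun_lim[OF _ S1.energy_conv_prob S2.energy_conv_prob])
    (intro same_fun_sum same_fun_mult same_fun_const same_fun_X_dyadic[OF n]; simp)

lemma same_fun_L: "same_fun L1 L2"
proof (rule same_fun_lim[OF _ S1.L_conv S2.L_conv])
  fix N
  have I: "same_fun (I1 n) (I2 n)" if n: "n \<ge> 1" for n
    by (rule same_fun_lim[OF _ S1.I_conv[OF n] S2.I_conv[OF n]])
      (auto intro!: same_fun_sum same_fun_mult same_fun_X_dyadic same_fun_dB n)
  show "same_fun (\<lambda>z. \<Sum>n=1..N. 1 / \<sigma> * I1 n z + - (1 / (2 * \<sigma>\<^sup>2)) * integral {0..T} (\<lambda>u. (X1 n u z)\<^sup>2))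
     (\<lambda>z. \<Sum>n=1..N. 1 / \<sigma> * I2 n z + - (1 / (2 * \<sigma>\<^sup>2)) * integral {0..T} (\<lambda>u. (X2 n u z)\<^sup>2))"
    by (intro same_fun_sum same_fun_add same_fun_mult same_fun_const I same_fun_energy) auto
qed

end

section \<open>From weak solutions to the linear system\<close>

lemma sum_cf:
  assumes "k 0 = 0" "n \<ge> 1"
  shows "(\<Sum>i=1..n. cf \<sigma> k n i y * z i) = \<sigma> * k (n - 1) * y (n - 1) * z (n - 1) - \<sigma> * k n * y (Suc n) * z n"
proof -
  obtain q where q: "n = Suc q" using assms(2) by (cases n) auto
  show ?thesis
  proof (cases "q = 0")
    case True
    then show ?thesis using assms(1) by (simp add: q cf_def)
  next
    case False
    have "(\<Sum>i=1..n. cf \<sigma> k n i y * z i) = (\<Sum>i\<in>{q, Suc q}. cf \<sigma> k n i y * z i)"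
      using False by (intro sum.mono_neutral_right) (auto simp: q cf_def)
    then show ?thesis by (simp add: q cf_def algebra_simps)
  qed
qed

text \<open>This is the drift that arises when increments of the shifted noise are summed against
  left-end values: the shift over a cell is the integral of g over that cell.\<close>

lemma riemann_product_limit:
  fixes f g :: "real \<Rightarrow> real"
  assumes f: "continuous_on {0..T} f" and g: "continuous_on {0..T} g" and T: "T > 0" and c: "c \<le> 2 ^ b"
  shows "(\<lambda>m. \<Sum>l<c * 2 ^ m. f (dy T (b + m) l) * integral {dy T (b + m) l..dy T (b + m) (Suc l)} g)
    \<longlonglongrightarrow> integral {0..dy T b c} (\<lambda>u. f u * g u)"
proof (rule tendstoI)
  fix e :: real assume e: "e > 0"
  define K where "K = integral {0..T} (\<lambda>u. \<bar>g u\<bar>)"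
  have gi: "(\<lambda>u. \<bar>g u\<bar>) integrable_on {0..T}" by (intro integrable_continuous_real continuous_intros g)
  have K: "K \<ge> 0" unfolding K_def by (rule Henstock_Kurzweil_Integration.integral_nonneg[OF gi]) simp
  define e' where "e' = e / (2 * (K + 1))"
  have e': "e' > 0" using e K by (simp add: e'_def)
  have e'K: "e' * K < e"
  proof -
    have "e' * K \<le> e' * (K + 1)" using e' by simp
    also have "\<dots> = e / 2" using K unfolding e'_def by (simp add: field_simps)
    finally show ?thesis using e by simp
  qed
  have "\<forall>\<^sub>F m in sequentially. \<forall>u\<in>{0..T}. \<forall>v\<in>{0..T}. \<bar>u - v\<bar> \<le> 1 * T / 2 ^ (b + m) \<longrightarrow> \<bar>f u - f v\<bar> \<le> e'"
    using eventually_sequentially_seg[of "\<lambda>m. \<forall>u\<in>{0..T}. \<forall>v\<in>{0..T}. \<bar>u - v\<bar> \<le> 1 * T / 2 ^ m \<longrightarrow> \<bar>f u - f v\<bar> \<le> e'" b] eventually_small_oscillation[OF f T e', of 1]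
    by (simp add: add.commute)
  then show "\<forall>\<^sub>F m in sequentially. dist (\<Sum>l<c * 2 ^ m. f (dy T (b + m) l) * integral {dy T (b + m) l..dy T (b + m) (Suc l)} g) (integral {0..dy T b c} (\<lambda>u. f u * g u)) < e"
  proof eventually_elim
    case (elim m)
    let ?t = "dy T (b + m)"
    have cm: "c * 2 ^ m \<le> 2 ^ (b + m)" using c by (simp add: power_add)
    have mem: "{?t l..?t (Suc l)} \<subseteq> {0..T}" if "l < c * 2 ^ m" for l
      using dy_nonneg[OF T, of "b + m" l] dy_le[OF T, of "Suc l" "b + m"] that cm by auto
    have top: "?t (c * 2 ^ m) = dy T b c" by (rule dy_refine)
    have sums: "(\<Sum>l<c * 2 ^ m. integral {?t l..?t (Suc l)} h) = integral {0..dy T b c} h" if "continuous_on {0..T} h" for h :: "real \<Rightarrow> real"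
      using sum_integral_grid[OF that T le0 cm] by (simp add: atLeast0LessThan top)
    have cfg: "continuous_on {0..T} (\<lambda>u. f u * g u)" by (intro continuous_intros f g)
    have cag: "continuous_on {0..T} (\<lambda>u. \<bar>g u\<bar>)" by (intro continuous_intros g)
    have piece: "\<bar>f (?t l) * integral {?t l..?t (Suc l)} g - integral {?t l..?t (Suc l)} (\<lambda>u. f u * g u)\<bar> \<le> e' * integral {?t l..?t (Suc l)} (\<lambda>u. \<bar>g u\<bar>)"
      if l: "l < c * 2 ^ m" for l
    proof -
      note on = continuous_on_subset[OF _ mem[OF l]]
      have i: "g integrable_on {?t l..?t (Suc l)}" "(\<lambda>u. f u * g u) integrable_on {?t l..?t (Suc l)}" "(\<lambda>u. \<bar>g u\<bar>) integrable_on {?t l..?t (Suc l)}"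
        by (intro integrable_continuous_real on g cfg cag)+
      have i4: "(\<lambda>u. f (?t l) * g u) integrable_on {?t l..?t (Suc l)}"
        by (intro integrable_continuous_real continuous_intros on g)
      have "f (?t l) * integral {?t l..?t (Suc l)} g - integral {?t l..?t (Suc l)} (\<lambda>u. f u * g u) = integral {?t l..?t (Suc l)} (\<lambda>u. f (?t l) * g u - f u * g u)"
        unfolding Henstock_Kurzweil_Integration.integral_diff[OF i4 i(2)] by simp
      also have "norm \<dots> \<le> integral {?t l..?t (Suc l)} (\<lambda>u. e' * \<bar>g u\<bar>)"
      proof (rule integral_norm_bound_integral)
        show "(\<lambda>u. f (?t l) * g u - f u * g u) integrable_on {?t l..?t (Suc l)}"
          by (intro integrable_diff i4 i(2))
        show "(\<lambda>u. e' * \<bar>g u\<bar>) integrable_on {?t l..?t (Suc l)}" by (intro integrable_continuous_real continuous_intros on g)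
        fix u assume u: "u \<in> {?t l..?t (Suc l)}"
        have "?t l \<in> {?t l..?t (Suc l)}" using T by (auto intro: dy_mono)
        then have "?t l \<in> {0..T}" "u \<in> {0..T}" using mem[OF l] u by blast+
        moreover have "\<bar>?t l - u\<bar> \<le> 1 * T / 2 ^ (b + m)" using u by (auto simp: dy_Suc)
        ultimately have "\<bar>f (?t l) - f u\<bar> \<le> e'" using elim by blast
        then show "norm (f (?t l) * g u - f u * g u) \<le> e' * \<bar>g u\<bar>"
          by (simp add: left_diff_distrib[symmetric] abs_mult mult_right_mono)
      qed
      finally show ?thesis by simp
    qed
    have "\<bar>(\<Sum>l<c * 2 ^ m. f (?t l) * integral {?t l..?t (Suc l)} g) - integral {0..dy T b c} (\<lambda>u. f u * g u)\<bar>
      = \<bar>\<Sum>l<c * 2 ^ m. f (?t l) * integral {?t l..?t (Suc l)} g - integral {?t l..?t (Suc l)} (\<lambda>u. f u * g u)\<bar>"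
      by (simp only: sum_subtractf sums[OF cfg])
    also have "\<dots> \<le> (\<Sum>l<c * 2 ^ m. e' * integral {?t l..?t (Suc l)} (\<lambda>u. \<bar>g u\<bar>))"
      by (rule order.trans[OF sum_abs sum_mono[OF piece]]) simp
    also have "\<dots> = e' * integral {0..dy T b c} (\<lambda>u. \<bar>g u\<bar>)" by (simp only: sum_distrib_left[symmetric] sums[OF cag])
    also have "\<dots> \<le> e' * K"
      unfolding K_def using e' dy_le[OF T c]
      by (intro mult_left_mono integral_subset_le gi integrable_continuous_real continuous_on_subset[OF cag]) auto
    finally show ?case using e'K by (simp add: dist_real_def)
  qed
qed

lemma (in prob_space) ito_conv_prob:
  assumes ito: "has_ito_integral M H W t I" and t: "t \<in> {0..T}"
    and H: "\<And>s. s \<in> {0..T} \<Longrightarrow> H s \<in> borel_measurable M" and W: "\<And>s. s \<in> {0..T} \<Longrightarrow> W s \<in> borel_measurable M"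
  shows "conv_prob M (\<lambda>m z. \<Sum>j<2 ^ m. H (t * real j / 2 ^ m) z * (W (t * real (Suc j) / 2 ^ m) z - W (t * real j / 2 ^ m) z)) I"
proof (rule conv_probI_measure)
  have mem: "t * real j / 2 ^ m \<in> {0..T}" if "j \<le> 2 ^ m" for j m
  proof -
    have "real j \<le> 2 ^ m" using that of_nat_le_iff[where 'a=real, of j "2 ^ m"] by simp
    then have "t * real j \<le> T * 2 ^ m" using t by (intro mult_mono) auto
    then show ?thesis using t by (simp add: pos_divide_le_eq)
  qed
  show "(\<lambda>z. \<Sum>j<2 ^ m. H (t * real j / 2 ^ m) z * (W (t * real (Suc j) / 2 ^ m) z - W (t * real j / 2 ^ m) z)) \<in> borel_measurable M" for m
    by (intro borel_measurable_sum borel_measurable_times borel_measurable_diff H W mem) auto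
qed (use ito in \<open>auto simp: has_ito_integral_def\<close>)

text \<open>Monotone convergence exchanges the sum over components with the time integral in
  [0, \<infinity>]; each single component is continuous, so its two notions of integral
  agree.\<close>

lemma energy_integral_eq:
  assumes cont: "\<And>n. continuous_on {0..T} (\<lambda>t. X n t z)" and sm: "\<And>t. t \<in> {0..T} \<Longrightarrow> summable (\<lambda>n. (X n t z)\<^sup>2)"
  shows "energy_integral T X z = (\<Sum>n. ennreal (integral {0..T} (\<lambda>t. (X n t z)\<^sup>2)))"
proof -
  have c2: "continuous_on {0..T} (\<lambda>t. (X n t z)\<^sup>2)" for n by (intro continuous_intros cont)
  have "energy_integral T X z = (\<integral>\<^sup>+t. (\<Sum>n. ennreal (indicator {0..T} t * (X n t z)\<^sup>2)) \<partial>lborel)"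
    unfolding energy_integral_def
  proof (rule nn_integral_cong)
    fix t
    show "ennreal (\<Sum>n. (X n t z)\<^sup>2) * indicator {0..T} t = (\<Sum>n. ennreal (indicator {0..T} t * (X n t z)\<^sup>2))"
    proof (cases "t \<in> {0..T}")
      case True
      then show ?thesis using suminf_ennreal2[OF zero_le_power2 sm[OF True]] by simp
    qed simp
  qed
  also have "\<dots> = (\<Sum>n. \<integral>\<^sup>+t. ennreal (indicator {0..T} t * (X n t z)\<^sup>2) \<partial>lborel)"
  proof (rule nn_integral_suminf)
    fix n
    have "(\<lambda>t. indicator {0..T} t *\<^sub>R (X n t z)\<^sup>2) \<in> borel_measurable borel"
      using borel_measurable_continuous_on_indicator[OF _ c2[of n]] by simp
    then show "(\<lambda>t. ennreal (indicator {0..T} t * (X n t z)\<^sup>2)) \<in> borel_measurable lborel" by simp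
  qed
  also have "\<dots> = (\<Sum>n. ennreal (integral {0..T} (\<lambda>t. (X n t z)\<^sup>2)))"
    by (intro suminf_cong nn_integral_has_integral_lebesgue integrable_integral integrable_continuous_real c2) simp
  finally show ?thesis .
qed

section \<open>Girsanov transform of one weak solution\<close>

locale exp_integrable_solution =
  fixes T \<sigma> :: real and k x :: "nat \<Rightarrow> real" and M :: "'a measure" and F :: "real \<Rightarrow> 'a measure"
    and W X :: "nat \<Rightarrow> real \<Rightarrow> 'a \<Rightarrow> real"
  assumes T: "T > 0" and \<sigma>: "\<sigma> \<noteq> 0" and k0: "k 0 = 0" and kpos: "\<And>n. n \<ge> 1 \<Longrightarrow> k n > 0"
    and sol: "weak_solution T \<sigma> k x M F W X" and exp_int: "exp_integrable T \<sigma> M X"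
begin

lemma fps: "filtered_prob_space_on T M F" and bm: "n \<ge> 1 \<Longrightarrow> brownian_motion_on T M F (W n)"
  and indep: "prob_space.indep_vars M (\<lambda>_. path_space T) (\<lambda>n. path_of T (W n)) {1..}"
  and X0: "X 0 t z = 0"
  and sm: "t \<in> {0..T} \<Longrightarrow> z \<in> space M \<Longrightarrow> summable (\<lambda>n. (X n t z)\<^sup>2)"
  using sol by (auto simp: weak_solution_def)

lemma X_cont: "z \<in> space M \<Longrightarrow> continuous_on {0..T} (\<lambda>t. X n t z)"
  using sol X0 by (cases "n = 0") (auto simp: weak_solution_def)

lemma X_adapted: "t \<in> {0..T} \<Longrightarrow> X n t \<in> borel_measurable (F t)"
proof (cases "n = 0")
  case True
  then have "X n t = (\<lambda>z. 0)" using X0 by auto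
  then show ?thesis by simp
qed (use sol in \<open>auto simp: weak_solution_def\<close>)

lemma X_equation:
  assumes "n \<ge> 1" "t \<in> {0..T}"
  obtains I1 I2 where "has_ito_integral M (\<lambda>s z. \<sigma> * k (n - 1) * X (n - 1) s z) (W (n - 1)) t I1"
    "has_ito_integral M (\<lambda>s z. \<sigma> * k n * X (Suc n) s z) (W n) t I2"
    "AE z in M. X n t z = x n
          + integral {0..t} (\<lambda>s. k (n - 1) * (X (n - 1) s z)\<^sup>2 - k n * X n s z * X (Suc n) s z)
          + I1 z - I2 z - integral {0..t} (\<lambda>s. \<sigma>\<^sup>2 / 2 * ((k n)\<^sup>2 + (k (n - 1))\<^sup>2) * X n s z)"
  using sol assms unfolding weak_solution_def by blast

sublocale prob_space M
  using fps by (simp add: filtered_prob_space_on_def)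

lemma F_subalgebra: "t \<in> {0..T} \<Longrightarrow> subalgebra M (F t)"
  using fps T unfolding filtered_prob_space_on_def subalgebra_def by force

lemma F_increasing: "0 \<le> s \<Longrightarrow> s \<le> t \<Longrightarrow> t \<le> T \<Longrightarrow> sets (F s) \<subseteq> sets (F t)"
  using fps unfolding filtered_prob_space_on_def by blast

sublocale WB: indep_brownian M F T W
  by unfold_locales (use T F_subalgebra F_increasing bm indep in auto)

sublocale W: gauss_grid M F T W
  by (rule WB.gauss_grid)

definition th :: "nat \<Rightarrow> real \<Rightarrow> 'a \<Rightarrow> real" where "th n t z = X n t z / \<sigma>"

lemma theta_cont: "z \<in> space M \<Longrightarrow> continuous_on {0..T} (\<lambda>t. th n t z)"
  unfolding th_def using \<sigma> by (intro continuous_intros X_cont) auto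

lemma X_meas: "t \<in> {0..T} \<Longrightarrow> X n t \<in> borel_measurable M"
  by (rule W.F_measurable_M[OF X_adapted])

lemma W_meas: "n \<ge> 1 \<Longrightarrow> t \<in> {0..T} \<Longrightarrow> W n t \<in> borel_measurable M"
  by (rule W.F_measurable_M[OF W.B_adapted])

lemma theta_adapted: "t \<in> {0..T} \<Longrightarrow> th n t \<in> borel_measurable (F t)"
  unfolding th_def[abs_def] by (intro borel_measurable_divide X_adapted borel_measurable_const)

lemma theta_meas: "t \<in> {0..T} \<Longrightarrow> th n t \<in> borel_measurable M"
  by (rule W.F_measurable_M[OF theta_adapted])

lemma integral_theta_meas: "0 \<le> s \<Longrightarrow> t \<le> T \<Longrightarrow> (\<lambda>z. integral {s..t} (\<lambda>u. th n u z)) \<in> borel_measurable M"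
  by (rule measurable_integral_continuous) (auto intro: continuous_on_subset[OF theta_cont] theta_meas)

lemma energy_meas: "(\<lambda>z. integral {0..T} (\<lambda>u. (X n u z)\<^sup>2)) \<in> borel_measurable M"
  by (intro measurable_integral_continuous continuous_intros X_cont borel_measurable_power X_meas)

text \<open>The integral of \<open>X n\<close> against \<open>W n\<close> occurs in the equation of
  component n + 1, with the factor \<sigma> k_n; dividing by \<sigma>^2 k_n, which is nonzero, gives
  the integral of \<open>th n\<close>.\<close>

lemma ex_ito: "n \<ge> 1 \<Longrightarrow> \<exists>J. conv_prob M (\<lambda>m z. \<Sum>j<2 ^ m. th n (dy T m j) z * W.dB m j n z) J"
proof -
  assume n: "n \<ge> 1"
  have TT: "T \<in> {0..T}" using T by simp
  obtain I1 where "has_ito_integral M (\<lambda>s z. \<sigma> * k (Suc n - 1) * X (Suc n - 1) s z) (W (Suc n - 1)) T I1"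
    by (rule X_equation[OF _ TT, of "Suc n"]) simp_all
  then have "has_ito_integral M (\<lambda>s z. \<sigma> * k n * X n s z) (W n) T I1" by simp
  from ito_conv_prob[OF this TT borel_measurable_times[OF borel_measurable_const X_meas] W_meas[OF n]]
  have "conv_prob M (\<lambda>m z. \<Sum>j<2 ^ m. \<sigma> * k n * X n (dy T m j) z * W.dB m j n z) I1"
    by (simp add: dy_def W.dB_def)
  from conv_prob_cmult[OF this, of "1 / (\<sigma>\<^sup>2 * k n)"]
  have "conv_prob M (\<lambda>m z. 1 / (\<sigma>\<^sup>2 * k n) * (\<Sum>j<2 ^ m. \<sigma> * k n * X n (dy T m j) z * W.dB m j n z)) (\<lambda>z. 1 / (\<sigma>\<^sup>2 * k n) * I1 z)" .
  moreover have "1 / (\<sigma>\<^sup>2 * k n) * (\<Sum>j<2 ^ m. \<sigma> * k n * X n (dy T m j) z * W.dB m j n z) = (\<Sum>j<2 ^ m. th n (dy T m j) z * W.dB m j n z)" for m z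
    unfolding sum_distrib_left th_def using \<sigma> kpos[OF n] by (intro sum.cong refl) (simp add: power2_eq_square)
  ultimately show ?thesis by auto
qed

definition I :: "nat \<Rightarrow> 'a \<Rightarrow> real" where
  "I n = (SOME J. conv_prob M (\<lambda>m z. \<Sum>j<2 ^ m. th n (dy T m j) z * W.dB m j n z) J)"

lemma I_conv: "n \<ge> 1 \<Longrightarrow> conv_prob M (\<lambda>m z. \<Sum>j<2 ^ m. th n (dy T m j) z * W.dB m j n z) (I n)"
  unfolding I_def using ex_ito by (rule someI_ex)

definition A :: "'a \<Rightarrow> real" where "A z = enn2real (energy_integral T X z) / \<sigma>\<^sup>2"

lemma energy_sum: "z \<in> space M \<Longrightarrow> energy_integral T X z = (\<Sum>n. ennreal (integral {0..T} (\<lambda>t. (X n t z)\<^sup>2)))"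
  by (intro energy_integral_eq X_cont sm)

lemma A_meas: "A \<in> borel_measurable M"
proof -
  have "(\<lambda>z. enn2real (\<Sum>n. ennreal (integral {0..T} (\<lambda>t. (X n t z)\<^sup>2))) / \<sigma>\<^sup>2) \<in> borel_measurable M"
    using energy_meas by measurable
  then show ?thesis by (rule measurable_cong[THEN iffD1, rotated]) (simp add: A_def energy_sum)
qed

lemma A_sums: "AE z in M. (\<lambda>n. integral {0..T} (\<lambda>t. (th (Suc n) t z)\<^sup>2)) sums A z"
proof -
  have "AE z in M. energy_integral T X z < \<infinity>" using exp_int by (simp add: exp_integrable_def)
  with AE_space show ?thesis
  proof eventually_elim
    case (elim z)
    let ?a = "\<lambda>n. integral {0..T} (\<lambda>t. (X n t z)\<^sup>2)"
    have a0: "0 \<le> ?a n" for n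
      by (intro Henstock_Kurzweil_Integration.integral_nonneg integrable_continuous_real continuous_intros X_cont elim) simp
    have fin: "(\<Sum>n. ennreal (?a n)) \<noteq> top" using elim energy_sum[of z] by auto
    have "summable ?a" by (rule summable_suminf_not_top[OF a0 fin])
    moreover have "enn2real (energy_integral T X z) = suminf ?a"
      using suminf_ennreal[OF a0 fin] suminf_nonneg[OF calculation a0] by (simp add: energy_sum[OF elim(1)])
    ultimately have "?a sums enn2real (energy_integral T X z)" by (simp add: summable_sums)
    then have "(\<lambda>n. ?a (Suc n)) sums enn2real (energy_integral T X z)"
      by (subst sums_Suc_iff) (simp add: X0)
    from sums_divide[OF this, of "\<sigma>\<^sup>2"] show ?case by (simp add: A_def th_def power_divide)
  qed
qed

text \<open>The polynomial factor in the exponential integrability condition, taken for i = 1, is at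
  least 1.\<close>

lemma exp_A: "integrable M (\<lambda>z. exp (A z))"
proof (rule integrableI_bounded)
  show "(\<lambda>z. exp (A z)) \<in> borel_measurable M" using A_meas by measurable
  have "(\<integral>\<^sup>+z. ennreal (norm (exp (A z))) \<partial>M) \<le> (\<integral>\<^sup>+z. ennreal (exp (A z) * (1 + integral {0..T} (\<lambda>t. (X 1 t z) ^ 4))\<^sup>2) \<partial>M)"
  proof (intro nn_integral_mono ennreal_leI)
    fix z assume z: "z \<in> space M"
    have "0 \<le> integral {0..T} (\<lambda>t. (X 1 t z) ^ 4)"
      by (intro Henstock_Kurzweil_Integration.integral_nonneg integrable_continuous_real continuous_intros X_cont z) simp
    then have "1 \<le> (1 + integral {0..T} (\<lambda>t. (X 1 t z) ^ 4))\<^sup>2" by (intro one_le_power) simp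
    then show "norm (exp (A z)) \<le> exp (A z) * (1 + integral {0..T} (\<lambda>t. (X 1 t z) ^ 4))\<^sup>2" by simp
  qed
  also have "\<dots> < \<infinity>" using exp_int unfolding exp_integrable_def A_def by blast
  finally show "(\<integral>\<^sup>+z. ennreal (norm (exp (A z))) \<partial>M) < \<infinity>" .
qed

sublocale girsanov M F T W th I A
  by unfold_locales (use theta_cont theta_adapted I_conv A_sums A_meas exp_A in auto)

lemma noise_conv:
  assumes n: "n \<ge> 1" and c: "c \<le> 2 ^ b" and t: "t = dy T b c"
    and I1: "has_ito_integral M (\<lambda>s z. \<sigma> * k (n - 1) * X (n - 1) s z) (W (n - 1)) t I1"
    and I2: "has_ito_integral M (\<lambda>s z. \<sigma> * k n * X (Suc n) s z) (W n) t I2"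
  shows "conv_prob M (\<lambda>m z. \<Sum>l<c * 2 ^ m. \<Sum>i=1..n. cf \<sigma> k n i (\<lambda>p. X p (dy T (b + m) l) z) * W.dB (b + m) l i z) (\<lambda>z. I1 z - I2 z)"
proof -
  have tT: "t \<in> {0..T}" unfolding t by (rule dy_mem[OF T c])
  have gc: "conv_prob M (\<lambda>m z. \<Sum>l<c * 2 ^ m. a * X p (dy T (b + m) l) z * W.dB (b + m) l i z) J"
    if i: "i \<ge> 1" and J: "has_ito_integral M (\<lambda>s z. a * X p s z) (W i) t J" for a p i J
  proof (rule W.grid_change[where H="\<lambda>s z. a * X p s z", OF _ _ i c t])
    show "continuous_on {0..T} (\<lambda>s. a * X p s z)" if "z \<in> space M" for z by (intro continuous_intros X_cont that)
    show "(\<lambda>z. a * X p s z) \<in> borel_measurable (F s)" if "s \<in> {0..T}" for s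
      by (intro borel_measurable_times borel_measurable_const X_adapted that)
    show "conv_prob M (\<lambda>m z. \<Sum>j<2 ^ m. a * X p (t * real j / 2 ^ m) z * (W i (t * real (Suc j) / 2 ^ m) z - W i (t * real j / 2 ^ m) z)) J"
      by (rule ito_conv_prob[OF J tT borel_measurable_times[OF borel_measurable_const X_meas] W_meas[OF i]])
  qed
  \<comment> \<open>For n = 1 the integrator is \<open>W 0\<close>, which is unspecified, but the
    integrand carries the factor \<open>k 0 = 0\<close>: the sums vanish, and so does their limit
    almost everywhere.\<close>
  have "conv_prob M (\<lambda>m z. \<Sum>l<c * 2 ^ m. \<sigma> * k (n - 1) * X (n - 1) (dy T (b + m) l) z * W.dB (b + m) l (n - 1) z) I1"
  proof (cases "n = 1")
    case True
    have "conv_prob M (\<lambda>m z. 0) I1"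
      by (rule conv_probI_measure) (use I1 k0 True in \<open>auto simp: has_ito_integral_def\<close>)
    then show ?thesis using k0 True by simp
  qed (use gc[OF _ I1] n in auto)
  from conv_prob_diff[OF this gc[OF n I2]] show ?thesis
    by (simp only: sum_cf[of k, OF k0 n] sum_subtractf)
qed

text \<open>Where the nonlinearity is produced: with th = X / \<sigma>, the noise coefficients times
  the shift give k_{n-1} X_{n-1}^2 - k_n X_n X_{n+1}, exactly the drift of the original
  equation.\<close>

lemma drift_limit:
  assumes n: "n \<ge> 1" and c: "c \<le> 2 ^ b" and z: "z \<in> space M"
  shows "(\<lambda>m. \<Sum>l<c * 2 ^ m. \<Sum>i=1..n. cf \<sigma> k n i (\<lambda>p. X p (dy T (b + m) l) z) * integral {dy T (b + m) l..dy T (b + m) (Suc l)} (\<lambda>u. th i u z))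
    \<longlonglongrightarrow> integral {0..dy T b c} (\<lambda>s. k (n - 1) * (X (n - 1) s z)\<^sup>2 - k n * X n s z * X (Suc n) s z)"
proof -
  let ?t = "dy T b c"
  have lim: "(\<lambda>m. \<Sum>l<c * 2 ^ m. a * X p (dy T (b + m) l) z * integral {dy T (b + m) l..dy T (b + m) (Suc l)} (\<lambda>u. th i u z))
    \<longlonglongrightarrow> integral {0..?t} (\<lambda>u. a * X p u z * th i u z)" for a p i
    by (rule riemann_product_limit[where f="\<lambda>u. a * X p u z", OF _ theta_cont[OF z] T c]) (intro continuous_intros X_cont z)
  have int: "(\<lambda>u. a * X p u z * th i u z) integrable_on {0..?t}" for a p i
    using dy_le[OF T c]
    by (intro integrable_continuous_real continuous_intros continuous_on_subset[OF X_cont[OF z]] continuous_on_subset[OF theta_cont[OF z]]) auto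
  have "integral {0..?t} (\<lambda>u. \<sigma> * k (n - 1) * X (n - 1) u z * th (n - 1) u z) - integral {0..?t} (\<lambda>u. \<sigma> * k n * X (Suc n) u z * th n u z)
    = integral {0..?t} (\<lambda>u. \<sigma> * k (n - 1) * X (n - 1) u z * th (n - 1) u z - \<sigma> * k n * X (Suc n) u z * th n u z)"
    by (rule Henstock_Kurzweil_Integration.integral_diff[symmetric, OF int int])
  also have "\<dots> = integral {0..?t} (\<lambda>s. k (n - 1) * (X (n - 1) s z)\<^sup>2 - k n * X n s z * X (Suc n) s z)"
    using \<sigma> by (simp add: th_def power2_eq_square mult.commute mult.left_commute)
  finally have eq: "integral {0..?t} (\<lambda>s. k (n - 1) * (X (n - 1) s z)\<^sup>2 - k n * X n s z * X (Suc n) s z) =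
      integral {0..?t} (\<lambda>u. \<sigma> * k (n - 1) * X (n - 1) u z * th (n - 1) u z) - integral {0..?t} (\<lambda>u. \<sigma> * k n * X (Suc n) u z * th n u z)" ..
  show ?thesis
    unfolding sum_cf[of k, OF k0 n] sum_subtractf eq by (rule tendsto_diff[OF lim lim])
qed

end

lemma conv_prob_cong:
  assumes "conv_prob M f g" "\<And>m z. z \<in> space M \<Longrightarrow> f m z = f' m z"
  shows "conv_prob M f' g"
proof -
  have "f' m \<in> borel_measurable M" for m
    using conv_prob_measurable(1)[OF assms(1), of m] assms(2) measurable_cong[of M "f m" "f' m" borel] by simp
  moreover have "(\<integral>z. min 1 \<bar>f' m z - g z\<bar> \<partial>M) = (\<integral>z. min 1 \<bar>f m z - g z\<bar> \<partial>M)" for m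
    by (rule Bochner_Integration.integral_cong) (simp_all add: assms(2))
  ultimately show ?thesis using assms(1) by (simp add: conv_prob_def)
qed

context exp_integrable_solution
begin

text \<open>The original measure is recovered from the new one with the inverse density 1 / Z = exp
  L, which is why L is taken to be -ln Z.\<close>

lemma girsanov_solution_exists:
  obtains Q B J L where "girsanov_solution Q F T B \<sigma> k x X J L" "sets Q = sets M"
    "\<And>S. S \<in> sets M \<Longrightarrow> emeasure M S = (\<integral>\<^sup>+z. ennreal (exp (L z)) * indicator S z \<partial>Q)"
proof -
  obtain Z where Z: "Z \<in> borel_measurable M" "\<And>z. 0 < Z z" "integrable M Z" "(\<integral>z. Z z \<partial>M) = 1"
    "conv_prob M (\<lambda>N z. IS {1..N} z + 1 / 2 * VS {1..N} z) (\<lambda>z. - ln (Z z))"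
    "gauss_grid (density M (\<lambda>z. ennreal (Z z))) F T Bq"
    "\<And>n. n \<ge> 1 \<Longrightarrow> integrable M (\<lambda>z. Z z * V n z)"
    "(\<lambda>n. \<integral>z. Z z * V (Suc n) z \<partial>M) \<longlonglongrightarrow> 0"
    by (rule girsanov_density) blast
  note [measurable] = Z(1)
  define Q where "Q = density M (\<lambda>z. ennreal (Z z))"
  interpret Q: gauss_grid Q F T Bq unfolding Q_def by (rule Z(6))
  have sQ: "sets Q = sets M" and spQ: "space Q = space M" by (simp_all add: Q_def)
  have Z0: "0 \<le> Z z" for z using Z(2)[of z] by simp
  have toQ: "conv_prob Q f g" if "conv_prob M f g" for f g
    unfolding Q_def by (rule conv_prob_density[OF that Z(3) Z0])
  have mQ: "borel_measurable Q = borel_measurable M" by (simp add: Q_def cong: measurable_cong_sets)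
  have aeQ: "AE z in Q. P z" if "AE z in M. P z" for P
    unfolding Q_def by (subst AE_density) (use that in auto)
  have dyT: "dy T m j \<in> {0..T}" if "j \<le> 2 ^ m" for j m by (rule dy_mem[OF T that])
  have dBq: "Q.dB m l n z = W.dB m l n z + integral {dy T m l..dy T m (Suc l)} (\<lambda>u. th n u z)" if l: "l < 2 ^ m" and w: "z \<in> space M" for m l n z
  proof -
    have le: "0 \<le> dy T m l" "dy T m l \<le> dy T m (Suc l)" "dy T m (Suc l) \<le> T"
      using l T by (auto intro: dy_nonneg dy_mono dy_le)
    have "(\<lambda>u. th n u z) integrable_on {0..dy T m (Suc l)}"
      using le by (intro integrable_continuous_real continuous_on_subset[OF theta_cont[OF w]]) auto
    from Henstock_Kurzweil_Integration.integral_combine[OF le(1,2) this] show ?thesis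
      by (simp add: Q.dB_def W.dB_def Bq_def)
  qed
  have V: "V n z = 1 / \<sigma>\<^sup>2 * integral {0..T} (\<lambda>u. (X n u z)\<^sup>2)" for n z
    unfolding V_def th_def by (simp add: power_divide)
  then have XV: "integral {0..T} (\<lambda>u. (X n u z)\<^sup>2) = \<sigma>\<^sup>2 * V n z" for n z using \<sigma> by simp
  have V_meas: "V n \<in> borel_measurable M" for n unfolding V[abs_def] using energy_meas by measurable
  have V0: "V 0 z = 0" for z by (simp add: V X0)
  have ZVi: "integrable M (\<lambda>z. Z z * V n z)" for n using Z(7)[of n] V0 by (cases "n = 0") auto
  have VQ: "integrable Q (V n)" "(\<integral>z. V n z \<partial>Q) = (\<integral>z. Z z * V n z \<partial>M)" for n
    unfolding Q_def using integrable_density[of "V n" M Z] integral_density[of "V n" M Z] V_meas Z0 ZVi by auto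
  \<comment> \<open>Sums against the new increments are the old noise sums plus the shift. Their
    limit, I1 - I2 plus the nonlinear drift, equals X - x plus the damping integral by the original
    equation.\<close>
  have X_eq: "conv_prob Q (\<lambda>m z. \<Sum>l<c * 2 ^ m. \<Sum>i=1..n. cf \<sigma> k n i (\<lambda>p. X p (dy T (b + m) l) z) * Q.dB (b + m) l i z)
        (\<lambda>z. X n (dy T b c) z - x n + cn \<sigma> k n * integral {0..dy T b c} (\<lambda>u. X n u z))"
    if n: "n \<ge> 1" and c: "c \<le> 2 ^ b" for n b c
  proof -
    let ?t = "dy T b c"
    let ?D = "\<lambda>z. integral {0..?t} (\<lambda>s. k (n - 1) * (X (n - 1) s z)\<^sup>2 - k n * X n s z * X (Suc n) s z)"
    let ?d = "\<lambda>m z. \<Sum>l<c * 2 ^ m. \<Sum>i=1..n. cf \<sigma> k n i (\<lambda>p. X p (dy T (b + m) l) z) * integral {dy T (b + m) l..dy T (b + m) (Suc l)} (\<lambda>u. th i u z)"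
    let ?n = "\<lambda>m z. \<Sum>l<c * 2 ^ m. \<Sum>i=1..n. cf \<sigma> k n i (\<lambda>p. X p (dy T (b + m) l) z) * W.dB (b + m) l i z"
    have lb: "Suc l \<le> 2 ^ (b + m)" if "l < c * 2 ^ m" for l m
    proof -
      have "c * 2 ^ m \<le> 2 ^ b * 2 ^ m" using c by simp
      with that have "Suc l \<le> 2 ^ b * 2 ^ m" by linarith
      then show ?thesis by (simp only: power_add)
    qed
    obtain I1 I2 where I: "has_ito_integral M (\<lambda>s z. \<sigma> * k (n - 1) * X (n - 1) s z) (W (n - 1)) ?t I1"
      "has_ito_integral M (\<lambda>s z. \<sigma> * k n * X (Suc n) s z) (W n) ?t I2"
      and eq: "AE z in M. X n ?t z = x n + ?D z + I1 z - I2 z - integral {0..?t} (\<lambda>s. \<sigma>\<^sup>2 / 2 * ((k n)\<^sup>2 + (k (n - 1))\<^sup>2) * X n s z)"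
      using X_equation[OF n dyT[OF c]] .
    have cfm: "(\<lambda>z. cf \<sigma> k n i (\<lambda>p. X p (dy T (b + m) l) z)) \<in> borel_measurable M" if "l < c * 2 ^ m" for i l m
      using X_meas[OF dyT[OF Suc_leD[OF lb[OF that]]], of i] X_meas[OF dyT[OF Suc_leD[OF lb[OF that]]], of "Suc n"] unfolding cf_def by measurable
    have dm: "?d m \<in> borel_measurable M" for m
    proof (intro borel_measurable_sum borel_measurable_times cfm integral_theta_meas)
      fix l assume "l \<in> {..<c * 2 ^ m}"
      then have "Suc l \<le> 2 ^ (b + m)" using lb by simp
      then show "0 \<le> dy T (b + m) l" "dy T (b + m) (Suc l) \<le> T" using T by (auto intro: dy_nonneg dy_le)
    qed auto
    have Dm: "?D \<in> borel_measurable M"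
      by (rule borel_measurable_LIMSEQ_real[OF drift_limit[OF n c] dm])
    have "conv_prob M ?d ?D"
      by (rule AE_imp_conv_prob[OF dm Dm AE_I2]) (rule drift_limit[OF n c])
    from conv_prob_add[OF noise_conv[OF n c refl I] this]
    have conv: "conv_prob Q (\<lambda>m z. ?n m z + ?d m z) (\<lambda>z. (I1 z - I2 z) + ?D z)" by (rule toQ)
    have lim: "AE z in Q. (I1 z - I2 z) + ?D z = X n ?t z - x n + cn \<sigma> k n * integral {0..?t} (\<lambda>u. X n u z)"
    proof (rule aeQ)
      have ieq: "integral {0..?t} (\<lambda>s. \<sigma>\<^sup>2 / 2 * ((k n)\<^sup>2 + (k (n - 1))\<^sup>2) * X n s z) = cn \<sigma> k n * integral {0..?t} (\<lambda>u. X n u z)" for z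
        unfolding cn_def by (rule Henstock_Kurzweil_Integration.integral_mult_right)
      show "AE z in M. (I1 z - I2 z) + ?D z = X n ?t z - x n + cn \<sigma> k n * integral {0..?t} (\<lambda>u. X n u z)"
        using eq
      proof eventually_elim
        case (elim z)
        then show ?case using ieq[of z] by linarith
      qed
    qed
    have gm: "(\<lambda>z. X n ?t z - x n + cn \<sigma> k n * integral {0..?t} (\<lambda>u. X n u z)) \<in> borel_measurable Q"
      unfolding mQ using dy_le[OF T c]
      by (intro borel_measurable_add borel_measurable_diff borel_measurable_times borel_measurable_const X_meas[OF dyT[OF c]] measurable_integral_continuous
          continuous_on_subset[OF X_cont] X_meas) auto
    have sumeq: "?n m z + ?d m z = (\<Sum>l<c * 2 ^ m. \<Sum>i=1..n. cf \<sigma> k n i (\<lambda>p. X p (dy T (b + m) l) z) * Q.dB (b + m) l i z)" if w: "z \<in> space Q" for m z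
      unfolding sum.distrib[symmetric] distrib_left[symmetric]
      by (intro sum.cong refl arg_cong2[where f="(*)"] dBq[symmetric]) (use lb w spQ in \<open>auto simp: Suc_le_eq\<close>)
    show ?thesis by (rule Q.conv_prob_cong_AE[OF conv_prob_cong[OF conv sumeq] lim gm])
  qed
  \<comment> \<open>The integral of X against the new noise: \<sigma> times the sum of the integral
    of \<open>th\<close> against the old noise and the energy of \<open>th\<close>.\<close>
  define J where "J n z = \<sigma> * (I n z + V n z)" for n z
  have J_conv: "conv_prob Q (\<lambda>m z. \<Sum>j<2 ^ m. X n (dy T m j) z * Q.dB m j n z) (J n)" if n: "n \<ge> 1" for n
  proof -
    let ?d = "\<lambda>m z. \<Sum>j<2 ^ m. th n (dy T m j) z * integral {dy T m j..dy T m (Suc j)} (\<lambda>u. th n u z)"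
    have lim: "(\<lambda>m. ?d m z) \<longlonglongrightarrow> V n z" if w: "z \<in> space M" for z
      using riemann_product_limit[where c=1 and b=0, OF theta_cont[OF w, of n] theta_cont[OF w, of n] T]
      by (simp add: V_def power2_eq_square dy_def)
    have dm: "?d m \<in> borel_measurable M" for m
      by (intro borel_measurable_sum borel_measurable_times theta_meas integral_theta_meas dyT) (use T in \<open>auto intro: dy_nonneg dy_le\<close>)
    have "conv_prob M ?d (V n)" by (rule AE_imp_conv_prob[OF dm V_meas AE_I2]) (rule lim)
    from conv_prob_cmult[OF conv_prob_add[OF I_conv[OF n] this], of \<sigma>]
    have conv: "conv_prob Q (\<lambda>m z. \<sigma> * ((\<Sum>j<2 ^ m. th n (dy T m j) z * W.dB m j n z) + ?d m z)) (J n)"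
      unfolding J_def[abs_def] by (rule toQ)
    have sumeq: "\<sigma> * ((\<Sum>j<2 ^ m. th n (dy T m j) z * W.dB m j n z) + ?d m z) = (\<Sum>j<2 ^ m. X n (dy T m j) z * Q.dB m j n z)" if w: "z \<in> space Q" for m z
      unfolding sum.distrib[symmetric] distrib_left[symmetric] sum_distrib_left
    proof (rule sum.cong[OF refl])
      fix j :: nat assume "j \<in> {..<2 ^ m}"
      then have "Q.dB m j n z = W.dB m j n z + integral {dy T m j..dy T m (Suc j)} (\<lambda>u. th n u z)" using w spQ by (intro dBq) auto
      then show "\<sigma> * (th n (dy T m j) z * (W.dB m j n z + integral {dy T m j..dy T m (Suc j)} (\<lambda>u. th n u z))) = X n (dy T m j) z * Q.dB m j n z"
        using \<sigma> by (simp add: th_def)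
    qed
    show ?thesis
      by (rule conv_prob_cong[OF conv sumeq])
  qed
  have "girsanov_solution Q F T Bq \<sigma> k x X J (\<lambda>z. - ln (Z z))"
  proof unfold_locales
    show "\<sigma> \<noteq> 0" "k 0 = 0" "\<And>n. n \<ge> 1 \<Longrightarrow> k n > 0" "\<And>t z. X 0 t z = 0" using \<sigma> k0 kpos X0 by auto
    show "continuous_on {0..T} (\<lambda>t. X n t z)" if "z \<in> space Q" for n z using X_cont that spQ by simp
    show "X n t \<in> borel_measurable (F t)" if "t \<in> {0..T}" for n t by (rule X_adapted[OF that])
    show "integrable Q (\<lambda>z. integral {0..T} (\<lambda>u. (X n u z)\<^sup>2))" for n unfolding XV using VQ(1) by simp
    have "(\<lambda>n. \<integral>z. Z z * V n z \<partial>M) \<longlonglongrightarrow> 0" using Z(8) by (rule LIMSEQ_imp_Suc)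
    from tendsto_mult[OF tendsto_const[of "\<sigma>\<^sup>2"] this]
    show "(\<lambda>n. \<integral>z. integral {0..T} (\<lambda>u. (X n u z)\<^sup>2) \<partial>Q) \<longlonglongrightarrow> 0" unfolding XV by (simp add: VQ(2))
    have "(\<Sum>n=1..N. 1 / \<sigma> * J n z + - (1 / (2 * \<sigma>\<^sup>2)) * integral {0..T} (\<lambda>u. (X n u z)\<^sup>2)) = IS {1..N} z + 1 / 2 * VS {1..N} z" for N z
      unfolding IS_def VS_def sum_distrib_left sum.distrib[symmetric]
      by (intro sum.cong refl) (use \<sigma> in \<open>simp add: J_def XV field_simps\<close>)
    then show "conv_prob Q (\<lambda>N z. \<Sum>n=1..N. 1 / \<sigma> * J n z + - (1 / (2 * \<sigma>\<^sup>2)) * integral {0..T} (\<lambda>u. (X n u z)\<^sup>2)) (\<lambda>z. - ln (Z z))"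
      using toQ[OF Z(5)] by (simp only:)
  qed (fact X_eq J_conv)+
  moreover have "emeasure M S = (\<integral>\<^sup>+z. ennreal (exp (- ln (Z z))) * indicator S z \<partial>Q)" if S: "S \<in> sets M" for S
  proof -
    note [measurable] = S
    have "(\<integral>\<^sup>+z. ennreal (exp (- ln (Z z))) * indicator S z \<partial>Q) = (\<integral>\<^sup>+z. ennreal (Z z) * (ennreal (exp (- ln (Z z))) * indicator S z) \<partial>M)"
      unfolding Q_def by (intro nn_integral_density) measurable
    also have "\<dots> = (\<integral>\<^sup>+z. indicator S z \<partial>M)"
    proof (rule nn_integral_cong)
      fix z
      have "ennreal (Z z) * ennreal (exp (- ln (Z z))) = 1"
        using Z(2)[of z] by (simp add: exp_minus flip: ennreal_mult)
      then show "ennreal (Z z) * (ennreal (exp (- ln (Z z))) * indicator S z) = indicator S z"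
        by (simp add: mult.assoc[symmetric])
    qed
    finally show ?thesis using S by simp
  qed
  ultimately show ?thesis using that sQ by blast
qed

text \<open>Component and time form one index, so that finite-dimensional events of the whole
  sequence of paths are boxes in a single product space; \<open>law_eq\<close> converts back to a
  sequence of paths.\<close>

definition paths :: "'a \<Rightarrow> nat \<times> real \<Rightarrow> real" where
  "paths z = (\<lambda>p\<in>{1..} \<times> {0..T}. X (fst p) (snd p) z)"

lemma paths_measurable: "paths \<in> measurable M (PiM ({1..} \<times> {0..T}) (\<lambda>_. borel))"
  unfolding paths_def[abs_def] by (rule measurable_restrict) (auto intro: X_meas)

lemma paths_vimage:
  assumes J: "J \<subseteq> {1..} \<times> {0..T}"
  shows "paths -` prod_emb ({1..} \<times> {0..T}) (\<lambda>_. borel) J (Pi\<^sub>E J S) \<inter> space M = {z\<in>space M. \<forall>p\<in>J. X (fst p) (snd p) z \<in> S p}"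
proof -
  have p: "paths z p = X (fst p) (snd p) z" if "p \<in> J" for z p
    unfolding paths_def by (rule restrict_apply') (rule subsetD[OF J that])
  have e: "paths z \<in> extensional ({1..} \<times> {0..T})" for z by (simp add: paths_def)
  have "paths z \<in> prod_emb ({1..} \<times> {0..T}) (\<lambda>_. borel) J (Pi\<^sub>E J S) \<longleftrightarrow> (\<forall>p\<in>J. X (fst p) (snd p) z \<in> S p)" for z
    unfolding prod_emb_iff using e[of z] p by (simp add: PiE_iff)
  then show ?thesis by auto
qed

lemma law_eq:
  "law T M X = distr (distr M (PiM ({1..} \<times> {0..T}) (\<lambda>_. borel)) paths) (PiM {1..} (\<lambda>_. path_space T))
     (\<lambda>y. \<lambda>n\<in>{1..}. \<lambda>t\<in>{0..T}. y (n, t))"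
proof -
  have g: "(\<lambda>y :: nat \<times> real \<Rightarrow> real. \<lambda>n\<in>{1..}. \<lambda>t\<in>{0..T}. y (n, t)) \<in> measurable (PiM ({1..} \<times> {0..T}) (\<lambda>_. borel)) (PiM {1..} (\<lambda>_. path_space T))"
    unfolding path_space_def
    by (rule measurable_restrict, rule measurable_restrict, rule measurable_component_singleton) simp
  show ?thesis
    unfolding law_def distr_distr[OF g paths_measurable]
    by (rule distr_cong) (auto simp: paths_def path_of_def intro!: restrict_ext)
qed

end

theorem theorem1:
  fixes T \<sigma> :: real and k x :: "nat \<Rightarrow> real"
    and M1 :: "'a measure" and F1 :: "real \<Rightarrow> 'a measure"
    and W1 X1 :: "nat \<Rightarrow> real \<Rightarrow> 'a \<Rightarrow> real"
    and M2 :: "'b measure" and F2 :: "real \<Rightarrow> 'b measure"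
    and W2 X2 :: "nat \<Rightarrow> real \<Rightarrow> 'b \<Rightarrow> real"
  assumes "T > 0" and "\<sigma> \<noteq> 0"
    and "k 0 = 0" and "\<forall>n\<ge>1. k n > 0"
    and "summable (\<lambda>n. (x n)\<^sup>2)"
    and "weak_solution T \<sigma> k x M1 F1 W1 X1" and "exp_integrable T \<sigma> M1 X1"
    and "weak_solution T \<sigma> k x M2 F2 W2 X2" and "exp_integrable T \<sigma> M2 X2"
  shows "law T M1 X1 = law T M2 X2"
proof -
  interpret E1: exp_integrable_solution T \<sigma> k x M1 F1 W1 X1 by (rule exp_integrable_solution.intro) (use assms in simp_all)
  interpret E2: exp_integrable_solution T \<sigma> k x M2 F2 W2 X2 by (rule exp_integrable_solution.intro) (use assms in simp_all)
  obtain Q1 B1 J1 L1 where Q1: "girsanov_solution Q1 F1 T B1 \<sigma> k x X1 J1 L1" "sets Q1 = sets M1"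
    "\<And>S. S \<in> sets M1 \<Longrightarrow> emeasure M1 S = (\<integral>\<^sup>+z. ennreal (exp (L1 z)) * indicator S z \<partial>Q1)"
    using E1.girsanov_solution_exists by blast
  obtain Q2 B2 J2 L2 where Q2: "girsanov_solution Q2 F2 T B2 \<sigma> k x X2 J2 L2" "sets Q2 = sets M2"
    "\<And>S. S \<in> sets M2 \<Longrightarrow> emeasure M2 S = (\<integral>\<^sup>+z. ennreal (exp (L2 z)) * indicator S z \<partial>Q2)"
    using E2.girsanov_solution_exists by blast
  interpret two_solutions Q1 F1 T B1 \<sigma> k x X1 J1 L1 Q2 F2 B2 X2 J2 L2
    by (rule two_solutions.intro[OF Q1(1) Q2(1)])
  let ?I = "{1..} \<times> {0..T} :: (nat \<times> real) set"
  let ?P = "PiM ?I (\<lambda>_. borel :: real measure)"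
  \<comment> \<open>Equality on finite-dimensional cylinders suffices. Each probability is written
    under the transformed measure with weight exp L, where event and weight are the same functional
    of the noise for both solutions.\<close>
  have "distr M1 ?P E1.paths = distr M2 ?P E2.paths"
  proof (rule measure_eqI_PiM_infinite)
    interpret D: prob_space "distr M1 ?P E1.paths" by (rule E1.prob_space_distr[OF E1.paths_measurable])
    show "finite_measure (distr M1 ?P E1.paths)" by unfold_locales
    fix A :: "nat \<times> real \<Rightarrow> real set" and J :: "(nat \<times> real) set"
    assume J: "finite J" "J \<subseteq> ?I" and A: "\<And>p. p \<in> J \<Longrightarrow> A p \<in> sets borel"
    let ?X = "prod_emb ?I (\<lambda>_. borel) J (Pi\<^sub>E J A)"
    have X: "?X \<in> sets ?P" using J A by (intro sets_PiM_I) auto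
    have e1: "E1.paths -` ?X \<inter> space M1 = {z\<in>space M1. \<forall>p\<in>J. X1 (fst p) (snd p) z \<in> A p}"
      by (rule E1.paths_vimage[OF J(2)])
    have e2: "E2.paths -` ?X \<inter> space M2 = {z\<in>space M2. \<forall>p\<in>J. X2 (fst p) (snd p) z \<in> A p}"
      by (rule E2.paths_vimage[OF J(2)])
    have sp: "space Q1 = space M1" "space Q2 = space M2" using sets_eq_imp_space_eq[OF Q1(2)] sets_eq_imp_space_eq[OF Q2(2)] by simp_all
    have "emeasure (distr M1 ?P E1.paths) ?X = (\<integral>\<^sup>+z. ennreal (exp (L1 z)) * indicator {z\<in>space M1. \<forall>p\<in>J. X1 (fst p) (snd p) z \<in> A p} z \<partial>Q1)"
      unfolding emeasure_distr[OF E1.paths_measurable X] e1[symmetric] by (rule Q1(3)[OF measurable_sets[OF E1.paths_measurable X]])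
    also have "\<dots> = (\<integral>\<^sup>+z. ennreal (exp (L1 z)) * indicator {z. \<forall>p\<in>J. X1 (fst p) (snd p) z \<in> A p} z \<partial>Q1)"
      by (rule nn_integral_cong) (auto simp: indicator_def sp)
    also have "\<dots> = (\<integral>\<^sup>+z. ennreal (exp (L2 z)) * indicator {z. \<forall>p\<in>J. X2 (fst p) (snd p) z \<in> A p} z \<partial>Q2)"
      using J(2) by (intro same_fun_law[OF J(1) same_fun_X A same_fun_L]) auto
    also have "\<dots> = (\<integral>\<^sup>+z. ennreal (exp (L2 z)) * indicator {z\<in>space M2. \<forall>p\<in>J. X2 (fst p) (snd p) z \<in> A p} z \<partial>Q2)"
      by (rule nn_integral_cong) (auto simp: indicator_def sp)
    also have "\<dots> = emeasure (distr M2 ?P E2.paths) ?X"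
      unfolding emeasure_distr[OF E2.paths_measurable X] e2[symmetric] by (rule Q2(3)[OF measurable_sets[OF E2.paths_measurable X], symmetric])
    finally show "emeasure (distr M1 ?P E1.paths) ?X = emeasure (distr M2 ?P E2.paths) ?X" .
  qed simp_all
  then show ?thesis by (simp only: E1.law_eq E2.law_eq)
qed

end
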